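(* Let $u\in H^1(\mathbb{R}^d)$ be the solution of $-\nabla\cdot(G\nabla u)-\omega^2\rho u=\epsilon^2f_\epsilon(\epsilon x)$ in $\mathbb{R}^d$ and $U_\epsilon(r)=u(r/\epsilon)$ (so $U_\epsilon$ solves $-\nabla\cdot(G(r/\epsilon)\nabla U_\epsilon)-\Omega_\epsilon^2\rho(r/\epsilon)U_\epsilon=f_\epsilon$). Define $$u^{(p)}(x)=\frac{1}{(2\pi)^{d/2}}\int_{\epsilon Y}\frac{\epsilon^2\langle\mathcal{J}[f_\epsilon(\epsilon\,\cdot)](k;\cdot),e^{ik\cdot}\phi_p(k;\cdot)\rangle}{\omega_p^2(k)-\omega^2}e^{ik\cdot x}\phi_p(k;x)\,dk,$$ and $U^{(p)}(r)=u^{(p)}(r/\epsilon)$. Then there is a constant $C$ independent of $\epsilon$ such that for all sufficiently small $\epsilon>0$, $$\|u-u^{(p)}\|_{L^2(\mathbb{R}^d)}\le C\epsilon^{3-d/2}\|F\|_{L^2(\mathbb{R}^d)},\qquad \|U_\epsilon-U^{(p)}\|_{L^2(\mathbb{R}^d)}\le C\epsilon^{3}\|F\|_{L^2(\mathbb{R}^d)}.$$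
   Context: Standing setting. Let $d\ge1$; $G,\rho:\mathbb{R}^d\to\mathbb{R}$ smooth, $\mathbb{Z}^d$-periodic, bounded below by a positive constant. $W_I=[-1/2,1/2]^d$, $W_{I^*}=[-\pi,\pi]^d$. Bloch transform $(\mathcal{J}\psi)(k;x)=(2\pi)^{-d/2}\sum_{j\in\mathbb{Z}^d}\psi(x+j)e^{-ik\cdot j}$ ($k\in W_{I^*}$, $x\in\mathbb{R}^d$), extended by continuity to $L^2(\mathbb{R}^d)$. Bloch eigenproblem: for each $k\in\mathbb{R}^d$, $-(\nabla+ik)\cdot[G(\nabla+ik)\phi]=\omega^2\rho\phi$ on $\mathbb{Z}^d$-periodic $\phi$ has eigenvalues $0\le\omega_0^2(k)\le\omega_1^2(k)\le\cdots$ with $\mathbb{Z}^d$-periodic eigenfunctions $\phi_m(k;\cdot)$, orthonormal w.r.t. $\int_{W_I}\rho\phi_m\overline{\phi_n}=\delta_{mn}$, complete in $L^2(W_I)$, and chosen (following Wilcox) analytic in $k$ wherever the multiplicity of the eigenvalue is locally constant. Notation: $\langle a,b\rangle=\int_{W_I}a\overline b$, $\langle g\rangle=\int_{W_I}g$. A fixed index $p\ge0$ is such that $\omega_p^2(0)$ is a simple eigenvalue. Frequency: $\Omega_\epsilon^2=\epsilon^{-2}\omega_p^2(0)+\sigma\hat\Omega^2$ with $\sigma\in\{1,-1\}$ and $\hat\Omega>0$ fixed independent of $\epsilon$, and the band-gap condition $\Omega_\epsilon^2\neq\epsilon^{-2}\omega_m^2(k)$ for all $k\in W_{I^*}$, $m\ge0$;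 set $\omega^2=\epsilon^2\Omega_\epsilon^2=\omega_p^2(0)+\epsilon^2\sigma\hat\Omega^2$. Fourier transform $\mathcal{F}[g](z)=(2\pi)^{-d/2}\int e^{-iz\cdot x}g(x)dx$. $F$ satisfies $F,\mathcal{F}[F]\in L^1\cap L^2(\mathbb{R}^d)$ and is supported in a bounded open set $Y\ni0$. Source: $f_\epsilon(r)=(2\pi)^{-d/2}\big(\int_{\mathbb{R}^d}F(k)e^{ik\cdot r}dk\big)\rho(r/\epsilon)\phi_p(0;r/\epsilon)$. *)

theory Defs
  imports "HOL-Analysis.Analysis"
begin

definition lattice :: "(real^'d) set" where
  "lattice = {j. \<forall>i. j$i \<in> \<int>}"

definition cell :: "(real^'d) set" where
  "cell = {x. \<forall>i. -1/2 \<le> x$i \<and> x$i \<le> 1/2}"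

definition dual_cell :: "(real^'d) set" where
  "dual_cell = {k. \<forall>i. -pi \<le> k$i \<and> k$i \<le> pi}"

definition zperiodic :: "(real^'d \<Rightarrow> 'b) \<Rightarrow> bool" where
  "zperiodic f \<longleftrightarrow> (\<forall>x. \<forall>j\<in>lattice. f (x + j) = f x)"

definition pdiff :: "'d \<Rightarrow> (real^'d \<Rightarrow> 'b::real_normed_vector) \<Rightarrow> real^'d \<Rightarrow> 'b" where
  "pdiff i f x = vector_derivative (\<lambda>t::real. f (x + t *\<^sub>R axis i 1)) (at 0)"

fun pdiffs :: "'d list \<Rightarrow> (real^'d \<Rightarrow> 'b::real_normed_vector) \<Rightarrow> real^'d \<Rightarrow> 'b" where
  "pdiffs [] f = f"
| "pdiffs (i # is) f = pdiff i (pdiffs is f)"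

definition smooth :: "(real^'d \<Rightarrow> 'b::real_normed_vector) \<Rightarrow> bool" where
  "smooth f \<longleftrightarrow> (\<forall>is x. pdiffs is f differentiable (at x))"

definition test_fun :: "(real^'d \<Rightarrow> real) \<Rightarrow> bool" where
  "test_fun \<psi> \<longleftrightarrow> smooth \<psi> \<and> bounded {x. \<psi> x \<noteq> 0}"

definition square_integrable_on :: "(real^'d) set \<Rightarrow> (real^'d \<Rightarrow> complex) \<Rightarrow> bool" where
  "square_integrable_on S f \<longleftrightarrow>
     set_borel_measurable lborel S f \<and> set_integrable lborel S (\<lambda>x. (norm (f x))^2)"

definition l2norm :: "(real^'d \<Rightarrow> complex) \<Rightarrow> real" where
  "l2norm f = sqrt (LINT x|lborel. (norm (f x))^2)"

definition cst :: "nat \<Rightarrow> real" where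
  "cst d = (2 * pi) powr (- real d / 2)"

definition cinner_cell :: "(real^'d \<Rightarrow> complex) \<Rightarrow> (real^'d \<Rightarrow> complex) \<Rightarrow> complex" where
  "cinner_cell a b = (LINT x:cell|lborel. a x * cnj (b x))"

text \<open>Bloch transform (series definition; for L^1 inputs the series converges absolutely a.e.).\<close>
definition bloch :: "(real^'d \<Rightarrow> complex) \<Rightarrow> real^'d \<Rightarrow> real^'d \<Rightarrow> complex" where
  "bloch \<psi> k x = of_real (cst CARD('d)) * infsum (\<lambda>j. \<psi> (x + j) * cis (- (k \<bullet> j))) lattice"

definition fourier :: "(real^'d \<Rightarrow> complex) \<Rightarrow> real^'d \<Rightarrow> complex" where
  "fourier g z = of_real (cst CARD('d)) * (LINT x|lborel. cis (- (z \<bullet> x)) * g x)"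

definition mult :: "(nat \<Rightarrow> real^'d \<Rightarrow> real) \<Rightarrow> nat \<Rightarrow> real^'d \<Rightarrow> nat" where
  "mult w2 m k = card {n. w2 n k = w2 m k}"

definition real_analytic_at :: "(real^'d \<Rightarrow> complex) \<Rightarrow> real^'d \<Rightarrow> bool" where
  "real_analytic_at f k0 \<longleftrightarrow>
     (\<exists>r>0. \<exists>c :: ('d \<Rightarrow> nat) \<Rightarrow> complex. \<forall>k\<in>ball k0 r.
        ((\<lambda>\<alpha>. c \<alpha> * (\<Prod>i\<in>UNIV. of_real (k$i - k0$i) ^ (\<alpha> i))) has_sum f k) UNIV)"

text \<open>Bloch eigen data: w2 m k = omega_m^2(k), phi m k = phi_m(k; .).\<close>
definition bloch_eigen ::
  "(real^'d \<Rightarrow> real) \<Rightarrow> (real^'d \<Rightarrow> real) \<Rightarrow> (nat \<Rightarrow> real^'d \<Rightarrow> real)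
     \<Rightarrow> (nat \<Rightarrow> real^'d \<Rightarrow> real^'d \<Rightarrow> complex) \<Rightarrow> bool" where
  "bloch_eigen G \<rho> w2 \<phi> \<longleftrightarrow>
    (\<forall>k.
      (\<forall>m. 0 \<le> w2 m k \<and> w2 m k \<le> w2 (Suc m) k) \<and>
      (\<forall>m. zperiodic (\<phi> m k) \<and> smooth (\<phi> m k)) \<and>
      (\<forall>m n. (LINT x:cell|lborel. of_real (\<rho> x) * \<phi> m k x * cnj (\<phi> n k x))
               = (if m = n then 1 else 0)) \<and>
      (\<forall>g. square_integrable_on cell g \<and> (\<forall>m. (LINT x:cell|lborel. g x * cnj (\<phi> m k x)) = 0)
              \<longrightarrow> (AE x in lborel. x \<in> cell \<longrightarrow> g x = 0)) \<and>
      (\<forall>m \<psi>. zperiodic \<psi> \<and> smooth (\<psi> :: real^'d \<Rightarrow> complex) \<longrightarrow>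
          (LINT x:cell|lborel. of_real (G x) *
              (\<Sum>i\<in>UNIV. (pdiff i (\<phi> m k) x + \<i> * of_real (k$i) * \<phi> m k x)
                          * cnj (pdiff i \<psi> x + \<i> * of_real (k$i) * \<psi> x)))
          = of_real (w2 m k) * (LINT x:cell|lborel. of_real (\<rho> x) * \<phi> m k x * cnj (\<psi> x)))) \<and>
    (\<forall>m k0. (\<exists>r>0. \<forall>k\<in>ball k0 r. mult w2 m k = mult w2 m k0)
              \<longrightarrow> (\<forall>x. real_analytic_at (\<lambda>k. \<phi> m k x) k0))"

definition weak_H1_solution ::
  "(real^'d \<Rightarrow> real) \<Rightarrow> (real^'d \<Rightarrow> real) \<Rightarrow> real \<Rightarrow> (real^'d \<Rightarrow> complex)
     \<Rightarrow> (real^'d \<Rightarrow> complex) \<Rightarrow> ('d \<Rightarrow> real^'d \<Rightarrow> complex) \<Rightarrow> bool" where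
  "weak_H1_solution G \<rho> c h u gu \<longleftrightarrow>
     square_integrable_on UNIV u \<and> (\<forall>i. square_integrable_on UNIV (gu i)) \<and>
     (\<forall>\<psi>. test_fun \<psi> \<longrightarrow> (\<forall>i.
        (LINT x|lborel. u x * of_real (pdiff i \<psi> x)) = - (LINT x|lborel. gu i x * of_real (\<psi> x)))) \<and>
     (\<forall>\<psi>. test_fun \<psi> \<longrightarrow>
        (LINT x|lborel. of_real (G x) * (\<Sum>i\<in>UNIV. gu i x * of_real (pdiff i \<psi> x))
                         - of_real (c * \<rho> x) * u x * of_real (\<psi> x))
        = (LINT x|lborel. h x * of_real (\<psi> x)))"

definition source ::
  "(real^'d \<Rightarrow> complex) \<Rightarrow> (real^'d \<Rightarrow> real) \<Rightarrow> (real^'d \<Rightarrow> complex) \<Rightarrow> real \<Rightarrow> real^'d \<Rightarrow> complex" where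
  "source F \<rho> \<phi>p \<epsilon> r =
     of_real (cst CARD('d)) * (LINT k|lborel. F k * cis (k \<bullet> r))
       * of_real (\<rho> ((1/\<epsilon>) *\<^sub>R r)) * \<phi>p ((1/\<epsilon>) *\<^sub>R r)"

text \<open>u^(p)(x), with g = f_eps(eps .) and w2c = omega^2.\<close>
definition upsol ::
  "(nat \<Rightarrow> real^'d \<Rightarrow> real) \<Rightarrow> (nat \<Rightarrow> real^'d \<Rightarrow> real^'d \<Rightarrow> complex) \<Rightarrow> nat \<Rightarrow> real
     \<Rightarrow> (real^'d \<Rightarrow> complex) \<Rightarrow> (real^'d) set \<Rightarrow> real \<Rightarrow> real^'d \<Rightarrow> complex" where
  "upsol w2 \<phi> p w2c g Y \<epsilon> x =
     of_real (cst CARD('d)) *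
     (LINT k:((\<lambda>k. \<epsilon> *\<^sub>R k) ` Y)|lborel.
        (of_real (\<epsilon>^2) * cinner_cell (bloch g k) (\<lambda>y. cis (k \<bullet> y) * \<phi> p k y)
           / of_real (w2 p k - w2c)) * cis (k \<bullet> x) * \<phi> p k x)"

end

theory Submission
  imports Defs
begin

text \<open>
  Fix the quasimomentum \<open>k\<close>. On the fibre the problem is diagonal in the eigenfunctions
  \<open>\<phi>\<^sub>m(k)\<close>, and the \<open>m\<close>-th coefficient of \<open>u\<close> is \<open>\<epsilon>\<^sup>2\<close> times that of the source divided by
  \<open>\<omega>\<^sub>m\<^sup>2(k) - \<omega>\<^sup>2\<close>. The source fibre is \<open>\<epsilon>\<^bsup>-d\<^esup> F(k/\<epsilon>) \<rho> \<phi>\<^sub>p(0)\<close>, hence supported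
  in \<open>\<epsilon> Y\<close>, and the approximation keeps the coefficient \<open>m = p\<close>. For \<open>m \<noteq> p\<close> the
  denominators stay away from \<open>0\<close>, because \<open>\<omega>\<^sub>p\<^sup>2(0)\<close> is simple and the eigenvalues are
  continuous, while \<open>\<phi>\<^sub>p(0)\<close> solves the problem at \<open>k\<close> up to \<open>O(\<bar>k\<bar>)\<close>, so that
  the remaining coefficients of the source carry a factor \<open>\<bar>k\<bar> = O(\<epsilon>)\<close>. This gives
  \<open>\<epsilon>\<^sup>2 \<cdot> \<epsilon>\<^bsup>-d\<^esup> \<cdot> \<epsilon> \<cdot> \<epsilon>\<^bsup>d/2\<^esup> = \<epsilon>\<^bsup>3 - d/2\<^esup>\<close>.

  To stay with absolutely convergent Bloch sums, the solution is first multiplied by a cut-off of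
  radius \<open>R\<close>. Since \<open>\<omega>\<^sup>2\<close> has a positive distance to all eigenvalues, the commutator terms vanish in
  \<open>L\<^sup>2\<close> as \<open>R \<rightarrow> \<infinity>\<close>.
\<close>

section \<open>Square-integrable functions\<close>

text \<open>The distance of \<omega>^2 to the spectrum depends on \<epsilon> and may be tiny, so it
  must not enter the constant. It is spent on two things only: the square integrability of the
  synthesized function at a fixed \<epsilon>, and the factor of the cut-off error, which vanishes
  with growing radius. Branch p, the one whose denominator is small, keeps its exact denominator in
  u^(p), so the source leaves no error there. For the other branches the denominators are measured
  by the separation of \<omega>_p^2(0) from its neighbours, a fixed number.

  The eigenfunctions are regular in k only where the multiplicity is locally constant. Joint
  measurability is therefore established for branch p near the origin alone; the other branches
  enter through sums over m at a single k.

  A weak solution has just one derivative in L^2. The tests are the waves e^(-ik.x) times the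
  conjugate of \<phi>_m(k), which are smooth and take over the second derivative.

  Completeness of the eigenfunctions at each k is the only spectral input beyond the eigenvalue
  equation; continuity in k and divergence of the eigenvalues are derived from it.\<close>

definition L2fun :: "'a measure \<Rightarrow> ('a \<Rightarrow> complex) \<Rightarrow> bool" where
  "L2fun M f \<longleftrightarrow> f \<in> borel_measurable M \<and> integrable M (\<lambda>x. (norm (f x))^2)"

definition L2ip :: "'a measure \<Rightarrow> ('a \<Rightarrow> complex) \<Rightarrow> ('a \<Rightarrow> complex) \<Rightarrow> complex" where
  "L2ip M f g = (LINT x|M. f x * cnj (g x))"

definition L2sq :: "'a measure \<Rightarrow> ('a \<Rightarrow> complex) \<Rightarrow> real" where
  "L2sq M f = (LINT x|M. (norm (f x))^2)"

lemma L2fun_sq: "L2fun M f \<Longrightarrow> integrable M (\<lambda>x. (norm (f x))^2)"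
  by (simp add: L2fun_def)

lemma borel_measurable_cnj [measurable]:
  "f \<in> borel_measurable M \<Longrightarrow> (\<lambda>x. cnj (f x)) \<in> borel_measurable M"
  by (rule borel_measurable_continuous_on[OF continuous_on_cnj[OF continuous_on_id]])

lemma L2sq_nonneg [simp]: "0 \<le> L2sq M f"
  by (simp add: L2sq_def)

lemma norm_add_sq_le: "(norm (a + b :: 'a::real_normed_vector))^2 \<le> 2 * (norm a)^2 + 2 * (norm b)^2"
proof -
  have "(norm (a + b))^2 \<le> (norm a + norm b)^2"
    by (intro power_mono norm_triangle_ineq) auto
  also have "\<dots> \<le> 2 * (norm a)^2 + 2 * (norm b)^2"
    using sum_squares_bound[of "norm a" "norm b"] by (simp add: power2_sum)
  finally show ?thesis .
qed

text \<open>The weight t becomes a bound for the distance of two quasimomenta in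
  \<open>energy_shift_le\<close>: the main term then grows only by the factor 1 + t, while 1 + 1/t
  meets a perturbation of size t^2, so that the total change is of first order.\<close>

lemma norm_add_sq_le_eps:
  fixes a b :: "'a::real_normed_vector"
  assumes "t > 0"
  shows "(norm (a + b))^2 \<le> (1 + t) * (norm a)^2 + (1 + 1/t) * (norm b)^2"
proof -
  have "(norm (a + b))^2 \<le> (norm a + norm b)^2"
    by (intro power_mono norm_triangle_ineq) auto
  also have "\<dots> \<le> (1 + t) * (norm a)^2 + (1 + 1/t) * (norm b)^2"
  proof -
    have "0 \<le> (sqrt t * norm a - norm b / sqrt t)^2" by simp
    also have "\<dots> = t * (norm a)^2 + (norm b)^2 / t - 2 * norm a * norm b"
      using assms by (simp add: power2_diff power_mult_distrib power_divide)
    finally show ?thesis by (simp add: power2_sum algebra_simps)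
  qed
  finally show ?thesis .
qed

lemma L2fun_mult_integrable:
  assumes "L2fun M f" "L2fun M g"
  shows "integrable M (\<lambda>x. f x * cnj (g x))"
proof (rule Bochner_Integration.integrable_bound)
  show "integrable M (\<lambda>x. (norm (f x))^2 + (norm (g x))^2)"
    using assms by (auto simp: L2fun_def)
  have [measurable]: "f \<in> borel_measurable M" "g \<in> borel_measurable M"
    using assms by (auto simp: L2fun_def)
  show "(\<lambda>x. f x * cnj (g x)) \<in> borel_measurable M" by measurable
  have "norm (f x) * norm (g x) \<le> (norm (f x))^2 + (norm (g x))^2" for x
    using sum_squares_bound[of "norm (f x)" "norm (g x)"]
      mult_nonneg_nonneg[OF norm_ge_zero norm_ge_zero, of "f x" "g x"] by linarith
  then show "AE x in M. norm (f x * cnj (g x)) \<le> norm ((norm (f x))^2 + (norm (g x))^2)"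
    by (simp add: norm_mult)
qed

lemma L2fun_add: assumes "L2fun M f" "L2fun M g" shows "L2fun M (\<lambda>x. f x + g x)"
  unfolding L2fun_def
proof
  have [measurable]: "f \<in> borel_measurable M" "g \<in> borel_measurable M"
    using assms by (auto simp: L2fun_def)
  show "(\<lambda>x. f x + g x) \<in> borel_measurable M" by measurable
  show "integrable M (\<lambda>x. (norm (f x + g x))^2)"
  proof (rule Bochner_Integration.integrable_bound)
    show "integrable M (\<lambda>x. 2 * (norm (f x))^2 + 2 * (norm (g x))^2)"
      using assms by (auto simp: L2fun_def)
    show "AE x in M. norm ((norm (f x + g x))^2) \<le> norm (2 * (norm (f x))^2 + 2 * (norm (g x))^2)"
      using norm_add_sq_le by auto
  qed measurable
qed

lemma L2fun_scale: assumes "L2fun M f" shows "L2fun M (\<lambda>x. c * f x)"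
  using assms by (auto simp: L2fun_def norm_mult power_mult_distrib)

lemma L2fun_uminus: assumes "L2fun M f" shows "L2fun M (\<lambda>x. - f x)"
  using L2fun_scale[OF assms, of "-1"] by simp

lemma L2fun_diff: assumes "L2fun M f" "L2fun M g" shows "L2fun M (\<lambda>x. f x - g x)"
  using L2fun_add[OF assms(1) L2fun_uminus[OF assms(2)]] by simp

lemma L2fun_sum: assumes "\<And>i. i \<in> I \<Longrightarrow> L2fun M (f i)" shows "L2fun M (\<lambda>x. \<Sum>i\<in>I. f i x)"
proof (cases "finite I")
  case True
  then show ?thesis using assms
  proof (induction I)
    case empty then show ?case by (simp add: L2fun_def)
  next
    case (insert i I) then show ?case by (auto intro: L2fun_add)
  qed
qed (simp add: L2fun_def)

lemma L2fun_bounded_mult: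
  assumes f: "L2fun M f" and [measurable]: "b \<in> borel_measurable M" and B: "\<And>x. norm (b x) \<le> B"
  shows "L2fun M (\<lambda>x. b x * f x)"
  unfolding L2fun_def
proof
  have [measurable]: "f \<in> borel_measurable M" using f by (auto simp: L2fun_def)
  show "(\<lambda>x. b x * f x) \<in> borel_measurable M" by measurable
  show "integrable M (\<lambda>x. (norm (b x * f x))^2)"
  proof (rule Bochner_Integration.integrable_bound)
    show "integrable M (\<lambda>x. B^2 * (norm (f x))^2)"
      using f by (auto simp: L2fun_def)
    have "(norm (b x))^2 \<le> B^2" for x using B[of x] by (intro power_mono) auto
    then show "AE x in M. norm ((norm (b x * f x))^2) \<le> norm (B^2 * (norm (f x))^2)"
      by (auto simp: norm_mult power_mult_distrib intro!: mult_right_mono AE_I2)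
  qed measurable
qed

lemma L2ip_diff_left: assumes "L2fun M f" "L2fun M g" "L2fun M h"
  shows "L2ip M (\<lambda>x. f x - g x) h = L2ip M f h - L2ip M g h"
  unfolding L2ip_def using assms
  by (simp add: left_diff_distrib L2fun_mult_integrable Bochner_Integration.integral_diff)

lemma L2ip_scale_left: "L2ip M (\<lambda>x. c * f x) h = c * L2ip M f h"
  unfolding L2ip_def by (simp add: mult.assoc)

lemma L2ip_cnj: "cnj (L2ip M f g) = L2ip M g f"
  unfolding L2ip_def using Bochner_Integration.integral_cnj[of M "\<lambda>x. f x * cnj (g x)"]
      by (simp add: mult.commute)

lemma L2ip_diff_right: assumes "L2fun M f" "L2fun M g" "L2fun M h"
  shows "L2ip M h (\<lambda>x. f x - g x) = L2ip M h f - L2ip M h g"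
  using arg_cong[OF L2ip_diff_left[OF assms], of cnj] by (simp add: L2ip_cnj)

lemma L2ip_sum_left: assumes "\<And>i. i \<in> I \<Longrightarrow> L2fun M (f i)" "L2fun M h"
  shows "L2ip M (\<lambda>x. \<Sum>i\<in>I. c i * f i x) h = (\<Sum>i\<in>I. c i * L2ip M (f i) h)"
proof -
  have "L2ip M (\<lambda>x. \<Sum>i\<in>I. c i * f i x) h = (LINT x|M. (\<Sum>i\<in>I. c i * (f i x * cnj (h x))))"
    unfolding L2ip_def by (simp add: sum_distrib_right mult.assoc)
  also have "\<dots> = (\<Sum>i\<in>I. (LINT x|M. c i * (f i x * cnj (h x))))"
    using assms by (intro Bochner_Integration.integral_sum integrable_mult_right L2fun_mult_integrable) auto
  finally show ?thesis by (simp add: L2ip_def)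
qed

lemma L2ip_sum_right: assumes "\<And>i. i \<in> I \<Longrightarrow> L2fun M (f i)" "L2fun M h"
  shows "L2ip M h (\<lambda>x. \<Sum>i\<in>I. c i * f i x) = (\<Sum>i\<in>I. cnj (c i) * L2ip M h (f i))"
  using arg_cong[where f=cnj, OF L2ip_sum_left[OF assms, where c=c]] by (simp add: L2ip_cnj)

lemma L2ip_self: "L2ip M f f = of_real (L2sq M f)"
  unfolding L2ip_def L2sq_def complex_norm_square[symmetric]
  by (metis (mono_tags, lifting) complex_norm_square integral_complex_of_real Bochner_Integration.integral_cong)

lemma L2sq_cong_AE:
  assumes "AE x in M. f x = f' x" "f \<in> borel_measurable M" "f' \<in> borel_measurable M"
  shows "L2sq M f = L2sq M f'"
  unfolding L2sq_def using assms by (intro integral_cong_AE) auto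

lemma L2sq_scale: "L2sq M (\<lambda>x. c * f x) = (norm c)^2 * L2sq M f"
  by (simp add: L2sq_def norm_mult power_mult_distrib)

lemma L2sq_add_le: assumes "L2fun M f" "L2fun M g"
  shows "L2sq M (\<lambda>x. f x + g x) \<le> 2 * L2sq M f + 2 * L2sq M g"
proof -
  have "L2sq M (\<lambda>x. f x + g x) \<le> (LINT x|M. 2 * (norm (f x))^2 + 2 * (norm (g x))^2)"
    unfolding L2sq_def using assms L2fun_add[OF assms]
    by (intro integral_mono norm_add_sq_le) (auto simp: L2fun_def)
  also have "\<dots> = 2 * L2sq M f + 2 * L2sq M g"
    using assms by (simp add: L2sq_def L2fun_def)
  finally show ?thesis .
qed

lemma L2sq_diff: assumes "L2fun M f" "L2fun M g"
  shows "L2sq M (\<lambda>x. f x - g x) = L2sq M f - 2 * Re (L2ip M f g) + L2sq M g"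
proof -
  have "complex_of_real (L2sq M (\<lambda>x. f x - g x)) = L2ip M f f - L2ip M f g - L2ip M g f + L2ip M g g"
    unfolding L2ip_self[symmetric] using assms L2fun_diff[OF assms]
    by (simp add: L2ip_diff_left L2ip_diff_right)
  from arg_cong[OF this, of Re] show ?thesis
    using arg_cong[OF L2ip_cnj[of M f g], of Re] by (simp add: L2ip_self)
qed

lemma L2_Cauchy_Schwarz: assumes f: "L2fun M f" and g: "L2fun M g"
  shows "(norm (L2ip M f g))^2 \<le> L2sq M f * L2sq M g"
proof -
  define z where "z = L2ip M f g"
  \<comment> \<open>Scaling g by a real multiple of z, the inner product itself, makes the cross
    term real, so that a polynomial in the real s remains. If g has norm zero it is affine and
    becomes negative for large s unless z = 0; otherwise s is taken as its minimizer.\<close>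
  have *: "0 \<le> L2sq M f - 2 * s * (norm z)^2 + s^2 * (norm z)^2 * L2sq M g" for s :: real
  proof -
    define c where "c = of_real s * z"
    have "0 \<le> L2sq M (\<lambda>x. f x - c * g x)" by simp
    also have "\<dots> = L2sq M f - 2 * Re (L2ip M f (\<lambda>x. c * g x)) + L2sq M (\<lambda>x. c * g x)"
      by (rule L2sq_diff[OF f L2fun_scale[OF g]])
    also have "L2ip M f (\<lambda>x. c * g x) = cnj c * z"
      using L2ip_cnj[of M "\<lambda>x. c * g x" f, symmetric] L2ip_cnj[of M f g]
      by (simp add: L2ip_scale_left z_def) (metis L2ip_cnj)
    also have "L2sq M (\<lambda>x. c * g x) = (s^2 * (norm z)^2) * L2sq M g"
      by (simp add: L2sq_scale c_def norm_mult power_mult_distrib)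
    also have "Re (cnj c * z) = s * (norm z)^2"
      by (simp add: c_def cmod_power2) (simp add: algebra_simps power2_eq_square)
    finally show ?thesis by (simp add: algebra_simps)
  qed
  show ?thesis
  proof (cases "L2sq M g = 0")
    case True
    have "norm z = 0"
    proof (rule ccontr)
      assume "norm z \<noteq> 0"
      then have "(norm z)^2 > 0" by simp
      then show False using *[of "(L2sq M f + 1) / (norm z)^2"] True L2sq_nonneg[of M f]
          by (simp add: divide_simps)
    qed
    then show ?thesis by (simp add: z_def)
  next
    case False
    then have pos: "L2sq M g > 0" using L2sq_nonneg[of M g] by linarith
    have "0 \<le> L2sq M f - (norm z)^2 / L2sq M g"
      using *[of "1 / L2sq M g"] pos by (simp add: power2_eq_square field_simps)
    then show ?thesis using pos by (simp add: z_def field_simps)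
  qed
qed

section \<open>Orthonormal systems: Bessel, Riesz-Fischer and Parseval\<close>

definition ONS :: "'a measure \<Rightarrow> (nat \<Rightarrow> 'a \<Rightarrow> complex) \<Rightarrow> bool" where
  "ONS M e \<longleftrightarrow> (\<forall>n. L2fun M (e n)) \<and> (\<forall>m n. L2ip M (e m) (e n) = (if m = n then 1 else 0))"

lemma ONS_L2fun: "ONS M e \<Longrightarrow> L2fun M (e n)" by (simp add: ONS_def)

lemma ONS_ip: "ONS M e \<Longrightarrow> L2ip M (e m) (e n) = (if m = n then 1 else 0)" by (simp add: ONS_def)

lemma L2sq_ONS_sum:
  assumes e: "ONS M e" and "finite I"
  shows "L2sq M (\<lambda>x. \<Sum>n\<in>I. c n * e n x) = (\<Sum>n\<in>I. (norm (c n))^2)"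
proof -
  have s: "L2fun M (\<lambda>x. \<Sum>n\<in>I. c n * e n x)"
    by (intro L2fun_sum L2fun_scale ONS_L2fun[OF e])
  have "complex_of_real (L2sq M (\<lambda>x. \<Sum>n\<in>I. c n * e n x)) = (\<Sum>i\<in>I. c i * (\<Sum>j\<in>I. cnj (c j) * L2ip M (e i) (e j)))"
    unfolding L2ip_self[symmetric] using e s by (simp add: L2ip_sum_left L2ip_sum_right ONS_L2fun)
  also have "\<dots> = (\<Sum>i\<in>I. c i * cnj (c i))"
    using assms(2) by (simp add: ONS_ip[OF e] if_distrib cong: if_cong)
  also have "\<dots> = complex_of_real (\<Sum>n\<in>I. (norm (c n))^2)"
    by (simp only: of_real_sum complex_norm_square)
  finally show ?thesis using of_real_eq_iff by blast
qed

lemma L2ip_ONS_sum: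
  assumes e: "ONS M e" and "finite I"
  shows "L2ip M (\<lambda>x. \<Sum>n\<in>I. c n * e n x) (e m) = (if m \<in> I then c m else 0)"
  using assms(2) by (simp add: L2ip_sum_left ONS_L2fun[OF e] ONS_ip[OF e] if_distrib cong: if_cong)

text \<open>Pythagoras for the projection onto finitely many members of the system. Bessel's
  inequality is its nonnegativity; Parseval's identity is its limit.\<close>

lemma L2sq_diff_ONS_sum:
  assumes e: "ONS M e" and f: "L2fun M f" and I: "finite I"
  shows "L2sq M (\<lambda>x. f x - (\<Sum>n\<in>I. L2ip M f (e n) * e n x)) = L2sq M f - (\<Sum>n\<in>I. (norm (L2ip M f (e n)))^2)"
proof -
  let ?c = "\<lambda>n. L2ip M f (e n)"
  have s: "L2fun M (\<lambda>x. \<Sum>n\<in>I. ?c n * e n x)"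
    by (intro L2fun_sum L2fun_scale ONS_L2fun[OF e])
  have "L2ip M f (\<lambda>x. \<Sum>n\<in>I. ?c n * e n x) = (\<Sum>n\<in>I. cnj (?c n) * ?c n)"
    by (rule L2ip_sum_right[OF ONS_L2fun[OF e] f])
  also have "\<dots> = of_real (\<Sum>n\<in>I. (norm (?c n))^2)"
    by (simp only: of_real_sum complex_norm_square mult.commute)
  finally show ?thesis
    unfolding L2sq_diff[OF f s] L2sq_ONS_sum[OF e I] by simp
qed

lemma Bessel_finite:
  assumes e: "ONS M e" and f: "L2fun M f" and I: "finite I"
  shows "(\<Sum>n\<in>I. (norm (L2ip M f (e n)))^2) \<le> L2sq M f"
  using L2sq_diff_ONS_sum[OF assms] L2sq_nonneg[of M "\<lambda>x. f x - (\<Sum>n\<in>I. L2ip M f (e n) * e n x)"] by linarith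

lemma Bessel:
  assumes e: "ONS M e" and f: "L2fun M f"
  shows "summable (\<lambda>n. (norm (L2ip M f (e n)))^2)" "(\<Sum>n. (norm (L2ip M f (e n)))^2) \<le> L2sq M f"
proof -
  show "summable (\<lambda>n. (norm (L2ip M f (e n)))^2)"
    by (rule summableI_nonneg_bounded[where x="L2sq M f"]) (use Bessel_finite[OF e f] in auto)
  then show "(\<Sum>n. (norm (L2ip M f (e n)))^2) \<le> L2sq M f"
    by (intro suminf_le_const) (use Bessel_finite[OF e f] in auto)
qed

lemma L2_fun_integrable_finite:
  assumes "finite_measure M" "L2fun M f"
  shows "integrable M f" "(LINT x|M. norm (f x))^2 \<le> measure M (space M) * L2sq M f"
proof -
  interpret finite_measure M by fact
  have [measurable]: "f \<in> borel_measurable M" using assms by (simp add: L2fun_def)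
  have one: "L2fun M (\<lambda>x. 1)" by (simp add: L2fun_def)
  show "integrable M f" using L2fun_mult_integrable[OF assms(2) one] by simp
  have nf: "L2fun M (\<lambda>x. of_real (norm (f x)))" using assms(2) by (auto simp: L2fun_def)
  have "L2ip M (\<lambda>x. of_real (norm (f x))) (\<lambda>x. 1) = of_real (LINT x|M. norm (f x))"
    by (simp add: L2ip_def)
  moreover have "L2sq M (\<lambda>x. of_real (norm (f x))) = L2sq M f" by (simp add: L2sq_def)
  ultimately show "(LINT x|M. norm (f x))^2 \<le> measure M (space M) * L2sq M f"
    using L2_Cauchy_Schwarz[OF nf one] by (simp add: L2sq_def mult.commute)
qed

text \<open>Riesz--Fischer along a fast subsequence: consecutive differences decay like \<open>2^-j\<close>, so they
  are summable almost everywhere, and Fatou's lemma controls the distance to the limit.\<close>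

lemma Riesz_Fischer_ONS:
  assumes fin: "finite_measure M" and e: "ONS M e" and c: "summable (\<lambda>n. (norm (c n :: complex))^2)"
  obtains s where "L2fun M s" "\<And>n. L2ip M s (e n) = c n" "L2sq M s = (\<Sum>n. (norm (c n))^2)"
    "(\<lambda>N. L2sq M (\<lambda>x. s x - (\<Sum>n<N. c n * e n x))) \<longlonglongrightarrow> 0"
proof -
  interpret finite_measure M by fact
  let ?a = "\<lambda>n. (norm (c n))^2"
  have [measurable]: "e n \<in> borel_measurable M" for n using e by (simp add: ONS_def L2fun_def)
  have tail: "(\<lambda>N. \<Sum>n. ?a (n + N)) \<longlonglongrightarrow> 0"
    using suminf_exist_split2[OF c] .
  have "\<exists>N0. \<forall>N\<ge>N0. (\<Sum>n. ?a (n + N)) < (1/4)^j" for j :: nat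
    using order_tendstoD(2)[OF tail, of "(1/4)^j"] by (auto simp: eventually_sequentially)
  then obtain N0 where N0: "\<And>j N. N \<ge> N0 j \<Longrightarrow> (\<Sum>n. ?a (n + N)) < (1/4)^j" by metis
  \<comment> \<open>The tails bound squared norms, so the threshold (1/4)^j makes the j-th
    difference at most 2^-j in norm. The maximum with \<open>Suc r\<close> keeps the indices
    strictly increasing.\<close>
  define N where "N = rec_nat (N0 0) (\<lambda>j r. max (Suc r) (N0 (Suc j)))"
  have N_Suc: "N (Suc j) = max (Suc (N j)) (N0 (Suc j))" for j by (simp add: N_def)
  have NN0: "N0 j \<le> N j" for j by (cases j) (simp_all add: N_def)
  have sm: "strict_mono N" by (rule strict_monoI_Suc) (simp add: N_Suc)
  have tl: "(\<Sum>n. ?a (n + N j)) \<le> (1/4)^j" for j using N0[OF NN0] by (simp add: less_imp_le)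
  define S where "S = (\<lambda>n x. \<Sum>i<n. c i * e i x)"
  have S[measurable]: "S n \<in> borel_measurable M" for n by (simp add: S_def)
  have SL: "L2fun M (S n)" for n unfolding S_def by (intro L2fun_sum L2fun_scale ONS_L2fun[OF e])
  have Sdiff: "S n x - S m x = (\<Sum>i\<in>{m..<n}. c i * e i x)" if "m \<le> n" for m n x
    using that by (simp add: S_def sum_diff_nat_ivl[of 0 m n "\<lambda>i. c i * e i x", simplified] lessThan_atLeast0)
  have Sd: "L2sq M (\<lambda>x. S n x - S m x) \<le> (\<Sum>i. ?a (i + m))" if "m \<le> n" for m n
  proof -
    have "L2sq M (\<lambda>x. S n x - S m x) = (\<Sum>i\<in>{m..<n}. ?a i)"
      using that by (simp add: Sdiff L2sq_ONS_sum[OF e])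
    also have "\<dots> = (\<Sum>i<n-m. ?a (i + m))"
      using that sum.shift_bounds_nat_ivl[of ?a 0 m "n-m"] by (simp add: lessThan_atLeast0)
    also have "\<dots> \<le> (\<Sum>i. ?a (i + m))"
      using summable_ignore_initial_segment[OF c] by (intro sum_le_suminf) auto
    finally show ?thesis .
  qed
  define g where "g = (\<lambda>j x. S (N (Suc j)) x - S (N j) x)"
  have gL: "L2fun M (g j)" for j unfolding g_def by (intro L2fun_diff SL)
  have g1: "(LINT x|M. norm (g j x)) \<le> sqrt (measure M (space M)) * (1/2)^j" for j
  proof -
    have "L2sq M (g j) \<le> (1/4)^j"
      unfolding g_def by (rule order_trans[OF Sd tl]) (use sm in \<open>simp add: strict_mono_less_eq\<close>)
    then have "(LINT x|M. norm (g j x))^2 \<le> measure M (space M) * (1/4)^j"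
      by (intro order_trans[OF L2_fun_integrable_finite(2)[OF fin gL]] mult_left_mono) auto
    also have "\<dots> = (sqrt (measure M (space M)) * (1/2)^j)^2"
      by (simp add: power_mult_distrib power2_eq_square power_divide flip: power_mult_distrib)
    finally show ?thesis by (rule power2_le_imp_le) auto
  qed
  have AEsum: "AE x in M. summable (\<lambda>j. norm (g j x))"
  proof -
    have [measurable]: "g j \<in> borel_measurable M" for j using gL by (simp add: L2fun_def)
    have "(\<integral>\<^sup>+x. (\<Sum>j. ennreal (norm (g j x))) \<partial>M) = (\<Sum>j. \<integral>\<^sup>+x. norm (g j x) \<partial>M)"
      by (rule nn_integral_suminf) auto
    also have "\<dots> = (\<Sum>j. ennreal (LINT x|M. norm (g j x)))"
      by (intro suminf_cong nn_integral_eq_integral integrable_norm L2_fun_integrable_finite(1)[OF fin gL]) auto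
    also have "\<dots> \<le> (\<Sum>j. ennreal (sqrt (measure M (space M)) * (1/2)^j))"
      by (intro suminf_le ennreal_leI g1) auto
    also have "\<dots> = ennreal (\<Sum>j. sqrt (measure M (space M)) * (1/2)^j)"
      by (rule suminf_ennreal2) (auto intro!: summable_mult summable_geometric)
    also have "\<dots> < \<infinity>" by simp
    finally have "AE x in M. (\<Sum>j. ennreal (norm (g j x))) \<noteq> \<infinity>"
      by (intro nn_integral_PInf_AE) auto
    then show ?thesis
    proof eventually_elim
      case (elim x)
      then show ?case by (intro summable_suminf_not_top) auto
    qed
  qed
  \<comment> \<open>Where the subsequence diverges, \<open>lim\<close> is an unspecified value; this
    concerns a null set only, and as a pointwise limit s stays measurable.\<close>
  define s where "s = (\<lambda>x. lim (\<lambda>j. S (N j) x))"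
  have [measurable]: "s \<in> borel_measurable M" unfolding s_def by measurable
  have conv: "AE x in M. (\<lambda>j. S (N j) x) \<longlonglongrightarrow> s x"
    using AEsum
  proof eventually_elim
    case (elim x)
    then have "summable (\<lambda>j. g j x)" by (rule summable_norm_cancel)
    then have "(\<lambda>n. \<Sum>j<n. g j x) \<longlonglongrightarrow> (\<Sum>j. g j x)" by (rule summable_LIMSEQ)
    moreover have "(\<Sum>j<n. g j x) = S (N n) x - S (N 0) x" for n
      unfolding g_def by (rule sum_lessThan_telescope)
    ultimately have "(\<lambda>n. (S (N n) x - S (N 0) x) + S (N 0) x) \<longlonglongrightarrow> (\<Sum>j. g j x) + S (N 0) x"
      by (intro tendsto_add) auto
    then show ?case unfolding s_def by (simp add: convergent_LIMSEQ_iff[symmetric] convergentI)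
  qed
  \<comment> \<open>Fatou along the subsequence turns the Cauchy estimate into a bound for the
    distance of s to every partial sum \<open>S n\<close>, hence into convergence of the whole
    sequence.\<close>
  have fatou: "(\<integral>\<^sup>+x. ennreal ((norm (s x - S n x))^2) \<partial>M) \<le> ennreal (\<Sum>i. ?a (i + n))" for n
  proof -
    have "(\<integral>\<^sup>+x. ennreal ((norm (s x - S n x))^2) \<partial>M)
          = (\<integral>\<^sup>+x. liminf (\<lambda>j. ennreal ((norm (S (N j) x - S n x))^2)) \<partial>M)"
      using conv
      by (intro nn_integral_cong_AE, eventually_elim)
         (intro lim_imp_Liminf[symmetric] tendsto_ennrealI tendsto_power tendsto_norm tendsto_diff
             tendsto_const, auto)
    also have "\<dots> \<le> liminf (\<lambda>j. \<integral>\<^sup>+x. ennreal ((norm (S (N j) x - S n x))^2) \<partial>M)"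
      by (rule nn_integral_liminf) measurable
    also have "\<dots> \<le> ennreal (\<Sum>i. ?a (i + n))"
    proof (rule Liminf_le)
      have "eventually (\<lambda>j. n \<le> N j) sequentially"
        using filterlim_subseq[OF sm] by (simp add: filterlim_at_top)
      then show "\<forall>\<^sub>F j in sequentially. (\<integral>\<^sup>+x. ennreal ((norm (S (N j) x - S n x))^2) \<partial>M)
            \<le> ennreal (\<Sum>i. ?a (i + n))"
      proof eventually_elim
        case (elim j)
        have "(\<integral>\<^sup>+x. ennreal ((norm (S (N j) x - S n x))^2) \<partial>M) = ennreal (L2sq M (\<lambda>x. S (N j) x - S n x))"
          unfolding L2sq_def using L2fun_diff[OF SL SL]
              by (intro nn_integral_eq_integral) (auto simp: L2fun_def)
        then show ?case using Sd[OF elim] by (simp add: ennreal_leI)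
      qed
    qed auto
    finally show ?thesis .
  qed
  have dL: "L2fun M (\<lambda>x. s x - S n x)" for n
    unfolding L2fun_def
  proof
    show "integrable M (\<lambda>x. (norm (s x - S n x))^2)"
      by (rule integrableI_bounded) (use fatou[of n] in \<open>auto intro: le_less_trans\<close>)
  qed measurable
  have dsq: "L2sq M (\<lambda>x. s x - S n x) \<le> (\<Sum>i. ?a (i + n))" for n
  proof -
    have "ennreal (L2sq M (\<lambda>x. s x - S n x)) = (\<integral>\<^sup>+x. ennreal ((norm (s x - S n x))^2) \<partial>M)"
      unfolding L2sq_def using dL by (intro nn_integral_eq_integral[symmetric]) (auto simp: L2fun_def)
    also note fatou
    finally show ?thesis by (subst (asm) ennreal_le_iff)
        (use summable_ignore_initial_segment[OF c] in \<open>auto intro!: suminf_nonneg\<close>)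
  qed
  have lim0: "(\<lambda>n. L2sq M (\<lambda>x. s x - S n x)) \<longlonglongrightarrow> 0"
    by (rule tendsto_sandwich[OF _ _ tendsto_const tail]) (use dsq in auto)
  have sL: "L2fun M s" using dL[of 0] by (simp add: S_def)
  have ip: "L2ip M s (e m) = c m" for m
  proof -
    have "(\<lambda>n. L2ip M (\<lambda>x. s x - S n x) (e m)) \<longlonglongrightarrow> 0"
    proof (rule Lim_null_comparison)
      show "\<forall>\<^sub>F n in sequentially. norm (L2ip M (\<lambda>x. s x - S n x) (e m))
            \<le> sqrt (L2sq M (\<lambda>x. s x - S n x) * L2sq M (e m))"
        using L2_Cauchy_Schwarz[OF dL ONS_L2fun[OF e]] by (intro always_eventually allI real_le_rsqrt) auto
      show "(\<lambda>n. sqrt (L2sq M (\<lambda>x. s x - S n x) * L2sq M (e m))) \<longlonglongrightarrow> 0"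
        using tendsto_real_sqrt[OF tendsto_mult_left_zero[OF lim0]] by simp
    qed
    moreover have "\<forall>\<^sub>F n in sequentially. L2ip M (\<lambda>x. s x - S n x) (e m) = L2ip M s (e m) - c m"
      using eventually_gt_at_top[of m]
    proof eventually_elim
      case (elim n)
      have "L2ip M (S n) (e m) = c m"
        unfolding S_def using L2ip_ONS_sum[OF e, of "{..<n}" c m] elim by simp
      then show ?case by (simp add: L2ip_diff_left sL SL ONS_L2fun[OF e])
    qed
    ultimately have "(\<lambda>n::nat. L2ip M s (e m) - c m) \<longlonglongrightarrow> 0" by (rule Lim_transform_eventually)
    then show ?thesis by (simp add: LIMSEQ_const_iff)
  qed
  have eq: "L2sq M (\<lambda>x. s x - S n x) = L2sq M s - (\<Sum>i<n. ?a i)" for n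
    using L2sq_diff_ONS_sum[OF e sL, of "{..<n}"] by (simp add: ip S_def)
  have "(\<lambda>n. L2sq M s - (\<Sum>i<n. ?a i)) \<longlonglongrightarrow> L2sq M s - (\<Sum>i. ?a i)"
    by (intro tendsto_diff tendsto_const summable_LIMSEQ c)
  then have "L2sq M s - (\<Sum>i. ?a i) = 0"
    using lim0 unfolding eq by (rule LIMSEQ_unique)
  then have "L2sq M s = (\<Sum>n. ?a n)" by simp
  then show thesis using that[OF sL ip] lim0 unfolding S_def by blast
qed

text \<open>The Riesz-Fischer limit of the expansion has the same coefficients as f, so totality
  forces it to agree with f almost everywhere. The statement for two functions follows by pairing g
  with the remainder, which Cauchy-Schwarz sends to zero.\<close>

lemma Parseval_total:
  assumes fin: "finite_measure M" and e: "ONS M e"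
    and tot: "\<And>g. L2fun M g \<Longrightarrow> (\<And>n. L2ip M g (e n) = 0) \<Longrightarrow> AE x in M. g x = 0"
    and f: "L2fun M f"
  shows "(\<lambda>N. L2sq M (\<lambda>x. f x - (\<Sum>n<N. L2ip M f (e n) * e n x))) \<longlonglongrightarrow> 0"
    "(\<lambda>n. (norm (L2ip M f (e n)))^2) sums L2sq M f"
    "L2fun M g \<Longrightarrow> (\<lambda>n. L2ip M g (e n) * cnj (L2ip M f (e n))) sums L2ip M g f"
proof -
  let ?c = "\<lambda>n. L2ip M f (e n)"
  obtain s where s: "L2fun M s" "\<And>n. L2ip M s (e n) = ?c n"
    "(\<lambda>N. L2sq M (\<lambda>x. s x - (\<Sum>n<N. ?c n * e n x))) \<longlonglongrightarrow> 0"
    by (rule Riesz_Fischer_ONS[OF fin e Bessel(1)[OF e f]]) blast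
  have "AE x in M. f x - s x = 0"
    using tot[OF L2fun_diff[OF f s(1)]] s f by (simp add: L2ip_diff_left ONS_L2fun[OF e])
  then have ae: "AE x in M. s x - (\<Sum>n<N. ?c n * e n x) = f x - (\<Sum>n<N. ?c n * e n x)" for N
    by (rule AE_mp) auto
  have pL: "L2fun M (\<lambda>x. \<Sum>n<N. ?c n * e n x)" for N
    by (intro L2fun_sum L2fun_scale ONS_L2fun[OF e])
  have "L2sq M (\<lambda>x. s x - (\<Sum>n<N. ?c n * e n x)) = L2sq M (\<lambda>x. f x - (\<Sum>n<N. ?c n * e n x))" for N
    by (rule L2sq_cong_AE[OF ae]) (use L2fun_diff[OF s(1) pL] L2fun_diff[OF f pL] in \<open>auto simp: L2fun_def\<close>)
  then show lim0: "(\<lambda>N. L2sq M (\<lambda>x. f x - (\<Sum>n<N. ?c n * e n x))) \<longlonglongrightarrow> 0"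
    using s(3) by simp
  then have "(\<lambda>N. L2sq M f - L2sq M (\<lambda>x. f x - (\<Sum>n<N. ?c n * e n x))) \<longlonglongrightarrow> L2sq M f - 0"
    by (intro tendsto_diff tendsto_const)
  then show "(\<lambda>n. (norm (?c n))^2) sums L2sq M f"
    by (simp add: sums_def L2sq_diff_ONS_sum[OF e f])
  assume g: "L2fun M g"
  have "(\<lambda>N. L2ip M g (\<lambda>x. f x - (\<Sum>n<N. ?c n * e n x))) \<longlonglongrightarrow> 0"
  proof (rule Lim_null_comparison)
    show "\<forall>\<^sub>F n in sequentially. norm (L2ip M g (\<lambda>x. f x - (\<Sum>n<n. ?c n * e n x)))
        \<le> sqrt (L2sq M g * L2sq M (\<lambda>x. f x - (\<Sum>n<n. ?c n * e n x)))"
      using L2_Cauchy_Schwarz[OF g L2fun_diff[OF f pL]] by (intro always_eventually allI real_le_rsqrt) auto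
    show "(\<lambda>n. sqrt (L2sq M g * L2sq M (\<lambda>x. f x - (\<Sum>n<n. ?c n * e n x)))) \<longlonglongrightarrow> 0"
      using tendsto_real_sqrt[OF tendsto_mult_right_zero[OF lim0]] by simp
  qed
  moreover have "L2ip M g (\<lambda>x. f x - (\<Sum>n<N. ?c n * e n x)) = L2ip M g f
        - (\<Sum>n<N. L2ip M g (e n) * cnj (?c n))" for N
    by (simp add: L2ip_diff_right[OF f pL g] L2ip_sum_right[OF ONS_L2fun[OF e] g] mult.commute[of "cnj _"])
  ultimately have "(\<lambda>N. L2ip M g f - (L2ip M g f - (\<Sum>n<N. L2ip M g (e n) * cnj (?c n)))) \<longlonglongrightarrow> L2ip M g f - 0"
    by (intro tendsto_diff tendsto_const) simp
  then show "(\<lambda>n. L2ip M g (e n) * cnj (?c n)) sums L2ip M g f"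
    by (simp add: sums_def)
qed

section \<open>Translates of the unit cell\<close>

text \<open>An enumeration of the lattice, so that sums over translates become ordinary series, to
  which monotone and dominated convergence apply directly.\<close>

definition lat :: "nat \<Rightarrow> real^'d" where "lat = from_nat_into lattice"

lemma lattice_eq_range: "(lattice :: (real^'d) set) = range (\<lambda>z::int^'d. \<chi> i. of_int (z$i))"
proof
  show "lattice \<subseteq> range (\<lambda>z::int^'d. (\<chi> i. of_int (z$i)) :: real^'d)"
  proof
    fix j :: "real^'d" assume "j \<in> lattice"
    then have "j = (\<chi> i. of_int ((\<chi> i. \<lfloor>j$i\<rfloor>) $ i))"
      by (simp add: lattice_def vec_eq_iff)
    then show "j \<in> range (\<lambda>z::int^'d. \<chi> i. of_int (z$i))" by (rule image_eqI) simp
  qed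
qed (auto simp: lattice_def)

lemma countable_lattice: "countable (lattice :: (real^'d) set)"
  unfolding lattice_eq_range by simp

lemma infinite_lattice: "infinite (lattice :: (real^'d) set)"
proof -
  have "inj (\<lambda>n::nat. (of_nat n *\<^sub>R axis undefined 1) :: real^'d)"
    by (auto simp: inj_def axis_def vec_eq_iff split: if_splits)
  moreover have "range (\<lambda>n::nat. (of_nat n *\<^sub>R axis undefined 1) :: real^'d) \<subseteq> lattice"
    by (auto simp: lattice_def axis_def)
  ultimately show ?thesis by (meson infinite_UNIV_nat finite_imageD finite_subset)
qed

lemma bij_lat: "bij_betw (lat :: nat \<Rightarrow> real^'d) UNIV lattice"
  unfolding lat_def by (rule bij_betw_from_nat_into[OF countable_lattice infinite_lattice])

lemma lat_in [simp]: "lat n \<in> lattice"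
  using bij_lat by (auto simp: bij_betw_def)

lemma lat_inj [simp]: "lat m = lat n \<longleftrightarrow> m = n"
  using bij_lat by (auto simp: bij_betw_def inj_def)

lemma lat_ex: "j \<in> lattice \<Longrightarrow> \<exists>n. j = lat n"
  using bij_lat by (auto simp: bij_betw_def)

lemma lattice_diff: "j \<in> lattice \<Longrightarrow> l \<in> lattice \<Longrightarrow> j - l \<in> lattice"
  by (simp add: lattice_def)

lemma zperiodic_lat [simp]: "zperiodic f \<Longrightarrow> f (x + lat n) = f x"
  by (simp add: zperiodic_def)

lemma cell_eq_cbox: "cell = cbox ((\<chi> i. -1/2) :: real^'d) (\<chi> i. 1/2)"
  by (auto simp: cell_def mem_box_cart)

lemma dual_cell_eq_cbox: "dual_cell = cbox ((\<chi> i. -pi) :: real^'d) (\<chi> i. pi)"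
  by (auto simp: dual_cell_def mem_box_cart)

lemma cell_borel [measurable]: "(cell :: (real^'d) set) \<in> sets borel"
  by (simp add: cell_eq_cbox)

lemma dual_cell_borel [measurable]: "(dual_cell :: (real^'d) set) \<in> sets borel"
  by (simp add: dual_cell_eq_cbox)

lemma compact_cell: "compact (cell :: (real^'d) set)"
  by (simp add: cell_eq_cbox)

lemma compact_dual_cell: "compact (dual_cell :: (real^'d) set)"
  by (simp add: dual_cell_eq_cbox)

lemma emeasure_cell: "emeasure lborel (cell :: (real^'d) set) = 1"
  unfolding cell_eq_cbox by (subst emeasure_lborel_cbox) (auto simp: Basis_vec_def inner_axis prod.neutral)

lemma dual_cell_scaled: "(2 * pi) *\<^sub>R x \<in> dual_cell \<longleftrightarrow> x \<in> cell"
proof -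
  have "(- pi \<le> 2 * pi * t \<and> 2 * pi * t \<le> pi) \<longleftrightarrow> (- (1/2) \<le> t \<and> t \<le> 1/2)" for t :: real
    using mult_le_cancel_left_pos[of pi "-1" "2 * t"] mult_le_cancel_left_pos[of pi "2 * t" 1] by auto
  then show ?thesis by (simp add: cell_def dual_cell_def)
qed

lemma AE_component_neq: "AE x in lborel. (x :: real^'d) $ i \<noteq> c"
proof -
  have "negligible {x :: real^'d. x \<bullet> axis i 1 = c}"
    by (rule negligible_standard_hyperplane) (simp add: axis_in_Basis_iff)
  then have "{x :: real^'d. x $ i = c} \<in> null_sets lebesgue"
    by (simp add: negligible_iff_null_sets inner_axis)
  moreover have "{x :: real^'d. x $ i = c} \<in> sets lborel"
    using closed_hyperplane[of "axis i 1 :: real^'d" c] by (simp add: inner_axis inner_commute borel_closed)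
  ultimately have "{x :: real^'d. x $ i = c} \<in> null_sets lborel"
    by (simp add: null_sets_completion_iff)
  from AE_not_in[OF this] show ?thesis by simp
qed

text \<open>The closed cells overlap along their faces, so they tile space only up to a null set.
  The points with no coordinate in Z + 1/2 avoid all faces.\<close>

lemma AE_no_half_integer: "AE x in lborel. \<forall>i. (x :: real^'d) $ i + 1/2 \<notin> \<int>"
proof -
  have "AE x in lborel. \<forall>i. \<forall>z::int. (x :: real^'d) $ i \<noteq> of_int z - 1/2"
    unfolding AE_all_countable using AE_component_neq by blast
  then show ?thesis
  proof eventually_elim
    case (elim x)
    show ?case
    proof (intro allI notI)
      fix i assume "x $ i + 1/2 \<in> \<int>"
      then obtain z where "x $ i + 1/2 = of_int z" by (auto elim: Ints_cases)
      then have "x $ i = of_int z - 1/2" by simp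
      with elim show False by blast
    qed
  qed
qed

lemma unique_translate_in_cell:
  fixes x :: "real^'d"
  assumes "\<forall>i. x $ i + 1/2 \<notin> \<int>"
  shows "\<exists>!n. x + lat n \<in> cell"
proof -
  \<comment> \<open>Minus the nearest integer in every coordinate.\<close>
  define j :: "real^'d" where "j = (\<chi> i. - of_int \<lfloor>x$i + 1/2\<rfloor>)"
  have "j \<in> lattice" by (simp add: j_def lattice_def)
  then obtain n where n: "j = lat n" using lat_ex by blast
  have "x + j \<in> cell"
  proof -
    have "- (1/2) \<le> x $ i + j $ i \<and> x $ i + j $ i \<le> 1/2" for i
      unfolding j_def by simp linarith
    then show ?thesis by (simp add: cell_def)
  qed
  moreover have "m = n" if "x + lat m \<in> cell" for m
  proof -
    have "(lat m :: real^'d) $ i = j $ i" for i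
    proof -
      have "(lat m :: real^'d) \<in> lattice" by simp
      then have "(lat m :: real^'d) $ i \<in> \<int>" by (simp add: lattice_def)
      then obtain z where z: "(lat m :: real^'d) $ i = of_int z" by (auto elim: Ints_cases)
      have "-1/2 \<le> x $ i + of_int z" "x $ i + of_int z \<le> 1/2"
        using that unfolding z[symmetric] cell_def mem_Collect_eq by (metis vector_add_component)+
      moreover have "x $ i + of_int z \<noteq> 1/2"
      proof
        assume "x $ i + of_int z = 1/2"
        then have "x $ i + 1/2 = of_int (1 - z)" by simp
        then show False using assms Ints_of_int by metis
      qed
      ultimately have "\<lfloor>x $ i + 1/2\<rfloor> = - z" by (intro floor_unique) auto
      then show ?thesis by (simp add: z j_def)
    qed
    then have "(lat m :: real^'d) = lat n" using n by (simp add: vec_eq_iff)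
    then show ?thesis by simp
  qed
  ultimately show ?thesis by (metis n)
qed

lemma suminf_indicator_translates:
  fixes x :: "real^'d"
  assumes "\<exists>!n. x + lat n \<in> cell"
  shows "(\<Sum>n. c * indicator cell (x + lat n) :: ennreal) = c"
    "(\<lambda>n. indicator cell (x + lat n) *\<^sub>R b) sums (b :: 'b::real_normed_vector)"
proof -
  obtain n where n: "x + lat n \<in> cell" "\<And>m. x + lat m \<in> cell \<Longrightarrow> m = n"
    using ex1E[OF assms] by metis
  have iff: "x + lat m \<in> cell \<longleftrightarrow> m = n" for m using n(1) n(2)[of m] by auto
  have *: "indicator cell (x + lat m) = (if m = n then 1 else (0 :: 'c::zero_neq_one))" for m
    unfolding indicator_def using iff[of m] by simp
  show "(\<Sum>n. c * indicator cell (x + lat n) :: ennreal) = c"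
    unfolding * by (subst suminf_finite[of "{n}"]) auto
  show "(\<lambda>n. indicator cell (x + lat n) *\<^sub>R b) sums b"
    unfolding * using sums_single[of n "\<lambda>_. b"] by (simp add: if_distrib if_distribR cong: if_cong)
qed

lemma AE_translates_cell: "AE x in lborel. \<exists>!n. (x :: real^'d) + lat n \<in> cell"
  using AE_no_half_integer by eventually_elim (rule unique_translate_in_cell)

lemma uminus_mem_cell [simp]: "- x \<in> cell \<longleftrightarrow> (x :: real^'d) \<in> cell"
proof -
  have "- (1/2) \<le> - t \<and> - t \<le> 1/2 \<longleftrightarrow> - (1/2) \<le> t \<and> t \<le> 1/2" for t :: real by linarith
  then show ?thesis by (simp add: cell_def)
qed

text \<open>Unfolding moves a shift from the function to the indicator of the cell, where x - j
  appears instead of x + j; the symmetry of the cell under x -> -x reduces this to the version with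
  the opposite sign.\<close>

lemma AE_translates_cell_minus: "AE x in lborel. \<exists>!n. - (x :: real^'d) + lat n \<in> cell"
  using AE_no_half_integer
proof eventually_elim
  case (elim x)
  have "(- x) $ i + 1/2 \<notin> \<int>" for i
  proof
    assume "(- x) $ i + 1/2 \<in> \<int>"
    then have "1 - ((- x) $ i + 1/2) \<in> \<int>" by (intro Ints_diff) auto
    then show False using elim[rule_format, of i] by (simp add: algebra_simps)
  qed
  then show ?case by (intro unique_translate_in_cell) auto
qed

section \<open>Translation, scaling and unfolding of integrals over the lattice\<close>

lemma nn_integral_translate:
  fixes f :: "real^'d \<Rightarrow> ennreal"
  assumes [measurable]: "f \<in> borel_measurable borel"
  shows "(\<integral>\<^sup>+x. f (x + a) \<partial>lborel) = (\<integral>\<^sup>+x. f x \<partial>lborel)"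
proof -
  have "(\<integral>\<^sup>+x. f x \<partial>lborel) = (\<integral>\<^sup>+x. f x \<partial>distr lborel borel ((+) a))" by (simp add: lborel_distr_plus)
  also have "\<dots> = (\<integral>\<^sup>+x. f (a + x) \<partial>lborel)" by (rule nn_integral_distr) auto
  finally show ?thesis by (simp add: add.commute)
qed

lemma integral_translate:
  fixes f :: "real^'d \<Rightarrow> 'b::{banach, second_countable_topology}"
  assumes [measurable]: "f \<in> borel_measurable borel"
  shows "(LINT x|lborel. f (x + a)) = (LINT x|lborel. f x)"
    "integrable lborel (\<lambda>x. f (x + a)) \<longleftrightarrow> integrable lborel f"
proof -
  have "(LINT x|lborel. f x) = (LINT x|distr lborel borel ((+) a). f x)" by (simp add: lborel_distr_plus)
  also have "\<dots> = (LINT x|lborel. f (a + x))" by (rule integral_distr) auto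
  finally show "(LINT x|lborel. f (x + a)) = (LINT x|lborel. f x)" by (simp add: add.commute)
  have "integrable lborel f \<longleftrightarrow> integrable (distr lborel borel ((+) a)) f" by (simp add: lborel_distr_plus)
  also have "\<dots> \<longleftrightarrow> integrable lborel (\<lambda>x. f (a + x))" by (rule integrable_distr_eq) auto
  finally show "integrable lborel (\<lambda>x. f (x + a)) \<longleftrightarrow> integrable lborel f" by (simp add: add.commute)
qed

lemma scale_lborel:
  fixes f :: "real^'d \<Rightarrow> 'b::{banach, second_countable_topology}" and g :: "real^'d \<Rightarrow> ennreal"
  assumes s: "s > 0"
  shows "g \<in> borel_measurable borel \<Longrightarrow> (\<integral>\<^sup>+x. g x \<partial>lborel) = ennreal (s ^ CARD('d))
        * (\<integral>\<^sup>+x. g (s *\<^sub>R x) \<partial>lborel)"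
    "f \<in> borel_measurable borel \<Longrightarrow> (LINT x|lborel. f x) = (s ^ CARD('d)) *\<^sub>R (LINT x|lborel. f (s *\<^sub>R x))"
    "f \<in> borel_measurable borel \<Longrightarrow> integrable lborel (\<lambda>x. f (s *\<^sub>R x)) \<longleftrightarrow> integrable lborel f"
proof -
  let ?T = "\<lambda>x::real^'d. 0 + s *\<^sub>R x"
  have L: "(lborel :: (real^'d) measure) = density (distr lborel borel ?T) (\<lambda>_. ennreal (\<bar>s\<bar>^DIM(real^'d)))"
    by (rule lborel_affine) (use s in auto)
  have D: "\<bar>s\<bar>^DIM(real^'d) = s ^ CARD('d)" using s by simp
  have T[measurable]: "?T \<in> borel_measurable borel" by simp
  show "(\<integral>\<^sup>+x. g x \<partial>lborel) = ennreal (s ^ CARD('d)) * (\<integral>\<^sup>+x. g (s *\<^sub>R x) \<partial>lborel)" if [measurable]: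
      "g \<in> borel_measurable borel"
    by (subst L) (use s in \<open>simp add: nn_integral_density nn_integral_distr nn_integral_cmult\<close>)
  show "(LINT x|lborel. f x) = (s ^ CARD('d)) *\<^sub>R (LINT x|lborel. f (s *\<^sub>R x))" if [measurable]:
      "f \<in> borel_measurable borel"
    by (subst L) (use s in \<open>simp add: integral_density integral_distr\<close>)
  show "integrable lborel (\<lambda>x. f (s *\<^sub>R x)) \<longleftrightarrow> integrable lborel f" if [measurable]: "f \<in> borel_measurable borel"
  proof -
    have "integrable lborel f \<longleftrightarrow> integrable lborel (\<lambda>x. s ^ CARD('d) *\<^sub>R f (s *\<^sub>R x))"
      by (subst L) (use s in \<open>simp add: integrable_density integrable_distr_eq\<close>)
    also have "\<dots> \<longleftrightarrow> integrable lborel (\<lambda>x. f (s *\<^sub>R x))"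
    proof
      assume "integrable lborel (\<lambda>x. s ^ CARD('d) *\<^sub>R f (s *\<^sub>R x))"
      from integrable_scaleR_right[OF this, of "1 / s ^ CARD('d)"] show "integrable lborel (\<lambda>x. f (s *\<^sub>R x))"
        using s by simp
    qed simp
    finally show ?thesis by simp
  qed
qed

lemma AE_translate:
  fixes a :: "real^'d"
  assumes "AE x in lborel. P x"
  shows "AE x in lborel. P (x + a)"
proof -
  have "AE x in distr lborel borel ((+) a). P x" unfolding lborel_distr_plus by (rule assms)
  then have "AE x in lborel. P (a + x)" by (rule AE_distrD[rotated]) auto
  then show ?thesis by (simp add: add.commute)
qed

text \<open>The translated cells form a partition of unity almost everywhere; after inserting it,
  each piece is moved back to the unit cell by translation invariance.\<close>

lemma nn_integral_unfold:
  fixes f :: "real^'d \<Rightarrow> ennreal"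
  assumes [measurable]: "f \<in> borel_measurable borel"
  shows "(\<integral>\<^sup>+x. f x \<partial>lborel) = (\<integral>\<^sup>+x. (\<Sum>n. f (x + lat n)) * indicator cell x \<partial>lborel)"
proof -
  have [measurable]: "(\<lambda>x::real^'d. indicator cell (x - lat n) :: ennreal) \<in> borel_measurable borel" for n
    by (rule measurable_compose[OF _ borel_measurable_indicator[OF cell_borel]]) measurable
  have "(\<integral>\<^sup>+x. f x \<partial>lborel) = (\<integral>\<^sup>+x. (\<Sum>n. f x * indicator cell (x - lat n)) \<partial>lborel)"
  proof (rule nn_integral_cong_AE, use AE_translates_cell_minus in eventually_elim)
    fix x :: "real^'d" assume "\<exists>!n. - x + lat n \<in> cell"
    from suminf_indicator_translates(1)[OF this, of "f x"]
    have "(\<Sum>n. f x * indicator cell (- x + lat n)) = f x" .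
    moreover have "indicator cell (- x + lat n) = (indicator cell (x - lat n) :: ennreal)" for n
      using uminus_mem_cell[of "x - lat n"] by (simp add: indicator_def)
    ultimately show "f x = (\<Sum>n. f x * indicator cell (x - lat n))" by simp
  qed
  also have "\<dots> = (\<Sum>n. \<integral>\<^sup>+x. f x * indicator cell (x - lat n) \<partial>lborel)"
    by (rule nn_integral_suminf) measurable
  also have "\<dots> = (\<Sum>n. \<integral>\<^sup>+x. f (x + lat n) * indicator cell x \<partial>lborel)"
  proof (rule suminf_cong)
    fix n
    have "(\<integral>\<^sup>+x. f (x + lat n) * indicator cell (x + lat n - lat n) \<partial>lborel)
          = (\<integral>\<^sup>+x. f x * indicator cell (x - lat n) \<partial>lborel)"
      by (rule nn_integral_translate) measurable
    then show "(\<integral>\<^sup>+x. f x * indicator cell (x - lat n) \<partial>lborel)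
          = (\<integral>\<^sup>+x. f (x + lat n) * indicator cell x \<partial>lborel)" by simp
  qed
  also have "\<dots> = (\<integral>\<^sup>+x. (\<Sum>n. f (x + lat n) * indicator cell x) \<partial>lborel)"
    by (rule nn_integral_suminf[symmetric]) measurable
  finally show ?thesis by simp
qed

lemma integral_unfold:
  fixes f :: "real^'d \<Rightarrow> complex"
  assumes f: "integrable lborel f"
  shows "AE x in lborel. x \<in> cell \<longrightarrow> summable (\<lambda>n. norm (f (x + lat n)))"
    "set_integrable lborel cell (\<lambda>x. \<Sum>n. f (x + lat n))"
    "(LINT x|lborel. f x) = (LINT x:cell|lborel. (\<Sum>n. f (x + lat n)))"
proof -
  have [measurable]: "f \<in> borel_measurable borel" using f by auto
  \<comment> \<open>Two pictures of the same piece of f: \<open>h n\<close> is pulled back to the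
    unit cell, the function \<open>h' n\<close> below sits on the n-th translated cell. They differ
    by a translation, so their integrals agree, while their sums are the unfolded function and
    f.\<close>
  define h where "h n x = indicator cell x *\<^sub>R f (x + lat n)" for n and x :: "real^'d"
  define h' where "h' n x = indicator cell (x - lat n) *\<^sub>R f x" for n and x :: "real^'d"
  have hm[measurable]: "h n \<in> borel_measurable borel" "h' n \<in> borel_measurable borel" for n
    unfolding h_def h'_def by measurable
  have hh: "h n x = h' n (x + lat n)" for n x by (simp add: h_def h'_def)
  have nn: "(\<Sum>n. \<integral>\<^sup>+x. norm (h n x) \<partial>lborel) = (\<integral>\<^sup>+x. norm (f x) \<partial>lborel)"
  proof -
    have "(\<Sum>n. \<integral>\<^sup>+x. norm (h n x) \<partial>lborel) = (\<integral>\<^sup>+x. (\<Sum>n. ennreal (norm (h n x))) \<partial>lborel)"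
      by (rule nn_integral_suminf[symmetric]) measurable
    also have "\<dots> = (\<integral>\<^sup>+x. (\<Sum>n. ennreal (norm (f (x + lat n)))) * indicator cell x \<partial>lborel)"
      by (rule nn_integral_cong) (subst ennreal_suminf_multc[symmetric], intro suminf_cong, simp add: h_def
          indicator_def)
    also have "\<dots> = (\<integral>\<^sup>+x. norm (f x) \<partial>lborel)"
      by (rule nn_integral_unfold[symmetric]) measurable
    finally show ?thesis .
  qed
  have fin: "(\<integral>\<^sup>+x. norm (f x) \<partial>lborel) < \<infinity>" using f by (simp add: integrable_iff_bounded)
  have hint: "integrable lborel (h n)" for n
  proof (rule integrableI_bounded)
    have "(\<integral>\<^sup>+x. norm (h n x) \<partial>lborel) = sum (\<lambda>n. \<integral>\<^sup>+x. norm (h n x) \<partial>lborel) {n}" by simp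
    also have "\<dots> \<le> (\<Sum>n. \<integral>\<^sup>+x. norm (h n x) \<partial>lborel)"
      by (rule sum_le_suminf) auto
    finally show "(\<integral>\<^sup>+x. norm (h n x) \<partial>lborel) < \<infinity>" using fin nn by (auto intro: le_less_trans)
  qed simp
  have h'int: "integrable lborel (h' n)" for n
    using hint[of n] unfolding hh by (subst (asm) integral_translate(2)) auto
  have eqn: "(\<integral>\<^sup>+x. norm (h n x) \<partial>lborel) = ennreal (LINT x|lborel. norm (h n x))" for n
    using hint by (intro nn_integral_eq_integral) auto
  have sumI: "summable (\<lambda>n. LINT x|lborel. norm (h n x))"
    using fin nn unfolding eqn by (intro summable_suminf_not_top) auto
  have AEs: "AE x in lborel. summable (\<lambda>n. norm (h n x))"
  proof -
    have "(\<integral>\<^sup>+x. (\<Sum>n. ennreal (norm (h n x))) \<partial>lborel) = (\<Sum>n. \<integral>\<^sup>+x. norm (h n x) \<partial>lborel)"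
      by (rule nn_integral_suminf) measurable
    then have "(\<integral>\<^sup>+x. (\<Sum>n. ennreal (norm (h n x))) \<partial>lborel) \<noteq> \<infinity>" using nn fin by simp
    then have "AE x in lborel. (\<Sum>n. ennreal (norm (h n x))) \<noteq> \<infinity>"
      by (intro nn_integral_PInf_AE) auto
    then show ?thesis
      by eventually_elim (auto intro!: summable_suminf_not_top)
  qed
  show "AE x in lborel. x \<in> cell \<longrightarrow> summable (\<lambda>n. norm (f (x + lat n)))"
    using AEs by eventually_elim (auto simp: h_def indicator_def split: if_splits)
  have ind: "indicator cell x *\<^sub>R (\<Sum>n. f (x + lat n)) = (\<Sum>n. h n x)" for x
    by (auto simp: h_def indicator_def)
  show "set_integrable lborel cell (\<lambda>x. \<Sum>n. f (x + lat n))"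
    unfolding set_integrable_def ind by (rule integrable_suminf[OF hint AEs sumI])
  have "(LINT x:cell|lborel. (\<Sum>n. f (x + lat n))) = (\<Sum>n. LINT x|lborel. h n x)"
    unfolding set_lebesgue_integral_def ind by (rule integral_suminf[OF hint AEs sumI])
  also have "\<dots> = (\<Sum>n. LINT x|lborel. h' n x)"
    unfolding hh by (subst integral_translate(1)) auto
  also have "\<dots> = (LINT x|lborel. (\<Sum>n. h' n x))"
  proof (rule integral_suminf[symmetric, OF h'int])
    have "(LINT x|lborel. norm (h' n x)) = (LINT x|lborel. norm (h n x))" for n
      unfolding hh by (rule integral_translate(1)[symmetric]) measurable
    then show "summable (\<lambda>n. LINT x|lborel. norm (h' n x))" using sumI by simp
    show "AE x in lborel. summable (\<lambda>n. norm (h' n x))"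
      using AE_translates_cell_minus
    proof eventually_elim
      case (elim x)
      from suminf_indicator_translates(2)[OF this, of "norm (f x)"]
      have "(\<lambda>n. indicator cell (- x + lat n) *\<^sub>R norm (f x)) sums norm (f x)" .
      moreover have "indicator cell (- x + lat n) = (indicator cell (x - lat n) :: real)" for n
        using uminus_mem_cell[of "x - lat n"] by (simp add: indicator_def)
      ultimately show ?case by (simp add: h'_def sums_iff)
    qed
  qed
  also have "\<dots> = (LINT x|lborel. f x)"
  proof (rule integral_cong_AE)
    show "AE x in lborel. (\<Sum>n. h' n x) = f x"
      using AE_translates_cell_minus
    proof eventually_elim
      case (elim x)
      from suminf_indicator_translates(2)[OF this, of "f x"]
      have "(\<lambda>n. indicator cell (- x + lat n) *\<^sub>R f x) sums f x" .
      moreover have "indicator cell (- x + lat n) = (indicator cell (x - lat n) :: real)" for n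
        using uminus_mem_cell[of "x - lat n"] by (simp add: indicator_def)
      ultimately show ?case by (simp add: h'_def sums_iff)
    qed
  qed measurable
  finally show "(LINT x|lborel. f x) = (LINT x:cell|lborel. (\<Sum>n. f (x + lat n)))" by simp
qed

lemma zperiodic_representative:
  fixes f :: "real^'d \<Rightarrow> 'b"
  assumes "zperiodic f"
  obtains y where "y \<in> cell" "f x = f y"
proof -
  define j :: "real^'d" where "j = (\<chi> i. - of_int \<lfloor>x$i + 1/2\<rfloor>)"
  have "j \<in> lattice" by (simp add: j_def lattice_def)
  then have "f (x + j) = f x" using assms by (simp add: zperiodic_def)
  moreover have "x + j \<in> cell"
  proof -
    have "- (1/2) \<le> x $ i + j $ i \<and> x $ i + j $ i \<le> 1/2" for i
      unfolding j_def by simp linarith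
    then show ?thesis by (simp add: cell_def)
  qed
  ultimately show ?thesis using that by metis
qed

lemma continuous_zperiodic_bounded:
  fixes f :: "real^'d \<Rightarrow> 'b::real_normed_vector"
  assumes "continuous_on UNIV f" "zperiodic f"
  obtains B where "B > 0" "\<And>x. norm (f x) \<le> B"
proof -
  have "compact (f ` cell)" using assms(1) compact_cell
    by (intro compact_continuous_image) (auto intro: continuous_on_subset)
  then obtain B where B: "B > 0" "\<And>y. y \<in> cell \<Longrightarrow> norm (f y) \<le> B"
    using compact_imp_bounded bounded_pos by (metis image_eqI)
  have "norm (f x) \<le> B" for x
    by (rule zperiodic_representative[OF assms(2), of x]) (use B in auto)
  then show ?thesis using B(1) that by blast
qed

text \<open>The shifted cell is another fundamental domain: unfolding f restricted to it returns, by
  periodicity, f on the unit cell.\<close>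

lemma integral_zperiodic_shift:
  fixes f :: "real^'d \<Rightarrow> complex"
  assumes c: "continuous_on UNIV f" and p: "zperiodic f"
  shows "(LINT x:cell|lborel. f (x + a)) = (LINT x:cell|lborel. f x)"
proof -
  have [measurable]: "f \<in> borel_measurable borel" by (rule borel_measurable_continuous_onI[OF c])
  define g where "g x = indicator cell (x - a) *\<^sub>R f x" for x
  obtain B where B: "B > 0" "\<And>x. norm (f x) \<le> B" using continuous_zperiodic_bounded[OF c p] by blast
  have gm[measurable]: "g \<in> borel_measurable borel" unfolding g_def by measurable
  have ga: "g (x + a) = indicator cell x *\<^sub>R f (x + a)" for x by (simp add: g_def)
  have gi: "integrable lborel (\<lambda>x. g (x + a))" unfolding ga
  proof (rule integrableI_bounded_set_indicator[where B=B])
    show "emeasure lborel (cell :: (real^'d) set) < \<infinity>" by (simp add: emeasure_cell)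
  qed (use B in auto)
  then have gi': "integrable lborel g" by (simp add: integral_translate(2))
  have "(LINT x:cell|lborel. f (x + a)) = (LINT x|lborel. g (x + a))"
    by (simp add: set_lebesgue_integral_def ga)
  also have "\<dots> = (LINT x|lborel. g x)" by (rule integral_translate(1)) simp
  also have "\<dots> = (LINT x:cell|lborel. (\<Sum>n. g (x + lat n)))" by (rule integral_unfold(3)[OF gi'])
  also have "\<dots> = (LINT x:cell|lborel. f x)"
    unfolding set_lebesgue_integral_def
  proof (rule integral_cong_AE)
    show "AE x in lborel. indicator cell x *\<^sub>R (\<Sum>n. g (x + lat n)) = indicator cell x *\<^sub>R f x"
      using AE_translate[OF AE_translates_cell, of "-a"]
    proof eventually_elim
      case (elim x)
      from suminf_indicator_translates(2)[OF this, of "f x"]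
      have "(\<lambda>n. g (x + lat n)) sums f x" by (simp add: g_def p algebra_simps)
      then show ?case by (simp add: sums_iff)
    qed
  qed measurable
  finally show ?thesis .
qed

section \<open>Calculus of smooth functions\<close>

lemma pdiff_has_derivative:
  fixes f :: "real^'d \<Rightarrow> 'b::real_normed_vector"
  assumes "(f has_derivative f') (at x)"
  shows "pdiff i f x = f' (axis i 1)"
proof -
  have "((\<lambda>t::real. x + t *\<^sub>R axis i 1) has_derivative (\<lambda>t. t *\<^sub>R axis i 1)) (at 0)"
    by (auto intro!: derivative_eq_intros)
  moreover have "(f has_derivative f') (at (x + 0 *\<^sub>R axis i 1))" using assms by simp
  ultimately have "((\<lambda>t. f (x + t *\<^sub>R axis i 1)) has_derivative (\<lambda>t. f' (t *\<^sub>R axis i 1))) (at 0)"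
    by (rule has_derivative_compose)
  moreover have "f' (t *\<^sub>R axis i 1) = t *\<^sub>R f' (axis i 1)" for t
    using assms by (simp add: has_derivative_bounded_linear linear_simps)
  ultimately show ?thesis
    unfolding pdiff_def by (intro vector_derivative_at) (simp add: has_vector_derivative_def)
qed

lemma has_vector_derivative_line:
  fixes f :: "real^'d \<Rightarrow> 'b::real_normed_vector"
  assumes "f differentiable (at (x + t *\<^sub>R axis i 1))"
  shows "((\<lambda>t. f (x + t *\<^sub>R axis i 1)) has_vector_derivative pdiff i f (x + t *\<^sub>R axis i 1)) (at t)"
proof -
  obtain f' where f': "(f has_derivative f') (at (x + t *\<^sub>R axis i 1))"
    using assms by (auto simp: differentiable_def)
  have "((\<lambda>t::real. x + t *\<^sub>R axis i 1) has_derivative (\<lambda>t. t *\<^sub>R axis i 1)) (at t)"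
    by (auto intro!: derivative_eq_intros)
  then have "((\<lambda>t. f (x + t *\<^sub>R axis i 1)) has_derivative (\<lambda>t. f' (t *\<^sub>R axis i 1))) (at t)"
    using f' by (rule has_derivative_compose)
  moreover have "f' (t *\<^sub>R axis i 1) = t *\<^sub>R f' (axis i 1)" for t
    using f' by (simp add: has_derivative_bounded_linear linear_simps)
  ultimately show ?thesis
    by (simp add: has_vector_derivative_def pdiff_has_derivative[OF f'])
qed

lemma pdiff_add:
  assumes "f differentiable (at x)" "g differentiable (at x)"
  shows "pdiff i (\<lambda>x. f x + g x) x = pdiff i f x + pdiff i g x"
proof -
  obtain f' g' where *: "(f has_derivative f') (at x)" "(g has_derivative g') (at x)"
    using assms by (auto simp: differentiable_def)
  show ?thesis
    using pdiff_has_derivative[OF has_derivative_add[OF *]] *[THEN pdiff_has_derivative] by simp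
qed

lemma pdiff_mult:
  fixes f g :: "real^'d \<Rightarrow> 'b::real_normed_algebra"
  assumes "f differentiable (at x)" "g differentiable (at x)"
  shows "pdiff i (\<lambda>x. f x * g x) x = pdiff i f x * g x + f x * pdiff i g x"
proof -
  obtain f' g' where *: "(f has_derivative f') (at x)" "(g has_derivative g') (at x)"
    using assms by (auto simp: differentiable_def)
  show ?thesis
    using pdiff_has_derivative[OF has_derivative_mult[OF *]] *[THEN pdiff_has_derivative] by simp
qed

lemma pdiff_linear:
  assumes L: "bounded_linear L" and "f differentiable (at x)"
  shows "pdiff i (\<lambda>x. L (f x)) x = L (pdiff i f x)"
proof -
  obtain f' where *: "(f has_derivative f') (at x)"
    using assms by (auto simp: differentiable_def)
  show ?thesis
    using pdiff_has_derivative[OF bounded_linear.has_derivative[OF L *]] pdiff_has_derivative[OF *] by simp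
qed

lemma pdiff_const [simp]: "pdiff i (\<lambda>_. c) = (\<lambda>_. 0)"
  by (rule ext) (use pdiff_has_derivative[OF has_derivative_const] in auto)

section \<open>Closure properties of smooth functions\<close>

text \<open>Smoothness speaks of all iterated partial derivatives at once. A class of differentiable
  functions that is stable under \<open>pdiff\<close> contains them all, so every closure property
  reduces to finding such a class.\<close>

lemma smooth_coinduct:
  assumes "P f" "\<And>f x. P f \<Longrightarrow> f differentiable (at x)" "\<And>f i. P f \<Longrightarrow> P (pdiff i f)"
  shows "smooth f"
proof -
  have "P (pdiffs is f)" for "is" by (induction "is") (use assms in auto)
  then show ?thesis using assms(2) by (auto simp: smooth_def)
qed

lemma smooth_pdiff: assumes "smooth f" shows "smooth (pdiff i f)"
proof -
  have "pdiffs is (pdiff i f) = pdiffs (is @ [i]) f" for "is" by (induction "is") auto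
  then show ?thesis using assms by (simp add: smooth_def)
qed

lemma smooth_differentiable: "smooth f \<Longrightarrow> f differentiable (at x)"
  unfolding smooth_def by (metis pdiffs.simps(1))

lemma smooth_continuous: "smooth f \<Longrightarrow> continuous_on A f"
  by (meson continuous_at_imp_continuous_on differentiable_imp_continuous_within smooth_differentiable)

lemma smooth_measurable: "smooth f \<Longrightarrow> f \<in> borel_measurable borel"
  by (rule borel_measurable_continuous_onI[OF smooth_continuous])

lemma smooth_const: "smooth (\<lambda>_. c)"
  by (rule smooth_coinduct[where P="\<lambda>f. \<exists>c. f = (\<lambda>_. c)"]) auto

lemma smooth_add: assumes "smooth f" "smooth g" shows "smooth (\<lambda>x. f x + g x)"
proof (rule smooth_coinduct[where P="\<lambda>h. \<exists>f g. smooth f \<and> smooth g \<and> h = (\<lambda>x. f x + g x)"])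
  fix h i assume "\<exists>f g. smooth f \<and> smooth g \<and> h = (\<lambda>x. f x + g x)"
  then obtain f g where *: "smooth f" "smooth g" "h = (\<lambda>x. f x + g x)" by blast
  then have "pdiff i h = (\<lambda>x. pdiff i f x + pdiff i g x)"
    by (auto simp: pdiff_add smooth_differentiable)
  then show "\<exists>f g. smooth f \<and> smooth g \<and> pdiff i h = (\<lambda>x. f x + g x)"
    using * smooth_pdiff by blast
qed (use assms in \<open>auto intro: differentiable_add smooth_differentiable\<close>)

text \<open>Products of smooth functions are not stable under \<open>pdiff\<close>, but by the
  Leibniz rule their finite sums are; this is the class for \<open>smooth_coinduct\<close>.\<close>

inductive sum_of_products :: "(real^'d \<Rightarrow> 'b::real_normed_algebra) \<Rightarrow> bool" where
  prod: "smooth f \<Longrightarrow> smooth g \<Longrightarrow> sum_of_products (\<lambda>x. f x * g x)"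
| add: "sum_of_products f \<Longrightarrow> sum_of_products g \<Longrightarrow> sum_of_products (\<lambda>x. f x + g x)"

lemma sum_of_products_differentiable: "sum_of_products f \<Longrightarrow> f differentiable (at x)"
  by (induction rule: sum_of_products.induct) (auto intro: differentiable_add differentiable_mult
      smooth_differentiable)

lemma sum_of_products_pdiff: "sum_of_products f \<Longrightarrow> sum_of_products (pdiff i f)"
proof (induction rule: sum_of_products.induct)
  case (prod f g)
  have "pdiff i (\<lambda>x. f x * g x) = (\<lambda>x. pdiff i f x * g x + f x * pdiff i g x)"
    by (auto simp: pdiff_mult smooth_differentiable prod)
  then show ?case by (auto intro!: sum_of_products.intros prod smooth_pdiff)
next
  case (add f g)
  have "pdiff i (\<lambda>x. f x + g x) = (\<lambda>x. pdiff i f x + pdiff i g x)"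
    by (auto simp: pdiff_add sum_of_products_differentiable add)
  then show ?case by (auto intro!: sum_of_products.add add)
qed

lemma smooth_mult:
  fixes f g :: "real^'d \<Rightarrow> 'b::real_normed_algebra"
  assumes "smooth f" "smooth g" shows "smooth (\<lambda>x. f x * g x)"
  by (rule smooth_coinduct[where P=sum_of_products])
     (auto intro: sum_of_products.prod assms sum_of_products_differentiable sum_of_products_pdiff)

lemma smooth_linear:
  fixes f :: "real^'d \<Rightarrow> 'b::real_normed_vector"
  assumes L: "bounded_linear L" and "smooth f" shows "smooth (\<lambda>x. L (f x))"
proof (rule smooth_coinduct[where P="\<lambda>h. \<exists>f. smooth f \<and> h = (\<lambda>x. L (f x))"])
  fix h i assume "\<exists>f. smooth f \<and> h = (\<lambda>x. L (f x))"
  then obtain f where *: "smooth f" "h = (\<lambda>x. L (f x))" by blast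
  then have "pdiff i h = (\<lambda>x. L (pdiff i f x))"
    by (auto simp: pdiff_linear[OF L] smooth_differentiable)
  then show "\<exists>f. smooth f \<and> pdiff i h = (\<lambda>x. L (f x))"
    using * smooth_pdiff by blast
next
  fix h :: "real^'d \<Rightarrow> _" and x :: "real^'d" assume "\<exists>f. smooth f \<and> h = (\<lambda>x. L (f x))"
  then show "h differentiable at x"
    using bounded_linear.has_derivative[OF L] smooth_differentiable unfolding differentiable_def by blast
qed (use assms in auto)

lemmas smooth_cnj = smooth_linear[OF bounded_linear_cnj]
  and smooth_Re = smooth_linear[OF bounded_linear_Re]
  and smooth_Im = smooth_linear[OF bounded_linear_Im]
  and smooth_of_real = smooth_linear[OF bounded_linear_of_real]
  and smooth_minus = smooth_linear[OF bounded_linear_minus[OF bounded_linear_ident]]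

lemmas pdiff_cnj = pdiff_linear[OF bounded_linear_cnj]
  and pdiff_Re = pdiff_linear[OF bounded_linear_Re]
  and pdiff_Im = pdiff_linear[OF bounded_linear_Im]
  and pdiff_of_real = pdiff_linear[OF bounded_linear_of_real]

lemma smooth_sum: assumes "\<And>i. i \<in> I \<Longrightarrow> smooth (f i)" shows "smooth (\<lambda>x. \<Sum>i\<in>I. f i x)"
proof (cases "finite I")
  case True
  then show ?thesis using assms by induction (auto intro: smooth_add smooth_const)
qed (simp add: smooth_const)

lemma smooth_diff: "smooth f \<Longrightarrow> smooth g \<Longrightarrow> smooth (\<lambda>x. f x - g x)"
  using smooth_add[OF _ smooth_minus] by simp

lemma pdiff_bounded_linear: "bounded_linear L \<Longrightarrow> pdiff i L = (\<lambda>_. L (axis i 1))"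
  by (rule ext) (rule pdiff_has_derivative[OF bounded_linear_imp_has_derivative])

lemma smooth_bounded_linear: assumes "bounded_linear L" shows "smooth L"
proof (rule smooth_coinduct[where P="\<lambda>f. f = L \<or> (\<exists>c. f = (\<lambda>_. c))"])
  fix f and x :: "real^'a" assume "f = L \<or> (\<exists>c. f = (\<lambda>_. c))"
  then show "f differentiable at x"
    using bounded_linear_imp_differentiable[OF assms] by auto
qed (auto simp: pdiff_bounded_linear[OF assms])

lemma pdiff_cis: "pdiff i (\<lambda>x. cis (k \<bullet> x)) x = \<i> * of_real (k $ i) * cis (k \<bullet> x)"
  "(\<lambda>x. cis (k \<bullet> x)) differentiable (at x)"
proof -
  have "((\<lambda>x. exp (\<i> * of_real (k \<bullet> x))) has_derivative
        (\<lambda>h. (\<i> * of_real (k \<bullet> h)) * exp (\<i> * of_real (k \<bullet> x)))) (at x)"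
  proof -
    have "((\<lambda>x. \<i> * of_real (k \<bullet> x)) has_derivative (\<lambda>h. \<i> * complex_of_real (k \<bullet> h))) (at x)"
      by (auto intro!: derivative_eq_intros)
    from has_derivative_compose[OF this DERIV_exp[THEN has_field_derivative_imp_has_derivative]]
    show ?thesis by (simp add: mult.commute)
  qed
  then have *: "((\<lambda>x. cis (k \<bullet> x)) has_derivative (\<lambda>h. (\<i> * of_real (k \<bullet> h)) * cis (k \<bullet> x))) (at x)"
    by (simp add: cis_conv_exp)
  show "(\<lambda>x. cis (k \<bullet> x)) differentiable (at x)" using * by (auto simp: differentiable_def)
  show "pdiff i (\<lambda>x. cis (k \<bullet> x)) x = \<i> * of_real (k $ i) * cis (k \<bullet> x)"
    using pdiff_has_derivative[OF *] by (simp add: inner_axis)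
qed

lemma smooth_cis: "smooth (\<lambda>x. cis (k \<bullet> x))"
proof (rule smooth_coinduct[where P="\<lambda>f. \<exists>c. f = (\<lambda>x. c * cis (k \<bullet> x))"])
  fix f i assume "\<exists>c. f = (\<lambda>x. c * cis (k \<bullet> x))"
  then obtain c where "f = (\<lambda>x. c * cis (k \<bullet> x))" by blast
  then have "pdiff i f = (\<lambda>x. (c * \<i> * of_real (k $ i)) * cis (k \<bullet> x))"
    by (auto simp: pdiff_linear[OF bounded_linear_mult_right] pdiff_cis)
  then show "\<exists>c. pdiff i f = (\<lambda>x. c * cis (k \<bullet> x))" by blast
qed (auto intro!: exI[of _ 1] differentiable_mult pdiff_cis(2))

lemma pdiff_scale_arg:
  assumes "f differentiable (at (c *\<^sub>R x))"
  shows "pdiff i (\<lambda>x. f (c *\<^sub>R x)) x = c *\<^sub>R pdiff i f (c *\<^sub>R x)" "(\<lambda>x. f (c *\<^sub>R x)) differentiable (at x)"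
proof -
  obtain f' where f': "(f has_derivative f') (at (c *\<^sub>R x))"
    using assms by (auto simp: differentiable_def)
  have "((\<lambda>x. c *\<^sub>R x) has_derivative (\<lambda>h. c *\<^sub>R h)) (at x)"
    by (auto intro!: derivative_eq_intros)
  then have *: "((\<lambda>x. f (c *\<^sub>R x)) has_derivative (\<lambda>h. f' (c *\<^sub>R h))) (at x)"
    using f' by (rule has_derivative_compose)
  show "(\<lambda>x. f (c *\<^sub>R x)) differentiable (at x)" using * by (auto simp: differentiable_def)
  show "pdiff i (\<lambda>x. f (c *\<^sub>R x)) x = c *\<^sub>R pdiff i f (c *\<^sub>R x)"
    using pdiff_has_derivative[OF *] pdiff_has_derivative[OF f'] f'
    by (simp add: has_derivative_bounded_linear linear_simps)
qed

lemma smooth_scale_arg: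
  fixes f :: "real^'d \<Rightarrow> 'b::real_normed_vector"
  assumes "smooth f" shows "smooth (\<lambda>x. f (c *\<^sub>R x))"
proof (rule smooth_coinduct[where P="\<lambda>h. \<exists>f a. smooth f \<and> h = (\<lambda>x. a *\<^sub>R f (c *\<^sub>R x))"])
  fix h i assume "\<exists>f a. smooth f \<and> h = (\<lambda>x. a *\<^sub>R f (c *\<^sub>R x))"
  then obtain f a where *: "smooth f" "h = (\<lambda>x. a *\<^sub>R f (c *\<^sub>R x))" by blast
  then have "pdiff i h = (\<lambda>x. (a * c) *\<^sub>R pdiff i f (c *\<^sub>R x))"
    by (auto simp: pdiff_linear[OF bounded_linear_scaleR_right] pdiff_scale_arg smooth_differentiable)
  then show "\<exists>f a. smooth f \<and> pdiff i h = (\<lambda>x. a *\<^sub>R f (c *\<^sub>R x))"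
    using * smooth_pdiff by blast
next
  fix h :: "real^'d \<Rightarrow> _" and x :: "real^'d" assume "\<exists>f a. smooth f \<and> h = (\<lambda>x. a *\<^sub>R f (c *\<^sub>R x))"
  then obtain f a where *: "smooth f" "h = (\<lambda>x. a *\<^sub>R f (c *\<^sub>R x))" by blast
  show "h differentiable at x"
    unfolding * by (rule differentiable_scaleR[OF differentiable_const
        pdiff_scale_arg(2)[OF smooth_differentiable[OF *(1)]]])
next
  show "\<exists>g a. smooth g \<and> (\<lambda>x. f (c *\<^sub>R x)) = (\<lambda>x. a *\<^sub>R g (c *\<^sub>R x))"
    using assms by (intro exI[of _ f] exI[of _ 1]) auto
qed

lemma zperiodic_pdiff: assumes "zperiodic f" shows "zperiodic (pdiff i f)"
  unfolding zperiodic_def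
proof safe
  fix x j :: "real^'a" assume "j \<in> lattice"
  then have "f (x + j + t *\<^sub>R axis i 1) = f (x + t *\<^sub>R axis i 1)" for t
    using assms by (metis zperiodic_def add.assoc add.commute)
  then show "pdiff i f (x + j) = pdiff i f x" by (simp add: pdiff_def)
qed

subsection \<open>Cut-off functions\<close>

text \<open>The flat functions t^-n e^(-1/t), continued by 0. The powers are included so that the
  family is stable under differentiation up to linear combinations; n = 0 is the classical
  example.\<close>

definition expinv :: "nat \<Rightarrow> real \<Rightarrow> real" where
  "expinv n t = (if t > 0 then inverse t ^ n * exp (- inverse t) else 0)"

lemma expinv_lim0: "((\<lambda>t. expinv n t) \<longlongrightarrow> 0) (at 0)"
proof (rule filterlim_split_at)
  show "((\<lambda>t. expinv n t) \<longlongrightarrow> 0) (at_left 0)"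
    by (rule Lim_transform_eventually[OF tendsto_const])
       (auto simp: eventually_at_left_field expinv_def intro!: exI[of _ "-1"])
  have "((\<lambda>t. inverse t ^ n / exp (inverse t)) \<longlongrightarrow> (0::real)) (at_right 0)"
    by (rule filterlim_compose[OF tendsto_power_div_exp_0 filterlim_inverse_at_top_right])
  then show "((\<lambda>t. expinv n t) \<longlongrightarrow> 0) (at_right 0)"
    by (rule Lim_transform_eventually)
       (auto simp: eventually_at_right_field expinv_def exp_minus divide_inverse intro!: exI[of _ "1"])
qed

lemma expinv_deriv:
  "(expinv n has_real_derivative (expinv (n + 2) t - real n * expinv (n + 1) t)) (at t)"
proof -
  consider "t > 0" | "t < 0" | "t = 0" by linarith
  then show ?thesis
  proof cases
    case 1
    have "((\<lambda>t. inverse t ^ n * exp (- inverse t)) has_real_derivative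
          (expinv (n + 2) t - real n * expinv (n + 1) t)) (at t)"
    proof -
      have 2: "((\<lambda>t. inverse t) has_real_derivative - (inverse t ^ 2)) (at t)"
        using DERIV_inverse[of t UNIV] 1 by (simp add: numeral_2_eq_2)
      have 3: "((\<lambda>t. inverse t ^ n) has_real_derivative - (real n * inverse t ^ (n + 1))) (at t)"
        using DERIV_power[OF 2, of n] by (cases n) (simp_all add: power2_eq_square algebra_simps)
      have 4: "((\<lambda>t. exp (- inverse t)) has_real_derivative exp (- inverse t) * inverse t ^ 2) (at t)"
        using DERIV_fun_exp[OF DERIV_minus[OF 2]] by simp
      show ?thesis
        using DERIV_mult[OF 3 4] 1 by (simp add: expinv_def power_add algebra_simps power2_eq_square)
    qed
    then show ?thesis
      by (rule has_field_derivative_transform_within_open[of _ _ _ "{0<..}"]) (use 1 in \<open>auto simp: expinv_def\<close>)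
  next
    case 2
    have "((\<lambda>t. 0) has_real_derivative (expinv (n + 2) t - real n * expinv (n + 1) t)) (at t)"
      using 2 by (auto simp: expinv_def)
    then show ?thesis
      by (rule has_field_derivative_transform_within_open[of _ _ _ "{..<0}"]) (use 2 in \<open>auto simp: expinv_def\<close>)
  next
    case 3
    \<comment> \<open>At the origin the difference quotient of \<open>expinv n\<close> is exactly
      \<open>expinv (Suc n)\<close>, so differentiability there is the limit already known for every
      n.\<close>
    have "((\<lambda>h. (expinv n (0 + h) - expinv n 0) / h) \<longlongrightarrow> 0) (at 0)"
    proof (rule Lim_transform_eventually[OF expinv_lim0[of "Suc n"]])
      show "\<forall>\<^sub>F h in at 0. expinv (Suc n) h = (expinv n (0 + h) - expinv n 0) / h"
        by (auto simp: expinv_def eventually_at_filter divide_inverse)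
    qed
    then show ?thesis using 3 by (simp add: DERIV_def expinv_def)
  qed
qed

text \<open>A partial derivative of g(x) \<open>expinv n\<close> (1 - |x|^2) is a sum of three terms
  of the same form, with indices n, n + 1 and n + 2, so this class is stable under
  \<open>pdiff\<close>.\<close>

inductive bump_sum :: "(real^'d \<Rightarrow> real) \<Rightarrow> bool" where
  base: "smooth g \<Longrightarrow> bump_sum (\<lambda>x. g x * expinv n (1 - x \<bullet> x))"
| add: "bump_sum f \<Longrightarrow> bump_sum g \<Longrightarrow> bump_sum (\<lambda>x. f x + g x)"

lemma expinv_comp_deriv:
  "((\<lambda>x::real^'d. expinv n (1 - x \<bullet> x)) has_derivative
     (\<lambda>h. (- 2 * (x \<bullet> h)) * (expinv (n + 2) (1 - x \<bullet> x) - real n * expinv (n + 1) (1 - x \<bullet> x)))) (at x)"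
proof -
  have "((\<lambda>x::real^'d. 1 - x \<bullet> x) has_derivative (\<lambda>h. - 2 * (x \<bullet> h))) (at x)"
    by (auto intro!: derivative_eq_intros simp: inner_commute)
  from has_derivative_compose[OF this expinv_deriv[THEN has_field_derivative_imp_has_derivative]]
  show ?thesis by (simp add: mult.commute)
qed

lemma bump_sum_differentiable: "bump_sum f \<Longrightarrow> f differentiable (at x)"
proof (induction rule: bump_sum.induct)
  case (base g n)
  then show ?case
    using differentiable_mult[OF smooth_differentiable[OF base] differentiableI[OF expinv_comp_deriv]] by simp
qed (auto intro: differentiable_add)

lemma bump_sum_pdiff: "bump_sum f \<Longrightarrow> bump_sum (pdiff i f)"
proof (induction rule: bump_sum.induct)
  case (base g n)
  have d: "(\<lambda>x. expinv n (1 - x \<bullet> x)) differentiable (at x)" for x :: "real^'a"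
    using expinv_comp_deriv by (auto simp: differentiable_def)
  have eq: "pdiff i (\<lambda>x. g x * expinv n (1 - x \<bullet> x)) =
    (\<lambda>x. (pdiff i g x * expinv n (1 - x \<bullet> x) +
       ((g x * (- 2 * x $ i)) * expinv (n + 2) (1 - x \<bullet> x) + (g x * (2 * real n * x $ i)) * expinv (n + 1)
           (1 - x \<bullet> x))))"
    using base
    by (intro ext) (simp add: pdiff_mult smooth_differentiable d pdiff_has_derivative[OF expinv_comp_deriv]
        inner_axis algebra_simps)
  have l: "smooth (\<lambda>x::real^'a. c * x $ i)" for c
    by (intro smooth_bounded_linear bounded_linear_compose[OF bounded_linear_mult_right] bounded_linear_vec_nth)
  show ?case
    unfolding eq by (intro bump_sum.intros smooth_mult smooth_pdiff base l)
next
  case (add f g)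
  have "pdiff i (\<lambda>x. f x + g x) = (\<lambda>x. pdiff i f x + pdiff i g x)"
    by (auto simp: pdiff_add bump_sum_differentiable add)
  then show ?case by (auto intro!: bump_sum.add add)
qed

text \<open>The factor \<open>exp 1\<close> normalizes the value at the origin to 1, and the squared
  norm keeps the function smooth there. There is no plateau: the values tend to 1 pointwise as R
  grows, which is all that the limits require.\<close>

definition cutoff :: "real \<Rightarrow> real^'d \<Rightarrow> real" where
  "cutoff R x = exp 1 * expinv 0 (1 - (inverse R *\<^sub>R x) \<bullet> (inverse R *\<^sub>R x))"

lemma smooth_cutoff: "smooth (cutoff R)"
proof -
  have "smooth (\<lambda>x::real^'d. exp 1 * expinv 0 (1 - x \<bullet> x))"
    by (rule smooth_coinduct[where P=bump_sum])
       (auto intro: bump_sum.base smooth_const bump_sum_differentiable bump_sum_pdiff)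
  from smooth_scale_arg[OF this, of "inverse R"] show ?thesis by (simp add: cutoff_def[abs_def])
qed

lemma cutoff_eq: "cutoff R x = cutoff 1 (inverse R *\<^sub>R x)"
  by (simp add: cutoff_def)

lemma cutoff_bounds: "0 \<le> cutoff R x" "cutoff R x \<le> 1"
proof -
  show "0 \<le> cutoff R x" by (simp add: cutoff_def expinv_def)
  let ?s = "1 - (inverse R *\<^sub>R x) \<bullet> (inverse R *\<^sub>R x)"
  have "?s \<le> 1" by (metis diff_le_eq inner_ge_zero le_add_same_cancel1)
  then have "?s > 0 \<Longrightarrow> 1 \<le> inverse ?s" by (rule one_le_inverse[rotated])
  then have "?s > 0 \<Longrightarrow> exp (- inverse ?s) \<le> exp (-1)" by simp
  then have "expinv 0 ?s \<le> exp (-1)" by (auto simp: expinv_def)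
  then have "cutoff R x \<le> exp 1 * exp (-1)" unfolding cutoff_def by (intro mult_left_mono) auto
  then show "cutoff R x \<le> 1" by (simp add: exp_minus)
qed

lemma cutoff_support: assumes "R > 0" "cutoff R x \<noteq> 0" shows "norm x < R"
proof -
  have "(inverse R *\<^sub>R x) \<bullet> (inverse R *\<^sub>R x) < 1"
    using assms by (auto simp: cutoff_def expinv_def split: if_splits)
  then have "norm (inverse R *\<^sub>R x) < 1" by (metis norm_eq_sqrt_inner real_sqrt_lt_1_iff)
  then show ?thesis using assms by (simp add: field_simps)
qed

lemma cutoff_test_fun: "R > 0 \<Longrightarrow> test_fun (cutoff R)"
  unfolding test_fun_def bounded_iff using smooth_cutoff cutoff_support by (fastforce intro: less_imp_le)

lemma cutoff_tendsto: "((\<lambda>n. cutoff (real (Suc n)) x) \<longlonglongrightarrow> 1)"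
proof -
  have "isCont (cutoff 1) (0::real^'a)"
    using smooth_continuous[OF smooth_cutoff, of UNIV 1] by (auto simp: continuous_on_eq_continuous_at)
  moreover have "(\<lambda>n. inverse (real (Suc n)) *\<^sub>R x) \<longlonglongrightarrow> 0 *\<^sub>R x"
    by (intro tendsto_scaleR LIMSEQ_inverse_real_of_nat tendsto_const)
  ultimately have "(\<lambda>n. cutoff 1 (inverse (real (Suc n)) *\<^sub>R x)) \<longlonglongrightarrow> cutoff 1 (0::real^'a)"
    by (intro isCont_tendsto_compose[of _ "cutoff 1"]) auto
  moreover have "cutoff 1 (0::real^'a) = 1" by (simp add: cutoff_def expinv_def exp_minus)
  ultimately show ?thesis unfolding cutoff_eq[of "real (Suc n)" x for n] by simp
qed

lemma bounded_support_pdiff: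
  fixes f :: "real^'d \<Rightarrow> 'b::real_normed_vector"
  assumes "\<And>x. norm x \<ge> R \<Longrightarrow> f x = 0" "norm x > R"
  shows "pdiff i f x = 0"
proof -
  have "(f has_derivative (\<lambda>_. 0)) (at x)"
  proof (rule has_derivative_transform_within_open[of "\<lambda>_. 0" _ x UNIV "- cball 0 R"])
    show "((\<lambda>_. 0) has_derivative (\<lambda>_. 0)) (at x)" by simp
  qed (use assms in \<open>auto simp: less_imp_le\<close>)
  from pdiff_has_derivative[OF this] show ?thesis by simp
qed

lemma smooth_compact_bounded:
  fixes f :: "real^'d \<Rightarrow> 'b::real_normed_vector"
  assumes "smooth f" "\<And>x. norm x > R \<Longrightarrow> f x = 0"
  obtains B where "B > 0" "\<And>x. norm (f x) \<le> B"
proof -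
  have "compact (f ` cball 0 R)"
    using smooth_continuous[OF assms(1)] by (intro compact_continuous_image) auto
  then obtain B where B: "B > 0" "\<And>y. y \<in> cball 0 R \<Longrightarrow> norm (f y) \<le> B"
    using compact_imp_bounded bounded_pos by (metis image_eqI)
  have "norm (f x) \<le> B" for x
    using B assms(2)[of x] by (cases "norm x > R") auto
  then show ?thesis using B(1) that by blast
qed

text \<open>Every derivative of the rescaled bump gains a factor 1/R. The second derivatives, of
  order 1/R^2, are recorded with 1/R only, so that one constant serves both orders.\<close>

lemma cutoff_derivative_bounds:
  obtains K where "K > 0"
    "\<And>R i x. R \<ge> 1 \<Longrightarrow> norm (pdiff i (cutoff R) (x::real^'d)) \<le> K / R"
    "\<And>R i j x. R \<ge> 1 \<Longrightarrow> norm (pdiff j (pdiff i (cutoff R)) (x::real^'d)) \<le> K / R"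
proof -
  let ?c = "cutoff 1 :: real^'d \<Rightarrow> real"
  have z0: "?c x = 0" if "norm x \<ge> 1" for x using cutoff_support[of 1 x] that by fastforce
  have z1: "pdiff i ?c x = 0" if "norm x > 1" for x i using bounded_support_pdiff[OF z0 that] .
  \<comment> \<open>The first derivatives are known to vanish outside the closed unit ball, not on
    its boundary; hence the larger radius.\<close>
  have z2: "pdiff j (pdiff i ?c) x = 0" if "norm x > 2" for x i j
    using bounded_support_pdiff[of 2 "pdiff i ?c", OF _ that] z1 by auto
  have s1: "smooth (pdiff i ?c)" for i by (intro smooth_pdiff smooth_cutoff)
  have "\<exists>B>0. \<forall>x. norm (pdiff i ?c x) \<le> B" for i
    by (rule smooth_compact_bounded[OF s1 z1]) auto
  then obtain B1 where B1: "\<And>i. B1 i > 0" "\<And>i x. norm (pdiff i ?c x) \<le> B1 i" by metis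
  have "\<exists>B>0. \<forall>x. norm (pdiff j (pdiff i ?c) x) \<le> B" for i j
    by (rule smooth_compact_bounded[OF smooth_pdiff[OF s1] z2]) auto
  then have "\<exists>Bf. \<forall>j. Bf j > 0 \<and> (\<forall>x. norm (pdiff j (pdiff i ?c) x) \<le> Bf j)" for i by (intro choice) auto
  then have "\<exists>B2. \<forall>i j. B2 i j > 0 \<and> (\<forall>x. norm (pdiff j (pdiff i ?c) x) \<le> B2 i j)" by (intro choice) auto
  then obtain B2 where B2: "\<And>i j. B2 i j > 0" "\<And>i j x. norm (pdiff j (pdiff i ?c) x) \<le> B2 i j" by auto
  define K where "K = (\<Sum>i\<in>UNIV. B1 i) + (\<Sum>i\<in>UNIV. \<Sum>j\<in>UNIV. B2 i j) + 1"
  have p1: "0 \<le> (\<Sum>i\<in>UNIV. B1 i)" "0 \<le> (\<Sum>j\<in>UNIV. B2 i j)" "0 \<le> (\<Sum>i\<in>UNIV. \<Sum>j\<in>UNIV. B2 i j)" for i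
    using B1 B2 by (auto intro!: sum_nonneg simp: less_imp_le)
  have b1: "B1 i \<le> K" for i
    using member_le_sum[of i UNIV B1] B1(1) p1 by (auto simp: K_def less_imp_le)
  have b2: "B2 i j \<le> K" for i j
  proof -
    have "B2 i j \<le> (\<Sum>j\<in>UNIV. B2 i j)" using B2(1) by (intro member_le_sum) (auto simp: less_imp_le)
    also have "\<dots> \<le> (\<Sum>i\<in>UNIV. \<Sum>j\<in>UNIV. B2 i j)" using p1 by (intro member_le_sum) auto
    finally show ?thesis using p1 by (simp add: K_def)
  qed
  have Kpos: "K > 0" using p1 by (simp add: K_def)
  have e: "cutoff R = (\<lambda>x. ?c (inverse R *\<^sub>R x))" for R by (rule ext) (rule cutoff_eq)
  have d1: "pdiff i (cutoff R) = (\<lambda>x. inverse R *\<^sub>R pdiff i ?c (inverse R *\<^sub>R x))" for R i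
    by (rule ext, subst e) (rule pdiff_scale_arg(1)[OF smooth_differentiable[OF smooth_cutoff]])
  have d2: "pdiff j (pdiff i (cutoff R)) x = inverse R
        *\<^sub>R (inverse R *\<^sub>R pdiff j (pdiff i ?c) (inverse R *\<^sub>R x))" for R i j x
    unfolding d1[where R=R]
    by (subst pdiff_linear[OF bounded_linear_scaleR_right])
       (auto intro!: pdiff_scale_arg smooth_differentiable smooth_scale_arg[OF s1]
           simp: pdiff_scale_arg(1)[OF smooth_differentiable[OF s1]])
  show ?thesis
  proof (rule that[OF Kpos])
    fix R :: real and i j :: 'd and x assume R: "R \<ge> 1"
    have "norm (pdiff i ?c (inverse R *\<^sub>R x)) / R \<le> K / R"
      using order_trans[OF B1(2) b1] R by (intro divide_right_mono) auto
    then show "norm (pdiff i (cutoff R) x) \<le> K / R"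
      unfolding d1[where R=R] using R by (simp add: divide_inverse mult.commute abs_mult)
    have "norm (pdiff j (pdiff i ?c) (inverse R *\<^sub>R x)) / R / R \<le> K / R / 1"
      using order_trans[OF B2(2) b2] R Kpos by (intro frac_le divide_right_mono) auto
    then show "norm (pdiff j (pdiff i (cutoff R)) x) \<le> K / R"
      unfolding d2[where R=R] using R by (simp add: divide_inverse mult.commute abs_mult)
  qed
qed

section \<open>Periodic functions on the unit cell\<close>

definition cint :: "(real^'d \<Rightarrow> complex) \<Rightarrow> complex" where
  "cint f = (LINT x:cell|lborel. f x)"

lemma set_integrable_cell: "continuous_on UNIV f \<Longrightarrow> set_integrable lborel cell
      (f :: real^'d \<Rightarrow> 'b::{banach, second_countable_topology})"
  unfolding set_integrable_def
  by (rule borel_integrable_compact[OF compact_cell]) (auto intro: continuous_on_subset)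

lemma cint_add: "continuous_on UNIV f \<Longrightarrow> continuous_on UNIV g \<Longrightarrow> cint (\<lambda>x. f x + g x) = cint f + cint g"
  unfolding cint_def by (intro set_integral_add set_integrable_cell)

lemma cint_minus: "cint (\<lambda>x. - f x) = - cint f"
  unfolding cint_def set_lebesgue_integral_def by simp

lemma cint_sum: "(\<And>i. i \<in> I \<Longrightarrow> continuous_on UNIV (f i)) \<Longrightarrow> finite I \<Longrightarrow> cint (\<lambda>x. \<Sum>i\<in>I. f i x)
      = (\<Sum>i\<in>I. cint (f i))"
  by (rotate_tac 1, induction I rule: finite_induct)
     (auto simp: cint_add continuous_on_sum, simp add: cint_def)

lemma
  shows zperiodic_add: "zperiodic f \<Longrightarrow> zperiodic g \<Longrightarrow> zperiodic (\<lambda>x. f x + (g x :: 'a::plus))"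
    and zperiodic_mult: "zperiodic f' \<Longrightarrow> zperiodic g' \<Longrightarrow> zperiodic (\<lambda>x. f' x * (g' x :: 'b::times))"
    and zperiodic_minus: "zperiodic h \<Longrightarrow> zperiodic (\<lambda>x. - (h x :: 'c::uminus))"
    and zperiodic_cnj: "zperiodic u \<Longrightarrow> zperiodic (\<lambda>x. cnj (u x))"
    and zperiodic_of_real: "zperiodic v \<Longrightarrow> zperiodic (\<lambda>x. complex_of_real (v x))"
    and zperiodic_const: "zperiodic (\<lambda>_. c)"
  by (simp_all add: zperiodic_def)

lemma zperiodic_sum: "(\<And>i. i \<in> I \<Longrightarrow> zperiodic (f i)) \<Longrightarrow> zperiodic (\<lambda>x. \<Sum>i\<in>I. f i x)"
  unfolding zperiodic_def by (auto intro: sum.cong)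

lemmas zperiodic_rules = zperiodic_add zperiodic_mult zperiodic_minus zperiodic_cnj zperiodic_of_real
  zperiodic_const zperiodic_sum

lemma difference_quotient_bound:
  fixes f :: "real^'d \<Rightarrow> 'b::real_normed_vector"
  assumes d: "\<And>x. f differentiable (at x)" and B: "\<And>x. norm (pdiff i f x) \<le> B"
  shows "norm (f (x + h *\<^sub>R axis i 1) - f x) \<le> B * \<bar>h\<bar>"
proof -
  have "norm (f (x + h *\<^sub>R axis i 1) - f (x + 0 *\<^sub>R axis i 1)) \<le> B * norm (h - 0)"
  proof (rule differentiable_bound[of UNIV "\<lambda>t. f (x + t *\<^sub>R axis i 1)"
      "\<lambda>t s. s *\<^sub>R pdiff i f (x + t *\<^sub>R axis i 1)"])
    show "((\<lambda>t. f (x + t *\<^sub>R axis i 1)) has_derivative (\<lambda>s. s *\<^sub>R pdiff i f (x + t *\<^sub>R axis i 1)))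
          (at t within UNIV)" for t
      using has_vector_derivative_line[where x=x and t=t and i=i, OF d] by (simp add: has_vector_derivative_def)
    show "onorm (\<lambda>s. s *\<^sub>R pdiff i f (x + t *\<^sub>R axis i 1)) \<le> B" for t
      using mult_right_mono[OF B[of "x + t *\<^sub>R axis i 1"] abs_ge_zero]
          by (intro onorm_le) (simp add: mult.commute)
  qed auto
  then show ?thesis by simp
qed

lemma has_vector_derivative_quotient:
  assumes "(F has_vector_derivative d) (at 0)"
  shows "((\<lambda>t. (F t - F 0) /\<^sub>R t) \<longlongrightarrow> d) (at 0)"
proof -
  have "((\<lambda>h. norm (F (0 + h) - F 0 - h *\<^sub>R d) / norm h) \<longlongrightarrow> 0) (at 0)"
    using assms unfolding has_vector_derivative_def has_derivative_at by blast
  then have "((\<lambda>t. norm ((F t - F 0) /\<^sub>R t - d)) \<longlongrightarrow> 0) (at 0)"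
  proof (rule Lim_transform_eventually)
    have "norm (F (0 + h) - F 0 - h *\<^sub>R d) / norm h = norm ((F h - F 0) /\<^sub>R h - d)" if "h \<noteq> 0" for h
    proof -
      have "(F h - F 0) /\<^sub>R h - d = (F h - F 0 - h *\<^sub>R d) /\<^sub>R h"
        using that by (simp add: scaleR_diff_right)
      then show ?thesis by (simp add: divide_inverse mult.commute)
    qed
    then show "\<forall>\<^sub>F h in at 0. norm (F (0 + h) - F 0 - h *\<^sub>R d) / norm h = norm ((F h - F 0) /\<^sub>R h - d)"
      by (auto simp: eventually_at_filter)
  qed
  then show ?thesis by (rule LIM_zero_cancel[OF tendsto_norm_zero_cancel])
qed

text \<open>Difference quotients of a periodic function integrate to zero over the cell because the
  cell integral is shift invariant. The mean value bound dominates them, so the limit integrates to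
  zero as well. Opposite faces thus cancel without any boundary integral.\<close>

lemma cint_pdiff_eq_0:
  fixes f :: "real^'d \<Rightarrow> complex"
  assumes s: "smooth f" and p: "zperiodic f"
  shows "cint (pdiff i f) = 0"
proof -
  obtain B where B: "B > 0" "\<And>x. norm (pdiff i f x) \<le> B"
    using continuous_zperiodic_bounded[OF smooth_continuous[OF smooth_pdiff[OF s]] zperiodic_pdiff[OF p]]
        by blast
  have [measurable]: "f \<in> borel_measurable borel" "pdiff i f \<in> borel_measurable borel"
    using s by (auto intro: smooth_measurable smooth_pdiff)
  define h where "h n = inverse (real (Suc n))" for n
  have hpos: "h n > 0" for n by (simp add: h_def)
  define q where "q n x = indicator cell x *\<^sub>R ((f (x + h n *\<^sub>R axis i 1) - f x) /\<^sub>R h n)" for n x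
  have q0: "(LINT x|lborel. q n x) = 0" for n
  proof -
    have c: "continuous_on UNIV (\<lambda>x. f (x + h n *\<^sub>R axis i 1))"
      by (intro continuous_on_compose2[OF smooth_continuous[OF s, of UNIV]] continuous_intros) auto
    have "(LINT x|lborel. q n x) = (LINT x:cell|lborel. f (x + h n *\<^sub>R axis i 1) - f x) /\<^sub>R h n"
      unfolding q_def set_lebesgue_integral_def by (subst integral_scaleR_right[symmetric])
          (simp add: mult.commute)
    also have "(LINT x:cell|lborel. f (x + h n *\<^sub>R axis i 1) - f x) = 0"
      by (subst set_integral_diff(2)) (auto intro!: set_integrable_cell c smooth_continuous s
          simp: integral_zperiodic_shift[OF smooth_continuous[OF s] p])
    finally show ?thesis by simp
  qed
  have "(\<lambda>n. LINT x|lborel. q n x) \<longlonglongrightarrow> (LINT x|lborel. indicator cell x *\<^sub>R pdiff i f x)"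
  proof (rule integral_dominated_convergence[where w="\<lambda>x. indicator cell x * B"])
    show "(\<lambda>x. indicator cell x *\<^sub>R pdiff i f x) \<in> borel_measurable lborel" by measurable
    show "q n \<in> borel_measurable lborel" for n unfolding q_def by measurable
    show "integrable lborel (\<lambda>x::real^'d. indicator cell x * B)"
      using set_integrable_cell[of "\<lambda>_::real^'d. B"] by (simp add: set_integrable_def continuous_on_const)
    show "AE x in lborel. (\<lambda>n. q n x) \<longlonglongrightarrow> indicator cell x *\<^sub>R pdiff i f x"
    proof (rule AE_I2)
      fix x :: "real^'d"
      have "((\<lambda>t. f (x + t *\<^sub>R axis i 1)) has_vector_derivative pdiff i f x) (at 0)"
        using has_vector_derivative_line[of f x 0 i] smooth_differentiable[OF s] by simp
      then have "((\<lambda>t. (f (x + t *\<^sub>R axis i 1) - f (x + 0 *\<^sub>R axis i 1)) /\<^sub>R t) \<longlongrightarrow> pdiff i f x) (at 0)"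
        by (rule has_vector_derivative_quotient)
      then have "(\<lambda>n. (f (x + h n *\<^sub>R axis i 1) - f (x + 0 *\<^sub>R axis i 1)) /\<^sub>R h n) \<longlonglongrightarrow> pdiff i f x"
      proof (rule filterlim_compose)
        show "filterlim h (at 0) sequentially"
          unfolding filterlim_at using hpos LIMSEQ_inverse_real_of_nat
          by (auto simp: h_def[abs_def] less_imp_neq[symmetric])
      qed
      then show "(\<lambda>n. q n x) \<longlonglongrightarrow> indicator cell x *\<^sub>R pdiff i f x"
        unfolding q_def by (intro tendsto_scaleR tendsto_const) simp
    qed
    show "AE x in lborel. norm (q n x) \<le> indicator cell x * B" for n
    proof (rule AE_I2)
      fix x :: "real^'d"
      have "norm (f (x + h n *\<^sub>R axis i 1) - f x) \<le> B * \<bar>h n\<bar>"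
        by (rule difference_quotient_bound[OF smooth_differentiable[OF s] B(2)])
      then have "norm ((f (x + h n *\<^sub>R axis i 1) - f x) /\<^sub>R h n) \<le> B"
        using hpos[of n] unfolding norm_scaleR by (simp add: inverse_eq_divide pos_divide_le_eq)
      then show "norm (q n x) \<le> indicator cell x * B"
        unfolding q_def by (auto simp: indicator_def)
    qed
  qed
  then have "(\<lambda>n::nat. 0) \<longlonglongrightarrow> (LINT x|lborel. indicator cell x *\<^sub>R pdiff i f x)" by (simp add: q0)
  then show ?thesis by (simp add: cint_def set_lebesgue_integral_def LIMSEQ_const_iff)
qed

text \<open>The weight \<open>w\<close> turns the inner products of the Bloch problem into those of a finite measure space.\<close>

definition cellM :: "(real^'d \<Rightarrow> real) \<Rightarrow> (real^'d) measure" where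
  "cellM w = density lborel (\<lambda>x. ennreal (indicator cell x * w x))"

lemma borel_measurable_cellM [simp]: "borel_measurable (cellM w) = borel_measurable borel"
  by (auto simp: cellM_def measurable_def)

lemma integral_cellM:
  fixes f :: "real^'d \<Rightarrow> complex"
  assumes [measurable]: "f \<in> borel_measurable borel" "w \<in> borel_measurable borel" and "\<And>x. 0 \<le> w x"
  shows "(LINT x|cellM w. f x) = cint (\<lambda>x. of_real (w x) * f x)"
    "integrable (cellM w) f \<longleftrightarrow> set_integrable lborel cell (\<lambda>x. of_real (w x) * f x)"
  unfolding cellM_def cint_def set_lebesgue_integral_def set_integrable_def using assms
  by (simp_all add: integral_density integrable_density scaleR_conv_of_real mult.assoc)

lemma integral_cellM_real:
  fixes f :: "real^'d \<Rightarrow> real"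
  assumes [measurable]: "f \<in> borel_measurable borel" "w \<in> borel_measurable borel" and "\<And>x. 0 \<le> w x"
  shows "(LINT x|cellM w. f x) = (LINT x:cell|lborel. w x * f x)"
    "integrable (cellM w) f \<longleftrightarrow> set_integrable lborel cell (\<lambda>x. w x * f x)"
  unfolding cellM_def set_lebesgue_integral_def set_integrable_def using assms
  by (simp_all add: integral_density integrable_density mult.assoc)

lemma AE_cellM:
  assumes [measurable]: "w \<in> borel_measurable borel" and "\<And>x. 0 < w x"
  shows "(AE x in cellM w. P x) \<longleftrightarrow> (AE x in lborel. x \<in> cell \<longrightarrow> P x)"
  unfolding cellM_def using assms by (subst AE_density)
      (auto simp: indicator_def ennreal_zero_less_mult_iff intro!: AE_cong)

lemma finite_measure_cellM:
  assumes "continuous_on UNIV w" "\<And>x. 0 \<le> w x"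
  shows "finite_measure (cellM w)"
proof (rule finite_measureI)
  have [measurable]: "w \<in> borel_measurable borel" by (rule borel_measurable_continuous_onI) fact
  have "emeasure (cellM w) (space (cellM w)) = (\<integral>\<^sup>+x. ennreal (indicator cell x * w x) \<partial>lborel)"
    by (simp add: cellM_def emeasure_density)
  also have "\<dots> < \<infinity>"
  proof -
    have "integrable lborel (\<lambda>x. indicator cell x * w x)"
      using set_integrable_cell[OF assms(1)] by (simp add: set_integrable_def)
    then show ?thesis using assms(2)
      by (subst nn_integral_eq_integral) (auto simp: indicator_def)
  qed
  finally show "emeasure (cellM w) (space (cellM w)) \<noteq> \<infinity>" by simp
qed

lemma L2fun_cellM_continuous:
  assumes "continuous_on UNIV w" "\<And>x. 0 \<le> w x" "continuous_on UNIV f"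
  shows "L2fun (cellM w) f"
proof -
  have [measurable]: "w \<in> borel_measurable borel" "f \<in> borel_measurable borel"
    using assms by (auto intro: borel_measurable_continuous_onI)
  have "set_integrable lborel cell (\<lambda>x. w x * (norm (f x))^2)"
    using assms by (intro set_integrable_cell continuous_intros)
  then show ?thesis using assms(2) by (simp add: L2fun_def integral_cellM_real)
qed

section \<open>The shifted cell operator\<close>

text \<open>The components of nabla + ik: partial derivatives conjugated by the plane wave e^(ik.x).
  Accordingly \<open>Lk\<close> is the Bloch operator on the fibre k and \<open>energy\<close> its
  quadratic form.\<close>

definition Dk :: "real^'d \<Rightarrow> 'd \<Rightarrow> (real^'d \<Rightarrow> complex) \<Rightarrow> real^'d \<Rightarrow> complex" where
  "Dk k i f x = pdiff i f x + \<i> * of_real (k$i) * f x"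

definition Lk :: "(real^'d \<Rightarrow> real) \<Rightarrow> real^'d \<Rightarrow> (real^'d \<Rightarrow> complex) \<Rightarrow> real^'d \<Rightarrow> complex" where
  "Lk G k f x = - (\<Sum>i\<in>UNIV. Dk k i (\<lambda>x. of_real (G x) * Dk k i f x) x)"

definition energy :: "(real^'d \<Rightarrow> real) \<Rightarrow> real^'d \<Rightarrow> (real^'d \<Rightarrow> complex) \<Rightarrow> real" where
  "energy G k f = (LINT x:cell|lborel. G x * (\<Sum>i\<in>UNIV. (norm (Dk k i f x))^2))"

lemma smooth_Dk: assumes "smooth f" shows "smooth (Dk k i f)"
proof -
  have "smooth (\<lambda>x. pdiff i f x + (\<i> * of_real (k$i)) * f x)"
    by (intro smooth_add smooth_pdiff smooth_mult smooth_const assms)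
  then show ?thesis by (simp add: Dk_def[abs_def] mult.assoc)
qed

lemma zperiodic_Dk: "zperiodic f \<Longrightarrow> zperiodic (Dk k i f)"
  unfolding Dk_def[abs_def] by (intro zperiodic_rules zperiodic_pdiff)

lemma smooth_Lk: assumes "smooth G" "smooth f" shows "smooth (Lk G k f)"
  unfolding Lk_def[abs_def]
  by (intro smooth_minus smooth_sum smooth_Dk smooth_mult smooth_of_real assms)

lemma zperiodic_Lk: assumes "zperiodic G" "zperiodic f" shows "zperiodic (Lk G k f)"
  unfolding Lk_def[abs_def]
  by (intro zperiodic_rules zperiodic_Dk assms)

text \<open>Under the conjugate in the second slot the term i k_i changes sign exactly as a partial
  derivative does in integration by parts, so \<open>Dk\<close> is skew-adjoint on periodic
  functions.\<close>

lemma Dk_by_parts: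
  fixes f g :: "real^'d \<Rightarrow> complex"
  assumes f: "smooth f" "zperiodic f" and g: "smooth g" "zperiodic g"
  shows "cint (\<lambda>x. Dk k i f x * cnj (g x)) = - cint (\<lambda>x. f x * cnj (Dk k i g x))"
proof -
  let ?F = "\<lambda>x. f x * cnj (g x)"
  have sF: "smooth ?F" by (intro smooth_mult smooth_cnj f g)
  have pF: "zperiodic ?F" by (intro zperiodic_rules f g)
  have "pdiff i ?F x = Dk k i f x * cnj (g x) + f x * cnj (Dk k i g x)" for x
    using f g by (simp add: pdiff_mult pdiff_cnj smooth_differentiable smooth_cnj Dk_def algebra_simps)
  then have "pdiff i ?F = (\<lambda>x. Dk k i f x * cnj (g x) + f x * cnj (Dk k i g x))" by blast
  then have "0 = cint (\<lambda>x. Dk k i f x * cnj (g x) + f x * cnj (Dk k i g x))"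
    using cint_pdiff_eq_0[OF sF pF, of i] by simp
  also have "\<dots> = cint (\<lambda>x. Dk k i f x * cnj (g x)) + cint (\<lambda>x. f x * cnj (Dk k i g x))"
    by (intro cint_add smooth_continuous smooth_mult smooth_cnj smooth_Dk f g)
  finally show ?thesis by (simp add: eq_neg_iff_add_eq_0)
qed

lemma Green_cell:
  fixes f g :: "real^'d \<Rightarrow> complex"
  assumes G: "smooth G" "zperiodic G" and f: "smooth f" "zperiodic f" and g: "smooth g" "zperiodic g"
  shows "cint (\<lambda>x. Lk G k f x * cnj (g x)) = cint (\<lambda>x. of_real (G x)
        * (\<Sum>i\<in>UNIV. Dk k i f x * cnj (Dk k i g x)))"
proof -
  let ?h = "\<lambda>i x. of_real (G x) * Dk k i f x"
  have sh: "smooth (?h i)" for i by (intro smooth_mult smooth_of_real smooth_Dk G f)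
  have ph: "zperiodic (?h i)" for i by (intro zperiodic_rules zperiodic_Dk G f)
  have "cint (\<lambda>x. Lk G k f x * cnj (g x)) = - cint (\<lambda>x. \<Sum>i\<in>UNIV. Dk k i (?h i) x * cnj (g x))"
    by (simp add: Lk_def sum_distrib_right cint_minus)
  also have "\<dots> = - (\<Sum>i\<in>UNIV. cint (\<lambda>x. Dk k i (?h i) x * cnj (g x)))"
    by (subst cint_sum) (auto intro!: smooth_continuous smooth_mult smooth_cnj smooth_Dk[OF sh] g)
  also have "\<dots> = (\<Sum>i\<in>UNIV. cint (\<lambda>x. ?h i x * cnj (Dk k i g x)))"
    by (simp add: Dk_by_parts[OF sh ph g] sum_negf)
  also have "\<dots> = cint (\<lambda>x. \<Sum>i\<in>UNIV. ?h i x * cnj (Dk k i g x))"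
    by (rule cint_sum[symmetric]) (auto intro!: smooth_continuous smooth_mult smooth_cnj sh smooth_Dk[OF g(1)])
  finally show ?thesis by (simp add: sum_distrib_left mult.assoc)
qed

lemma of_real_energy:
  assumes "smooth G" "smooth f"
  shows "complex_of_real (energy G k f) = cint (\<lambda>x. of_real (G x) * (\<Sum>i\<in>UNIV. Dk k i f x * cnj (Dk k i f x)))"
proof -
  have "complex_of_real (energy G k f) = (LINT x|lborel. complex_of_real
        (indicator cell x *\<^sub>R (G x * (\<Sum>i\<in>UNIV. (norm (Dk k i f x))^2))))"
    unfolding energy_def set_lebesgue_integral_def by (rule integral_complex_of_real[symmetric])
  also have "\<dots> = (LINT x|lborel. indicator cell x *\<^sub>R
        (of_real (G x) * (\<Sum>i\<in>UNIV. Dk k i f x * cnj (Dk k i f x))))"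
    by (intro Bochner_Integration.integral_cong)
       (auto simp: complex_norm_square[symmetric] scaleR_conv_of_real)
  finally show ?thesis by (simp add: cint_def set_lebesgue_integral_def)
qed

text \<open>Between the two quasimomenta the shifted gradient changes by multiplication with i (k' -
  k), and Young's inequality with weight t separates this change. The weight is a bound for the
  distance and not the distance itself, so that it stays positive when k = k'.\<close>

lemma energy_shift_le:
  fixes f :: "real^'d \<Rightarrow> complex"
  assumes G: "smooth G" "\<And>x. 0 \<le> G x" "\<And>x. G x \<le> C" and f: "smooth f" and t: "t > 0" "norm (k - k') \<le> t"
  shows "energy G k' f \<le> (1 + t) * energy G k f + (1 + t) * t * C * (LINT x:cell|lborel. (norm (f x))^2)"
proof -
  have cont: "continuous_on UNIV G" "continuous_on UNIV f" "continuous_on UNIV (Dk k i f)"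
      "continuous_on UNIV (Dk k' i f)" for i
    by (intro smooth_continuous G smooth_Dk f)+
  have pt: "G x * (\<Sum>i\<in>UNIV. (norm (Dk k' i f x))^2)
      \<le> (1 + t) * (G x * (\<Sum>i\<in>UNIV. (norm (Dk k i f x))^2)) + ((1 + t) * t * C) * (norm (f x))^2" for x
  proof -
    have "(\<Sum>i\<in>UNIV. (norm (Dk k' i f x))^2) \<le> (\<Sum>i\<in>UNIV. (1 + t) * (norm (Dk k i f x))^2 + (1 + 1/t)
          * ((k'$i - k$i)^2 * (norm (f x))^2))"
    proof (rule sum_mono)
      fix i
      have "Dk k' i f x = Dk k i f x + \<i> * of_real (k'$i - k$i) * f x"
        by (simp add: Dk_def algebra_simps)
      then show "(norm (Dk k' i f x))^2 \<le> (1 + t) * (norm (Dk k i f x))^2 + (1 + 1/t)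
            * ((k'$i - k$i)^2 * (norm (f x))^2)"
        using norm_add_sq_le_eps[OF t(1), of "Dk k i f x" "\<i> * of_real (k'$i - k$i) * f x"]
        by (simp only: norm_mult norm_ii norm_of_real power_mult_distrib power2_abs mult_1 power_one)
    qed
    also have "\<dots> = (1 + t) * (\<Sum>i\<in>UNIV. (norm (Dk k i f x))^2) + (1 + 1/t)
          * ((norm (k - k'))^2 * (norm (f x))^2)"
      by (simp add: sum.distrib sum_distrib_left[symmetric] sum_distrib_right[symmetric] norm_vec_def
          L2_set_def power2_commute sum_nonneg)
    also have "\<dots> \<le> (1 + t) * (\<Sum>i\<in>UNIV. (norm (Dk k i f x))^2) + (1 + 1/t) * (t^2 * (norm (f x))^2)"
      using t by (intro add_left_mono mult_left_mono mult_right_mono power_mono) auto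
    also have "(1 + 1/t) * (t^2 * (norm (f x))^2) = ((1 + t) * t) * (norm (f x))^2"
      using t by (simp add: field_simps power2_eq_square)
    finally have "G x * (\<Sum>i\<in>UNIV. (norm (Dk k' i f x))^2) \<le> G x
          * ((1 + t) * (\<Sum>i\<in>UNIV. (norm (Dk k i f x))^2) + ((1 + t) * t) * (norm (f x))^2)"
      using G(2) by (intro mult_left_mono) auto
    also have "\<dots> = (1 + t) * (G x * (\<Sum>i\<in>UNIV. (norm (Dk k i f x))^2)) + G x * (((1 + t) * t) * (norm (f x))^2)"
      by (simp add: algebra_simps)
    also have "\<dots> \<le> (1 + t) * (G x * (\<Sum>i\<in>UNIV. (norm (Dk k i f x))^2)) + C * (((1 + t) * t) * (norm (f x))^2)"
      using G(3) t by (intro add_left_mono mult_right_mono) auto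
    finally show ?thesis by (simp add: algebra_simps)
  qed
  have "energy G k' f \<le> (LINT x:cell|lborel. (1 + t) * (G x * (\<Sum>i\<in>UNIV. (norm (Dk k i f x))^2))
        + ((1 + t) * t * C) * (norm (f x))^2)"
    unfolding energy_def by (rule set_integral_mono)
        (auto intro!: set_integrable_cell continuous_intros cont pt)
  also have "\<dots> = (1 + t) * energy G k f + (1 + t) * t * C * (LINT x:cell|lborel. (norm (f x))^2)"
    unfolding energy_def
    by (subst set_integral_add(2)) (auto intro!: set_integrable_cell continuous_intros cont)
  finally show ?thesis .
qed

text \<open>Elimination of one equation and one pivot unknown at a time. It supplies the dimension
  count of the min-max principle: m + 1 free coefficients against m orthogonality
  conditions.\<close>

lemma underdetermined_solution:
  fixes A :: "'i \<Rightarrow> 'j \<Rightarrow> complex"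
  assumes "finite J" "finite I" "card J < card I"
  shows "\<exists>\<alpha>. (\<exists>i\<in>I. \<alpha> i \<noteq> 0) \<and> (\<forall>j\<in>J. (\<Sum>i\<in>I. \<alpha> i * A i j) = 0)"
  using assms
proof (induction J arbitrary: I A rule: finite_induct)
  case empty
  then obtain i where "i \<in> I" by (metis card.empty less_irrefl ex_in_conv)
  then show ?case by (intro exI[of _ "\<lambda>_. 1"]) auto
next
  case (insert j J)
  show ?case
  proof (cases "\<forall>i\<in>I. A i j = 0")
    case True
    then show ?thesis using insert.IH[of I A] insert.prems insert.hyps by auto
  next
    case False
    then obtain i0 where i0: "i0 \<in> I" "A i0 j \<noteq> 0" by blast
    define I' where "I' = I - {i0}"
    have I: "I = insert i0 I'" "i0 \<notin> I'" "finite I'" using i0 insert.prems by (auto simp: I'_def)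
    have "card J < card I'" using insert.prems insert.hyps I by simp
    from insert.IH[OF I(3) this, of "\<lambda>i j'. A i j' - A i j / A i0 j * A i0 j'"]
    obtain \<alpha> where \<alpha>: "\<exists>i\<in>I'. \<alpha> i \<noteq> 0" "\<forall>j'\<in>J. (\<Sum>i\<in>I'. \<alpha> i * (A i j' - A i j / A i0 j * A i0 j')) = 0"
      by blast
    \<comment> \<open>The value of the pivot unknown that equation j prescribes; the reduced system
      was formed so that the remaining equations then hold with it.\<close>
    define s where "s = - (\<Sum>i\<in>I'. \<alpha> i * A i j) / A i0 j"
    define \<beta> where "\<beta> = \<alpha>(i0 := s)"
    have "(\<Sum>i\<in>I. \<beta> i * A i j') = s * A i0 j' + (\<Sum>i\<in>I'. \<alpha> i * A i j')" for j'
    proof -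
      have "(\<Sum>i\<in>I'. \<beta> i * A i j') = (\<Sum>i\<in>I'. \<alpha> i * A i j')"
        using I(2) by (intro sum.cong) (auto simp: \<beta>_def)
      then show ?thesis using I by (simp add: \<beta>_def)
    qed
    moreover have "s * A i0 j + (\<Sum>i\<in>I'. \<alpha> i * A i j) = 0" using i0 by (simp add: s_def)
    moreover have "s * A i0 j' + (\<Sum>i\<in>I'. \<alpha> i * A i j') = 0" if "j' \<in> J" for j'
    proof -
      have "0 = (\<Sum>i\<in>I'. \<alpha> i * A i j' - (\<alpha> i * A i j) * (A i0 j' / A i0 j))"
        using \<alpha>(2) that by (simp add: right_diff_distrib mult.assoc)
      also have "\<dots> = (\<Sum>i\<in>I'. \<alpha> i * A i j') - (\<Sum>i\<in>I'. \<alpha> i * A i j) * (A i0 j' / A i0 j)"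
        by (simp only: sum_subtractf sum_distrib_right)
      finally show ?thesis by (simp add: s_def divide_inverse mult_ac)
    qed
    moreover have "\<exists>i\<in>I. \<beta> i \<noteq> 0" using \<alpha>(1) I by (auto simp: \<beta>_def)
    ultimately show ?thesis by (intro exI[of _ \<beta>]) auto
  qed
qed

section \<open>Spectral facts for the Bloch problem\<close>

locale bloch_problem =
  fixes G \<rho> :: "real^'d \<Rightarrow> real" and w2 :: "nat \<Rightarrow> real^'d \<Rightarrow> real"
    and \<phi> :: "nat \<Rightarrow> real^'d \<Rightarrow> real^'d \<Rightarrow> complex"
  assumes sG: "smooth G" and sr: "smooth \<rho>" and pG: "zperiodic G" and pr: "zperiodic \<rho>"
    and G_lower: "\<exists>c>0. \<forall>x. c \<le> G x" and r_lower: "\<exists>c>0. \<forall>x. c \<le> \<rho> x"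
    and eig: "bloch_eigen G \<rho> w2 \<phi>"
begin

lemma G_bounds: obtains G0 G1 where "0 < G0" "0 < G1" "\<And>x. G0 \<le> G x" "\<And>x. G x \<le> G1"
proof -
  obtain B where "B > 0" "\<And>x. norm (G x) \<le> B"
    using continuous_zperiodic_bounded[OF smooth_continuous[OF sG] pG] by blast
  then show ?thesis using G_lower that by (metis abs_le_D1 real_norm_def)
qed

lemma r_bounds: obtains r0 r1 where "0 < r0" "0 < r1" "\<And>x. r0 \<le> \<rho> x" "\<And>x. \<rho> x \<le> r1"
proof -
  obtain B where "B > 0" "\<And>x. norm (\<rho> x) \<le> B"
    using continuous_zperiodic_bounded[OF smooth_continuous[OF sr] pr] by blast
  then show ?thesis using r_lower that by (metis abs_le_D1 real_norm_def)
qed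

lemma r_pos: "0 < \<rho> x"
  using r_lower by (meson less_le_trans)

lemma r_nonneg: "0 \<le> \<rho> x"
  using r_pos[of x] by simp

lemma G_pos: "0 < G x"
  using G_lower by (meson less_le_trans)

lemma r_measurable [measurable]: "\<rho> \<in> borel_measurable borel"
  by (rule smooth_measurable[OF sr])

lemma G_measurable [measurable]: "G \<in> borel_measurable borel"
  by (rule smooth_measurable[OF sG])

abbreviation M :: "(real^'d) measure" where "M \<equiv> cellM \<rho>"

lemma finite_measure_M: "finite_measure M"
  by (rule finite_measure_cellM) (auto intro: smooth_continuous sr r_nonneg)

lemma L2fun_M: "smooth f \<Longrightarrow> L2fun M f"
  by (rule L2fun_cellM_continuous) (auto intro: smooth_continuous sr r_nonneg)

lemma L2ip_M: "f \<in> borel_measurable borel \<Longrightarrow> g \<in> borel_measurable borel \<Longrightarrow>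
    L2ip M f g = cint (\<lambda>x. of_real (\<rho> x) * (f x * cnj (g x)))"
  unfolding L2ip_def by (rule integral_cellM(1)) (auto intro: r_nonneg)

lemma L2sq_M: "f \<in> borel_measurable borel \<Longrightarrow> L2sq M f = (LINT x:cell|lborel. \<rho> x * (norm (f x))^2)"
  unfolding L2sq_def by (rule integral_cellM_real(1)) (auto intro: r_nonneg)

lemma L2sq_M_bound:
  assumes [measurable]: "f \<in> borel_measurable borel" and b: "\<And>x. norm (f x) \<le> c"
  shows "L2sq M f \<le> measure M (space M) * c^2"
proof -
  interpret finite_measure M by (rule finite_measure_M)
  have "(norm (f x))^2 \<le> c^2" for x using b[of x] by (intro power_mono) auto
  then have "L2sq M f \<le> (LINT x|M. c^2)"
    unfolding L2sq_def by (intro integral_mono') auto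
  then show ?thesis by simp
qed

lemma w2_nonneg: "0 \<le> w2 m k"
  using eig unfolding bloch_eigen_def by blast

lemma w2_mono: "m \<le> n \<Longrightarrow> w2 m k \<le> w2 n k"
proof (erule lift_Suc_mono_le[rotated])
  show "w2 m k \<le> w2 (Suc m) k" for m
    using eig unfolding bloch_eigen_def by blast
qed

lemma phi_smooth: "smooth (\<phi> m k)" and phi_periodic: "zperiodic (\<phi> m k)"
  using eig unfolding bloch_eigen_def by blast+

lemma phi_measurable [measurable]: "\<phi> m k \<in> borel_measurable borel"
  by (rule smooth_measurable[OF phi_smooth])

lemma L2fun_phi: "L2fun M (\<phi> m k)"
  by (rule L2fun_M[OF phi_smooth])

lemma phi_ONS: "ONS M (\<lambda>m. \<phi> m k)"
proof -
  have "(LINT x:cell|lborel. of_real (\<rho> x) * \<phi> m k x * cnj (\<phi> n k x)) = (if m = n then 1 else 0)" for m n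
    using eig unfolding bloch_eigen_def by blast
  then show ?thesis
    unfolding ONS_def by (auto simp: L2fun_phi L2ip_M cint_def mult.assoc)
qed

text \<open>Completeness in \<open>bloch_eigen\<close> refers to the unweighted pairing, so it is
  applied to \<rho> g, whose unweighted coefficients are the weighted ones of g. The upper bound of
  \<rho> makes \<rho> g square integrable and its positivity returns to g.\<close>

lemma phi_total:
  assumes g: "L2fun M g" and z: "\<And>m. L2ip M g (\<phi> m k) = 0"
  shows "AE x in M. g x = 0"
proof -
  have [measurable]: "g \<in> borel_measurable borel" using g by (simp add: L2fun_def)
  obtain r0 r1 where rb: "0 < r0" "0 < r1" "\<And>x. r0 \<le> \<rho> x" "\<And>x. \<rho> x \<le> r1" using r_bounds by blast
  let ?h = "\<lambda>x. of_real (\<rho> x) * g x"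
  have compl: "square_integrable_on cell h \<Longrightarrow> (\<forall>m. (LINT x:cell|lborel. h x * cnj (\<phi> m k x)) = 0)
      \<Longrightarrow> (AE x in lborel. x \<in> cell \<longrightarrow> h x = 0)" for h
    using eig unfolding bloch_eigen_def by blast
  have "set_integrable lborel cell (\<lambda>x. \<rho> x * (norm (g x))^2)"
    using g by (simp add: L2fun_def integral_cellM_real r_nonneg)
  then have "integrable lborel (\<lambda>x. r1 * (indicator cell x *\<^sub>R (\<rho> x * (norm (g x))^2)))"
    by (intro integrable_mult_right) (simp add: set_integrable_def)
  then have "integrable lborel (\<lambda>x. indicator cell x *\<^sub>R (norm (?h x))^2)"
  proof (rule Bochner_Integration.integrable_bound)
    show "AE x in lborel. norm (indicator cell x *\<^sub>R (norm (?h x))^2)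
          \<le> norm (r1 * (indicator cell x *\<^sub>R (\<rho> x * (norm (g x))^2)))"
    proof (rule AE_I2)
      fix x :: "real^'d"
      have "\<rho> x * (\<rho> x * (norm (g x))^2) \<le> r1 * (\<rho> x * (norm (g x))^2)"
        using rb(4)[of x] r_nonneg[of x] by (intro mult_right_mono) auto
      then show "norm (indicator cell x *\<^sub>R (norm (?h x))^2)
            \<le> norm (r1 * (indicator cell x *\<^sub>R (\<rho> x * (norm (g x))^2)))"
        using r_nonneg[of x] rb(2)
        by (auto simp: indicator_def norm_mult power_mult_distrib power2_eq_square mult_ac)
    qed
  qed measurable
  then have sq: "square_integrable_on cell ?h"
    unfolding square_integrable_on_def set_integrable_def set_borel_measurable_def by simp
  have "(LINT x:cell|lborel. ?h x * cnj (\<phi> m k x)) = 0" for m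
    using z[of m] by (simp add: L2ip_M cint_def mult.assoc)
  then have "AE x in lborel. x \<in> cell \<longrightarrow> ?h x = 0" by (intro compl[OF sq]) blast
  then have "AE x in lborel. x \<in> cell \<longrightarrow> g x = 0"
    by eventually_elim (use r_pos in \<open>auto simp: less_imp_neq[symmetric]\<close>)
  then show ?thesis by (simp add: AE_cellM r_pos)
qed

lemma phi_Parseval:
  assumes "L2fun M f"
  shows "(\<lambda>n. (norm (L2ip M f (\<phi> n k)))^2) sums L2sq M f"
    "L2fun M g \<Longrightarrow> (\<lambda>n. L2ip M g (\<phi> n k) * cnj (L2ip M f (\<phi> n k))) sums L2ip M g f"
proof -
  show "(\<lambda>n. (norm (L2ip M f (\<phi> n k)))^2) sums L2sq M f"
    by (rule Parseval_total(2)[OF finite_measure_M phi_ONS _ assms]) (rule phi_total)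
  show "(\<lambda>n. L2ip M g (\<phi> n k) * cnj (L2ip M f (\<phi> n k))) sums L2ip M g f" if "L2fun M g"
    by (rule Parseval_total(3)[OF finite_measure_M phi_ONS _ assms that]) (rule phi_total)
qed

section \<open>The eigenvalue equation in weak, pointwise and spectral form\<close>

lemma weak_eigen:
  assumes "smooth \<psi>" "zperiodic \<psi>"
  shows "cint (\<lambda>x. of_real (G x) * (\<Sum>i\<in>UNIV. Dk k i (\<phi> m k) x * cnj (Dk k i \<psi> x)))
    = of_real (w2 m k) * cint (\<lambda>x. of_real (\<rho> x) * \<phi> m k x * cnj (\<psi> x))"
  using eig assms unfolding bloch_eigen_def Dk_def cint_def by blast

lemma Lk_weak_eigen:
  assumes "smooth \<psi>" "zperiodic \<psi>"
  shows "cint (\<lambda>x. Lk G k (\<phi> m k) x * cnj (\<psi> x)) = of_real (w2 m k)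
        * cint (\<lambda>x. of_real (\<rho> x) * \<phi> m k x * cnj (\<psi> x))"
  using Green_cell[OF sG pG phi_smooth phi_periodic assms] weak_eigen[OF assms] by simp

lemma cell_integral_zero_imp:
  fixes f :: "real^'d \<Rightarrow> real"
  assumes "continuous_on UNIV f" "\<And>x. 0 \<le> f x" "(LINT x:cell|lborel. f x) = 0" "x \<in> cell"
  shows "f x = (0::real)"
proof -
  have "set_integrable lborel cell f" by (rule set_integrable_cell) fact
  from set_borel_integral_eq_integral(2)[OF this] assms(3) have "integral cell f = 0" by simp
  moreover have "box ((\<chi> i. -1/2) :: real^'d) (\<chi> i. 1/2) \<noteq> {}"
  proof -
    have "0 \<in> box ((\<chi> i. -1/2) :: real^'d) (\<chi> i. 1/2)" by (simp add: mem_box_cart)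
    then show ?thesis by blast
  qed
  ultimately show ?thesis
    using integral_cbox_eq_0_iff[of "(\<chi> i. -1/2) :: real^'d" "\<chi> i. 1/2" f] assms
    by (auto simp: cell_eq_cbox intro: continuous_on_subset)
qed

text \<open>The residual of the equation is itself smooth and periodic, hence an admissible test
  function for its own equation; its square integrates to zero and continuity makes it vanish. The
  pointwise form is what allows the eigenfunctions to be used on the whole space.\<close>

lemma strong_eigen: "Lk G k (\<phi> m k) x = of_real (w2 m k * \<rho> x) * \<phi> m k x"
proof -
  define r where "r x = Lk G k (\<phi> m k) x - of_real (w2 m k * \<rho> x) * \<phi> m k x" for x
  have s: "smooth r" unfolding r_def[abs_def] of_real_mult
    by (intro smooth_diff smooth_Lk smooth_mult smooth_of_real smooth_const sG sr phi_smooth)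
  have p: "zperiodic r" unfolding r_def[abs_def] of_real_mult diff_conv_add_uminus
    by (intro zperiodic_rules zperiodic_Lk phi_periodic pG pr)
  have "cint (\<lambda>x. r x * cnj (r x)) = cint (\<lambda>x. Lk G k (\<phi> m k) x * cnj (r x) +
        - (of_real (w2 m k) * (of_real (\<rho> x) * \<phi> m k x * cnj (r x))))"
    by (simp add: r_def algebra_simps)
  also have "\<dots> = cint (\<lambda>x. Lk G k (\<phi> m k) x * cnj (r x)) +
        - (of_real (w2 m k) * cint (\<lambda>x. of_real (\<rho> x) * \<phi> m k x * cnj (r x)))"
  proof (subst cint_add)
    show "continuous_on UNIV (\<lambda>x. Lk G k (\<phi> m k) x * cnj (r x))"
      by (intro smooth_continuous smooth_mult smooth_cnj s smooth_Lk sG phi_smooth)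
    show "continuous_on UNIV (\<lambda>x. - (of_real (w2 m k) * (of_real (\<rho> x) * \<phi> m k x * cnj (r x))))"
      by (intro smooth_continuous smooth_minus smooth_mult smooth_const smooth_cnj s smooth_of_real sr
          phi_smooth)
  qed (simp add: cint_minus, simp add: cint_def)
  also have "\<dots> = 0" using Lk_weak_eigen[OF s p] by simp
  finally have "cint (\<lambda>x. r x * cnj (r x)) = 0" .
  moreover have "cint (\<lambda>x. r x * cnj (r x)) = of_real (LINT x:cell|lborel. (norm (r x))^2)"
    unfolding cint_def set_lebesgue_integral_def integral_complex_of_real[symmetric]
    by (intro Bochner_Integration.integral_cong) (auto simp: complex_norm_square[symmetric] scaleR_conv_of_real)
  ultimately have "(LINT x:cell|lborel. (norm (r x))^2) = 0" by simp
  moreover have "continuous_on UNIV (\<lambda>x. (norm (r x))^2)"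
    by (intro continuous_intros smooth_continuous s)
  ultimately have "(norm (r y))^2 = 0" if "y \<in> cell" for y
    using cell_integral_zero_imp[of "\<lambda>x. (norm (r x))^2", OF _ _ _ that] by simp
  moreover obtain y where "y \<in> cell" "r x = r y" using zperiodic_representative[OF p] by blast
  ultimately have "r x = 0" by simp
  then show ?thesis by (simp add: r_def)
qed

text \<open>Division by \<rho> makes the operator symmetric for the weighted inner product. On
  smooth periodic functions it therefore acts diagonally on the coefficients, and its pairing with v
  is the energy.\<close>

lemma Lk_coeff:
  assumes v: "smooth v" "zperiodic v"
  shows "L2ip M (\<lambda>x. Lk G k v x / of_real (\<rho> x)) (\<phi> m k) = of_real (w2 m k) * L2ip M v (\<phi> m k)"
    "L2ip M (\<lambda>x. Lk G k v x / of_real (\<rho> x)) v = of_real (energy G k v)"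
    "L2fun M (\<lambda>x. Lk G k v x / of_real (\<rho> x))"
proof -
  have [measurable]: "Lk G k v \<in> borel_measurable borel" "v \<in> borel_measurable borel"
    using v sG by (auto intro: smooth_measurable smooth_Lk)
  have ip: "L2ip M (\<lambda>x. Lk G k v x / of_real (\<rho> x)) f = cint (\<lambda>x. Lk G k v x * cnj (f x))" if "smooth f" for f
    using that r_pos by (subst L2ip_M) (auto intro: smooth_measurable simp: less_imp_neq[symmetric])
  have "L2ip M (\<lambda>x. Lk G k v x / of_real (\<rho> x)) (\<phi> m k)
        = cint (\<lambda>x. of_real (G x) * (\<Sum>i\<in>UNIV. Dk k i v x * cnj (Dk k i (\<phi> m k) x)))"
    by (simp add: ip phi_smooth Green_cell[OF sG pG v phi_smooth phi_periodic])
  also have "\<dots> = cnj (cint (\<lambda>x. of_real (G x) * (\<Sum>i\<in>UNIV. Dk k i (\<phi> m k) x * cnj (Dk k i v x))))"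
    unfolding cint_def set_lebesgue_integral_def
    by (simp add: Bochner_Integration.integral_cnj[symmetric] mult.commute del:
        Bochner_Integration.integral_cnj)
  also have "\<dots> = of_real (w2 m k) * cnj (L2ip M (\<phi> m k) v)"
    unfolding weak_eigen[OF v] by (simp add: L2ip_M mult.assoc)
  finally show "L2ip M (\<lambda>x. Lk G k v x / of_real (\<rho> x)) (\<phi> m k) = of_real (w2 m k) * L2ip M v (\<phi> m k)"
    by (simp add: L2ip_cnj)
  show "L2ip M (\<lambda>x. Lk G k v x / of_real (\<rho> x)) v = of_real (energy G k v)"
    by (simp add: ip v Green_cell[OF sG pG v v] of_real_energy[OF sG v(1)])
  show "L2fun M (\<lambda>x. Lk G k v x / of_real (\<rho> x))"
  proof (rule L2fun_cellM_continuous)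
    show "continuous_on UNIV (\<lambda>x. Lk G k v x / of_real (\<rho> x))"
      using r_pos by (intro continuous_intros smooth_continuous smooth_Lk sG sr v)
          (auto simp: less_imp_neq[symmetric])
  qed (auto intro: smooth_continuous sr r_nonneg)
qed

text \<open>Parseval's identity for the pair formed by v and its image under the operator: the
  spectral form of the energy, for smooth v.\<close>

lemma energy_sums:
  assumes v: "smooth v" "zperiodic v"
  shows "(\<lambda>m. w2 m k * (norm (L2ip M v (\<phi> m k)))^2) sums energy G k v"
proof -
  have "(\<lambda>m. of_real (w2 m k) * L2ip M v (\<phi> m k) * cnj (L2ip M v (\<phi> m k))) sums complex_of_real (energy G k v)"
    using phi_Parseval(2)[where k=k, OF L2fun_M[OF v(1)] Lk_coeff(3)[where k=k, OF v]]
        unfolding Lk_coeff[OF v] .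
  also have "(\<lambda>m. of_real (w2 m k) * L2ip M v (\<phi> m k) * cnj (L2ip M v (\<phi> m k))) =
      (\<lambda>m. complex_of_real (w2 m k * (norm (L2ip M v (\<phi> m k)))^2))"
    unfolding of_real_mult complex_norm_square by (simp add: mult.assoc)
  finally show ?thesis unfolding sums_of_real_iff .
qed

section \<open>Dependence of the eigenvalues on the quasimomentum, and their divergence\<close>

text \<open>The min-max argument. A nonzero combination v of the first m + 1 eigenfunctions at k can
  be made orthogonal to the first m at k'. Its energy relative to its norm is at most
  \<open>w2 m k\<close> at k and at least \<open>w2 m k'\<close> at k', and
  \<open>energy_shift_le\<close> compares the two energies. The constant is the same for all
  m.\<close>

lemma w2_shift_le:
  obtains K where "K > 0" "\<And>m k k' t. t > 0 \<Longrightarrow> norm (k - k') \<le> t \<Longrightarrow> w2 m k' \<le> (1 + t) * (w2 m k + t * K)"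
proof -
  obtain r0 r1 where rb: "0 < r0" "0 < r1" "\<And>x. r0 \<le> \<rho> x" "\<And>x. \<rho> x \<le> r1" using r_bounds by blast
  obtain G0 G1 where Gb: "0 < G0" "0 < G1" "\<And>x. G0 \<le> G x" "\<And>x. G x \<le> G1" using G_bounds by blast
  show ?thesis
  proof (rule that[of "G1 / r0"])
    show "G1 / r0 > 0" using rb Gb by simp
    fix m and k k' :: "real^'d" and t :: real assume t: "t > 0" "norm (k - k') \<le> t"
    \<comment> \<open>The set \<open>{..m}\<close> has m + 1 elements and \<open>{..<m}\<close> has
      m, which is just enough for a nontrivial solution.\<close>
    obtain \<alpha> where \<alpha>: "\<exists>n\<in>{..m}. \<alpha> n \<noteq> 0" "\<forall>j\<in>{..<m}. (\<Sum>n\<in>{..m}. \<alpha> n * L2ip M (\<phi> n k) (\<phi> j k')) = 0"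
      using underdetermined_solution[of "{..<m}" "{..m}" "\<lambda>n j. L2ip M (\<phi> n k) (\<phi> j k')"] by auto
    define v where "v x = (\<Sum>n\<in>{..m}. \<alpha> n * \<phi> n k x)" for x
    have v: "smooth v" "zperiodic v" unfolding v_def[abs_def]
      by (intro smooth_sum smooth_mult smooth_const phi_smooth zperiodic_rules phi_periodic)+
    have vk: "L2ip M v (\<phi> n k) = (if n \<le> m then \<alpha> n else 0)" for n
      unfolding v_def[abs_def] using L2ip_ONS_sum[OF phi_ONS, of "{..m}"] by simp
    have vk': "L2ip M v (\<phi> j k') = 0" if "j < m" for j
      unfolding v_def[abs_def] using \<alpha>(2) that by (subst L2ip_sum_left) (auto intro: L2fun_phi)
    have "L2sq M v = (\<Sum>n\<in>{..m}. (norm (\<alpha> n))^2)"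
      unfolding v_def[abs_def] by (rule L2sq_ONS_sum[OF phi_ONS]) simp
    moreover have "\<dots> > 0" using \<alpha>(1) by (auto intro!: sum_pos2)
    ultimately have pos: "L2sq M v > 0" by simp
    have Pk: "(\<lambda>n. w2 m k'' * (norm (L2ip M v (\<phi> n k'')))^2) sums (w2 m k'' * L2sq M v)" for k''
      by (intro sums_mult phi_Parseval(1) L2fun_M v)
    have e1: "energy G k v \<le> w2 m k * L2sq M v"
    proof (rule sums_le[OF _ energy_sums[OF v] Pk])
      fix n show "w2 n k * (norm (L2ip M v (\<phi> n k)))^2 \<le> w2 m k * (norm (L2ip M v (\<phi> n k)))^2"
        using vk[of n] w2_mono[of n m k] by (cases "n \<le> m") (auto intro: mult_right_mono)
    qed
    have e2: "w2 m k' * L2sq M v \<le> energy G k' v"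
    proof (rule sums_le[OF _ Pk energy_sums[OF v]])
      fix n show "w2 m k' * (norm (L2ip M v (\<phi> n k')))^2 \<le> w2 n k' * (norm (L2ip M v (\<phi> n k')))^2"
        using vk'[of n] w2_mono[of m n k'] by (cases "n < m") (auto intro: mult_right_mono)
    qed
    have e3: "energy G k' v \<le> (1 + t) * energy G k v + (1 + t) * t * G1 * (LINT x:cell|lborel. (norm (v x))^2)"
      using G_pos Gb(4) by (intro energy_shift_le[OF sG _ _ v(1) t]) (auto intro: less_imp_le)
    have "(LINT x:cell|lborel. (norm (v x))^2) \<le> L2sq M v / r0"
    proof -
      have cv: "continuous_on UNIV v" "continuous_on UNIV \<rho>" using v sr by (auto intro: smooth_continuous)
      have "r0 * (LINT x:cell|lborel. (norm (v x))^2) = (LINT x:cell|lborel. r0 * (norm (v x))^2)" by simp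
      also have "\<dots> \<le> (LINT x:cell|lborel. \<rho> x * (norm (v x))^2)"
        using rb(3) by (intro set_integral_mono set_integrable_cell continuous_intros cv mult_right_mono) auto
      also have "\<dots> = L2sq M v" by (rule L2sq_M[symmetric]) (rule smooth_measurable[OF v(1)])
      finally show ?thesis using rb(1) by (simp add: field_simps)
    qed
    then have e4: "(1 + t) * t * G1 * (LINT x:cell|lborel. (norm (v x))^2) \<le> (1 + t) * t * G1 * (L2sq M v / r0)"
      using t Gb by (intro mult_left_mono) auto
    have e5: "(1 + t) * energy G k v \<le> (1 + t) * (w2 m k * L2sq M v)"
      using e1 t by (intro mult_left_mono) auto
    have "w2 m k' * L2sq M v \<le> (1 + t) * (w2 m k * L2sq M v) + (1 + t) * t * G1 * (L2sq M v / r0)"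
      using e2 e3 e4 e5 by linarith
    also have "\<dots> = ((1 + t) * (w2 m k + t * (G1 / r0))) * L2sq M v"
      using rb(1) by (simp add: field_simps)
    finally have "w2 m k' * L2sq M v \<le> ((1 + t) * (w2 m k + t * (G1 / r0))) * L2sq M v" .
    then show "w2 m k' \<le> (1 + t) * (w2 m k + t * (G1 / r0))" using pos by simp
  qed
qed

text \<open>The shift estimate serves twice with t = |k - k'|: as it stands for the upper bound, and
  with the two quasimomenta interchanged for the lower one.\<close>

lemma w2_isCont: "isCont (w2 m) k"
proof -
  obtain K where K: "K > 0" "\<And>m k k' t. t > 0 \<Longrightarrow> norm (k - k') \<le> t \<Longrightarrow> w2 m k' \<le> (1 + t) * (w2 m k + t * K)"
    using w2_shift_le by blast
  have n0: "((\<lambda>k'. norm (k - k')) \<longlongrightarrow> 0) (at k)"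
    by (rule tendsto_norm_zero) (auto intro!: tendsto_eq_intros)
  have "((\<lambda>k'. w2 m k') \<longlongrightarrow> w2 m k) (at k)"
  proof (rule tendsto_sandwich)
    show "\<forall>\<^sub>F k' in at k. w2 m k / (1 + norm (k - k')) - norm (k - k') * K \<le> w2 m k'"
      unfolding eventually_at_filter
    proof (intro always_eventually allI impI)
      fix k' :: "real^'d" assume "k' \<noteq> k"
      then have t: "norm (k - k') > 0" by simp
      then have "w2 m k \<le> (1 + norm (k - k')) * (w2 m k' + norm (k - k') * K)"
        using K(2)[OF t, of k' k m] by (simp add: norm_minus_commute)
      then have "w2 m k / (1 + norm (k - k')) \<le> w2 m k' + norm (k - k') * K"
        by (subst pos_divide_le_eq) (simp_all add: mult.commute add_pos_nonneg)
      then show "w2 m k / (1 + norm (k - k')) - norm (k - k') * K \<le> w2 m k'" by simp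
    qed
    show "\<forall>\<^sub>F k' in at k. w2 m k' \<le> (1 + norm (k - k')) * (w2 m k + norm (k - k') * K)"
      unfolding eventually_at_filter using K(2) by (intro always_eventually) auto
    have "((\<lambda>k'. w2 m k / (1 + norm (k - k')) - norm (k - k') * K) \<longlongrightarrow> w2 m k / (1 + 0) - 0 * K) (at k)"
      by (intro tendsto_add tendsto_diff tendsto_divide tendsto_mult n0 tendsto_const) simp
    then show "((\<lambda>k'. w2 m k / (1 + norm (k - k')) - norm (k - k') * K) \<longlongrightarrow> w2 m k) (at k)" by simp
    have "((\<lambda>k'. (1 + norm (k - k')) * (w2 m k + norm (k - k') * K)) \<longlongrightarrow> (1 + 0) * (w2 m k + 0 * K)) (at k)"
      by (intro tendsto_add tendsto_mult n0 tendsto_const)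
    then show "((\<lambda>k'. (1 + norm (k - k')) * (w2 m k + norm (k - k') * K)) \<longlongrightarrow> w2 m k) (at k)" by simp
  qed
  then show ?thesis by (simp add: isCont_def)
qed

text \<open>If all eigenvalues at k = 0 were at most B, then by Parseval the operator would be
  bounded by B on smooth periodic functions. Plane waves of high frequency contradict this, since
  the second-order term \<kappa>^2 G outgrows the first-order term coming from the derivative of
  G.\<close>

lemma w2_unbounded: "\<exists>m. w2 m 0 > B"
proof (rule ccontr)
  assume "\<not> ?thesis"
  then have B: "w2 m 0 \<le> B" for m by (simp add: not_less)
  obtain r0 r1 where rb: "0 < r0" "0 < r1" "\<And>x. r0 \<le> \<rho> x" "\<And>x. \<rho> x \<le> r1" using r_bounds by blast
  obtain G0 G1 where Gb: "0 < G0" "0 < G1" "\<And>x. G0 \<le> G x" "\<And>x. G x \<le> G1" using G_bounds by blast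
  define i :: 'd where "i = undefined"
  obtain B1 where B1: "B1 > 0" "\<And>x. norm (pdiff i G x) \<le> B1"
    using continuous_zperiodic_bounded[OF smooth_continuous[OF smooth_pdiff[OF sG]] zperiodic_pdiff[OF pG]]
        by blast
  \<comment> \<open>The test function is a plane wave in one coordinate direction, periodic because
    \<kappa> is a multiple of 2 pi. The quotient bounds the modulus of its image from below
    everywhere; its sign is assumed so that it may be squared.\<close>
  have main: "(\<kappa>^2 * G0 - \<kappa> * B1) / r1 \<le> B" if k: "\<kappa> = 2 * pi * real N"
      and c0: "(\<kappa>^2 * G0 - \<kappa> * B1) / r1 \<ge> 0" for \<kappa> and N :: nat
  proof -
    let ?k = "\<kappa> *\<^sub>R axis i 1 :: real^'d"
    define v where "v x = cis (?k \<bullet> x)" for x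
    have v: "smooth v" unfolding v_def[abs_def] by (rule smooth_cis)
    have pv: "zperiodic v"
      unfolding zperiodic_def
    proof safe
      fix x j :: "real^'d" assume "j \<in> lattice"
      then obtain z where z: "j $ i = of_int z" by (auto simp: lattice_def elim!: Ints_cases)
      have "?k \<bullet> j = 2 * pi * of_int (int N * z)" by (simp add: inner_axis' z k)
      then have "cis (?k \<bullet> j) = 1" by (metis cis_multiple_2pi Ints_of_int)
      then show "v (x + j) = v x" by (simp add: v_def inner_add_right cis_mult[symmetric])
    qed
    have pd: "pdiff l v x = \<i> * of_real (?k $ l) * v x" for l x
      unfolding v_def[abs_def] by (rule pdiff_cis)
    have D: "Dk 0 l v = (\<lambda>x. (\<i> * of_real (?k $ l)) * v x)" for l
      by (rule ext) (simp add: Dk_def pd)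
    have DD: "Dk 0 l (\<lambda>x. of_real (G x) * Dk 0 l v x) x
        = (if l = i then (\<i> * of_real \<kappa> * of_real (pdiff i G x) - of_real (\<kappa>^2 * G x)) * v x else 0)" for l x
    proof -
      have "Dk 0 l (\<lambda>x. of_real (G x) * Dk 0 l v x) x
            = pdiff l (\<lambda>x. of_real (G x) * ((\<i> * of_real (?k $ l)) * v x)) x"
        unfolding D by (simp add: Dk_def)
      also have "\<dots> = of_real (pdiff l G x) * ((\<i> * of_real (?k $ l)) * v x) + of_real (G x)
            * ((\<i> * of_real (?k $ l)) * (\<i> * of_real (?k $ l) * v x))"
        by (simp add: pdiff_mult smooth_differentiable smooth_of_real smooth_mult smooth_const sG v
            pdiff_of_real
             pdiff_linear[OF bounded_linear_mult_right] pd)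
      finally show ?thesis by (auto simp: axis_def algebra_simps power2_eq_square)
    qed
    have L: "Lk G 0 v x = (of_real (\<kappa>^2 * G x) - \<i> * of_real (\<kappa> * pdiff i G x)) * v x" for x
      unfolding Lk_def DD by (simp add: algebra_simps)
    have lower: "(\<kappa>^2 * G0 - \<kappa> * B1) / r1 \<le> norm (Lk G 0 v x / of_real (\<rho> x))" for x
    proof -
      have "\<kappa> \<ge> 0" by (simp add: k)
      have "\<kappa>^2 * G0 - \<kappa> * B1 \<le> \<kappa>^2 * G x - \<kappa> * \<bar>pdiff i G x\<bar>"
        using Gb(3) B1(2)[of x] \<open>\<kappa> \<ge> 0\<close> by (intro diff_mono mult_left_mono) auto
      also have "\<dots> \<le> norm (complex_of_real (\<kappa>^2 * G x)) - norm (\<i> * complex_of_real (\<kappa> * pdiff i G x))"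
        using \<open>\<kappa> \<ge> 0\<close> by (simp only: norm_mult norm_of_real norm_ii) (simp add: abs_mult mult_left_mono)
      also have "\<dots> \<le> norm (Lk G 0 v x)"
        unfolding L v_def norm_mult[of _ "cis _"] norm_cis mult_1_right by (rule norm_triangle_ineq2)
      finally have *: "\<kappa>^2 * G0 - \<kappa> * B1 \<le> norm (Lk G 0 v x)" .
      have "(\<kappa>^2 * G0 - \<kappa> * B1) / r1 \<le> (\<kappa>^2 * G0 - \<kappa> * B1) / \<rho> x"
        using c0 rb r_pos[of x] by (intro divide_left_mono) (auto simp: zero_le_divide_iff)
      also have "\<dots> \<le> norm (Lk G 0 v x) / \<rho> x" using * r_pos[of x] by (intro divide_right_mono) auto
      finally show ?thesis using r_pos[of x] by (simp add: norm_divide)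
    qed
    let ?g = "\<lambda>x. Lk G 0 v x / of_real (\<rho> x)"
    have Lv: "L2fun M v" and Lg: "L2fun M ?g" by (rule L2fun_M[OF v], rule Lk_coeff(3)[OF v pv])
    have "((\<kappa>^2 * G0 - \<kappa> * B1) / r1)^2 * L2sq M v \<le> L2sq M ?g"
    proof -
      interpret finite_measure M by (rule finite_measure_M)
      have "((\<kappa>^2 * G0 - \<kappa> * B1) / r1)^2 * L2sq M v = (LINT x|M. ((\<kappa>^2 * G0 - \<kappa> * B1) / r1)^2 * (norm (v x))^2)"
        by (simp add: L2sq_def)
      also have "\<dots> \<le> L2sq M ?g" unfolding L2sq_def
        using Lv Lg lower c0
        by (intro integral_mono) (auto simp: L2fun_def v_def intro!: power_mono)
      finally show ?thesis .
    qed
    also have "L2sq M ?g \<le> B^2 * L2sq M v"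
    proof (rule sums_le[OF _ phi_Parseval(1)[OF Lg] sums_mult[OF phi_Parseval(1)[OF Lv]]])
      fix n
      have "(w2 n 0)^2 \<le> B^2" using B[of n] w2_nonneg[of n 0] by (intro power_mono) auto
      then show "(norm (L2ip M ?g (\<phi> n 0)))^2 \<le> B^2 * (norm (L2ip M v (\<phi> n 0)))^2"
        unfolding Lk_coeff[OF v pv] by (simp add: norm_mult power_mult_distrib mult_right_mono)
    qed
    finally have ineq: "((\<kappa>^2 * G0 - \<kappa> * B1) / r1)^2 * L2sq M v \<le> B^2 * L2sq M v" .
    have "0 < L2sq M v"
    proof (rule ccontr)
      assume "\<not> 0 < L2sq M v"
      then have z: "L2sq M v = 0" using L2sq_nonneg[of M v] by linarith
      have "(LINT x:cell|lborel. \<rho> x * (norm (v x))^2) = 0"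
        using z L2sq_M[OF smooth_measurable[OF v]] by simp
      moreover have "continuous_on UNIV (\<lambda>x. \<rho> x * (norm (v x))^2)"
        by (intro continuous_intros smooth_continuous[OF sr] smooth_continuous[OF v])
      moreover have "0 \<le> \<rho> x * (norm (v x))^2" for x using r_nonneg[of x] by simp
      ultimately have "\<rho> 0 * (norm (v 0))^2 = 0"
        using cell_integral_zero_imp[of "\<lambda>x. \<rho> x * (norm (v x))^2" 0] by (simp add: cell_def)
      then show False using r_pos[of 0] by (simp add: v_def)
    qed
    then have "((\<kappa>^2 * G0 - \<kappa> * B1) / r1)^2 \<le> B^2" using ineq by simp
    moreover have "B \<ge> 0" using B[of 0] w2_nonneg[of 0 0] by simp
    ultimately show ?thesis using power2_le_imp_le by blast
  qed
  \<comment> \<open>The size is chosen so that \<kappa> is at least 1 and \<kappa> G0 - B1 is at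
    least r1 (B + 1); the lower bound of \<open>main\<close> is then at least B + 1, beyond
    B.\<close>
  obtain N :: nat where N: "real N > (B1 + r1 * (B + 1)) / G0 + 1" using reals_Archimedean2 by blast
  define \<kappa> where "\<kappa> = 2 * pi * real N"
  have "B \<ge> 0" using B[of 0] w2_nonneg[of 0 0] by simp
  have q0: "(B1 + r1 * (B + 1)) / G0 \<ge> 0" using \<open>B \<ge> 0\<close> B1 rb Gb by simp
  have "real N \<le> \<kappa>" unfolding \<kappa>_def using pi_gt3 by (intro mult_right_mono[of 1 "2*pi", simplified]) auto
  then have k1: "\<kappa> \<ge> 1" "\<kappa> \<ge> (B1 + r1 * (B + 1)) / G0" using N q0 by linarith+
  then have "\<kappa> * G0 - B1 \<ge> r1 * (B + 1)" using Gb by (simp add: field_simps)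
  then have "\<kappa> * (\<kappa> * G0 - B1) \<ge> 1 * (r1 * (B + 1))"
    using k1 \<open>B \<ge> 0\<close> rb by (intro mult_mono) auto
  then have "(\<kappa>^2 * G0 - \<kappa> * B1) / r1 \<ge> B + 1"
    using rb by (simp add: pos_le_divide_eq algebra_simps power2_eq_square)
  then show False using main[OF \<kappa>_def] \<open>B \<ge> 0\<close> by linarith
qed

section \<open>Spectral gaps and the coupling between branches\<close>

text \<open>Only finitely many branches can come close to w on the dual cell: a branch that is high
  enough at k = 0 stays above w on this bounded set by the shift estimate, and so do all later ones.
  Each of the others has a positive minimal distance by continuity and compactness.\<close>

lemma uniform_gap:
  assumes "\<And>m k. k \<in> dual_cell \<Longrightarrow> w2 m k \<noteq> w"
  obtains \<gamma> where "\<gamma> > 0" "\<And>m k. k \<in> dual_cell \<Longrightarrow> \<gamma> \<le> \<bar>w2 m k - w\<bar>"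
proof -
  obtain K where K: "K > 0" "\<And>m k k' t. t > 0 \<Longrightarrow> norm (k - k') \<le> t \<Longrightarrow> w2 m k' \<le> (1 + t) * (w2 m k + t * K)"
    using w2_shift_le by blast
  obtain T where T: "T > 0" "\<And>k::real^'d. k \<in> dual_cell \<Longrightarrow> norm k \<le> T"
    using compact_imp_bounded[OF compact_dual_cell] bounded_pos by metis
  \<comment> \<open>The threshold is the shift estimate from k to 0 with t = T, solved so that it
    leaves \<open>w2 N k\<close> above |w| + 1.\<close>
  obtain N where N: "w2 N 0 > (1 + T) * (\<bar>w\<bar> + 1 + T * K)" using w2_unbounded by blast
  have big: "1 \<le> \<bar>w2 m k - w\<bar>" if "m \<ge> N" "k \<in> dual_cell" for m k
  proof -
    have "(1 + T) * (\<bar>w\<bar> + 1 + T * K) < (1 + T) * (w2 N k + T * K)"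
      using N K(2)[OF T(1), of k 0 N] T(2)[OF that(2)] by simp
    then have "\<bar>w\<bar> + 1 < w2 N k" using T(1) by simp
    then show ?thesis using w2_mono[OF that(1), of k] by linarith
  qed
  have "\<exists>g>0. \<forall>k\<in>dual_cell. g \<le> \<bar>w2 m k - w\<bar>" for m
  proof -
    have "continuous_on dual_cell (\<lambda>k. \<bar>w2 m k - w\<bar>)"
      using w2_isCont by (intro continuous_intros continuous_at_imp_continuous_on) auto
    moreover have "dual_cell \<noteq> ({} :: (real^'d) set)" by (auto simp: dual_cell_def intro!: exI[of _ 0])
    ultimately obtain k0 where "k0 \<in> dual_cell" "\<forall>k\<in>dual_cell. \<bar>w2 m k0 - w\<bar> \<le> \<bar>w2 m k - w\<bar>"
      using continuous_attains_inf[OF compact_dual_cell] by blast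
    then show ?thesis using assms[of k0 m] by (intro exI[of _ "\<bar>w2 m k0 - w\<bar>"]) auto
  qed
  then obtain g where g: "\<And>m. g m > 0" "\<And>m k. k \<in> dual_cell \<Longrightarrow> g m \<le> \<bar>w2 m k - w\<bar>" by metis
  \<comment> \<open>The element 1 accounts for all branches from N on.\<close>
  define \<gamma> where "\<gamma> = Min (insert 1 (g ` {..<N}))"
  show ?thesis
  proof (rule that[of \<gamma>])
    show "\<gamma> > 0" unfolding \<gamma>_def using g(1) by (subst Min_gr_iff) auto
    fix m and k :: "real^'d" assume k: "k \<in> dual_cell"
    show "\<gamma> \<le> \<bar>w2 m k - w\<bar>"
    proof (cases "m < N")
      case True
      then have "\<gamma> \<le> g m" unfolding \<gamma>_def by (intro Min_le) auto
      then show ?thesis using g(2)[OF k, of m] by linarith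
    next
      case False
      have "\<gamma> \<le> 1" unfolding \<gamma>_def by (intro Min_le) auto
      then show ?thesis using big[of m k] False k by linarith
    qed
  qed
qed

text \<open>\<open>\<phi>\<^sub>p(0)\<close> solves the shifted eigenproblem up to an error of order \<open>k\<close>; testing with \<open>\<phi>\<^sub>m(k)\<close>
  and Bessel's inequality bound the coupling to the other branches.\<close>

lemma coupling_bound:
  obtains C where "C > 0"
    "\<And>k I. norm k \<le> 1 \<Longrightarrow> finite I \<Longrightarrow>
      (\<Sum>m\<in>I. (w2 m k - w2 p 0)^2 * (norm (L2ip M (\<phi> p 0) (\<phi> m k)))^2) \<le> C * (norm k)^2"
proof -
  let ?f = "\<phi> p 0"
  obtain r0 r1 where rb: "0 < r0" "0 < r1" "\<And>x. r0 \<le> \<rho> x" "\<And>x. \<rho> x \<le> r1" using r_bounds by blast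
  let ?Gf = "\<lambda>x. of_real (G x) * ?f x"
  have sGf: "smooth ?Gf" and pGf: "zperiodic ?Gf"
    by (intro smooth_mult smooth_of_real sG phi_smooth zperiodic_rules pG phi_periodic)+
  \<comment> \<open>Expanding (nabla + ik).[G (nabla + ik) f] in powers of the k_i, this is the
    coefficient of i k_i, and G f is that of - k_i^2. Neither depends on k, so periodicity bounds
    both uniformly.\<close>
  define A where "A i x = pdiff i ?Gf x + of_real (G x) * pdiff i ?f x" for i x
  have sA: "smooth (A i)" and pA: "zperiodic (A i)" for i
    unfolding A_def[abs_def]
    by (intro smooth_add smooth_mult smooth_of_real smooth_pdiff sGf sG phi_smooth zperiodic_rules
        zperiodic_pdiff pGf pG phi_periodic)+
  have "\<exists>B>0. \<forall>x. norm (A i x) \<le> B" for i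
    using continuous_zperiodic_bounded[OF smooth_continuous[OF sA] pA] by metis
  then obtain BA where BA: "\<And>i. BA i > 0" "\<And>i x. norm (A i x) \<le> BA i" by metis
  obtain BG where BG: "BG > 0" "\<And>x. norm (?Gf x) \<le> BG"
    using continuous_zperiodic_bounded[OF smooth_continuous[OF sGf] pGf] by blast
  define S where "S = (\<Sum>i\<in>UNIV. BA i + BG)"
  have S0: "S > 0" unfolding S_def using BA(1) BG(1) by (intro sum_pos) (auto intro: add_pos_pos)
  have diff: "Lk G k ?f x - Lk G 0 ?f x = - (\<Sum>i\<in>UNIV. \<i> * of_real (k$i) * A i x - of_real ((k$i)^2)
        * ?Gf x)" for k x
  proof -
    have "Dk k i (\<lambda>x. of_real (G x) * Dk k i ?f x) x = Dk 0 i (\<lambda>x. of_real (G x) * Dk 0 i ?f x) x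
        + (\<i> * of_real (k$i) * A i x - of_real ((k$i)^2) * ?Gf x)" for i
    proof -
      have e: "(\<lambda>x. of_real (G x) * Dk k i ?f x) =
            (\<lambda>x. of_real (G x) * pdiff i ?f x + (\<i> * of_real (k$i)) * ?Gf x)"
        by (rule ext) (simp add: Dk_def algebra_simps)
      have e0: "(\<lambda>x. of_real (G x) * Dk 0 i ?f x) = (\<lambda>x. of_real (G x) * pdiff i ?f x)"
        by (rule ext) (simp add: Dk_def)
      have "pdiff i (\<lambda>x. of_real (G x) * pdiff i ?f x + (\<i> * of_real (k$i)) * ?Gf x) x
          = pdiff i (\<lambda>x. of_real (G x) * pdiff i ?f x) x + (\<i> * of_real (k$i)) * pdiff i ?Gf x"
        by (subst pdiff_add)
           (auto intro!: smooth_differentiable smooth_mult smooth_const sGf smooth_of_real sG smooth_pdiff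
               phi_smooth
             simp: pdiff_linear[OF bounded_linear_mult_right] smooth_differentiable[OF sGf])
      then show ?thesis
        unfolding e e0 unfolding Dk_def by (simp add: A_def algebra_simps power2_eq_square)
    qed
    then show ?thesis unfolding Lk_def by (simp add: sum.distrib)
  qed
  have bd: "norm (Lk G k ?f x - Lk G 0 ?f x) \<le> S * norm k" if k: "norm k \<le> 1" for k x
  proof -
    have "norm (Lk G k ?f x - Lk G 0 ?f x) \<le> (\<Sum>i\<in>UNIV. norm
          (\<i> * of_real (k$i) * A i x - of_real ((k$i)^2) * ?Gf x))"
      unfolding diff norm_minus_cancel by (rule norm_sum)
    also have "\<dots> \<le> (\<Sum>i\<in>UNIV. (BA i + BG) * norm k)"
    proof (rule sum_mono)
      fix i
      have ki: "\<bar>k $ i\<bar> \<le> norm k" by (rule component_le_norm_cart)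
      \<comment> \<open>Here |k| <= 1 enters: the quadratic part of the expansion is absorbed into
        the linear one.\<close>
      have ki2: "(k$i)^2 \<le> norm k"
        using mult_mono[OF ki order_trans[OF ki k]] by (simp add: power2_eq_square abs_mult[symmetric])
      have "norm (\<i> * of_real (k$i) * A i x - of_real ((k$i)^2) * ?Gf x) \<le> \<bar>k$i\<bar> * norm (A i x) + (k$i)^2
            * norm (?Gf x)"
        by (rule order_trans[OF norm_triangle_ineq4]) (simp add: norm_mult norm_power)
      also have "\<dots> \<le> norm k * BA i + norm k * BG"
        using ki ki2 BA(2) BG(2) by (intro add_mono mult_mono) auto
      finally show "norm (\<i> * of_real (k$i) * A i x - of_real ((k$i)^2) * ?Gf x) \<le> (BA i + BG) * norm k"
        by (simp add: algebra_simps)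
    qed
    also have "\<dots> = S * norm k" by (simp add: S_def sum_distrib_right)
    finally show ?thesis .
  qed
  define C where "C = measure M (space M) * (S / r0)^2 + 1"
  show ?thesis
  proof (rule that[of C])
    show "C > 0" unfolding C_def by (intro add_nonneg_pos) auto
    fix k :: "real^'d" and I :: "nat set" assume k: "norm k \<le> 1" and I: "finite I"
    let ?Lf = "\<lambda>x. Lk G k ?f x / of_real (\<rho> x)"
    define g where "g x = ?Lf x - of_real (w2 p 0) * ?f x" for x
    have gL: "L2fun M g" unfolding g_def[abs_def]
      by (intro L2fun_diff L2fun_scale L2fun_phi Lk_coeff(3) phi_smooth phi_periodic)
    have gip: "L2ip M g (\<phi> m k) = of_real (w2 m k - w2 p 0) * L2ip M ?f (\<phi> m k)" for m
      unfolding g_def[abs_def]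
      by (subst L2ip_diff_left)
         (auto intro!: L2fun_scale L2fun_phi Lk_coeff(3) phi_smooth phi_periodic
           simp: L2ip_scale_left Lk_coeff(1)[OF phi_smooth phi_periodic] algebra_simps)
    have "norm (g x) \<le> S / r0 * norm k" for x
    proof -
      have "g x = (Lk G k ?f x - Lk G 0 ?f x) / of_real (\<rho> x)"
        using r_pos[of x] by (simp add: g_def strong_eigen field_simps)
      then have "norm (g x) = norm (Lk G k ?f x - Lk G 0 ?f x) / \<rho> x"
        using r_pos[of x] by (simp add: norm_divide)
      also have "\<dots> \<le> S * norm k / r0"
        using bd[OF k, of x] rb r_pos[of x] S0 by (intro frac_le) auto
      finally show ?thesis by simp
    qed
    then have "L2sq M g \<le> measure M (space M) * (S / r0 * norm k)^2"
      using gL by (intro L2sq_M_bound) (auto simp: L2fun_def)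
    also have "\<dots> \<le> C * (norm k)^2"
      unfolding C_def by (simp add: power_mult_distrib power_divide algebra_simps)
    finally have "L2sq M g \<le> C * (norm k)^2" .
    moreover have "(\<Sum>m\<in>I. (norm (L2ip M g (\<phi> m k)))^2) \<le> L2sq M g"
      by (rule Bessel_finite[OF phi_ONS gL I])
    moreover have "(norm (L2ip M g (\<phi> m k)))^2 = (w2 m k - w2 p 0)^2 * (norm (L2ip M ?f (\<phi> m k)))^2" for m
      unfolding gip norm_mult power_mult_distrib norm_of_real power2_abs ..
    ultimately show "(\<Sum>m\<in>I. (w2 m k - w2 p 0)^2 * (norm (L2ip M ?f (\<phi> m k)))^2) \<le> C * (norm k)^2" by simp
  qed
qed

text \<open>The eigenvalues are ordered in m at every k, so the continuity of branch p and its two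
  neighbours near 0 controls all branches; the others lie beyond the neighbours.\<close>

lemma simple_branch_gap:
  assumes simple: "\<And>m. m \<noteq> p \<Longrightarrow> w2 m 0 \<noteq> w2 p 0"
  obtains \<delta> r where "\<delta> > 0" "r > 0"
    "\<And>k m. norm k < r \<Longrightarrow> m \<noteq> p \<Longrightarrow> 2 * \<delta> \<le> \<bar>w2 m k - w2 p 0\<bar>"
    "\<And>k. norm k < r \<Longrightarrow> \<bar>w2 p k - w2 p 0\<bar> < \<delta>"
proof -
  have up: "w2 p 0 < w2 (Suc p) 0" using simple[of "Suc p"] w2_mono[of p "Suc p" 0] by simp
  define d1 where "d1 = w2 (Suc p) 0 - w2 p 0"
  \<comment> \<open>Branch 0 has no lower neighbour; 1 stands for an arbitrary positive gap.\<close>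
  define d2 where "d2 = (if p = 0 then 1 else w2 p 0 - w2 (p - 1) 0)"
  have "w2 (p - 1) 0 < w2 p 0" if "p \<noteq> 0"
    using simple[of "p - 1"] w2_mono[of "p - 1" p 0] that by (cases p) (auto simp: less_le)
  then have d: "d1 > 0" "d2 > 0"
    using up by (auto simp: d1_def d2_def)
  \<comment> \<open>A neighbour is at least 3 \<delta> away at k = 0 and moves by less than
    \<delta>, which leaves 2 \<delta>.\<close>
  define \<delta> where "\<delta> = min d1 d2 / 3"
  have \<delta>: "\<delta> > 0" "3 * \<delta> \<le> d1" "3 * \<delta> \<le> d2" using d by (auto simp: \<delta>_def)
  have "\<exists>r>0. \<forall>k. norm k < r \<longrightarrow> \<bar>w2 m k - w2 m 0\<bar> < \<delta>" for m
    using w2_isCont[where m=m and k=0] \<delta>(1) unfolding continuous_at_eps_delta dist_norm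
        by (metis diff_zero real_norm_def)
  then obtain R where R: "\<And>m. R m > 0" "\<And>m k. norm k < R m \<Longrightarrow> \<bar>w2 m k - w2 m 0\<bar> < \<delta>" by metis
  define r where "r = min (R p) (min (R (Suc p)) (R (p - 1)))"
  show ?thesis
  proof (rule that[of \<delta> r])
    show "\<delta> > 0" "r > 0" using \<delta> R(1) by (auto simp: r_def)
    fix k :: "real^'d" assume k: "norm k < r"
    then show "\<bar>w2 p k - w2 p 0\<bar> < \<delta>" by (intro R(2)) (simp add: r_def)
    fix m assume "m \<noteq> p"
    then consider "m \<ge> Suc p" | "p > 0" "m \<le> p - 1" by linarith
    then show "2 * \<delta> \<le> \<bar>w2 m k - w2 p 0\<bar>"
    proof cases
      case 1
      have "\<bar>w2 (Suc p) k - w2 (Suc p) 0\<bar> < \<delta>" using k by (intro R(2)) (simp add: r_def)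
      then show ?thesis using w2_mono[OF 1, of k] \<delta> by (simp add: d1_def)
    next
      case 2
      have "\<bar>w2 (p - 1) k - w2 (p - 1) 0\<bar> < \<delta>" using k by (intro R(2)) (simp add: r_def)
      then show ?thesis using w2_mono[OF 2(2), of k] \<delta> 2 by (simp add: d2_def)
    qed
  qed
qed

end

section \<open>Localizing the weak solution\<close>

lemma square_integrable_UNIV: "square_integrable_on UNIV f \<longleftrightarrow> L2fun lborel f"
  by (simp add: square_integrable_on_def L2fun_def set_borel_measurable_def set_integrable_def)

lemma borel_measurable_cis [measurable]:
  "f \<in> borel_measurable M \<Longrightarrow> (\<lambda>x. cis (f x)) \<in> borel_measurable M"
  unfolding cis_conv_exp by measurable

text \<open>Complex test functions. The weak formulation tests with real ones, whereas the waves to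
  be inserted are complex.\<close>

definition compact_smooth :: "(real^'d \<Rightarrow> complex) \<Rightarrow> bool" where
  "compact_smooth \<psi> \<longleftrightarrow> smooth \<psi> \<and> (\<exists>R. \<forall>x. norm x > R \<longrightarrow> \<psi> x = 0)"

lemma compact_smooth_mult: "compact_smooth f \<Longrightarrow> smooth g \<Longrightarrow> compact_smooth (\<lambda>x. f x * g x)"
  unfolding compact_smooth_def by (auto intro: smooth_mult)

lemma compact_smooth_mult': "compact_smooth f \<Longrightarrow> smooth g \<Longrightarrow> compact_smooth (\<lambda>x. g x * f x)"
  unfolding compact_smooth_def by (auto intro: smooth_mult)

lemma compact_smooth_pdiff: assumes "compact_smooth f" shows "compact_smooth (pdiff i f)"
proof -
  obtain R where R: "\<And>x. norm x > R \<Longrightarrow> f x = 0" and s: "smooth f" using assms by (auto simp: compact_smooth_def)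
  have "pdiff i f x = 0" if "norm x > R + 1" for x
    by (rule bounded_support_pdiff[of "R + 1" f]) (use R that in auto)
  then show ?thesis using smooth_pdiff[OF s] by (auto simp: compact_smooth_def)
qed

lemma compact_smooth_L2: assumes "compact_smooth f" shows "L2fun lborel f" "f \<in> borel_measurable borel"
proof -
  obtain R where R: "\<And>x. norm x > R \<Longrightarrow> f x = 0" and s: "smooth f" using assms by (auto simp: compact_smooth_def)
  show [measurable]: "f \<in> borel_measurable borel" by (rule smooth_measurable[OF s])
  obtain B where B: "B > 0" "\<And>x. norm (f x) \<le> B" using smooth_compact_bounded[OF s R] by blast
  have "integrable lborel (\<lambda>x. indicator (cball 0 R) x *\<^sub>R (norm (f x))^2)"
  proof (rule integrableI_bounded_set_indicator[where B="B^2"])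
    show "emeasure lborel (cball (0::real^'a) R) < \<infinity>" by (rule emeasure_bounded_finite[OF bounded_cball])
    show "AE x in lborel. x \<in> cball 0 R \<longrightarrow> norm ((norm (f x))^2) \<le> B^2"
      using B by (auto intro!: power_mono)
  qed auto
  also have "(\<lambda>x. indicator (cball 0 R) x *\<^sub>R (norm (f x))^2) = (\<lambda>x. (norm (f x))^2)"
    using R by (fastforce simp: indicator_def)
  finally show "L2fun lborel f" by (simp add: L2fun_def)
qed

lemma L2_mult_compact_integrable:
  assumes u: "L2fun lborel u" and f: "compact_smooth f"
  shows "integrable lborel (\<lambda>x. u x * f x)"
proof -
  have "compact_smooth (\<lambda>x. cnj (f x))" using f by (auto simp: compact_smooth_def intro: smooth_cnj)
  from L2fun_mult_integrable[OF u compact_smooth_L2(1)[OF this]] show ?thesis by simp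
qed

lemma compact_smooth_parts:
  assumes "compact_smooth \<psi>"
  shows "test_fun (\<lambda>x. Re (\<psi> x))" "test_fun (\<lambda>x. Im (\<psi> x))"
    "compact_smooth (\<lambda>x. of_real (Re (\<psi> x)))" "compact_smooth (\<lambda>x. of_real (Im (\<psi> x)))"
proof -
  obtain R where R: "\<And>x. norm x > R \<Longrightarrow> \<psi> x = 0" and s: "smooth \<psi>" using assms by (auto simp: compact_smooth_def)
  have "{x. Re (\<psi> x) \<noteq> 0} \<subseteq> cball 0 R" "{x. Im (\<psi> x) \<noteq> 0} \<subseteq> cball 0 R"
    using R by (force simp: not_le[symmetric])+
  then have "bounded {x. Re (\<psi> x) \<noteq> 0}" "bounded {x. Im (\<psi> x) \<noteq> 0}"
    by (auto intro: bounded_subset[OF bounded_cball])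
  then show "test_fun (\<lambda>x. Re (\<psi> x))" "test_fun (\<lambda>x. Im (\<psi> x))"
    unfolding test_fun_def using smooth_Re[OF s] smooth_Im[OF s] by auto
  show "compact_smooth (\<lambda>x. of_real (Re (\<psi> x)))" "compact_smooth (\<lambda>x. of_real (Im (\<psi> x)))"
    unfolding compact_smooth_def using R by (auto intro!: smooth_of_real smooth_Re smooth_Im s exI[of _ R])
qed

lemma integral_complex_split:
  assumes "integrable M (\<lambda>x. a x * complex_of_real (Re (\<psi> x)))"
      "integrable M (\<lambda>x. a x * complex_of_real (Im (\<psi> x)))"
  shows "(LINT x|M. a x * \<psi> x) = (LINT x|M. a x * complex_of_real (Re (\<psi> x))) + \<i>
        * (LINT x|M. a x * complex_of_real (Im (\<psi> x)))"
proof -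
  have "(LINT x|M. a x * \<psi> x) = (LINT x|M. a x * complex_of_real (Re (\<psi> x)) + \<i>
        * (a x * complex_of_real (Im (\<psi> x))))"
  proof (intro Bochner_Integration.integral_cong refl)
    fix x
    have "\<psi> x = complex_of_real (Re (\<psi> x)) + \<i> * complex_of_real (Im (\<psi> x))" by (rule complex_eq)
    then have "a x * \<psi> x = a x * (complex_of_real (Re (\<psi> x)) + \<i> * complex_of_real (Im (\<psi> x)))" by simp
    then show "a x * \<psi> x = a x * complex_of_real (Re (\<psi> x)) + \<i> * (a x * complex_of_real (Im (\<psi> x)))"
      by (simp only: distrib_left mult.left_commute)
  qed
  also have "\<dots> = (LINT x|M. a x * complex_of_real (Re (\<psi> x)))
        + (LINT x|M. \<i> * (a x * complex_of_real (Im (\<psi> x))))"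
    using assms by (intro Bochner_Integration.integral_add integrable_mult_right)
  finally show ?thesis by simp
qed

locale weak_solution = bloch_problem +
  fixes c :: real and h u :: "real^'a \<Rightarrow> complex" and gu :: "'a \<Rightarrow> real^'a \<Rightarrow> complex"
  assumes weak: "weak_H1_solution G \<rho> c h u gu" and h: "L2fun lborel h"
begin

lemma u_L2: "L2fun lborel u" and gu_L2: "L2fun lborel (gu i)"
  using weak by (auto simp: weak_H1_solution_def square_integrable_UNIV)

lemma u_measurable [measurable]: "u \<in> borel_measurable borel" "gu i \<in> borel_measurable borel"
    "h \<in> borel_measurable borel"
  using u_L2 gu_L2 h by (auto simp: L2fun_def)

lemma u_integrable: "compact_smooth \<psi> \<Longrightarrow> integrable lborel (\<lambda>x. u x * \<psi> x)"
  and gu_integrable: "compact_smooth \<psi> \<Longrightarrow> integrable lborel (\<lambda>x. gu i x * \<psi> x)"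
  and h_integrable: "compact_smooth \<psi> \<Longrightarrow> integrable lborel (\<lambda>x. h x * \<psi> x)"
  by (auto intro: L2_mult_compact_integrable u_L2 gu_L2 h)

text \<open>Neither this identity nor the weak equation conjugates the test function, so both sides
  are complex linear in it, and the real and imaginary parts may be tested separately.\<close>

lemma weak_derivative:
  assumes \<psi>: "compact_smooth \<psi>"
  shows "(LINT x|lborel. u x * pdiff i \<psi> x) = - (LINT x|lborel. gu i x * \<psi> x)"
proof -
  have s: "smooth \<psi>" using \<psi> by (simp add: compact_smooth_def)
  have pd: "pdiff i (\<lambda>x. Re (\<psi> x)) x = Re (pdiff i \<psi> x)" "pdiff i (\<lambda>x. Im (\<psi> x)) x = Im (pdiff i \<psi> x)" for x
    by (auto simp: pdiff_Re pdiff_Im smooth_differentiable[OF s])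
  have W: "test_fun \<eta> \<Longrightarrow> (LINT x|lborel. u x * of_real (pdiff i \<eta> x)) =
        - (LINT x|lborel. gu i x * of_real (\<eta> x))" for \<eta>
    using weak by (simp add: weak_H1_solution_def)
  note p1 = compact_smooth_parts[OF \<psi>] and p2 = compact_smooth_parts[OF compact_smooth_pdiff[OF \<psi>], of i]
  show ?thesis
    unfolding integral_complex_split[OF u_integrable[OF p2(3)] u_integrable[OF p2(4)]]
      integral_complex_split[OF gu_integrable[OF p1(3)] gu_integrable[OF p1(4)]]
    using W[OF p1(1)] W[OF p1(2)] unfolding pd by (simp add: algebra_simps)
qed

lemma weak_equation:
  assumes \<psi>: "compact_smooth \<psi>"
  shows "(\<Sum>i\<in>UNIV. LINT x|lborel. gu i x * (of_real (G x) * pdiff i \<psi> x)) - of_real c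
        * (LINT x|lborel. u x * (of_real (\<rho> x) * \<psi> x))
    = (LINT x|lborel. h x * \<psi> x)"
proof -
  have s: "smooth \<psi>" using \<psi> by (simp add: compact_smooth_def)
  have pd: "pdiff i (\<lambda>x. Re (\<psi> x)) x = Re (pdiff i \<psi> x)" "pdiff i (\<lambda>x. Im (\<psi> x)) x = Im (pdiff i \<psi> x)" for x i
    by (auto simp: pdiff_Re pdiff_Im smooth_differentiable[OF s])
  have W: "(\<Sum>i\<in>UNIV. LINT x|lborel. gu i x * (of_real (G x) * of_real (pdiff i \<eta> x))) - of_real c
        * (LINT x|lborel. u x * (of_real (\<rho> x) * of_real (\<eta> x)))
      = (LINT x|lborel. h x * of_real (\<eta> x))" if t: "test_fun \<eta>" and cs: "compact_smooth
          (\<lambda>x. of_real (\<eta> x))" for \<eta>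
  proof -
    have sm: "smooth \<eta>" using t by (simp add: test_fun_def)
    have pe: "pdiff i (\<lambda>x. complex_of_real (\<eta> x)) = (\<lambda>x. of_real (pdiff i \<eta> x))" for i
      by (rule ext) (simp add: pdiff_of_real smooth_differentiable[OF sm])
    have i1: "integrable lborel (\<lambda>x. gu i x * (of_real (G x) * of_real (pdiff i \<eta> x)))" for i
      using compact_smooth_pdiff[OF cs, of i] by (intro gu_integrable compact_smooth_mult' smooth_of_real
          sG) (simp add: pe)
    have i2: "integrable lborel (\<lambda>x. u x * (of_real (\<rho> x) * of_real (\<eta> x)))"
      by (intro u_integrable compact_smooth_mult' smooth_of_real sr cs)
    have "(LINT x|lborel. h x * of_real (\<eta> x)) = (LINT x|lborel. of_real (G x)
          * (\<Sum>i\<in>UNIV. gu i x * of_real (pdiff i \<eta> x))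
                         - of_real (c * \<rho> x) * u x * of_real (\<eta> x))"
      using weak t by (simp add: weak_H1_solution_def)
    also have "\<dots> = (LINT x|lborel. (\<Sum>i\<in>UNIV. gu i x * (of_real (G x) * of_real (pdiff i \<eta> x))) - of_real c
          * (u x * (of_real (\<rho> x) * of_real (\<eta> x))))"
      by (intro Bochner_Integration.integral_cong refl) (simp add: sum_distrib_left mult_ac)
    also have "\<dots> = (LINT x|lborel. (\<Sum>i\<in>UNIV. gu i x * (of_real (G x) * of_real (pdiff i \<eta> x))))
          - (LINT x|lborel. of_real c * (u x * (of_real (\<rho> x) * of_real (\<eta> x))))"
      by (intro Bochner_Integration.integral_diff Bochner_Integration.integrable_sum integrable_mult_right
          i1 i2)
    also have "(LINT x|lborel. (\<Sum>i\<in>UNIV. gu i x * (of_real (G x) * of_real (pdiff i \<eta> x))))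
          = (\<Sum>i\<in>UNIV. (LINT x|lborel. gu i x * (of_real (G x) * of_real (pdiff i \<eta> x))))"
      by (intro Bochner_Integration.integral_sum i1)
    finally show ?thesis by simp
  qed
  note p1 = compact_smooth_parts[OF \<psi>] and p2 = compact_smooth_parts[OF compact_smooth_pdiff[OF \<psi>]]
  have gs: "(LINT x|lborel. gu i x * (of_real (G x) * pdiff i \<psi> x))
        = (LINT x|lborel. gu i x * (of_real (G x) * of_real (Re (pdiff i \<psi> x))))
     + \<i> * (LINT x|lborel. gu i x * (of_real (G x) * of_real (Im (pdiff i \<psi> x))))" for i
    using integral_complex_split[of lborel "\<lambda>x. gu i x * of_real (G x)" "pdiff i \<psi>"]
      gu_integrable[OF compact_smooth_mult'[OF p2(3) smooth_of_real[OF sG]], of i i]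
      gu_integrable[OF compact_smooth_mult'[OF p2(4) smooth_of_real[OF sG]], of i i]
    by (simp add: mult.assoc)
  have us: "(LINT x|lborel. u x * (of_real (\<rho> x) * \<psi> x))
        = (LINT x|lborel. u x * (of_real (\<rho> x) * of_real (Re (\<psi> x))))
     + \<i> * (LINT x|lborel. u x * (of_real (\<rho> x) * of_real (Im (\<psi> x))))"
    using integral_complex_split[of lborel "\<lambda>x. u x * of_real (\<rho> x)" \<psi>]
      u_integrable[OF compact_smooth_mult'[OF p1(3) smooth_of_real[OF sr]]]
      u_integrable[OF compact_smooth_mult'[OF p1(4) smooth_of_real[OF sr]]]
    by (simp add: mult.assoc)
  have hs: "(LINT x|lborel. h x * \<psi> x) = (LINT x|lborel. h x * of_real (Re (\<psi> x))) + \<i>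
        * (LINT x|lborel. h x * of_real (Im (\<psi> x)))"
    by (rule integral_complex_split) (intro h_integrable p1)+
  show ?thesis
    unfolding gs us hs W[OF p1(1,3), symmetric] W[OF p1(2,4), symmetric] pd
    by (simp add: sum.distrib sum_distrib_left algebra_simps)
qed

text \<open>The commutator of div(G grad) with multiplication by \<theta>, applied to u and written
  with the weak gradient. Formally -div(G grad(\<theta> u)) equals \<theta> (c \<rho> u + h) minus
  this function.\<close>

definition commutator :: "(real^'a \<Rightarrow> real) \<Rightarrow> real^'a \<Rightarrow> complex" where
  "commutator \<theta> x = (\<Sum>i\<in>UNIV. 2 * (gu i x * of_real (G x * pdiff i \<theta> x))
      + u x * of_real (pdiff i (\<lambda>x. G x * pdiff i \<theta> x) x))"

text \<open>Integrating by parts twice moves the operator from \<open>\<theta> u\<close> to the smooth generalized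
  eigenfunction \<open>e\<close>, so that only a commutator with the cut-off \<open>\<theta>\<close> is left, and no derivative of \<open>e\<close>.\<close>

lemma localized_identity:
  assumes t: "test_fun \<theta>" and e: "smooth e" and eig: "\<And>x. Lk G 0 e x = of_real (w * \<rho> x) * e x"
  shows "of_real (w - c) * (LINT x|lborel. u x * (of_real (\<rho> x * \<theta> x) * e x))
    = (LINT x|lborel. (of_real (\<theta> x) * h x - commutator \<theta> x) * e x)"
proof -
  define X where "X x = complex_of_real (\<theta> x)" for x
  define Gc where "Gc x = complex_of_real (G x)" for x
  have sm: "smooth \<theta>" using t by (simp add: test_fun_def)
  obtain R where R: "\<And>x. \<theta> x \<noteq> 0 \<Longrightarrow> norm x \<le> R"
    using t unfolding test_fun_def bounded_iff by blast
  have sX: "smooth X" and sGc: "smooth Gc" unfolding X_def[abs_def] Gc_def[abs_def]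
      by (intro smooth_of_real sm sG)+
  have cX: "compact_smooth X" unfolding compact_smooth_def
  proof (intro conjI exI allI impI)
    fix x :: "real^'a" assume "norm x > R"
    then show "X x = 0" using R[of x] by (cases "\<theta> x = 0") (auto simp: X_def)
  qed (rule sX)
  have pX: "pdiff i X = (\<lambda>x. of_real (pdiff i \<theta> x))" for i
    unfolding X_def[abs_def] by (rule ext) (simp add: pdiff_of_real smooth_differentiable[OF sm])
  have pGX: "pdiff i (\<lambda>x. Gc x * pdiff i X x) x = of_real (pdiff i (\<lambda>x. G x * pdiff i \<theta> x) x)" for i x
  proof -
    have "smooth (\<lambda>x. G x * pdiff i \<theta> x)" by (intro smooth_mult smooth_pdiff sG sm)
    from pdiff_of_real[OF smooth_differentiable[OF this], of i x] show ?thesis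
      by (simp add: pX Gc_def)
  qed
  have e0: "(\<Sum>i\<in>UNIV. pdiff i (\<lambda>x. Gc x * pdiff i e x) x) = - (of_real (w * \<rho> x) * e x)" for x
    using eig[of x] by (simp add: Lk_def Dk_def[abs_def] Gc_def[abs_def] minus_equation_iff eq_commute)
  have cPe: "compact_smooth (\<lambda>x. X x * pdiff i (\<lambda>x. Gc x * pdiff i e x) x)" for i
    by (intro compact_smooth_mult cX smooth_pdiff smooth_mult sGc e)
  \<comment> \<open>A is what the weak equation tested with \<theta> e contains; B and D are the two
    halves of the commutator paired with e.\<close>
  define A where "A i = (LINT x|lborel. gu i x * (Gc x * pdiff i (\<lambda>x. X x * e x) x))" for i
  define B where "B i = (LINT x|lborel. gu i x * (Gc x * pdiff i X x * e x))" for i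
  define D where "D i = (LINT x|lborel. u x * (pdiff i (\<lambda>x. Gc x * pdiff i X x) x * e x))" for i
  have c1: "compact_smooth (\<lambda>x. X x * (Gc x * pdiff i e x))" for i
    by (intro compact_smooth_mult cX smooth_mult sGc smooth_pdiff e)
  have c2: "compact_smooth (\<lambda>x. Gc x * pdiff i X x * e x)" for i
    by (intro compact_smooth_mult compact_smooth_mult' compact_smooth_pdiff cX sGc e)
  have c3: "compact_smooth (\<lambda>x. X x * e x)" by (intro compact_smooth_mult cX e)
  have c4: "compact_smooth (\<lambda>x. pdiff i (\<lambda>x. Gc x * pdiff i X x) x * e x)" for i
    by (intro compact_smooth_mult compact_smooth_pdiff compact_smooth_mult' cX sGc e)
  have c5: "compact_smooth (\<lambda>x. pdiff i X x * (Gc x * pdiff i e x))" for i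
    by (intro compact_smooth_mult compact_smooth_pdiff cX smooth_mult sGc smooth_pdiff e)
  have d1: "pdiff i (\<lambda>x. X x * (Gc x * pdiff i e x)) x = pdiff i X x * (Gc x * pdiff i e x) + X x
        * pdiff i (\<lambda>x. Gc x * pdiff i e x) x" for i x
    by (intro pdiff_mult smooth_differentiable sX smooth_mult sGc smooth_pdiff e)
  have d2: "pdiff i (\<lambda>x. Gc x * pdiff i X x * e x) x = pdiff i (\<lambda>x. Gc x * pdiff i X x) x * e x
        + pdiff i X x * (Gc x * pdiff i e x)" for i x
    by (subst pdiff_mult) (auto intro!: smooth_differentiable sX smooth_mult sGc smooth_pdiff e simp: mult_ac)
  have d3: "Gc x * pdiff i (\<lambda>x. X x * e x) x = Gc x * pdiff i X x * e x + X x * (Gc x * pdiff i e x)" for i x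
    by (subst pdiff_mult) (auto intro!: smooth_differentiable sX smooth_mult sGc smooth_pdiff e
        simp: algebra_simps)
  \<comment> \<open>The weak derivative is applied to two test functions, \<theta> G times the
    derivative of e and e G times the derivative of \<theta>. Together with the product rule inside
    A, this eliminates every integral in which a first derivative of e appears.\<close>
  have main: "(LINT x|lborel. u x * (X x * pdiff i (\<lambda>x. Gc x * pdiff i e x) x)) = - A i + 2 * B i + D i" for i
  proof -
    have "- (LINT x|lborel. gu i x * (X x * (Gc x * pdiff i e x)))
          = (LINT x|lborel. u x * (pdiff i X x * (Gc x * pdiff i e x)) + u x
          * (X x * pdiff i (\<lambda>x. Gc x * pdiff i e x) x))"
      unfolding weak_derivative[OF c1, symmetric] d1 by (simp add: distrib_left)
    also have "\<dots> = (LINT x|lborel. u x * (pdiff i X x * (Gc x * pdiff i e x)))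
          + (LINT x|lborel. u x * (X x * pdiff i (\<lambda>x. Gc x * pdiff i e x) x))"
      by (intro Bochner_Integration.integral_add u_integrable c5 cPe)
    finally have 1: "(LINT x|lborel. u x * (X x * pdiff i (\<lambda>x. Gc x * pdiff i e x) x))
      = - (LINT x|lborel. gu i x * (X x * (Gc x * pdiff i e x))) -
          (LINT x|lborel. u x * (pdiff i X x * (Gc x * pdiff i e x)))" by simp
    have "- B i = (LINT x|lborel. u x * (pdiff i (\<lambda>x. Gc x * pdiff i X x) x * e x) + u x
          * (pdiff i X x * (Gc x * pdiff i e x)))"
      unfolding B_def weak_derivative[OF c2, symmetric] d2 by (simp add: distrib_left)
    also have "\<dots> = D i + (LINT x|lborel. u x * (pdiff i X x * (Gc x * pdiff i e x)))"
      unfolding D_def by (intro Bochner_Integration.integral_add u_integrable c5 c4)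
    finally have 2: "(LINT x|lborel. u x * (pdiff i X x * (Gc x * pdiff i e x))) = - B i - D i" by simp
    have "A i = (LINT x|lborel. gu i x * (Gc x * pdiff i X x * e x) + gu i x * (X x * (Gc x * pdiff i e x)))"
      unfolding A_def d3 by (simp add: distrib_left)
    also have "\<dots> = B i + (LINT x|lborel. gu i x * (X x * (Gc x * pdiff i e x)))"
      unfolding B_def by (intro Bochner_Integration.integral_add gu_integrable c2 c1)
    finally have 3: "(LINT x|lborel. gu i x * (X x * (Gc x * pdiff i e x))) = A i - B i" by simp
    show ?thesis unfolding 1 2 3 by simp
  qed
  have r: "(LINT x|lborel. u x * (of_real (\<rho> x * \<theta> x) * e x))
        = (LINT x|lborel. u x * (of_real (\<rho> x) * (X x * e x)))"
    by (simp add: X_def mult_ac)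
  have "- (of_real w * (LINT x|lborel. u x * (of_real (\<rho> x * \<theta> x) * e x)))
        = (LINT x|lborel. u x * (X x * (\<Sum>i\<in>UNIV. pdiff i (\<lambda>x. Gc x * pdiff i e x) x)))"
    unfolding e0 integral_mult_right_zero[symmetric] Bochner_Integration.integral_minus[symmetric]
    by (intro Bochner_Integration.integral_cong refl) (simp add: X_def mult_ac)
  also have "\<dots> = (\<Sum>i\<in>UNIV. (LINT x|lborel. u x * (X x * pdiff i (\<lambda>x. Gc x * pdiff i e x) x)))"
    unfolding sum_distrib_left by (intro Bochner_Integration.integral_sum u_integrable cPe)
  also have "\<dots> = - (\<Sum>i\<in>UNIV. A i) + (\<Sum>i\<in>UNIV. 2 * B i + D i)"
    unfolding main by (simp add: sum.distrib sum_negf sum_subtractf)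
  finally have I1: "of_real w * (LINT x|lborel. u x * (of_real (\<rho> x * \<theta> x) * e x)) = (\<Sum>i\<in>UNIV. A i)
        - (\<Sum>i\<in>UNIV. 2 * B i + D i)"
    by (simp add: algebra_simps minus_equation_iff)
  have I2: "(\<Sum>i\<in>UNIV. A i) = of_real c * (LINT x|lborel. u x * (of_real (\<rho> x * \<theta> x) * e x))
        + (LINT x|lborel. h x * (X x * e x))"
    using weak_equation[OF c3] unfolding A_def r Gc_def by (simp add: algebra_simps)
  have I3: "(\<Sum>i\<in>UNIV. 2 * B i + D i) = (LINT x|lborel. commutator \<theta> x * e x)"
      "integrable lborel (\<lambda>x. commutator \<theta> x * e x)"
  proof -
    have eq: "commutator \<theta> x * e x = (\<Sum>i\<in>UNIV. 2 * (gu i x * (Gc x * pdiff i X x * e x)) + u x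
          * (pdiff i (\<lambda>x. Gc x * pdiff i X x) x * e x))" for x
      unfolding commutator_def pGX sum_distrib_right
          by (intro sum.cong refl) (simp add: pX Gc_def algebra_simps)
    have int: "integrable lborel (\<lambda>x. 2 * (gu i x * (Gc x * pdiff i X x * e x)) + u x
          * (pdiff i (\<lambda>x. Gc x * pdiff i X x) x * e x))" for i
      by (intro Bochner_Integration.integrable_add integrable_mult_right gu_integrable u_integrable c2 c4)
    show "integrable lborel (\<lambda>x. commutator \<theta> x * e x)"
      unfolding eq by (intro Bochner_Integration.integrable_sum int)
    have "(LINT x|lborel. commutator \<theta> x * e x) = (\<Sum>i\<in>UNIV.
          (LINT x|lborel. 2 * (gu i x * (Gc x * pdiff i X x * e x)) + u x
          * (pdiff i (\<lambda>x. Gc x * pdiff i X x) x * e x)))"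
      unfolding eq by (intro Bochner_Integration.integral_sum int)
    also have "\<dots> = (\<Sum>i\<in>UNIV. 2 * B i + D i)"
      unfolding B_def D_def
      by (intro sum.cong refl, subst Bochner_Integration.integral_add)
         (auto intro!: integrable_mult_right gu_integrable u_integrable c2 c4)
    finally show "(\<Sum>i\<in>UNIV. 2 * B i + D i) = (LINT x|lborel. commutator \<theta> x * e x)" by simp
  qed
  have "(LINT x|lborel. (of_real (\<theta> x) * h x - commutator \<theta> x) * e x)
        = (LINT x|lborel. h x * (X x * e x) - commutator \<theta> x * e x)"
    by (intro Bochner_Integration.integral_cong refl) (simp add: X_def algebra_simps)
  also have "\<dots> = (LINT x|lborel. h x * (X x * e x)) - (LINT x|lborel. commutator \<theta> x * e x)"
    by (intro Bochner_Integration.integral_diff h_integrable c3 I3(2))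
  finally have I4: "(LINT x|lborel. (of_real (\<theta> x) * h x - commutator \<theta> x) * e x)
      = (LINT x|lborel. h x * (X x * e x)) - (\<Sum>i\<in>UNIV. 2 * B i + D i)"
    using I3 by simp
  show ?thesis unfolding of_real_diff left_diff_distrib[of "of_real w"] I1 I2 I4 by simp
qed

text \<open>Every term contains a first or second derivative of the cut-off, of order 1/R,
  multiplied by u or its weak gradient, which have fixed L^2 norms. Integrability comes from the
  bounded support.\<close>

lemma commutator_small:
  obtains K where "K \<ge> 0"
    "\<And>R. R \<ge> 1 \<Longrightarrow> L2fun lborel (commutator (cutoff R)) \<and> integrable lborel (commutator (cutoff R)) \<and>
       L2sq lborel (commutator (cutoff R)) \<le> K / R^2"
proof -
  obtain Kc where Kc: "Kc > 0"
    "\<And>R i x. R \<ge> 1 \<Longrightarrow> norm (pdiff i (cutoff R) (x::real^'a)) \<le> Kc / R"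
    "\<And>R i j x. R \<ge> 1 \<Longrightarrow> norm (pdiff j (pdiff i (cutoff R)) (x::real^'a)) \<le> Kc / R"
    using cutoff_derivative_bounds by blast
  obtain G0 G1 where Gb: "0 < G0" "0 < G1" "\<And>x. G0 \<le> G x" "\<And>x. G x \<le> G1" using G_bounds by blast
  have "\<exists>B>0. \<forall>x. norm (pdiff i G x) \<le> B" for i
    using continuous_zperiodic_bounded[OF smooth_continuous[OF smooth_pdiff[OF sG]] zperiodic_pdiff[OF pG]]
        by metis
  then obtain B where B: "\<And>i. B i > 0" "\<And>i x. norm (pdiff i G x) \<le> B i" by metis
  define B' where "B' = (\<Sum>i\<in>UNIV. B i)"
  have B': "norm (pdiff i G x) \<le> B'" for i x
    unfolding B'_def by (rule order_trans[OF B(2)], rule member_le_sum) (auto intro: less_imp_le B(1))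
  have B'0: "B' \<ge> 0" using order_trans[OF norm_ge_zero B'] .
  define g where "g x = complex_of_real (\<Sum>i\<in>UNIV. norm (gu i x) + norm (u x))" for x
  have gL: "L2fun lborel g"
  proof -
    have "L2fun lborel (\<lambda>x. \<Sum>i\<in>UNIV. complex_of_real (norm (gu i x)) + complex_of_real (norm (u x)))"
    proof (intro L2fun_sum L2fun_add)
      show "L2fun lborel (\<lambda>x. complex_of_real (norm (u x)))" using u_L2 by (auto simp: L2fun_def)
      show "L2fun lborel (\<lambda>x. complex_of_real (norm (gu i x)))" for i using gu_L2[of i]
          by (auto simp: L2fun_def)
    qed
    then show ?thesis by (simp add: g_def[abs_def])
  qed
  define C where "C = 2 * G1 * Kc + (B' + G1) * Kc"
  have C0: "C \<ge> 0" unfolding C_def using Gb Kc(1) B'0 by (intro add_nonneg_nonneg mult_nonneg_nonneg) auto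
  show ?thesis
  proof (rule that[of "C^2 * L2sq lborel g"])
    show "C^2 * L2sq lborel g \<ge> 0" by simp
    fix R :: real assume R: "R \<ge> 1"
    let ?q = "commutator (cutoff R)"
    have sc: "smooth (cutoff R :: real^'a \<Rightarrow> real)" by (rule smooth_cutoff)
    have [measurable]: "pdiff i (cutoff R) \<in> borel_measurable borel"
        "pdiff i (\<lambda>x. G x * pdiff i (cutoff R) x) \<in> borel_measurable borel" for i :: 'a
      by (intro smooth_measurable smooth_pdiff smooth_mult sG sc)+
    have qm[measurable]: "?q \<in> borel_measurable borel" unfolding commutator_def[abs_def] by measurable
    have b2: "norm (pdiff i (\<lambda>x. G x * pdiff i (cutoff R) x) x) \<le> (B' + G1) * Kc / R" for i x
    proof -
      have "pdiff i (\<lambda>x. G x * pdiff i (cutoff R) x) x = pdiff i G x * pdiff i (cutoff R) x + G x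
            * pdiff i (pdiff i (cutoff R)) x"
        by (intro pdiff_mult smooth_differentiable sG smooth_pdiff sc)
      also have "norm \<dots> \<le> norm (pdiff i G x) * norm (pdiff i (cutoff R) x) + norm (G x)
            * norm (pdiff i (pdiff i (cutoff R)) x)"
        by (rule order_trans[OF norm_triangle_ineq]) (simp add: abs_mult)
      also have "\<dots> \<le> B' * (Kc / R) + G1 * (Kc / R)"
        using B'[of i x] Kc(2)[OF R, of i x] Kc(3)[OF R, of i i x] Gb G_pos[of x] B'0
        by (intro add_mono mult_mono) auto
      finally show ?thesis using R by (simp add: field_simps)
    qed
    have qb: "norm (?q x) \<le> norm (of_real (C / R) * g x)" for x
    proof -
      have "norm (?q x) \<le> (\<Sum>i\<in>UNIV. norm (2 * (gu i x * of_real (G x * pdiff i (cutoff R) x)) + u x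
            * of_real (pdiff i (\<lambda>x. G x * pdiff i (cutoff R) x) x)))"
        unfolding commutator_def by (rule norm_sum)
      also have "\<dots> \<le> (\<Sum>i\<in>UNIV. C / R * (norm (gu i x) + norm (u x)))"
      proof (rule sum_mono)
        fix i
        have "norm (2 * (gu i x * complex_of_real (G x * pdiff i (cutoff R) x)) + u x
              * of_real (pdiff i (\<lambda>x. G x * pdiff i (cutoff R) x) x))
          \<le> 2 * (norm (gu i x) * (G x * norm (pdiff i (cutoff R) x))) + norm (u x) * norm
              (pdiff i (\<lambda>x. G x * pdiff i (cutoff R) x) x)"
          by (rule order_trans[OF norm_triangle_ineq]) (use G_pos[of x] in \<open>simp add: norm_mult abs_mult\<close>)
        also have "\<dots> \<le> 2 * (norm (gu i x) * (G1 * (Kc / R))) + norm (u x) * ((B' + G1) * Kc / R)"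
          using Kc(2)[OF R, of i x] b2 Gb(2,4) G_pos[of x] by (intro add_mono mult_left_mono mult_mono) auto
        also have "\<dots> = (2 * G1 * Kc) / R * norm (gu i x) + ((B' + G1) * Kc) / R * norm (u x)"
            by (simp add: mult_ac)
        also have "\<dots> \<le> C / R * norm (gu i x) + C / R * norm (u x)"
          using Gb Kc(1) B'0 R unfolding C_def
          by (intro add_mono mult_right_mono divide_right_mono) auto
        finally show "norm (2 * (gu i x * complex_of_real (G x * pdiff i (cutoff R) x)) + u x
              * of_real (pdiff i (\<lambda>x. G x * pdiff i (cutoff R) x) x))
          \<le> C / R * (norm (gu i x) + norm (u x))" by (simp add: distrib_left)
      qed
      also have "\<dots> = C / R * (\<Sum>i\<in>UNIV. norm (gu i x) + norm (u x))" by (simp only: sum_distrib_left)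
      also have "\<dots> = norm (of_real (C / R) * g x)"
        unfolding g_def norm_mult norm_of_real using C0 R by (simp add: sum_nonneg)
      finally show ?thesis .
    qed
    have rL: "L2fun lborel (\<lambda>x. of_real (C / R) * g x)" by (rule L2fun_scale[OF gL])
    have qL: "L2fun lborel ?q"
      unfolding L2fun_def
    proof
      show "integrable lborel (\<lambda>x. (norm (?q x))^2)"
        by (rule Bochner_Integration.integrable_bound[OF L2fun_sq[OF rL]])
            (use qm power_mono[OF qb norm_ge_zero, of _ 2] in \<open>auto intro!: AE_I2\<close>)
    qed simp
    have "L2sq lborel ?q \<le> L2sq lborel (\<lambda>x. of_real (C / R) * g x)"
      unfolding L2sq_def by (intro integral_mono L2fun_sq qL rL power_mono qb) auto
    also have "\<dots> = C^2 * L2sq lborel g / R^2"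
      unfolding L2sq_scale norm_of_real by (simp add: power_divide)
    finally have le: "L2sq lborel ?q \<le> C^2 * L2sq lborel g / R^2" .
    have z: "cutoff R x = 0" if "norm x \<ge> R" for x :: "real^'a"
      using cutoff_support[of R x] R that by force
    have z1: "pdiff i (cutoff R) x = 0" if "norm x > R" for x :: "real^'a" and i
      by (rule bounded_support_pdiff[OF z that])
    have z2: "pdiff i (\<lambda>x. G x * pdiff i (cutoff R) x) x = 0" if "norm x > R + 1" for x i
      by (rule bounded_support_pdiff[of "R + 1", OF _ that]) (use z1 in auto)
    \<comment> \<open>Pairing with the indicator of a ball containing the support turns square
      integrability into integrability.\<close>
    have "L2fun lborel (\<lambda>x::real^'a. complex_of_real (indicator (cball 0 (R + 1)) x))"
      unfolding L2fun_def
    proof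
      have "integrable lborel (\<lambda>x::real^'a. indicator (cball 0 (R + 1)) x *\<^sub>R (1::real))"
        by (intro integrableI_bounded_set_indicator[where B=1])
            (use emeasure_bounded_finite[OF bounded_cball, of "0::real^'a" "R + 1"] in auto)
      also have "(\<lambda>x::real^'a. indicator (cball 0 (R + 1)) x *\<^sub>R (1::real))
            = (\<lambda>x. (norm (complex_of_real (indicator (cball 0 (R + 1)) x)))^2)"
        by (auto simp: fun_eq_iff indicator_def)
      finally show "integrable lborel (\<lambda>x::real^'a.
            (norm (complex_of_real (indicator (cball 0 (R + 1)) x)))^2)" .
    qed (intro borel_measurable_continuous_on[OF continuous_on_of_real_id] borel_measurable_indicator, simp)
    from L2fun_mult_integrable[OF qL this] have "integrable lborel
          (\<lambda>x. ?q x * of_real (indicator (cball 0 (R + 1)) x))"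
      by simp
    moreover have "?q x * of_real (indicator (cball 0 (R + 1)) x) = ?q x" for x
      using z1[of x] z2[of x] by (cases "norm x > R + 1") (auto simp: commutator_def indicator_def)
    ultimately have "integrable lborel ?q" by simp
    then show "L2fun lborel ?q \<and> integrable lborel ?q \<and> L2sq lborel ?q \<le> C^2 * L2sq lborel g / R^2"
      using qL le by blast
  qed
qed

end

section \<open>Fourier series on the dual cell\<close>

lemma cst_pos: "cst d > 0"
  by (simp add: cst_def)

lemma cst_sq: "(cst d)^2 * (2 * pi)^d = 1" "(2 * pi)^d * (cst d)^2 = 1"
proof -
  have "(cst d)^2 = (2 * pi) powr (- real d)"
    unfolding cst_def power2_eq_square by (simp add: powr_add[symmetric])
  also have "\<dots> = 1 / (2 * pi)^d" by (simp add: powr_minus powr_realpow divide_inverse)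
  finally show "(cst d)^2 * (2 * pi)^d = 1" "(2 * pi)^d * (cst d)^2 = 1" by simp_all
qed

text \<open>A density on the whole space instead of a restricted space, so that measurability
  remains plain Borel measurability.\<close>

definition dualM :: "(real^'d) measure" where
  "dualM = density lborel (\<lambda>k. ennreal (indicator dual_cell k))"

lemma borel_measurable_dualM [simp]: "borel_measurable dualM = borel_measurable borel"
  by (auto simp: dualM_def measurable_def)

lemma sets_dualM [simp, measurable_cong]: "sets dualM = sets borel"
  by (simp add: dualM_def)

lemma space_dualM [simp]: "space dualM = UNIV"
  by (simp add: dualM_def)

lemma integral_dualM:
  fixes f :: "real^'d \<Rightarrow> 'b::{banach, second_countable_topology}"
  assumes [measurable]: "f \<in> borel_measurable borel"
  shows "(LINT x|dualM. f x) = (LINT x:dual_cell|lborel. f x)"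
    "integrable dualM f \<longleftrightarrow> set_integrable lborel dual_cell f"
  unfolding dualM_def set_lebesgue_integral_def set_integrable_def
  by (simp_all add: integral_density integrable_density)

lemma AE_dualM: "(AE x in dualM. P x) \<longleftrightarrow> (AE x in lborel. x \<in> dual_cell \<longrightarrow> P x)"
  unfolding dualM_def by (subst AE_density) (auto simp: indicator_def intro!: AE_cong)

lemma finite_measure_dualM: "finite_measure (dualM :: (real^'d) measure)"
proof (rule finite_measureI)
  have "emeasure dualM (space (dualM :: (real^'d) measure)) = emeasure lborel (dual_cell :: (real^'d) set)"
    by (simp add: dualM_def emeasure_density ennreal_indicator)
  also have "\<dots> < \<infinity>"
    by (rule emeasure_bounded_finite[OF compact_imp_bounded[OF compact_dual_cell]])
  finally show "emeasure dualM (space (dualM :: (real^'d) measure)) \<noteq> \<infinity>" by simp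
qed

lemma bounded_integrable_dualM:
  fixes f :: "real^'d \<Rightarrow> 'b::{banach, second_countable_topology}"
  assumes "f \<in> borel_measurable borel" "\<And>k. norm (f k) \<le> B"
  shows "integrable dualM f"
proof -
  interpret finite_measure dualM by (rule finite_measure_dualM)
  show ?thesis using assms by (intro integrable_const_bound[where B=B]) auto
qed

lemma L2fun_dualM_bounded:
  assumes "f \<in> borel_measurable borel" "\<And>k. norm (f k) \<le> B"
  shows "L2fun dualM f"
  unfolding L2fun_def
proof
  show "integrable dualM (\<lambda>x. (norm (f x))^2)"
    by (rule bounded_integrable_dualM[where B="B^2"]) (use assms in \<open>auto intro!: power_mono\<close>)
qed (use assms in simp)

text \<open>After scaling to the unit cell, for j with a nonzero coordinate j_i, the shift by 1/(2
  j_i) in that coordinate changes the sign of the exponential but not the integral of this periodic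
  function, which is therefore zero.\<close>

lemma exponential_integral:
  fixes j :: "real^'d"
  assumes j: "j \<in> lattice"
  shows "(LINT k|dualM. cis (k \<bullet> j)) = (if j = 0 then (2 * pi)^CARD('d) else 0)"
proof -
  have m: "(\<lambda>k::real^'d. indicator dual_cell k *\<^sub>R cis (k \<bullet> j)) \<in> borel_measurable borel" by measurable
  have ind: "indicator dual_cell ((2 * pi) *\<^sub>R x) = (indicator cell x :: real)" for x :: "real^'d"
    by (simp add: indicator_def dual_cell_scaled)
  have "(LINT k|dualM. cis (k \<bullet> j)) = (LINT k|lborel. indicator dual_cell k *\<^sub>R cis (k \<bullet> j))"
    by (subst integral_dualM(1)) (auto simp: set_lebesgue_integral_def)
  also have "\<dots> = (2 * pi)^CARD('d) *\<^sub>R (LINT x|lborel. indicator cell x *\<^sub>R cis ((2 * pi) *\<^sub>R x \<bullet> j))"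
    by (subst scale_lborel(2)[OF _ m, of "2 * pi"]) (simp_all only: ind, simp)
  also have "(LINT x|lborel. indicator cell x *\<^sub>R cis ((2 * pi) *\<^sub>R x \<bullet> j))
        = cint (\<lambda>x. cis ((2 * pi) *\<^sub>R x \<bullet> j))"
    by (simp add: cint_def set_lebesgue_integral_def)
  finally have eq: "(LINT k|dualM. cis (k \<bullet> j)) = (2 * pi)^CARD('d) *\<^sub>R cint (\<lambda>x. cis ((2 * pi) *\<^sub>R x \<bullet> j))" .
  show ?thesis
  proof (cases "j = 0")
    case True
    have "cint (\<lambda>x::real^'d. 1) = 1"
      by (simp add: cint_def set_lebesgue_integral_def measure_def emeasure_cell)
    then show ?thesis using eq True by (simp add: scaleR_conv_of_real)
  next
    case False
    then obtain i where i: "j $ i \<noteq> 0" by (auto simp: vec_eq_iff)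
    let ?f = "\<lambda>x::real^'d. cis ((2 * pi) *\<^sub>R x \<bullet> j)"
    have "zperiodic ?f"
      unfolding zperiodic_def
    proof safe
      fix x l :: "real^'d" assume l: "l \<in> lattice"
      have "l \<bullet> j \<in> \<int>" unfolding inner_vec_def using l j by (auto simp: lattice_def intro!: Ints_sum Ints_mult)
      then have "cis (2 * pi * (l \<bullet> j)) = 1" by (rule cis_multiple_2pi)
      then show "?f (x + l) = ?f x" by (simp add: inner_add_left distrib_left cis_mult[symmetric])
    qed
    then have "cint (\<lambda>x. ?f (x + axis i (1 / (2 * j $ i)))) = cint ?f"
      unfolding cint_def by (rule integral_zperiodic_shift[rotated]) (intro continuous_intros continuous_on_cis)
    moreover have "?f (x + axis i (1 / (2 * j $ i))) = - ?f x" for x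
    proof -
      have "(2 * pi) *\<^sub>R (x + axis i (1 / (2 * j $ i))) \<bullet> j = (2 * pi) *\<^sub>R x \<bullet> j + pi"
        using i by (simp add: inner_add_left inner_axis' distrib_left)
      then show ?thesis by (simp only: cis_mult[symmetric] cis_pi) simp
    qed
    ultimately have "- cint ?f = cint ?f" by (simp add: cint_minus)
    then have "2 * cint ?f = 0" by (metis add.left_inverse mult_2)
    then have "cint ?f = 0" by simp
    then show ?thesis using eq False by simp
  qed
qed

text \<open>The usual exponentials multiplied by the phase e^(-ik.x). The phase preserves
  orthonormality and makes the n-th coefficient refer to the point x + j itself, which is how the
  values on a lattice coset are encoded.\<close>

definition expo :: "real^'d \<Rightarrow> nat \<Rightarrow> real^'d \<Rightarrow> complex" where
  "expo x n k = of_real (cst CARD('d)) * cis (- (k \<bullet> (x + lat n)))"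

lemma expo_measurable [measurable]: "expo x n \<in> borel_measurable borel"
  unfolding expo_def[abs_def] by measurable

lemma norm_expo: "norm (expo (x :: real^'d) n k) = cst CARD('d)"
  using cst_pos by (simp add: expo_def norm_mult abs_of_pos)

lemma expo_L2: "L2fun dualM (expo (x :: real^'d) n)"
  by (rule L2fun_dualM_bounded[OF expo_measurable, where B="cst CARD('d)"]) (simp add: norm_expo)

lemma expo_ONS: "ONS dualM (expo (x :: real^'d))"
  unfolding ONS_def
proof (intro conjI allI expo_L2)
  fix m n
  have "expo x m k * cnj (expo x n k) = of_real ((cst CARD('d))^2) * cis (k \<bullet> (lat n - lat m))" for k
    by (simp add: expo_def cis_cnj cis_mult power2_eq_square inner_add_right inner_diff_right mult_ac)
  then have "L2ip dualM (expo x m) (expo x n) = of_real ((cst CARD('d))^2)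
        * (LINT k|dualM. cis (k \<bullet> (lat n - lat m :: real^'d)))"
    unfolding L2ip_def by simp
  also have "\<dots> = (if m = n then 1 else 0)"
    using cst_sq(1)[of "CARD('d)", THEN arg_cong[where f=complex_of_real]]
    by (subst exponential_integral) (auto intro: lattice_diff)
  finally show "L2ip dualM (expo x m) (expo x n) = (if m = n then 1 else 0)" .
qed

definition fseries :: "(nat \<Rightarrow> complex) \<Rightarrow> real^'d \<Rightarrow> real^'d \<Rightarrow> complex" where
  "fseries a x k = (\<Sum>n. a n * cis (- (k \<bullet> (x + lat n))))"

lemma fseries_measurable [measurable]: "fseries a x \<in> borel_measurable borel"
  unfolding fseries_def[abs_def] by measurable

text \<open>Absolute summability bounds all partial sums by one constant, which is integrable on the
  finite dual cell; dominated convergence then passes coefficients and norms to the limit. The power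
  of 2 pi undoes the normalization of \<open>expo\<close>.\<close>

lemma fseries_L2:
  fixes x :: "real^'d"
  assumes a: "summable (\<lambda>n. norm (a n))"
  shows "L2fun dualM (fseries a x)"
    "L2ip dualM (fseries a x) (expo x m) = a m / of_real (cst CARD('d))"
    "(\<lambda>n. (norm (a n))^2 * (2 * pi)^CARD('d)) sums L2sq dualM (fseries a x)"
proof -
  let ?c = "cst CARD('d)"
  define A where "A = (\<Sum>n. norm (a n))"
  define S where "S N k = (\<Sum>n<N. (a n / of_real ?c) * expo x n k)" for N k
  have S_eq: "S N k = (\<Sum>n<N. a n * cis (- (k \<bullet> (x + lat n))))" for N k
    unfolding S_def using cst_pos[of "CARD('d)"] by (intro sum.cong) (auto simp: expo_def)
  have sm: "summable (\<lambda>n. norm (a n * cis (- (k \<bullet> (x + lat n)))))" for k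
    using a by (simp add: norm_mult)
  have lim: "(\<lambda>N. S N k) \<longlonglongrightarrow> fseries a x k" for k
    unfolding S_eq fseries_def by (rule summable_LIMSEQ[OF summable_norm_cancel[OF sm]])
  have bS: "norm (S N k) \<le> A" for N k
  proof -
    have "norm (S N k) \<le> (\<Sum>n<N. norm (a n * cis (- (k \<bullet> (x + lat n)))))" unfolding S_eq by (rule norm_sum)
    also have "\<dots> \<le> A" unfolding A_def using a by (simp add: norm_mult sum_le_suminf)
    finally show ?thesis .
  qed
  have bF: "norm (fseries a x k) \<le> A" for k
    by (rule LIMSEQ_le_const2[OF tendsto_norm[OF lim]]) (use bS in auto)
  have [measurable]: "S N \<in> borel_measurable borel" for N unfolding S_def[abs_def] by measurable
  show L: "L2fun dualM (fseries a x)" by (rule L2fun_dualM_bounded[OF fseries_measurable bF])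
  have "(\<lambda>N. L2ip dualM (S N) (expo x m)) \<longlonglongrightarrow> L2ip dualM (fseries a x) (expo x m)"
    unfolding L2ip_def
  proof (rule integral_dominated_convergence[where w="\<lambda>_. A * ?c"])
    show "integrable dualM (\<lambda>_::real^'d. A * ?c)" by (rule bounded_integrable_dualM) auto
    show "AE k in dualM. (\<lambda>N. S N k * cnj (expo x m k)) \<longlonglongrightarrow> fseries a x k * cnj (expo x m k)"
      by (intro AE_I2 tendsto_mult lim tendsto_const)
    show "AE k in dualM. norm (S N k * cnj (expo x m k)) \<le> A * ?c" for N
      using bS cst_pos[of "CARD('d)"] by (intro AE_I2) (auto simp: norm_mult norm_expo intro!: mult_right_mono)
  qed simp_all
  moreover have "\<forall>\<^sub>F N in sequentially. L2ip dualM (S N) (expo x m) = a m / of_real ?c"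
    using eventually_gt_at_top[of m]
  proof eventually_elim
    case (elim N)
    have "L2ip dualM (\<lambda>k. \<Sum>n<N. (a n / of_real ?c) * expo x n k) (expo x m)
          = (if m \<in> {..<N} then a m / of_real ?c else 0)"
      by (rule L2ip_ONS_sum[OF expo_ONS]) simp
    then show ?case unfolding S_def[abs_def] using elim by (simp only: lessThan_iff if_True)
  qed
  ultimately have "(\<lambda>N::nat. a m / of_real ?c) \<longlonglongrightarrow> L2ip dualM (fseries a x) (expo x m)"
    by (rule Lim_transform_eventually)
  then show "L2ip dualM (fseries a x) (expo x m) = a m / of_real ?c" by (simp add: LIMSEQ_const_iff)
  have "(\<lambda>N. L2sq dualM (S N)) \<longlonglongrightarrow> L2sq dualM (fseries a x)"
    unfolding L2sq_def
  proof (rule integral_dominated_convergence[where w="\<lambda>_. A^2"])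
    show "integrable dualM (\<lambda>_::real^'d. A^2)" by (rule bounded_integrable_dualM) auto
    show "AE k in dualM. (\<lambda>N. (norm (S N k))^2) \<longlonglongrightarrow> (norm (fseries a x k))^2"
      by (intro AE_I2 tendsto_power tendsto_norm lim)
    show "AE k in dualM. norm ((norm (S N k))^2) \<le> A^2" for N
      using bS by (intro AE_I2) (auto intro!: power_mono)
  qed simp_all
  moreover have "L2sq dualM (S N) = (\<Sum>n<N. (norm (a n))^2 * (2 * pi)^CARD('d))" for N
  proof -
    have "L2sq dualM (S N) = (\<Sum>n<N. (norm (a n / of_real ?c))^2)"
      unfolding S_def[abs_def] by (rule L2sq_ONS_sum[OF expo_ONS]) simp
    also have "\<dots> = (\<Sum>n<N. (norm (a n))^2 * (2 * pi)^CARD('d))"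
      using cst_sq(1)[of "CARD('d)"] cst_pos[of "CARD('d)"]
      by (intro sum.cong refl) (simp add: norm_divide power_divide divide_eq_eq mult.assoc mult.commute)
    finally show ?thesis .
  qed
  ultimately show "(\<lambda>n. (norm (a n))^2 * (2 * pi)^CARD('d)) sums L2sq dualM (fseries a x)"
    by (simp add: sums_def)
qed

subsection \<open>Uniqueness of Fourier coefficients of integrable functions\<close>

inductive trig :: "(real^'d \<Rightarrow> complex) \<Rightarrow> bool" where
  base: "j \<in> lattice \<Longrightarrow> trig (\<lambda>k. c * cis (k \<bullet> j))"
| add: "trig f \<Longrightarrow> trig g \<Longrightarrow> trig (\<lambda>k. f k + g k)"

lemma trig_const: "trig (\<lambda>_. c)"
  using trig.base[of 0 c] by (simp add: lattice_def)

lemma trig_mult_base: "trig g \<Longrightarrow> j \<in> lattice \<Longrightarrow> trig (\<lambda>k. c * cis (k \<bullet> j) * g k)"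
proof (induction rule: trig.induct)
  case (base l c')
  have "j + l \<in> lattice" using base by (simp add: lattice_def)
  from trig.base[OF this, of "c * c'"] show ?case
    by (simp add: inner_add_right cis_mult[symmetric] mult_ac)
qed (simp add: distrib_left trig.add)

lemma trig_mult: "trig f \<Longrightarrow> trig g \<Longrightarrow> trig (\<lambda>k. f k * g k)"
  by (induction rule: trig.induct) (simp_all add: trig_mult_base distrib_right trig.add)

lemma trig_sum: "finite I \<Longrightarrow> (\<And>i. i \<in> I \<Longrightarrow> trig (f i)) \<Longrightarrow> trig (\<lambda>k. \<Sum>i\<in>I. f i k)"
  by (induction I rule: finite_induct) (auto intro: trig_const trig.add)

text \<open>The map k -> (e^(i k_1), ..., e^(i k_d)). It identifies opposite faces of the dual cell,
  so that continuous functions on its image are exactly those a trigonometric polynomial can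
  approximate uniformly.\<close>

definition torus :: "real^'d \<Rightarrow> complex^'d" where
  "torus k = (\<chi> i. cis (k $ i))"

lemma continuous_torus: "continuous_on A torus"
  unfolding torus_def by (intro continuous_on_vec_lambda continuous_on_cis continuous_intros)

lemma axis_lattice: "axis i 1 \<in> lattice" "- axis i 1 \<in> lattice"
  by (auto simp: lattice_def axis_def)

lemma trig_cos_sin: "trig (\<lambda>k::real^'d. c * of_real (cos (k $ i)))"
    "trig (\<lambda>k::real^'d. c * of_real (sin (k $ i)))"
proof -
  have e: "k \<bullet> axis i 1 = k $ i" "k \<bullet> - axis i 1 = - (k $ i)" for k :: "real^'d" by (simp_all add: inner_axis)
  have eq: "c * of_real (cos (k $ i)) = (c/2) * cis (k \<bullet> axis i 1) + (c/2) * cis (k \<bullet> - axis i 1)"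
    "c * of_real (sin (k $ i)) = (- \<i> * c/2) * cis (k \<bullet> axis i 1) + (\<i> * c/2) * cis (k \<bullet> - axis i 1)"
        for k :: "real^'d"
    unfolding e by (simp_all add: complex_eq_iff field_simps)
  show "trig (\<lambda>k::real^'d. c * of_real (cos (k $ i)))" "trig (\<lambda>k::real^'d. c * of_real (sin (k $ i)))"
    unfolding eq by (intro trig.intros axis_lattice)+
qed

text \<open>A real linear functional of the torus point is a combination of cosines and sines of the
  coordinates; products and sums stay trigonometric because the lattice is closed under
  addition.\<close>

lemma trig_polynomial:
  assumes "real_polynomial_function p"
  shows "trig (\<lambda>k. complex_of_real (p (torus k)))"
  using assms
proof (induction rule: real_polynomial_function.induct)
  case (linear L)
  have "torus k = (\<Sum>i\<in>UNIV. cos (k $ i) *\<^sub>R axis i 1 + sin (k $ i) *\<^sub>R axis i \<i>)" for k :: "real^'a"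
    by (simp add: torus_def vec_eq_iff axis_def complex_eq_iff if_distrib[of "\<lambda>z. _ * z"] if_distrib[of Re]
        if_distrib[of Im] cong: if_cong)
  then have "complex_of_real (L (torus k)) = (\<Sum>i\<in>UNIV. of_real (L (axis i 1)) * of_real (cos (k $ i))
        + of_real (L (axis i \<i>)) * of_real (sin (k $ i)))" for k :: "real^'a"
    using linear by (simp add: linear_simps linear_sum bounded_linear.linear mult.commute)
  then show ?case by (simp add: trig_sum trig.add trig_cos_sin)
next
  case (const c)
  then show ?case by (rule trig_const)
qed (simp_all add: trig.add trig_mult)

lemma trig_bounded: "trig t \<Longrightarrow> t \<in> borel_measurable borel \<and> (\<exists>B. \<forall>k. norm (t k) \<le> B)"
proof (induction rule: trig.induct)
  case (base j c)
  have "(\<lambda>k. c * cis (k \<bullet> j)) \<in> borel_measurable borel" by measurable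
  then show ?case by (auto simp: norm_mult)
next
  case (add f g)
  then obtain B1 B2 where "\<And>k. norm (f k) \<le> B1" "\<And>k. norm (g k) \<le> B2" by blast
  then have "norm (f k + g k) \<le> B1 + B2" for k by (meson add_mono norm_triangle_le)
  then show ?case using add by auto
qed

lemma integrable_mult_bounded:
  fixes f g :: "'a \<Rightarrow> complex"
  assumes f: "integrable M f" and [measurable]: "g \<in> borel_measurable M"
      and B: "\<And>x. x \<in> space M \<Longrightarrow> norm (g x) \<le> B"
  shows "integrable M (\<lambda>x. f x * g x)"
proof (rule Bochner_Integration.integrable_bound[OF integrable_mult_left[OF integrable_norm[OF f], of B]])
  have [measurable]: "f \<in> borel_measurable M" using f by auto
  show "(\<lambda>x. f x * g x) \<in> borel_measurable M" by measurable
  show "AE x in M. norm (f x * g x) \<le> norm (norm (f x) * B)"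
  proof (rule AE_I2)
    fix x assume "x \<in> space M"
    from B[OF this] have "norm (f x) * norm (g x) \<le> norm (f x) * B" by (intro mult_left_mono) auto
    also have "\<dots> \<le> \<bar>norm (f x) * B\<bar>" by simp
    finally show "norm (f x * g x) \<le> norm (norm (f x) * B)" by (simp add: norm_mult)
  qed
qed

lemma trig_annihilates:
  fixes f :: "real^'d \<Rightarrow> complex"
  assumes f: "integrable dualM f" and z: "\<And>j. j \<in> lattice \<Longrightarrow> (LINT k|dualM. f k * cis (k \<bullet> j)) = 0"
    and t: "trig t"
  shows "integrable dualM (\<lambda>k. f k * t k)" "(LINT k|dualM. f k * t k) = 0"
proof -
  have i: "integrable dualM (\<lambda>k. f k * t k)" if "trig t" for t
    using trig_bounded[OF that] by (auto intro: integrable_mult_bounded[OF f])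
  show "integrable dualM (\<lambda>k. f k * t k)" by (rule i[OF t])
  show "(LINT k|dualM. f k * t k) = 0"
    using t
  proof (induction rule: trig.induct)
    case (base j c)
    then show ?case using z[of j] by (simp add: mult.left_commute[of _ c])
  next
    case (add g h)
    then show ?case by (simp add: distrib_left i)
  qed
qed

text \<open>The positive and the negative part are densities of finite measures that agree on open
  sets, a generator stable under intersections. The measures coincide, hence so do the densities
  almost everywhere.\<close>

lemma AE_zero_if_open_integrals_zero:
  fixes r :: "real^'d \<Rightarrow> real"
  assumes r: "integrable lborel r" and z: "\<And>A. open A \<Longrightarrow> (LINT x|lborel. indicator A x * r x) = 0"
  shows "AE x in lborel. r x = 0"
proof -
  have [measurable]: "r \<in> borel_measurable borel" using r by auto
  define M1 where "M1 = density lborel (\<lambda>x. ennreal (max 0 (r x)))"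
  define M2 where "M2 = density lborel (\<lambda>x. ennreal (max 0 (- r x)))"
  have i: "integrable lborel (\<lambda>x. indicator A x * max 0 (r x))"
      "integrable lborel (\<lambda>x. indicator A x * max 0 (- r x))"
    if [measurable]: "A \<in> sets borel" for A
    by (rule Bochner_Integration.integrable_bound[OF r]; auto simp: indicator_def)+
  have em: "emeasure M1 A = ennreal (LINT x|lborel. indicator A x * max 0 (r x))"
    "emeasure M2 A = ennreal (LINT x|lborel. indicator A x * max 0 (- r x))" if [measurable]:
        "A \<in> sets borel" for A
  proof -
    have "emeasure M1 A = (\<integral>\<^sup>+x. ennreal (indicator A x * max 0 (r x)) \<partial>lborel)"
      unfolding M1_def by (subst emeasure_density) (auto intro!: nn_integral_cong simp: indicator_def)
    then show "emeasure M1 A = ennreal (LINT x|lborel. indicator A x * max 0 (r x))"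
      using nn_integral_eq_integral[OF i(1)[OF that]] by simp
    have "emeasure M2 A = (\<integral>\<^sup>+x. ennreal (indicator A x * max 0 (- r x)) \<partial>lborel)"
      unfolding M2_def by (subst emeasure_density) (auto intro!: nn_integral_cong simp: indicator_def)
    then show "emeasure M2 A = ennreal (LINT x|lborel. indicator A x * max 0 (- r x))"
      using nn_integral_eq_integral[OF i(2)[OF that]] by simp
  qed
  have eq: "emeasure M1 A = emeasure M2 A" if "open A" for A
  proof -
    have [measurable]: "A \<in> sets borel" using that by simp
    have "(LINT x|lborel. indicator A x * max 0 (r x)) - (LINT x|lborel. indicator A x * max 0 (- r x))
        = (LINT x|lborel. indicator A x * max 0 (r x) - indicator A x * max 0 (- r x))"
      by (rule Bochner_Integration.integral_diff[OF i, symmetric]) auto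
    also have "\<dots> = (LINT x|lborel. indicator A x * r x)"
      by (intro Bochner_Integration.integral_cong refl) (auto simp: max_def)
    finally show ?thesis using z[OF that] by (simp add: em)
  qed
  have "M1 = M2"
  proof (rule measure_eqI_generator_eq[of "{A. open A}" UNIV M1 M2 "\<lambda>_. UNIV"])
    show "Int_stable {A::(real^'d) set. open A}" by (auto simp: Int_stable_def)
    show "sets M1 = sigma_sets UNIV {A. open A}" "sets M2 = sigma_sets UNIV {A. open A}"
      by (simp_all add: M1_def M2_def borel_def)
    show "emeasure M1 UNIV \<noteq> \<infinity>" using em(1)[of UNIV] by simp
  qed (use eq in auto)
  then have "AE x in lborel. ennreal (max 0 (r x)) = ennreal (max 0 (- r x))"
    unfolding M1_def M2_def by (subst (asm) sigma_finite_measure.density_unique_iff[OF sigma_finite_lborel])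
        auto
  then show ?thesis by eventually_elim (auto simp: max_def split: if_splits)
qed

text \<open>By Stone--Weierstrass on the torus, vanishing coefficients annihilate every continuous function of
  \<open>e\<^sup>i\<^sup>k\<close>; truncated multiples of the distance to the complement then approximate indicators of open sets.\<close>

lemma fourier_unique:
  fixes f :: "real^'d \<Rightarrow> complex"
  assumes f: "integrable dualM f" and z: "\<And>j. j \<in> lattice \<Longrightarrow> (LINT k|dualM. f k * cis (k \<bullet> j)) = 0"
  shows "AE k in dualM. f k = 0"
proof -
  have fm[measurable]: "f \<in> borel_measurable borel" using f
      by (metis borel_measurable_dualM borel_measurable_integrable)
  \<comment> \<open>The open cube: there a point shares its image under \<open>torus\<close> with no
    other point of the closed dual cell. The faces removed form a null set.\<close>
  define Q :: "(real^'d) set" where "Q = box (\<chi> i. -pi) (\<chi> i. pi)"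
  have Q_iff: "k \<in> Q \<longleftrightarrow> (\<forall>i. -pi < k $ i \<and> k $ i < pi)" for k by (simp add: Q_def mem_box_cart)
  have QD: "Q \<subseteq> dual_cell" by (auto simp: Q_iff dual_cell_def less_imp_le)
  have [measurable]: "Q \<in> sets borel" by (simp add: Q_def)
  have main: "(LINT k|dualM. f k * of_real (indicator B k)) = 0" if B: "open B" "B \<subseteq> Q" for B
  proof -
    have [measurable]: "B \<in> sets borel" using B by simp
    define K where "K = torus ` (dual_cell - B)"
    have "compact (dual_cell - B)" using compact_dual_cell B(1) by (rule compact_diff)
    then have cK: "compact K" unfolding K_def by (intro compact_continuous_image continuous_torus)
    \<comment> \<open>The distance to an empty set would be 0 by convention; a corner of the closed
      cell shows that K is not empty.\<close>
    have "(\<chi> i. pi) \<in> dual_cell - B" using B(2) by (auto simp: Q_iff dual_cell_def)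
    then have Kne: "K \<noteq> {}" by (auto simp: K_def)
    \<comment> \<open>Equal torus points differ coordinatewise by multiples of 2 pi. One point lies
      in the open cube and the other in the closed one, so the differences are strictly below 2 pi
      and vanish. Hence within the dual cell the distance to K is positive precisely on B.\<close>
    have inK: "k \<notin> B" if "k \<in> dual_cell" "torus k \<in> K" for k
    proof
      assume "k \<in> B"
      obtain k' where k': "k' \<in> dual_cell" "k' \<notin> B" "torus k = torus k'" using \<open>torus k \<in> K\<close>
          by (auto simp: K_def)
      have "k $ i = k' $ i" for i
      proof -
        have "cis (k $ i) = cis (k' $ i)" using k'(3) by (simp add: torus_def vec_eq_iff)
        then have "cis (k $ i - k' $ i) = 1" by (metis cis_divide cis_neq_zero divide_self)
        then have "cos (k $ i - k' $ i) = 1" by (metis cis.sel(1) one_complex.sel(1))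
        then obtain n :: int where n: "k $ i - k' $ i = of_int n * 2 * pi" unfolding cos_one_2pi_int by auto
        have "-pi < k $ i \<and> k $ i < pi" using \<open>k \<in> B\<close> B(2) Q_iff by blast
        moreover have "-pi \<le> k' $ i \<and> k' $ i \<le> pi" using k'(1) by (simp add: dual_cell_def)
        ultimately have "\<bar>k $ i - k' $ i\<bar> < 2 * pi" by linarith
        then have "\<bar>of_int n\<bar> * (2 * pi) < 1 * (2 * pi)" unfolding n by (simp add: abs_mult)
        then have "\<bar>of_int n :: real\<bar> < 1" using pi_gt_zero by (simp only: mult_less_cancel_right)
        then have "n = 0" by linarith
        then show ?thesis using n by simp
      qed
      then have "k = k'" by (simp add: vec_eq_iff)
      then show False using k'(2) \<open>k \<in> B\<close> by simp
    qed
    define g where "g n z = min 1 (real n * infdist z K)" for n z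
    have cg: "continuous_on A (g n)" for n A unfolding g_def by (intro continuous_intros)
    have g01: "0 \<le> g n z" "g n z \<le> 1" for n z by (auto simp: g_def infdist_nonneg)
    have gm[measurable]: "(\<lambda>k. g n (torus k)) \<in> borel_measurable borel" for n
      by (intro borel_measurable_continuous_onI continuous_on_compose2[OF cg continuous_torus]) auto
    have gi: "integrable dualM (\<lambda>k. f k * of_real (g n (torus k)))" for n
      by (rule integrable_mult_bounded[OF f, where B=1]) (use g01 in auto)
    have zero: "(LINT k|dualM. f k * of_real (g n (torus k))) = 0" for n
    proof -
      define I where "I = (LINT k|dualM. norm (f k))"
      have "norm (LINT k|dualM. f k * of_real (g n (torus k))) \<le> e * I" if e: "e > 0" for e
      proof -
        have "compact (torus ` (dual_cell :: (real^'d) set))"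
          by (intro compact_continuous_image continuous_torus compact_dual_cell)
        then obtain p where p: "real_polynomial_function p"
            "\<And>z. z \<in> torus ` (dual_cell :: (real^'d) set) \<Longrightarrow> \<bar>g n z - p z\<bar> < e"
          using Stone_Weierstrass_real_polynomial_function[OF _ cg e] by blast
        note tr = trig_annihilates[OF f z trig_polynomial[OF p(1)]]
        have "(LINT k|dualM. f k * of_real (g n (torus k)))
              = (LINT k|dualM. f k * of_real (g n (torus k)) - f k * of_real (p (torus k)))"
          using gi tr by simp
        also have "norm \<dots> \<le> (LINT k|dualM. norm (f k) * e)"
        proof (rule order_trans[OF integral_norm_bound integral_mono_AE])
          show "integrable dualM (\<lambda>k. norm (f k * of_real (g n (torus k)) - f k * of_real (p (torus k))))"
              using gi tr by simp
          show "integrable dualM (\<lambda>k. norm (f k) * e)" using f by simp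
          show "AE k in dualM. norm (f k * of_real (g n (torus k)) - f k * of_real (p (torus k)))
                \<le> norm (f k) * e"
            unfolding AE_dualM
          proof (intro AE_I2 impI)
            fix k :: "real^'d" assume "k \<in> dual_cell"
            then have "\<bar>g n (torus k) - p (torus k)\<bar> \<le> e" using p(2) by (simp add: less_imp_le)
            moreover have "f k * of_real (g n (torus k)) - f k * of_real (p (torus k)) = f k
                  * of_real (g n (torus k) - p (torus k))"
              by (simp add: right_diff_distrib)
            ultimately show "norm (f k * of_real (g n (torus k)) - f k * of_real (p (torus k))) \<le> norm (f k)
                  * e"
              by (simp add: norm_mult mult_left_mono del: of_real_diff)
          qed
        qed
        also have "\<dots> = e * I" by (simp add: I_def mult.commute)
        finally show ?thesis .
      qed
      moreover have "I \<ge> 0" by (simp add: I_def)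
      ultimately have "norm (LINT k|dualM. f k * of_real (g n (torus k))) \<le> 0"
      proof -
        assume *: "\<And>e. e > 0 \<Longrightarrow> norm (LINT k|dualM. f k * of_real (g n (torus k))) \<le> e * I" and I: "I \<ge> 0"
        show ?thesis
        proof (rule field_le_epsilon)
          fix e :: real assume "e > 0"
          then have "norm (LINT k|dualM. f k * of_real (g n (torus k))) \<le> e / (I + 1) * I" using I
              by (intro *) auto
          also have "\<dots> \<le> 0 + e" using I \<open>e > 0\<close> by (simp add: field_simps)
          finally show "norm (LINT k|dualM. f k * of_real (g n (torus k))) \<le> 0 + e" .
        qed
      qed
      then show ?thesis by simp
    qed
    have "(\<lambda>n. LINT k|dualM. f k * of_real (g n (torus k))) \<longlonglongrightarrow> (LINT k|dualM. f k * of_real (indicator B k))"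
    proof (rule integral_dominated_convergence[where w="\<lambda>k. norm (f k)"])
      show "AE k in dualM. (\<lambda>n. f k * of_real (g n (torus k))) \<longlonglongrightarrow> f k * of_real (indicator B k)"
        unfolding AE_dualM
      proof (intro AE_I2 impI tendsto_mult tendsto_const tendsto_of_real)
        fix k :: "real^'d" assume k: "k \<in> dual_cell"
        show "(\<lambda>n. g n (torus k)) \<longlonglongrightarrow> indicator B k"
        proof (cases "k \<in> B")
          case True
          then have "torus k \<notin> K" using inK[OF k] by blast
          then have d: "infdist (torus k) K > 0"
            using in_closed_iff_infdist_zero[OF compact_imp_closed[OF cK] Kne]
                infdist_nonneg[of "torus k" K] by (metis less_eq_real_def)
          obtain N :: nat where N: "real N > 1 / infdist (torus k) K" using reals_Archimedean2 by blast
          have "g n (torus k) = 1" if "n \<ge> N" for n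
          proof -
            have "1 / infdist (torus k) K < real n" using N that by (meson less_le_trans of_nat_le_iff)
            then have "1 \<le> real n * infdist (torus k) K" using d by (simp add: pos_divide_less_eq)
            then show ?thesis by (simp add: g_def)
          qed
          then show ?thesis using True
            by (intro tendsto_eventually) (auto simp: eventually_sequentially)
        next
          case False
          then have "torus k \<in> K" using k by (auto simp: K_def)
          then show ?thesis using False by (simp add: g_def)
        qed
      qed
      show "AE k in dualM. norm (f k * of_real (g n (torus k))) \<le> norm (f k)" for n
        using g01 by (intro AE_I2) (auto simp: norm_mult intro!: mult_left_le)
    qed (use f in auto)
    then show ?thesis unfolding zero by (simp add: LIMSEQ_const_iff)
  qed
  have fi: "integrable lborel (\<lambda>k. indicator Q k *\<^sub>R f k)"
  proof -
    have "integrable lborel (\<lambda>k. indicator dual_cell k *\<^sub>R f k)"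
      using f integral_dualM(2)[OF fm] by (simp add: set_integrable_def)
    then show ?thesis
    proof (rule Bochner_Integration.integrable_bound)
      show "AE k in lborel. norm (indicator Q k *\<^sub>R f k) \<le> norm (indicator dual_cell k *\<^sub>R f k)"
        using QD by (intro AE_I2) (auto simp: indicator_def)
    qed measurable
  qed
  have main': "(LINT k|lborel. of_real (indicator A k) * (indicator Q k *\<^sub>R f k)) = 0" if "open A" for A
  proof -
    have "(LINT k|lborel. of_real (indicator A k) * (indicator Q k *\<^sub>R f k))
          = (LINT k|dualM. f k * of_real (indicator (A \<inter> Q) k))"
    proof -
      have [measurable]: "A \<in> sets borel" using that by simp
      have "(\<lambda>k. f k * complex_of_real (indicator (A \<inter> Q) k)) \<in> borel_measurable borel" by measurable
      from integral_dualM(1)[OF this] show ?thesis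
        unfolding set_lebesgue_integral_def
        using QD by (auto simp: indicator_def intro!: Bochner_Integration.integral_cong)
    qed
    also have "\<dots> = 0" by (rule main) (use that in \<open>auto simp: Q_def\<close>)
    finally show ?thesis .
  qed
  have int: "integrable lborel (\<lambda>k. of_real (indicator A k) * (indicator Q k *\<^sub>R f k))" if "open A" for A
  proof (rule Bochner_Integration.integrable_bound[OF fi])
    have [measurable]: "A \<in> sets borel" using that by simp
    show "(\<lambda>k. of_real (indicator A k) * (indicator Q k *\<^sub>R f k)) \<in> borel_measurable lborel" by measurable
  qed (auto simp: indicator_def)
  have "AE k in lborel. Re (indicator Q k *\<^sub>R f k) = 0"
  proof (rule AE_zero_if_open_integrals_zero)
    show "integrable lborel (\<lambda>k. Re (indicator Q k *\<^sub>R f k))" using fi by (rule integrable_Re)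
    fix A :: "(real^'d) set" assume A: "open A"
    show "(LINT k|lborel. indicator A k * Re (indicator Q k *\<^sub>R f k)) = 0"
      using integral_Re[OF int[OF A]] main'[OF A] by (simp add: mult.left_commute)
  qed
  moreover have "AE k in lborel. Im (indicator Q k *\<^sub>R f k) = 0"
  proof (rule AE_zero_if_open_integrals_zero)
    show "integrable lborel (\<lambda>k. Im (indicator Q k *\<^sub>R f k))" using fi by (rule integrable_Im)
    fix A :: "(real^'d) set" assume A: "open A"
    show "(LINT k|lborel. indicator A k * Im (indicator Q k *\<^sub>R f k)) = 0"
      using integral_Im[OF int[OF A]] main'[OF A] by (simp add: mult.left_commute)
  qed
  moreover have "AE k in lborel. \<forall>i. (k::real^'d) $ i \<noteq> pi" "AE k in lborel. \<forall>i. (k::real^'d) $ i \<noteq> - pi"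
    unfolding AE_all_countable using AE_component_neq by blast+
  ultimately have "AE k in lborel. k \<in> dual_cell \<longrightarrow> f k = 0"
  proof eventually_elim
    case (elim k)
    show ?case
    proof
      assume "k \<in> dual_cell"
      then have "k \<in> Q" using elim unfolding Q_iff dual_cell_def by (auto simp: less_le)
      then show "f k = 0" using elim by (simp add: complex_eq_iff)
    qed
  qed
  then show ?thesis by (simp add: AE_dualM)
qed

lemma fourier_unique_shifted:
  fixes f :: "real^'d \<Rightarrow> complex" and x :: "real^'d"
  assumes f: "integrable dualM f" and z: "\<And>n. (LINT k|dualM. f k * cis (k \<bullet> (x + lat n))) = 0"
  shows "AE k in dualM. f k = 0"
proof -
  have "AE k in dualM. f k * cis (k \<bullet> x) = 0"
  proof (rule fourier_unique)
    show "integrable dualM (\<lambda>k. f k * cis (k \<bullet> x))"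
      by (rule integrable_mult_bounded[OF f, where B=1]) auto
    fix j :: "real^'d" assume "j \<in> lattice"
    then obtain n where "j = lat n" using lat_ex by blast
    then show "(LINT k|dualM. f k * cis (k \<bullet> x) * cis (k \<bullet> j)) = 0"
      using z[of n] by (simp add: inner_add_right cis_mult[symmetric] mult.assoc)
  qed
  then show ?thesis by eventually_elim simp
qed

section \<open>The Bloch transform\<close>

abbreviation unitM :: "(real^'d) measure" where "unitM \<equiv> cellM (\<lambda>_. 1)"

lemma sets_cellM [simp, measurable_cong]: "sets (cellM w) = sets borel"
  by (simp add: cellM_def)

lemma nn_integral_unitM:
  assumes [measurable]: "f \<in> borel_measurable borel"
  shows "(\<integral>\<^sup>+x. f x \<partial>unitM) = (\<integral>\<^sup>+x. f x * indicator cell x \<partial>lborel)"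
  unfolding cellM_def by (subst nn_integral_density) (auto intro!: nn_integral_cong simp: indicator_def)

lemma AE_unitM: "(AE x in unitM. P x) \<longleftrightarrow> (AE x in lborel. x \<in> cell \<longrightarrow> P x)"
  by (rule AE_cellM) auto

lemma finite_measure_unitM: "finite_measure (unitM :: (real^'d) measure)"
  by (rule finite_measure_cellM) auto

lemma integral_unitM:
  fixes f :: "real^'d \<Rightarrow> complex"
  assumes [measurable]: "f \<in> borel_measurable borel"
  shows "(LINT x|unitM. f x) = cint f"
  by (simp add: integral_cellM)

lemma L2ip_unitM: "f \<in> borel_measurable borel \<Longrightarrow> g \<in> borel_measurable borel \<Longrightarrow> L2ip unitM f g
      = cint (\<lambda>x. f x * cnj (g x))"
  by (simp add: L2ip_def integral_cellM)

lemma pair_dual_unit: "pair_sigma_finite (dualM :: (real^'d) measure) (unitM :: (real^'d) measure)"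
  by (intro pair_sigma_finite.intro finite_measure.axioms(1) finite_measure_dualM finite_measure_unitM)

lemma borel_measurable_dual_unit: "borel_measurable (dualM \<Otimes>\<^sub>M unitM) = borel_measurable (borel \<Otimes>\<^sub>M borel)"
  by (intro measurable_cong_sets sets_pair_measure_cong) auto

lemma dual_unit_swap:
  fixes f :: "real^'d \<Rightarrow> real^'d \<Rightarrow> ennreal"
  assumes "case_prod f \<in> borel_measurable (borel \<Otimes>\<^sub>M borel)"
  shows "(\<integral>\<^sup>+k. \<integral>\<^sup>+x. f k x \<partial>unitM \<partial>dualM) = (\<integral>\<^sup>+x. \<integral>\<^sup>+k. f k x \<partial>dualM \<partial>unitM)"
  using pair_sigma_finite.Fubini'[OF pair_dual_unit, of f] assms by (simp add: borel_measurable_dual_unit)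

lemma L2fun_iff_nn:
  assumes "f \<in> borel_measurable M"
  shows "L2fun M f \<longleftrightarrow> (\<integral>\<^sup>+x. ennreal ((norm (f x))^2) \<partial>M) < \<infinity>"
    "L2fun M f \<Longrightarrow> (\<integral>\<^sup>+x. ennreal ((norm (f x))^2) \<partial>M) = ennreal (L2sq M f)"
  using assms by (auto simp: L2fun_def L2sq_def integrable_iff_bounded intro!: nn_integral_eq_integral)

section \<open>The periodic part of the Bloch transform and its Plancherel identity\<close>

text \<open>The Bloch transform without its normalization and without the factor e^(ik.x). This is
  the part that is compared with the periodic eigenfunctions.\<close>

definition bsum :: "(real^'d \<Rightarrow> complex) \<Rightarrow> real^'d \<Rightarrow> real^'d \<Rightarrow> complex" where
  "bsum v k x = fseries (\<lambda>n. v (x + lat n)) x k"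

lemma bsum_measurable_pair [measurable]:
  assumes [measurable]: "v \<in> borel_measurable borel"
  shows "(\<lambda>(k, x). bsum v k x) \<in> borel_measurable (borel \<Otimes>\<^sub>M borel)"
  unfolding bsum_def fseries_def by measurable

lemma bsum_measurable [measurable]:
  assumes [measurable]: "v \<in> borel_measurable borel"
  shows "bsum v k \<in> borel_measurable borel"
  unfolding bsum_def[abs_def] fseries_def by measurable

lemma summable_translates:
  assumes "integrable lborel v"
  shows "AE x in unitM. summable (\<lambda>n. norm (v (x + lat n) :: complex))"
  unfolding AE_unitM by (rule integral_unfold(1)[OF assms])

text \<open>Unfolding read backwards: a periodic weight can be pulled into the lattice sum, so the
  fibre coefficient is an integral of v over the whole space against a wave. This is the bridge
  between the weak equation and the fibres.\<close>

lemma bsum_coeff: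
  fixes v q :: "real^'d \<Rightarrow> complex"
  assumes v: "integrable lborel v" and q[measurable]: "q \<in> borel_measurable borel"
      and B: "\<And>x. norm (q x) \<le> B" and p: "zperiodic q"
  shows "cint (\<lambda>x. bsum v k x * q x) = (LINT x|lborel. v x * (cis (- (k \<bullet> x)) * q x))"
    "integrable lborel (\<lambda>x. v x * (cis (- (k \<bullet> x)) * q x))"
proof -
  have [measurable]: "v \<in> borel_measurable borel" using v by auto
  show i: "integrable lborel (\<lambda>x. v x * (cis (- (k \<bullet> x)) * q x))"
    by (rule integrable_mult_bounded[OF v, where B=B]) (use B in \<open>auto simp: norm_mult\<close>)
  have "(LINT x|lborel. v x * (cis (- (k \<bullet> x)) * q x))
        = cint (\<lambda>x. \<Sum>n. v (x + lat n) * (cis (- (k \<bullet> (x + lat n))) * q (x + lat n)))"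
    unfolding cint_def by (rule integral_unfold(3)[OF i])
  also have "\<dots> = cint (\<lambda>x. bsum v k x * q x)"
    unfolding cint_def set_lebesgue_integral_def
  proof (rule integral_cong_AE)
    show "AE x in lborel. indicator cell x *\<^sub>R (\<Sum>n. v (x + lat n)
          * (cis (- (k \<bullet> (x + lat n))) * q (x + lat n))) = indicator cell x *\<^sub>R (bsum v k x * q x)"
      using integral_unfold(1)[OF v]
    proof eventually_elim
      case (elim x)
      show ?case
      proof (cases "x \<in> cell")
        case True
        then have "summable (\<lambda>n. norm (v (x + lat n) * cis (- (k \<bullet> (x + lat n)))))" using elim
            by (simp add: norm_mult)
        then have "summable (\<lambda>n. v (x + lat n) * cis (- (k \<bullet> (x + lat n))))" by (rule summable_norm_cancel)
        from suminf_mult2[OF this, of "q x"] show ?thesis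
          using p by (simp add: bsum_def fseries_def mult.assoc)
      qed simp
    qed
  qed measurable
  finally show "cint (\<lambda>x. bsum v k x * q x) = (LINT x|lborel. v x * (cis (- (k \<bullet> x)) * q x))" by simp
qed

lemma bsum_mult_periodic:
  assumes "zperiodic q" "summable (\<lambda>n. norm (v (x + lat n)))"
  shows "bsum (\<lambda>x. v x * q x) k x = bsum v k x * q x"
proof -
  have "summable (\<lambda>n. norm (v (x + lat n) * cis (- (k \<bullet> (x + lat n)))))" using assms(2) by (simp add: norm_mult)
  then have "summable (\<lambda>n. v (x + lat n) * cis (- (k \<bullet> (x + lat n))))" by (rule summable_norm_cancel)
  from suminf_mult2[OF this, of "q x"] show ?thesis
    using assms(1) by (simp add: bsum_def fseries_def mult_ac)
qed

lemma bloch_eq_bsum: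
  fixes v :: "real^'d \<Rightarrow> complex"
  assumes "summable (\<lambda>n. norm (v (x + lat n)))"
  shows "bloch v k x = of_real (cst CARD('d)) * (cis (k \<bullet> x) * bsum v k x)"
proof -
  let ?t = "\<lambda>n. v (x + lat n) * cis (- (k \<bullet> lat n))"
  have sn: "summable (\<lambda>n. norm (?t n))" using assms by (simp add: norm_mult)
  have "(?t has_sum (\<Sum>n. ?t n)) UNIV"
    by (rule norm_summable_imp_has_sum[OF sn summable_sums[OF summable_norm_cancel[OF sn]]])
  then have "(\<Sum>n. ?t n) = infsum ?t UNIV" by (simp add: infsumI)
  also have "\<dots> = infsum (\<lambda>j. v (x + j) * cis (- (k \<bullet> j))) lattice"
    by (rule infsum_reindex_bij_betw[OF bij_lat, of "\<lambda>j. v (x + j) * cis (- (k \<bullet> j))"])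
  finally have "infsum (\<lambda>j. v (x + j) * cis (- (k \<bullet> j))) lattice = (\<Sum>n. ?t n)" ..
  also have "\<dots> = (\<Sum>n. cis (k \<bullet> x) * (v (x + lat n) * cis (- (k \<bullet> (x + lat n)))))"
    by (intro suminf_cong) (simp add: inner_add_right mult.left_commute[of "cis _"] cis_mult)
  also have "\<dots> = cis (k \<bullet> x) * bsum v k x"
  proof -
    have "summable (\<lambda>n. norm (v (x + lat n) * cis (- (k \<bullet> (x + lat n)))))" using assms by (simp add: norm_mult)
    then have "summable (\<lambda>n. v (x + lat n) * cis (- (k \<bullet> (x + lat n))))" by (rule summable_norm_cancel)
    from suminf_mult[OF this, of "cis (k \<bullet> x)"] show ?thesis by (simp add: bsum_def fseries_def)
  qed
  finally show ?thesis by (simp add: bloch_def)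
qed

text \<open>Parseval in k for almost every fixed x, followed by unfolding in x, after exchanging the
  two integrals.\<close>

lemma bsum_L2:
  fixes v :: "real^'d \<Rightarrow> complex"
  assumes v: "integrable lborel v" "L2fun lborel v"
  shows "(\<integral>\<^sup>+k. \<integral>\<^sup>+x. ennreal ((norm (bsum v k x))^2) \<partial>unitM \<partial>dualM)
        = ennreal ((2 * pi)^CARD('d) * L2sq lborel v)"
proof -
  have [measurable]: "v \<in> borel_measurable borel" using v by auto
  have m: "(\<lambda>(k, x). ennreal ((norm (bsum v k x))^2)) \<in> borel_measurable (borel \<Otimes>\<^sub>M borel)" by measurable
  have "(\<integral>\<^sup>+k. \<integral>\<^sup>+x. ennreal ((norm (bsum v k x))^2) \<partial>unitM \<partial>dualM)
        = (\<integral>\<^sup>+x. \<integral>\<^sup>+k. ennreal ((norm (bsum v k x))^2) \<partial>dualM \<partial>unitM)"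
    by (rule dual_unit_swap[OF m])
  also have "\<dots> = (\<integral>\<^sup>+x. (\<Sum>n. ennreal ((norm (v (x + lat n)))^2 * (2 * pi)^CARD('d))) \<partial>unitM)"
  proof (rule nn_integral_cong_AE, use summable_translates[OF v(1)] in eventually_elim)
    fix x :: "real^'d" assume s: "summable (\<lambda>n. norm (v (x + lat n)))"
    note F = fseries_L2[OF s, of x]
    have "(\<integral>\<^sup>+k. ennreal ((norm (bsum v k x))^2) \<partial>dualM) = ennreal (L2sq dualM (fseries (\<lambda>n. v (x + lat n)) x))"
      unfolding bsum_def by (rule L2fun_iff_nn(2)[OF _ F(1)]) simp
    also have "\<dots> = (\<Sum>n. ennreal ((norm (v (x + lat n)))^2 * (2 * pi)^CARD('d)))"
      using F(3) by (subst sums_unique[OF F(3)], intro suminf_ennreal2[symmetric]) (auto simp: sums_iff)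
    finally show "(\<integral>\<^sup>+k. ennreal ((norm (bsum v k x))^2) \<partial>dualM)
          = (\<Sum>n. ennreal ((norm (v (x + lat n)))^2 * (2 * pi)^CARD('d)))" .
  qed
  also have "\<dots> = (\<integral>\<^sup>+x. ennreal ((norm (v x))^2 * (2 * pi)^CARD('d)) \<partial>lborel)"
    by (subst nn_integral_unitM) (auto intro!: nn_integral_unfold[symmetric])
  also have "\<dots> = ennreal (LINT x|lborel. (norm (v x))^2 * (2 * pi)^CARD('d))"
    using v by (intro nn_integral_eq_integral) (auto simp: L2fun_def)
  finally show ?thesis by (simp add: L2sq_def mult.commute)
qed

lemma bsum_L2fun_AE:
  fixes v :: "real^'d \<Rightarrow> complex"
  assumes v: "integrable lborel v" "L2fun lborel v"
  shows "AE k in dualM. L2fun unitM (bsum v k)"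
proof -
  have [measurable]: "v \<in> borel_measurable borel" using v by auto
  have m: "(\<lambda>k. \<integral>\<^sup>+x. ennreal ((norm (bsum v k x))^2) \<partial>unitM) \<in> borel_measurable dualM"
  proof -
    interpret pair_sigma_finite "dualM :: (real^'d) measure" "unitM :: (real^'d) measure"
        by (rule pair_dual_unit)
    have "(\<lambda>(k, x). ennreal ((norm (bsum v k x))^2)) \<in> borel_measurable (dualM \<Otimes>\<^sub>M unitM)"
      unfolding borel_measurable_dual_unit by measurable
    from M2.borel_measurable_nn_integral[OF this] show ?thesis .
  qed
  have "AE k in dualM. (\<integral>\<^sup>+x. ennreal ((norm (bsum v k x))^2) \<partial>unitM) \<noteq> \<infinity>"
    by (rule nn_integral_PInf_AE[OF m]) (simp add: bsum_L2[OF v])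
  then show ?thesis
    by eventually_elim (subst L2fun_iff_nn(1), auto simp: top.not_eq_extremum)
qed

text \<open>The values of \<open>v - U\<close> on a lattice coset are Fourier coefficients in \<open>k\<close>, so Bessel's inequality
  in \<open>k\<close> controls the distance to a synthesized function \<open>U\<close>, without inverting the Bloch transform.\<close>

lemma bloch_Bessel:
  fixes v U :: "real^'d \<Rightarrow> complex" and P :: "real^'d \<Rightarrow> real^'d \<Rightarrow> complex"
  assumes v: "integrable lborel v"
    and Pm: "(\<lambda>(k, x). P k x) \<in> borel_measurable (borel \<Otimes>\<^sub>M borel)" and Pp: "\<And>k. zperiodic (P k)"
    and Pf: "(\<integral>\<^sup>+k. \<integral>\<^sup>+x. ennreal ((norm (P k x))^2) \<partial>unitM \<partial>dualM) < \<infinity>"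
    and U: "\<And>x. U x = of_real (cst CARD('d)) * (LINT k|dualM. P k x * cis (k \<bullet> x))"
        and [measurable]: "U \<in> borel_measurable borel"
  shows "(\<integral>\<^sup>+x. ennreal ((norm (v x - U x))^2) \<partial>lborel)
     \<le> ennreal ((cst CARD('d))^2) * (\<integral>\<^sup>+k. \<integral>\<^sup>+x. ennreal
         ((norm (bsum v k x - P k x / of_real (cst CARD('d))))^2) \<partial>unitM \<partial>dualM)"
proof -
  let ?c = "cst CARD('d)"
  have c: "?c > 0" by (rule cst_pos)
  have [measurable]: "v \<in> borel_measurable borel" using v by auto
  note [measurable] = Pm
  have Pxm[measurable]: "(\<lambda>k. P k x) \<in> borel_measurable borel" for x
    using measurable_compose[OF measurable_Pair[OF measurable_ident measurable_const[of x]] Pm] by simp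
  have m: "(\<lambda>(k, x). ennreal ((norm (bsum v k x - P k x / of_real ?c))^2)) \<in> borel_measurable (borel \<Otimes>\<^sub>M borel)"
    by measurable
  have mP: "(\<lambda>(k, x). ennreal ((norm (P k x))^2)) \<in> borel_measurable (borel \<Otimes>\<^sub>M borel)" by measurable
  have Pfx: "AE x in unitM. L2fun dualM (\<lambda>k. P k x)"
  proof -
    interpret pair_sigma_finite "unitM :: (real^'d) measure" "dualM :: (real^'d) measure"
      using pair_dual_unit by (auto simp: pair_sigma_finite_def)
    have "(\<lambda>(x, k). ennreal ((norm (P k x))^2)) \<in> borel_measurable (borel \<Otimes>\<^sub>M borel)" by measurable
    moreover have "borel_measurable (unitM \<Otimes>\<^sub>M dualM)
          = borel_measurable (borel \<Otimes>\<^sub>M (borel :: (real^'d) measure))"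
      by (intro measurable_cong_sets sets_pair_measure_cong) auto
    ultimately have mm: "(\<lambda>x. \<integral>\<^sup>+k. ennreal ((norm (P k x))^2) \<partial>dualM) \<in> borel_measurable unitM"
      using M2.borel_measurable_nn_integral by blast
    have "(\<integral>\<^sup>+x. \<integral>\<^sup>+k. ennreal ((norm (P k x))^2) \<partial>dualM \<partial>unitM) \<noteq> \<infinity>"
      using Pf dual_unit_swap[OF mP] by simp
    then have "AE x in unitM. (\<integral>\<^sup>+k. ennreal ((norm (P k x))^2) \<partial>dualM) \<noteq> \<infinity>"
      by (rule nn_integral_PInf_AE[OF mm])
    then show ?thesis
      by eventually_elim (subst L2fun_iff_nn(1), auto simp: top.not_eq_extremum)
  qed
  have "(\<integral>\<^sup>+x. ennreal ((norm (v x - U x))^2) \<partial>lborel)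
        = (\<integral>\<^sup>+x. (\<Sum>n. ennreal ((norm (v (x + lat n) - U (x + lat n)))^2)) \<partial>unitM)"
    by (subst nn_integral_unitM) (auto intro!: nn_integral_unfold)
  also have "\<dots> \<le> (\<integral>\<^sup>+x. (\<integral>\<^sup>+k. ennreal (?c^2) * ennreal ((norm (bsum v k x - P k x / of_real ?c))^2) \<partial>dualM)
        \<partial>unitM)"
  proof (rule nn_integral_mono_AE, use summable_translates[OF v(1)] Pfx in eventually_elim)
    fix x :: "real^'d" assume s: "summable (\<lambda>n. norm (v (x + lat n)))" and PL: "L2fun dualM (\<lambda>k. P k x)"
    note F = fseries_L2[OF s, of x]
    \<comment> \<open>By periodicity of \<open>P k\<close> the coefficients of b with respect to
      \<open>expo x\<close> are the values of U on the coset of x, up to the normalization; those of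
      the lattice series are the values of v.\<close>
    define b where "b k = (1 / of_real ?c) * P k x" for k
    have bL: "L2fun dualM b" unfolding b_def[abs_def] by (rule L2fun_scale[OF PL])
    define D where "D k = fseries (\<lambda>n. v (x + lat n)) x k - b k" for k
    have DL: "L2fun dualM D" unfolding D_def[abs_def] by (rule L2fun_diff[OF F(1) bL])
    have "L2ip dualM b (expo x n) = U (x + lat n) / of_real ?c" for n
    proof -
      have "b k * cnj (expo x n k) = P k (x + lat n) * cis (k \<bullet> (x + lat n))" for k
        using c by (simp add: b_def expo_def cis_cnj Pp)
      then show ?thesis using c unfolding L2ip_def U by simp
    qed
    then have co: "L2ip dualM D (expo x n) = (v (x + lat n) - U (x + lat n)) / of_real ?c" for n
      unfolding D_def[abs_def] by (simp add: L2ip_diff_left[OF F(1) bL expo_L2] F(2) diff_divide_distrib)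
    note Be = Bessel[OF expo_ONS[of x] DL]
    have "(\<Sum>n. ennreal ((norm (v (x + lat n) - U (x + lat n)))^2))
          = (\<Sum>n. ennreal (?c^2 * (norm (L2ip dualM D (expo x n)))^2))"
      using c by (intro suminf_cong) (simp add: co norm_divide power_divide)
    also have "\<dots> = ennreal (\<Sum>n. ?c^2 * (norm (L2ip dualM D (expo x n)))^2)"
      by (rule suminf_ennreal2) (auto intro: summable_mult Be(1))
    also have "\<dots> = ennreal (?c^2 * (\<Sum>n. (norm (L2ip dualM D (expo x n)))^2))"
      by (simp add: suminf_mult[OF Be(1)])
    also have "\<dots> \<le> ennreal (?c^2 * L2sq dualM D)"
      using Be(2) by (intro ennreal_leI mult_left_mono) auto
    also have "\<dots> = ennreal (?c^2) * (\<integral>\<^sup>+k. ennreal ((norm (D k))^2) \<partial>dualM)"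
      using DL by (subst L2fun_iff_nn(2)) (auto simp: L2fun_def ennreal_mult)
    also have "\<dots> = (\<integral>\<^sup>+k. ennreal (?c^2) * ennreal ((norm (bsum v k x - P k x / of_real ?c))^2) \<partial>dualM)"
      by (subst nn_integral_cmult[symmetric]) (auto simp: D_def b_def bsum_def)
    finally show "(\<Sum>n. ennreal ((norm (v (x + lat n) - U (x + lat n)))^2))
          \<le> (\<integral>\<^sup>+k. ennreal (?c^2) * ennreal ((norm (bsum v k x - P k x / of_real ?c))^2) \<partial>dualM)" .
  qed
  also have "\<dots> = (\<integral>\<^sup>+k. \<integral>\<^sup>+x. ennreal (?c^2) * ennreal ((norm (bsum v k x - P k x / of_real ?c))^2) \<partial>unitM
        \<partial>dualM)"
    by (rule dual_unit_swap[symmetric]) measurable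
  also have "\<dots> = ennreal (?c^2) * (\<integral>\<^sup>+k. \<integral>\<^sup>+x. ennreal ((norm (bsum v k x - P k x / of_real ?c))^2) \<partial>unitM
        \<partial>dualM)"
  proof -
    interpret pair_sigma_finite "dualM :: (real^'d) measure" "unitM :: (real^'d) measure"
        by (rule pair_dual_unit)
    have "(\<lambda>k. \<integral>\<^sup>+x. ennreal ((norm (bsum v k x - P k x / of_real ?c))^2) \<partial>unitM) \<in> borel_measurable dualM"
      using M2.borel_measurable_nn_integral[of "\<lambda>k x. ennreal ((norm (bsum v k x - P k x / of_real ?c))^2)"
          dualM] m
      by (simp add: borel_measurable_dual_unit)
    moreover have "(\<lambda>x. ennreal ((norm (bsum v k x - P k x / of_real ?c))^2)) \<in> borel_measurable unitM" for k
      using measurable_compose[OF measurable_Pair[OF measurable_const[of k] measurable_ident] m] by simp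
    ultimately show ?thesis by (subst nn_integral_cmult[symmetric])
        (auto intro!: nn_integral_cong nn_integral_cmult)
  qed
  finally show ?thesis .
qed

section \<open>Regularity of the eigenfunctions in the quasimomentum\<close>

text \<open>Absolute convergence at a corner point k0 + s (1, ..., 1) dominates the power series on
  the smaller cube. In the difference to the value at k0 the constant monomial cancels, and every
  other one carries an additional factor |k - k0| / s.\<close>

lemma real_analytic_at_isCont:
  fixes f :: "real^'d \<Rightarrow> complex"
  assumes "real_analytic_at f k0"
  shows "isCont f k0"
proof -
  obtain r c where r: "r > 0" and S: "\<And>k. k \<in> ball k0 r \<Longrightarrow>
      ((\<lambda>\<alpha>::'d \<Rightarrow> nat. c \<alpha> * (\<Prod>i\<in>UNIV. of_real (k$i - k0$i) ^ (\<alpha> i))) has_sum f k) UNIV"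
    using assms unfolding real_analytic_at_def by blast
  define one :: "real^'d" where "one = (\<chi> i. 1)"
  have "one \<noteq> 0" by (simp add: one_def vec_eq_iff)
  then have n1: "norm one > 0" by simp
  \<comment> \<open>With this choice the corner lies at distance r/2 from k0, inside the ball of
    convergence.\<close>
  define s where "s = r / (2 * norm one)"
  have s: "s > 0" using r n1 by (simp add: s_def)
  have "k0 + s *\<^sub>R one \<in> ball k0 r" using r n1 by (simp add: dist_norm s_def)
  from S[OF this] have "(\<lambda>\<alpha>. c \<alpha> * (\<Prod>i\<in>UNIV. of_real s ^ (\<alpha> i))) summable_on UNIV"
    by (auto simp: one_def summable_on_def)
  then have "(\<lambda>\<alpha>. norm (c \<alpha> * (\<Prod>i\<in>UNIV. of_real s ^ (\<alpha> i)))) summable_on UNIV"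
    by (simp only: summable_on_iff_abs_summable_on_complex)
  then have "(\<lambda>\<alpha>. norm (c \<alpha>) * (\<Prod>i\<in>UNIV. s ^ (\<alpha> i))) summable_on UNIV"
    using s by (simp add: norm_mult prod_norm[symmetric] norm_power)
  then obtain A where A: "((\<lambda>\<alpha>. norm (c \<alpha>) * (\<Prod>i\<in>UNIV. s ^ (\<alpha> i))) has_sum A) UNIV"
    by (auto simp: summable_on_def)
  have bound: "norm (f k - f k0) \<le> norm (k - k0) / s * A" if k: "k \<in> ball k0 (min r s)" for k
  proof -
    have nk: "norm (k - k0) \<le> s" using k by (simp add: dist_norm norm_minus_commute)
    have kr: "k \<in> ball k0 r" "k0 \<in> ball k0 r" using k r by auto
    define \<tau> where "\<tau> = norm (k - k0) / s"
    have \<tau>: "0 \<le> \<tau>" "\<tau> \<le> 1" using nk s by (auto simp: \<tau>_def)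
    have comp: "\<bar>k $ i - k0 $ i\<bar> \<le> \<tau> * s" for i
      using component_le_norm_cart[of "k - k0" i] s by (simp add: \<tau>_def)
    have comp': "\<bar>k $ i - k0 $ i\<bar> \<le> s" for i
      using order_trans[OF comp[of i] mult_right_mono[OF \<tau>(2), of s]] s by simp
    have hs: "((\<lambda>\<alpha>. c \<alpha> * (\<Prod>i\<in>UNIV. of_real (k$i - k0$i) ^ (\<alpha> i)) - c \<alpha>
          * (\<Prod>i\<in>UNIV. of_real (k0$i - k0$i) ^ (\<alpha> i))) has_sum (f k - f k0)) UNIV"
      using has_sum_add[OF S[OF kr(1)] has_sum_cmult_right[OF S[OF kr(2)], of "-1"]] by simp
    have hA: "((\<lambda>\<alpha>. \<tau> * (norm (c \<alpha>) * (\<Prod>i\<in>UNIV. s ^ (\<alpha> i)))) has_sum (\<tau> * A)) UNIV"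
      by (rule has_sum_cmult_right[OF A])
    have "norm (f k - f k0) \<le> \<tau> * A"
    proof (rule norm_infsum_le[OF hs hA])
      fix \<alpha> :: "'d \<Rightarrow> nat"
      show "norm (c \<alpha> * (\<Prod>i\<in>UNIV. of_real (k$i - k0$i) ^ (\<alpha> i)) - c \<alpha>
            * (\<Prod>i\<in>UNIV. of_real (k0$i - k0$i) ^ (\<alpha> i)))
          \<le> \<tau> * (norm (c \<alpha>) * (\<Prod>i\<in>UNIV. s ^ (\<alpha> i)))"
      proof (cases "\<alpha> = (\<lambda>_. 0)")
        case True
        then show ?thesis using \<tau> s by simp
      next
        case False
        then obtain i where i: "\<alpha> i \<noteq> 0" by auto
        then obtain m where m: "\<alpha> i = Suc m" using not0_implies_Suc by blast
        have z: "(\<Prod>i\<in>UNIV. of_real (k0$i - k0$i) ^ (\<alpha> i)) = (0::complex)"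
          using i by (intro prod_zero) auto
        \<comment> \<open>One occurrence of the coordinate i is estimated by \<tau> s, all other
          factors by powers of s.\<close>
        have "(\<Prod>l\<in>UNIV. \<bar>k$l - k0$l\<bar> ^ (\<alpha> l)) = \<bar>k$i - k0$i\<bar> ^ (\<alpha> i) * (\<Prod>l\<in>UNIV - {i}. \<bar>k$l - k0$l\<bar> ^ (\<alpha> l))"
          by (rule prod.remove) auto
        also have "\<dots> \<le> (\<tau> * s ^ (\<alpha> i)) * (\<Prod>l\<in>UNIV - {i}. s ^ (\<alpha> l))"
        proof (intro mult_mono prod_mono)
          show "\<bar>k$i - k0$i\<bar> ^ (\<alpha> i) \<le> \<tau> * s ^ (\<alpha> i)"
            unfolding m power_Suc mult.assoc[symmetric] using comp[of i] comp'[of i] s \<tau>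
            by (intro mult_mono power_mono) auto
        qed (use comp' s \<tau> in \<open>auto intro!: power_mono prod_nonneg\<close>)
        also have "\<dots> = \<tau> * (\<Prod>l\<in>UNIV. s ^ (\<alpha> l))"
          by (subst prod.remove[of UNIV i "\<lambda>l. s ^ \<alpha> l"]) auto
        finally have "(\<Prod>l\<in>UNIV. \<bar>k$l - k0$l\<bar> ^ (\<alpha> l)) \<le> \<tau> * (\<Prod>l\<in>UNIV. s ^ (\<alpha> l))" .
        from mult_left_mono[OF this norm_ge_zero[of "c \<alpha>"]] show ?thesis
          unfolding z by (simp add: norm_mult prod_norm[symmetric] norm_power mult_ac flip: of_real_diff)
      qed
    qed
    then show ?thesis by (simp add: \<tau>_def)
  qed
  have "((\<lambda>k. norm (k - k0) / s * A) \<longlongrightarrow> norm (k0 - k0) / s * A) (at k0)"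
    by (intro tendsto_intros) (use s in simp)
  then have t0: "((\<lambda>k. norm (k - k0) / s * A) \<longlongrightarrow> 0) (at k0)" by simp
  have "((\<lambda>k. f k - f k0) \<longlongrightarrow> 0) (at k0)"
  proof (rule Lim_null_comparison[OF _ t0])
    show "\<forall>\<^sub>F k in at k0. norm (f k - f k0) \<le> norm (k - k0) / s * A"
      unfolding eventually_at using bound r s by (intro exI[of _ "min r s"]) (auto simp: dist_commute)
  qed
  then show ?thesis unfolding isCont_def by (rule LIM_zero_cancel)
qed

text \<open>Replacing x by the corner of its grid cube of side 1/(n+1) leaves countably many values
  of the second argument, so the composition is measurable. Continuity in x recovers the function as
  the grid is refined.\<close>

lemma Caratheodory_measurable:
  fixes f :: "real^'d \<Rightarrow> real^'d \<Rightarrow> complex"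
  assumes m: "\<And>x. (\<lambda>k. f k x) \<in> borel_measurable borel" and c: "\<And>k. continuous_on UNIV (f k)"
  shows "(\<lambda>(k, x). f k x) \<in> borel_measurable (borel \<Otimes>\<^sub>M borel)"
proof -
  define g :: "nat \<Rightarrow> real^'d \<Rightarrow> int^'d" where "g n x = (\<chi> i. \<lfloor>real (Suc n) * x $ i\<rfloor>)" for n x
  define y :: "nat \<Rightarrow> int^'d \<Rightarrow> real^'d" where "y n z = (\<chi> i. of_int (z $ i) / real (Suc n))" for n z
  have ym: "(\<lambda>p. f (fst p) (y n (g n (snd p)))) \<in> borel_measurable (borel \<Otimes>\<^sub>M borel)" for n
  proof (rule measurable_compose_countable'[where f="\<lambda>z p. f (fst p) (y n z)" and g="\<lambda>p. g n (snd p)"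
      and I=UNIV])
    show "(\<lambda>p. f (fst p) (y n z)) \<in> borel_measurable (borel \<Otimes>\<^sub>M borel)" for z
      by (rule measurable_compose[OF measurable_fst m])
    have gm: "g n \<in> measurable borel (count_space UNIV)"
    proof -
      have "g n -` {z} \<inter> space borel \<in> sets borel" for z
      proof -
        have "g n -` {z} \<inter> space borel = {x \<in> space borel. \<forall>i. \<lfloor>real (Suc n) * x $ i\<rfloor> = z $ i}"
          by (auto simp: g_def vec_eq_iff)
        also have "\<dots> \<in> sets borel" by measurable
        finally show ?thesis .
      qed
      then show ?thesis by (subst measurable_count_space_eq2_countable) auto
    qed
    show "(\<lambda>p. g n (snd p)) \<in> borel \<Otimes>\<^sub>M borel \<rightarrow>\<^sub>M count_space UNIV"
      by (rule measurable_compose[OF measurable_snd gm])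
  qed simp
  have lim: "(\<lambda>n. y n (g n x)) \<longlonglongrightarrow> x" for x
  proof (rule vec_tendstoI)
    fix i
    have b: "norm (y n (g n x) $ i - x $ i) \<le> inverse (real (Suc n))" for n
    proof -
      have *: "real_of_int \<lfloor>real (Suc n) * x $ i\<rfloor> \<le> real (Suc n) * x $ i"
          "real (Suc n) * x $ i < real_of_int \<lfloor>real (Suc n) * x $ i\<rfloor> + 1"
        by linarith+
      have "y n (g n x) $ i - x $ i = (real_of_int \<lfloor>real (Suc n) * x $ i\<rfloor> - real (Suc n) * x $ i)
            / real (Suc n)"
        unfolding y_def g_def by (simp only: vec_lambda_beta) (simp add: diff_divide_distrib del: of_nat_Suc)
      also have "norm \<dots> \<le> 1 / real (Suc n)"
      proof -
        have "norm (real_of_int \<lfloor>real (Suc n) * x $ i\<rfloor> - real (Suc n) * x $ i) \<le> 1"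
          using * unfolding real_norm_def abs_le_iff by linarith
        then show ?thesis unfolding norm_divide by (intro frac_le) auto
      qed
      finally show ?thesis by (simp add: inverse_eq_divide)
    qed
    have "(\<lambda>n. y n (g n x) $ i - x $ i) \<longlonglongrightarrow> 0"
      by (rule Lim_null_comparison[OF _ LIMSEQ_inverse_real_of_nat]) (use b in \<open>auto intro!: always_eventually\<close>)
    then show "(\<lambda>n. y n (g n x) $ i) \<longlonglongrightarrow> x $ i" by (rule LIM_zero_cancel)
  qed
  have "(\<lambda>p. f (fst p) (snd p)) \<in> borel_measurable (borel \<Otimes>\<^sub>M borel)"
  proof (rule borel_measurable_LIMSEQ_metric[OF ym])
    fix p :: "(real^'d) \<times> (real^'d)"
    show "(\<lambda>n. f (fst p) (y n (g n (snd p)))) \<longlonglongrightarrow> f (fst p) (snd p)"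
      using continuous_on_tendsto_compose[OF c lim] by simp
  qed
  then show ?thesis by (simp add: case_prod_unfold)
qed

section \<open>The error on a single fibre\<close>

context bloch_problem
begin

lemma L2_unit_M:
  assumes f: "L2fun unitM f" and r1: "\<And>x. \<rho> x \<le> r1"
  shows "L2fun M f"
proof -
  have [measurable]: "f \<in> borel_measurable borel" using f by (simp add: L2fun_def)
  have "set_integrable lborel cell (\<lambda>x. 1 * (norm (f x))^2)"
    using f unfolding L2fun_def by (subst (asm) integral_cellM_real(2)) auto
  then have "set_integrable lborel cell (\<lambda>x. r1 * (norm (f x))^2)" by simp
  then have "set_integrable lborel cell (\<lambda>x. \<rho> x * (norm (f x))^2)"
    unfolding set_integrable_def
  proof (rule Bochner_Integration.integrable_bound)
    show "AE x in lborel. norm (indicator cell x *\<^sub>R (\<rho> x * (norm (f x))^2))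
          \<le> norm (indicator cell x *\<^sub>R (r1 * (norm (f x))^2))"
    proof (rule AE_I2)
      fix x :: "real^'d"
      have "0 \<le> \<rho> x" "\<rho> x \<le> r1" using r_nonneg r1 by auto
      then have "\<bar>\<rho> x * (norm (f x))^2\<bar> \<le> \<bar>r1 * (norm (f x))^2\<bar>" by (simp add: mult_right_mono abs_mult)
      then show "norm (indicator cell x *\<^sub>R (\<rho> x * (norm (f x))^2))
            \<le> norm (indicator cell x *\<^sub>R (r1 * (norm (f x))^2))"
        by (auto simp: indicator_def)
    qed
  qed measurable
  then show ?thesis unfolding L2fun_def by (simp add: integral_cellM_real r_nonneg)
qed

lemma L2sq_unit_le:
  assumes f: "L2fun unitM f" and r: "0 < r0" "\<And>x. r0 \<le> \<rho> x"
  shows "L2sq unitM f \<le> L2sq M f / r0"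
proof -
  obtain s0 r1 where rb: "0 < s0" "0 < r1" "\<And>x. s0 \<le> \<rho> x" "\<And>x. \<rho> x \<le> r1" using r_bounds by blast
  have [measurable]: "f \<in> borel_measurable borel" using f by (simp add: L2fun_def)
  have i1: "set_integrable lborel cell (\<lambda>x. (norm (f x))^2)"
    using f unfolding L2fun_def by (subst (asm) integral_cellM_real(2)) auto
  have i2: "set_integrable lborel cell (\<lambda>x. \<rho> x * (norm (f x))^2)"
    using L2_unit_M[OF f rb(4)] unfolding L2fun_def by (simp add: integral_cellM_real r_nonneg)
  have "r0 * L2sq unitM f = (LINT x:cell|lborel. r0 * (norm (f x))^2)"
    by (simp add: L2sq_def integral_cellM_real)
  also have "\<dots> \<le> (LINT x:cell|lborel. \<rho> x * (norm (f x))^2)"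
    using i1 i2 r(2) by (intro set_integral_mono) (auto intro: mult_right_mono)
  also have "\<dots> = L2sq M f" by (rule L2sq_M[symmetric]) simp
  finally show ?thesis using r(1) by (simp add: field_simps)
qed

text \<open>The source enters the weak equation without \<rho>, so its coefficients are unweighted,
  while the eigenfunctions are orthonormal for the weighted product. Dividing by \<rho> passes from
  one to the other at the cost of a factor 1/r0.\<close>

lemma unit_Bessel:
  assumes N: "L2fun unitM N" and r: "0 < r0" "\<And>x. r0 \<le> \<rho> x" and I: "finite I"
  shows "(\<Sum>m\<in>I. (norm (L2ip unitM N (\<phi> m k)))^2) \<le> L2sq unitM N / r0"
proof -
  obtain s0 r1 where rb: "0 < s0" "0 < r1" "\<And>x. s0 \<le> \<rho> x" "\<And>x. \<rho> x \<le> r1" using r_bounds by blast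
  have [measurable]: "N \<in> borel_measurable borel" using N by (simp add: L2fun_def)
  define n where "n x = complex_of_real (1 / \<rho> x) * N x" for x
  have [measurable]: "n \<in> borel_measurable borel" unfolding n_def[abs_def] by measurable
  have nL: "L2fun M n" unfolding n_def[abs_def]
  proof (rule L2fun_bounded_mult[OF L2_unit_M[OF N rb(4)], where B="1 / r0"])
    show "norm (complex_of_real (1 / \<rho> x)) \<le> 1 / r0" for x
      using r r_pos[of x] by (simp add: frac_le norm_divide)
  qed simp
  have "L2ip M n (\<phi> m k) = L2ip unitM N (\<phi> m k)" for m
    using r_pos by (simp add: L2ip_M L2ip_unitM n_def less_imp_neq[symmetric])
  then have "(\<Sum>m\<in>I. (norm (L2ip unitM N (\<phi> m k)))^2) \<le> L2sq M n"
    using Bessel_finite[OF phi_ONS[of k] nL I] by simp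
  also have "\<dots> = (LINT x:cell|lborel. (1 / \<rho> x) * (norm (N x))^2)"
    unfolding L2sq_M[OF \<open>n \<in> _\<close>] n_def norm_mult power_mult_distrib norm_of_real power2_abs
    using r_pos by (simp add: power2_eq_square less_imp_neq[symmetric])
  also have "\<dots> \<le> (LINT x:cell|lborel. (1 / r0) * (norm (N x))^2)"
  proof (rule set_integral_mono)
    show i1: "set_integrable lborel cell (\<lambda>x. (1 / r0) * (norm (N x))^2)"
    proof -
      have "set_integrable lborel cell (\<lambda>x. (norm (N x))^2)"
        using N unfolding L2fun_def by (subst (asm) integral_cellM_real(2)) auto
      then show ?thesis by simp
    qed
    have le: "1 / \<rho> x * (norm (N x))^2 \<le> 1 / r0 * (norm (N x))^2" for x
      using r r_pos[of x] by (intro mult_right_mono frac_le) auto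
    then show "1 / \<rho> x * (norm (N x))^2 \<le> 1 / r0 * (norm (N x))^2" for x .
    show "set_integrable lborel cell (\<lambda>x. (1 / \<rho> x) * (norm (N x))^2)"
      using i1 unfolding set_integrable_def
    proof (rule Bochner_Integration.integrable_bound)
      show "AE x in lborel. norm (indicator cell x *\<^sub>R (1 / \<rho> x * (norm (N x))^2))
            \<le> norm (indicator cell x *\<^sub>R (1 / r0 * (norm (N x))^2))"
      proof (rule AE_I2)
        fix x :: "real^'d"
        have "0 \<le> 1 / \<rho> x * (norm (N x))^2" using r_pos[of x] by simp
        then have "\<bar>1 / \<rho> x * (norm (N x))^2\<bar> \<le> \<bar>1 / r0 * (norm (N x))^2\<bar>" using le[of x] by linarith
        then show "norm (indicator cell x *\<^sub>R (1 / \<rho> x * (norm (N x))^2))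
              \<le> norm (indicator cell x *\<^sub>R (1 / r0 * (norm (N x))^2))"
          by (auto simp: indicator_def)
      qed
    qed measurable
  qed
  also have "\<dots> = L2sq unitM N / r0" by (simp add: L2sq_def integral_cellM_real)
  finally show ?thesis .
qed

abbreviation coupling :: "nat \<Rightarrow> nat \<Rightarrow> real^'d \<Rightarrow> complex" where
  "coupling p m k \<equiv> L2ip M (\<phi> p 0) (\<phi> m k)"

text \<open>The m-th coefficient of g is a source part plus a perturbation from N, both divided by
  the same denominator. Subtracting the term of branch p removes its source part exactly, whatever
  the size of that denominator. The remaining source parts are collected in B, and the spectral
  distance \<gamma> multiplies the perturbation N only.\<close>

lemma fibre_estimate:
  assumes \<gamma>: "\<gamma> > 0" "\<And>m. \<gamma> \<le> \<bar>w2 m k - c\<bar>"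
    and g: "L2fun unitM g" and N: "L2fun unitM N" and r: "0 < r0" "\<And>x. r0 \<le> \<rho> x"
    and rel: "\<And>m. of_real (w2 m k - c) * L2ip M g (\<phi> m k) = l * coupling p m k + L2ip unitM N (\<phi> m k)"
    and B: "\<And>I. finite I \<Longrightarrow> p \<notin> I \<Longrightarrow> (norm l)^2 * (\<Sum>m\<in>I. (norm (coupling p m k))^2 / (w2 m k - c)^2) \<le> B"
  shows "L2sq unitM (\<lambda>x. g x - l * coupling p p k / of_real (w2 p k - c) * \<phi> p k x)
        \<le> (2 * B + 2 / (\<gamma>^2 * r0) * L2sq unitM N) / r0"
    "L2fun unitM (\<lambda>x. g x - l * coupling p p k / of_real (w2 p k - c) * \<phi> p k x)"
proof -
  obtain s0 r1 where rb: "0 < s0" "0 < r1" "\<And>x. s0 \<le> \<rho> x" "\<And>x. \<rho> x \<le> r1" using r_bounds by blast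
  let ?b = "l * coupling p p k / of_real (w2 p k - c)"
  let ?D = "\<lambda>x. g x - ?b * \<phi> p k x"
  have phiU: "L2fun unitM (\<phi> p k)" by (rule L2fun_cellM_continuous) (auto intro: smooth_continuous phi_smooth)
  show DU: "L2fun unitM ?D" by (intro L2fun_diff g L2fun_scale phiU)
  have DM: "L2fun M ?D" by (rule L2_unit_M[OF DU rb(4)])
  have nz: "w2 m k - c \<noteq> 0" for m using \<gamma>(1) \<gamma>(2)[of m] by auto
  have gm: "L2ip M g (\<phi> m k) = (l * coupling p m k + L2ip unitM N (\<phi> m k)) / of_real (w2 m k - c)" for m
    using rel[of m] nz[of m] by (simp add: field_simps)
  have co: "L2ip M ?D (\<phi> m k) = (if m = p then 0 else l * coupling p m k / of_real (w2 m k - c))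
        + L2ip unitM N (\<phi> m k) / of_real (w2 m k - c)" for m
  proof -
    have "L2ip M ?D (\<phi> m k) = L2ip M g (\<phi> m k) - L2ip M (\<lambda>x. ?b * \<phi> p k x) (\<phi> m k)"
      by (rule L2ip_diff_left[OF L2_unit_M[OF g rb(4)] L2fun_scale[OF L2fun_phi] L2fun_phi])
    also have "\<dots> = (l * coupling p m k + L2ip unitM N (\<phi> m k)) / of_real (w2 m k - c) - ?b
          * (if p = m then 1 else 0)"
      by (simp only: L2ip_scale_left ONS_ip[OF phi_ONS] gm)
    finally show ?thesis by (auto simp: add_divide_distrib)
  qed
  have bound: "(norm (L2ip M ?D (\<phi> m k)))^2 \<le> 2 * (if m = p then 0 else (norm l)^2
        * ((norm (coupling p m k))^2 / (w2 m k - c)^2))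
      + 2 / \<gamma>^2 * (norm (L2ip unitM N (\<phi> m k)))^2" for m
  proof -
    have "(norm (L2ip unitM N (\<phi> m k) / of_real (w2 m k - c)))^2 = (norm (L2ip unitM N (\<phi> m k)))^2 / \<bar>w2 m k
          - c\<bar>^2"
      by (simp only: norm_divide norm_of_real power_divide)
    also have "\<dots> \<le> (norm (L2ip unitM N (\<phi> m k)))^2 / \<gamma>^2"
      using \<gamma>(1) \<gamma>(2)[of m] nz[of m] by (intro divide_left_mono power_mono) auto
    finally have 1: "(norm (L2ip unitM N (\<phi> m k) / of_real (w2 m k - c)))^2
          \<le> (norm (L2ip unitM N (\<phi> m k)))^2 / \<gamma>^2" .
    have 2: "(norm (if m = p then 0 else l * coupling p m k / of_real (w2 m k - c)))^2
        = (if m = p then 0 else (norm l)^2 * ((norm (coupling p m k))^2 / (w2 m k - c)^2))"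
      by (simp add: norm_divide norm_mult power_divide power_mult_distrib del: of_real_diff)
    have "(norm (L2ip M ?D (\<phi> m k)))^2 \<le> 2 * (norm
          (if m = p then 0 else l * coupling p m k / of_real (w2 m k - c)))^2
        + 2 * (norm (L2ip unitM N (\<phi> m k) / of_real (w2 m k - c)))^2"
      unfolding co by (rule norm_add_sq_le)
    then show ?thesis unfolding 2 using 1 by simp
  qed
  have "L2sq M ?D \<le> 2 * B + 2 / (\<gamma>^2 * r0) * L2sq unitM N"
  proof -
    have sums: "(\<lambda>m. (norm (L2ip M ?D (\<phi> m k)))^2) sums L2sq M ?D" by (rule phi_Parseval(1)[OF DM])
    have "(\<Sum>m<n. (norm (L2ip M ?D (\<phi> m k)))^2) \<le> 2 * B + 2 / (\<gamma>^2 * r0) * L2sq unitM N" for n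
    proof -
      have "(\<Sum>m<n. (norm (L2ip M ?D (\<phi> m k)))^2) \<le>
            (\<Sum>m<n. 2 * (if m = p then 0 else (norm l)^2 * ((norm (coupling p m k))^2 / (w2 m k - c)^2))
          + 2 / \<gamma>^2 * (norm (L2ip unitM N (\<phi> m k)))^2)"
        by (intro sum_mono bound)
      also have "\<dots> = 2 * (\<Sum>m<n. if m = p then 0 else (norm l)^2 * ((norm (coupling p m k))^2 / (w2 m k - c)^2))
          + 2 / \<gamma>^2 * (\<Sum>m<n. (norm (L2ip unitM N (\<phi> m k)))^2)"
        unfolding sum.distrib by (simp only: sum_distrib_left)
      also have "(\<Sum>m<n. if m = p then 0 else (norm l)^2 * ((norm (coupling p m k))^2 / (w2 m k - c)^2))
          = (\<Sum>m\<in>{..<n} - {p}. (norm l)^2 * ((norm (coupling p m k))^2 / (w2 m k - c)^2))"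
        by (rule sum.mono_neutral_cong_right) auto
      also have "\<dots> = (norm l)^2 * (\<Sum>m\<in>{..<n} - {p}. (norm (coupling p m k))^2 / (w2 m k - c)^2)"
        by (simp only: sum_distrib_left)
      also have "2 * ((norm l)^2 * (\<Sum>m\<in>{..<n} - {p}. (norm (coupling p m k))^2 / (w2 m k - c)^2))
          + 2 / \<gamma>^2 * (\<Sum>m<n. (norm (L2ip unitM N (\<phi> m k)))^2) \<le> 2 * B + 2 / \<gamma>^2 * (L2sq unitM N / r0)"
        by (intro add_mono mult_left_mono B unit_Bessel[OF N r]) auto
      also have "2 / \<gamma>^2 * (L2sq unitM N / r0) = 2 / (\<gamma>^2 * r0) * L2sq unitM N" by simp
      finally show ?thesis .
    qed
    then show ?thesis
      using suminf_le_const[OF sums_summable[OF sums]] unfolding sums_unique[OF sums, symmetric] by blast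
  qed
  then have "L2sq M ?D / r0 \<le> (2 * B + 2 / (\<gamma>^2 * r0) * L2sq unitM N) / r0"
    using r(1) by (intro divide_right_mono) auto
  then show "L2sq unitM ?D \<le> (2 * B + 2 / (\<gamma>^2 * r0) * L2sq unitM N) / r0"
    using L2sq_unit_le[OF DU r] by linarith
qed

text \<open>Conjugation turns nabla + ik into nabla - ik, which the wave e^(-ik.x) gauges away.
  Conjugated eigenfunctions thus become generalized eigenfunctions on the whole space, in the form
  in which they occur in the fibre coefficients.\<close>

lemma Lk_conj_wave:
  assumes f: "smooth f"
  shows "Lk G 0 (\<lambda>x. cis ((- k) \<bullet> x) * cnj (f x)) x = cis ((- k) \<bullet> x) * cnj (Lk G k f x)"
proof -
  have wave: "pdiff i (\<lambda>x. cis ((- k) \<bullet> x) * cnj (g x)) x = cis ((- k) \<bullet> x) * cnj (Dk k i g x)" if g: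
      "smooth g" for g i x
    by (subst pdiff_mult) (auto intro!: smooth_differentiable[OF smooth_cis[of "- k", simplified]]
        smooth_differentiable smooth_cnj g
        simp: pdiff_cis(1)[of i "- k", simplified] pdiff_cnj[OF smooth_differentiable[OF g]] Dk_def
            algebra_simps)
  have D0: "Dk 0 i g = pdiff i g" for i g by (rule ext) (simp add: Dk_def)
  have "(\<lambda>x. of_real (G x) * Dk 0 i (\<lambda>x. cis ((- k) \<bullet> x) * cnj (f x)) x)
        = (\<lambda>x. cis ((- k) \<bullet> x) * cnj (of_real (G x) * Dk k i f x))" for i
    unfolding D0 wave[OF f] by (rule ext) (simp add: mult_ac)
  then have "Lk G 0 (\<lambda>x. cis ((- k) \<bullet> x) * cnj (f x)) x =
        - (\<Sum>i\<in>UNIV. pdiff i (\<lambda>x. cis ((- k) \<bullet> x) * cnj (of_real (G x) * Dk k i f x)) x)"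
    unfolding Lk_def D0[of _ "\<lambda>x. of_real (G x) * _ x"] by (simp add: D0)
  also have "\<dots> = - (\<Sum>i\<in>UNIV. cis ((- k) \<bullet> x) * cnj (Dk k i (\<lambda>x. of_real (G x) * Dk k i f x) x))"
    by (simp only: wave[OF smooth_mult[OF smooth_of_real[OF sG] smooth_Dk[OF f]]])
  finally show ?thesis by (simp add: Lk_def sum_distrib_left)
qed

end

section \<open>Summing over the fibres\<close>

context weak_solution
begin

text \<open>The source of the localized problem, \<theta> h minus the commutator, written as h plus
  this function: h keeps its exact Bloch coefficients and all dependence on R is confined to a part
  that vanishes.\<close>

definition residual :: "real \<Rightarrow> real^'a \<Rightarrow> complex" where
  "residual R x = (of_real (cutoff R x) - 1) * h x - commutator (cutoff R) x"

lemma cutoff_measurable [measurable]: "cutoff R \<in> borel_measurable borel"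
  by (rule smooth_measurable[OF smooth_cutoff])

lemma norm_cutoff_le: "norm (complex_of_real (cutoff R x) - 1) \<le> 1" "norm (complex_of_real (cutoff R x)) \<le> 1"
proof -
  have "complex_of_real (cutoff R x) - 1 = of_real (cutoff R x - 1)" by simp
  then show "norm (complex_of_real (cutoff R x) - 1) \<le> 1"
    using cutoff_bounds[of R x] by (simp only: norm_of_real abs_le_iff) linarith
  show "norm (complex_of_real (cutoff R x)) \<le> 1"
    using cutoff_bounds[of R x] by simp
qed

lemma residual_L2:
  assumes R: "R \<ge> 1"
  shows "L2fun lborel (residual R)"
proof -
  obtain K where K: "K \<ge> 0" "\<And>R. R \<ge> 1 \<Longrightarrow> L2fun lborel (commutator (cutoff R))
        \<and> integrable lborel (commutator (cutoff R)) \<and>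
       L2sq lborel (commutator (cutoff R)) \<le> K / R^2" using commutator_small by blast
  have "L2fun lborel (\<lambda>x. (of_real (cutoff R x) - 1) * h x)"
  proof (rule L2fun_bounded_mult[OF h, where B=1])
    show "norm (complex_of_real (cutoff R x) - 1) \<le> 1" for x by (rule norm_cutoff_le)
  qed measurable
  then show ?thesis unfolding residual_def[abs_def] using K(2)[OF R] by (intro L2fun_diff) auto
qed

lemma residual_integrable:
  assumes R: "R \<ge> 1" and hi: "integrable lborel h"
  shows "integrable lborel (residual R)"
proof -
  obtain K where K: "K \<ge> 0" "\<And>R. R \<ge> 1 \<Longrightarrow> L2fun lborel (commutator (cutoff R))
        \<and> integrable lborel (commutator (cutoff R)) \<and>
       L2sq lborel (commutator (cutoff R)) \<le> K / R^2" using commutator_small by blast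
  have "integrable lborel (\<lambda>x. h x * (of_real (cutoff R x) - 1))"
  proof (rule integrable_mult_bounded[OF hi, where B=1])
    show "norm (complex_of_real (cutoff R x) - 1) \<le> 1" for x by (rule norm_cutoff_le)
  qed measurable
  then show ?thesis unfolding residual_def[abs_def] using K(2)[OF R]
    by (intro Bochner_Integration.integrable_diff) (auto simp: mult.commute)
qed

text \<open>The two parts vanish for different reasons: (\<theta> - 1) h by dominated convergence,
  without a rate, and the commutator at the rate 1/R.\<close>

lemma residual_tendsto: "(\<lambda>n. L2sq lborel (residual (real (Suc n)))) \<longlonglongrightarrow> 0"
proof -
  obtain K where K: "K \<ge> 0" "\<And>R. R \<ge> 1 \<Longrightarrow> L2fun lborel (commutator (cutoff R))
        \<and> integrable lborel (commutator (cutoff R)) \<and>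
       L2sq lborel (commutator (cutoff R)) \<le> K / R^2" using commutator_small by blast
  let ?a = "\<lambda>n x. (complex_of_real (cutoff (real (Suc n)) x) - 1) * h x"
  note b1 = norm_cutoff_le(1)
  have aL: "L2fun lborel (?a n)" for n
    by (rule L2fun_bounded_mult[OF h _ b1]) measurable
  have "(\<lambda>n. L2sq lborel (?a n)) \<longlonglongrightarrow> (LINT x|(lborel :: (real^'a) measure). 0)"
    unfolding L2sq_def
  proof (rule integral_dominated_convergence[where w="\<lambda>x. (norm (h x))^2"])
    show "integrable lborel (\<lambda>x. (norm (h x))^2)" using h by (simp add: L2fun_def)
    show "AE x in lborel. (\<lambda>n. (norm (?a n x))^2) \<longlonglongrightarrow> 0"
    proof (rule AE_I2)
      fix x :: "real^'a"
      have "(\<lambda>n. (norm (?a n x))^2) \<longlonglongrightarrow> (norm ((complex_of_real 1 - 1) * h x))^2"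
        by (intro tendsto_power tendsto_norm tendsto_mult tendsto_diff tendsto_of_real cutoff_tendsto
            tendsto_const)
      then show "(\<lambda>n. (norm (?a n x))^2) \<longlonglongrightarrow> 0" by simp
    qed
    show "AE x in lborel. norm ((norm (?a n x))^2) \<le> (norm (h x))^2" for n
    proof (rule AE_I2)
      fix x :: "real^'a"
      have "norm (?a n x) \<le> 1 * norm (h x)" unfolding norm_mult by (intro mult_right_mono b1) simp
      then show "norm ((norm (?a n x))^2) \<le> (norm (h x))^2" by (auto intro!: power_mono)
    qed
    show "(\<lambda>x. (norm (?a n x))^2) \<in> borel_measurable lborel" for n by measurable
  qed simp
  then have a0: "(\<lambda>n. L2sq lborel (?a n)) \<longlonglongrightarrow> 0" by simp
  have k0: "(\<lambda>n. K / (real (Suc n))^2) \<longlonglongrightarrow> 0"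
  proof -
    have "(\<lambda>n. K * (inverse (real (Suc n)))^2) \<longlonglongrightarrow> K * 0^2"
      by (intro tendsto_mult tendsto_power LIMSEQ_inverse_real_of_nat tendsto_const)
    then show ?thesis by (simp add: divide_inverse power_inverse)
  qed
  have up: "(\<lambda>n. 2 * L2sq lborel (?a n) + 2 * (K / (real (Suc n))^2)) \<longlonglongrightarrow> 0"
    using tendsto_add[OF tendsto_mult_right_zero[OF a0, of 2] tendsto_mult_right_zero[OF k0, of 2]] by simp
  show ?thesis
  proof (rule tendsto_sandwich[OF _ _ tendsto_const up])
    show "\<forall>\<^sub>F n in sequentially. L2sq lborel (residual (real (Suc n))) \<le> 2 * L2sq lborel (?a n) + 2
          * (K / (real (Suc n))^2)"
    proof (intro always_eventually allI)
      fix n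
      have c: "L2fun lborel (commutator (cutoff (real (Suc n))))"
          "L2sq lborel (commutator (cutoff (real (Suc n)))) \<le> K / (real (Suc n))^2"
        using K(2)[of "real (Suc n)"] by auto
      have "L2sq lborel (residual (real (Suc n))) = L2sq lborel
            (\<lambda>x. ?a n x + (- commutator (cutoff (real (Suc n))) x))"
        by (simp add: residual_def[abs_def])
      also have "\<dots> \<le> 2 * L2sq lborel (?a n) + 2 * L2sq lborel (\<lambda>x. - commutator (cutoff (real (Suc n))) x)"
        by (rule L2sq_add_le[OF aL L2fun_uminus[OF c(1)]])
      also have "L2sq lborel (\<lambda>x. - commutator (cutoff (real (Suc n))) x)
            = L2sq lborel (commutator (cutoff (real (Suc n))))"
        by (simp add: L2sq_def)
      finally show "L2sq lborel (residual (real (Suc n))) \<le> 2 * L2sq lborel (?a n) + 2 * (K / (real (Suc n))^2)"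
        using c(2) by linarith
    qed
  qed simp
qed

lemma localized_L2: assumes "R > 0"
  shows "L2fun lborel (\<lambda>x. of_real (cutoff R x) * u x)" "integrable lborel (\<lambda>x. of_real (cutoff R x) * u x)"
proof -
  show "L2fun lborel (\<lambda>x. of_real (cutoff R x) * u x)"
    by (rule L2fun_bounded_mult[OF u_L2 _ norm_cutoff_le(2)]) measurable
  have "compact_smooth (\<lambda>x::real^'a. complex_of_real (cutoff R x))"
    unfolding compact_smooth_def
  proof
    have "cutoff R x = 0" if "norm x > R" for x :: "real^'a" using cutoff_support[OF assms, of x] that by force
    then show "\<exists>R'. \<forall>x::real^'a. norm x > R' \<longrightarrow> complex_of_real (cutoff R x) = 0" by auto
  qed (intro smooth_of_real smooth_cutoff)
  from u_integrable[OF this] show "integrable lborel (\<lambda>x. of_real (cutoff R x) * u x)"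
      by (simp add: mult.commute)
qed

lemma phi_conj_bounded:
  obtains B where "\<And>x. norm (cnj (\<phi> m k x)) \<le> B"
  using continuous_zperiodic_bounded[OF smooth_continuous[OF phi_smooth] phi_periodic]
      by (metis complex_mod_cnj)

text \<open>The weighted coefficient of the localized solution unfolds to an integral of u against
  the wave, to which \<open>localized_identity\<close> applies; folding the right-hand side back
  leaves the source coefficient and that of the residual. Formally this is the fibre equation,
  diagonal in m.\<close>

lemma bsum_relation:
  assumes R: "R \<ge> 1" and hi: "integrable lborel h"
    and co: "(LINT x|lborel. h x * (cis (- (k \<bullet> x)) * cnj (\<phi> m k x))) = s"
  shows "of_real (w2 m k - c) * L2ip M (bsum (\<lambda>x. of_real (cutoff R x) * u x) k) (\<phi> m k) = s
        + L2ip unitM (bsum (residual R) k) (\<phi> m k)"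
proof -
  let ?v = "\<lambda>x. of_real (cutoff R x) * u x"
  let ?e = "\<lambda>x. cis ((- k) \<bullet> x) * cnj (\<phi> m k x)"
  have R0: "R > 0" using R by simp
  obtain B where B: "\<And>x. norm (cnj (\<phi> m k x)) \<le> B" using phi_conj_bounded by blast
  obtain r0 r1 where rb: "0 < r0" "0 < r1" "\<And>x. r0 \<le> \<rho> x" "\<And>x. \<rho> x \<le> r1" using r_bounds by blast
  have vm: "?v \<in> borel_measurable borel" by measurable
  have rm: "residual R \<in> borel_measurable borel" using residual_L2[OF R] by (simp add: L2fun_def)
  have pc: "zperiodic (\<lambda>x. cnj (\<phi> m k x))" "zperiodic (\<lambda>x. of_real (\<rho> x) * cnj (\<phi> m k x))"
    by (intro zperiodic_rules phi_periodic pr)+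
  have "L2ip M (bsum ?v k) (\<phi> m k) = cint (\<lambda>x. bsum ?v k x * (of_real (\<rho> x) * cnj (\<phi> m k x)))"
    by (subst L2ip_M) (use vm in \<open>auto simp: mult_ac\<close>)
  also have "\<dots> = (LINT x|lborel. ?v x * (cis (- (k \<bullet> x)) * (of_real (\<rho> x) * cnj (\<phi> m k x))))"
  proof (rule bsum_coeff(1)[OF localized_L2(2)[OF R0]])
    show "norm (of_real (\<rho> x) * cnj (\<phi> m k x)) \<le> r1 * B" for x
      unfolding norm_mult using rb(4)[of x] r_nonneg[of x] B[of x] rb(2) by (intro mult_mono) auto
  qed (use pc in auto)
  also have "\<dots> = (LINT x|lborel. u x * (of_real (\<rho> x * cutoff R x) * ?e x))"
    by (intro Bochner_Integration.integral_cong refl) (simp add: mult_ac)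
  finally have 1: "L2ip M (bsum ?v k) (\<phi> m k) = (LINT x|lborel. u x * (of_real (\<rho> x * cutoff R x) * ?e x))" .
  have "of_real (w2 m k - c) * (LINT x|lborel. u x * (of_real (\<rho> x * cutoff R x) * ?e x))
      = (LINT x|lborel. (of_real (cutoff R x) * h x - commutator (cutoff R) x) * ?e x)"
  proof (rule localized_identity)
    show "test_fun (cutoff R)" by (rule cutoff_test_fun[OF R0])
    show "smooth ?e" by (intro smooth_mult smooth_cis smooth_cnj phi_smooth)
    show "Lk G 0 ?e x = of_real (w2 m k * \<rho> x) * ?e x" for x
      unfolding Lk_conj_wave[OF phi_smooth] strong_eigen by (simp add: mult_ac)
  qed
  also have "\<dots> = (LINT x|lborel. h x * (cis (- (k \<bullet> x)) * cnj (\<phi> m k x)) + residual R x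
        * (cis (- (k \<bullet> x)) * cnj (\<phi> m k x)))"
    by (intro Bochner_Integration.integral_cong refl) (simp add: residual_def algebra_simps)
  also have "\<dots> = s + (LINT x|lborel. residual R x * (cis (- (k \<bullet> x)) * cnj (\<phi> m k x)))"
    by (subst Bochner_Integration.integral_add)
       (auto intro!: bsum_coeff(2)[OF hi _ B pc(1)] bsum_coeff(2)[OF residual_integrable[OF R hi] _ B pc(1)]
           simp: co)
  also have "(LINT x|lborel. residual R x * (cis (- (k \<bullet> x)) * cnj (\<phi> m k x)))
        = L2ip unitM (bsum (residual R) k) (\<phi> m k)"
    by (subst bsum_coeff(1)[OF residual_integrable[OF R hi] _ B pc(1), symmetric])
        (use rm in \<open>auto simp: L2ip_unitM\<close>)
  finally show ?thesis unfolding 1 .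
qed

text \<open>For each radius the fibre estimate is integrated over the dual cell, with
  \<open>bloch_Bessel\<close> on the left and Plancherel for the residual. As the radius grows the
  residual disappears together with its factor containing \<gamma>, and Fatou passes from the
  localized solution to u. Only b, free of \<gamma>, survives.\<close>

lemma error_bound:
  assumes hi: "integrable lborel h"
    and \<gamma>: "\<gamma> > 0" "\<And>m k. k \<in> dual_cell \<Longrightarrow> \<gamma> \<le> \<bar>w2 m k - c\<bar>"
    and lam: "L2fun dualM lam"
    and co: "AE k in dualM. \<forall>m. (LINT x|lborel. h x * (cis (- (k \<bullet> x)) * cnj (\<phi> m k x))) = lam k
          * coupling p m k"
    and b: "\<And>k I. k \<in> dual_cell \<Longrightarrow> finite I \<Longrightarrow> p \<notin> I \<Longrightarrow> (norm (lam k))^2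
          * (\<Sum>m\<in>I. (norm (coupling p m k))^2 / (w2 m k - c)^2) \<le> b * (norm (lam k))^2"
    and r: "0 < r0" "\<And>x. r0 \<le> \<rho> x"
    and Pm: "(\<lambda>(k, x). P k x) \<in> borel_measurable (borel \<Otimes>\<^sub>M borel)" and Pp: "\<And>k. zperiodic (P k)"
    and P: "\<And>k x. k \<in> dual_cell \<Longrightarrow> P k x = of_real (cst CARD('a))
          * (lam k * coupling p p k / of_real (w2 p k - c) * \<phi> p k x)"
    and U: "\<And>x. U x = of_real (cst CARD('a)) * (LINT k|dualM. P k x * cis (k \<bullet> x))"
        and Um[measurable]: "U \<in> borel_measurable borel"
  shows "(\<integral>\<^sup>+x. ennreal ((norm (u x - U x))^2) \<partial>lborel)
        \<le> ennreal ((cst CARD('a))^2 * (2 * b / r0 * L2sq dualM lam))"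
proof -
  let ?c = "cst CARD('a)"
  have cpos: "?c > 0" by (rule cst_pos)
  have lamm[measurable]: "lam \<in> borel_measurable borel" using lam by (simp add: L2fun_def)
  \<comment> \<open>A crude bound, by |coupling| <= 1 and the spectral distance, whose sole purpose
    is the square integrability of P required by \<open>bloch_Bessel\<close>; its constant does not
    reach the result.\<close>
  have PD: "(\<integral>\<^sup>+x. ennreal ((norm (P k x))^2) \<partial>unitM) \<le> ennreal ((?c^2 / (\<gamma>^2 * r0)) * (norm (lam k))^2)"
      if k: "k \<in> dual_cell" for k
  proof -
    have phiU: "L2fun unitM (\<phi> p k)" by (rule L2fun_cellM_continuous) (auto intro: smooth_continuous phi_smooth)
    let ?z = "of_real ?c * (lam k * coupling p p k / of_real (w2 p k - c))"
    have one: "L2sq M (\<phi> m k') = 1" for m k' using ONS_ip[OF phi_ONS, where m=m and n=m] unfolding L2ip_self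
        by (simp add: of_real_eq_1_iff)
    have cc: "(norm (coupling p p k))^2 \<le> 1" using L2_Cauchy_Schwarz[OF L2fun_phi L2fun_phi, of p 0 p k]
        by (simp add: one)
    have nz: "\<gamma>^2 \<le> (w2 p k - c)^2" using \<gamma>(1) \<gamma>(2)[OF k, of p] by (metis abs_le_square_iff abs_of_pos)
    have g2: "0 < \<gamma>^2" using \<gamma>(1) by simp
    have "(norm ?z)^2 = ?c^2 * ((norm (lam k))^2 * (norm (coupling p p k))^2 / (w2 p k - c)^2)"
      by (simp only: norm_mult norm_divide norm_of_real power_mult_distrib power_divide power2_abs)
    also have "\<dots> \<le> ?c^2 * ((norm (lam k))^2 * 1 / \<gamma>^2)"
      using cc nz g2 by (intro mult_left_mono frac_le mult_nonneg_nonneg) auto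
    finally have z: "(norm ?z)^2 \<le> ?c^2 * ((norm (lam k))^2 * 1 / \<gamma>^2)" .
    have "(\<integral>\<^sup>+x. ennreal ((norm (P k x))^2) \<partial>unitM) = (\<integral>\<^sup>+x. ennreal ((norm (?z * \<phi> p k x))^2) \<partial>unitM)"
      by (simp add: P[OF k] mult.assoc)
    also have "\<dots> = ennreal (L2sq unitM (\<lambda>x. ?z * \<phi> p k x))"
      by (rule L2fun_iff_nn(2)[OF _ L2fun_scale[OF phiU]]) simp
    also have "L2sq unitM (\<lambda>x. ?z * \<phi> p k x) = (norm ?z)^2 * L2sq unitM (\<phi> p k)" by (rule L2sq_scale)
    also have "\<dots> \<le> (?c^2 * ((norm (lam k))^2 * 1 / \<gamma>^2)) * (1 / r0)"
      using L2sq_unit_le[OF phiU r] z by (intro mult_mono) (auto simp: one)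
    also have "\<dots> = (?c^2 / (\<gamma>^2 * r0)) * (norm (lam k))^2" by simp
    finally show ?thesis by (simp add: ennreal_leI)
  qed
  have Pf: "(\<integral>\<^sup>+k. \<integral>\<^sup>+x. ennreal ((norm (P k x))^2) \<partial>unitM \<partial>dualM) < \<infinity>"
  proof -
    have "(\<integral>\<^sup>+k. \<integral>\<^sup>+x. ennreal ((norm (P k x))^2) \<partial>unitM \<partial>dualM)
          \<le> (\<integral>\<^sup>+k. ennreal ((?c^2 / (\<gamma>^2 * r0)) * (norm (lam k))^2) \<partial>dualM)"
      by (rule nn_integral_mono_AE) (unfold AE_dualM, intro AE_I2 impI PD)
    also have "\<dots> = ennreal (LINT k|dualM. (?c^2 / (\<gamma>^2 * r0)) * (norm (lam k))^2)"
      using lam r(1) by (intro nn_integral_eq_integral) (auto simp: L2fun_def)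
    finally show ?thesis by (rule le_less_trans) simp
  qed
  \<comment> \<open>The factor of the residual: from the fibre estimate, including the return to the
    unweighted norm, and from the Plancherel constant.\<close>
  define K where "K = 2 / (\<gamma>^2 * r0) / r0 * (2 * pi)^CARD('a)"
  have K0: "K \<ge> 0" using r(1) by (simp add: K_def)
  have b0: "0 \<le> b * (norm (lam k))^2" if "k \<in> dual_cell" for k using b[OF that, of "{}"] by simp
  have b0': "0 \<le> b * L2sq dualM lam"
  proof -
    have "0 \<le> (LINT k|dualM. b * (norm (lam k))^2)"
      by (rule integral_nonneg_AE) (simp add: AE_dualM b0)
    then show ?thesis by (simp add: L2sq_def)
  qed
  have step: "(\<integral>\<^sup>+x. ennreal ((norm (of_real (cutoff R x) * u x - U x))^2) \<partial>lborel)
      \<le> ennreal (?c^2 * (2 * b / r0 * L2sq dualM lam + K * L2sq lborel (residual R)))" if R: "R \<ge> 1" for R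
  proof -
    let ?v = "\<lambda>x. of_real (cutoff R x) * u x"
    have R0: "R > 0" using R by simp
    have rm[measurable]: "residual R \<in> borel_measurable borel" using residual_L2[OF R] by (simp add: L2fun_def)
    note vI = localized_L2(2)[OF R0] and vL = localized_L2(1)[OF R0]
    note nI = residual_integrable[OF R hi] and nL = residual_L2[OF R]
    let ?n2 = "\<lambda>k. \<integral>\<^sup>+x. ennreal ((norm (bsum (residual R) k x))^2) \<partial>unitM"
    have n2m: "?n2 \<in> borel_measurable dualM"
    proof -
      interpret pair_sigma_finite "dualM :: (real^'a) measure" "unitM :: (real^'a) measure"
          by (rule pair_dual_unit)
      have "(\<lambda>(k, x). ennreal ((norm (bsum (residual R) k x))^2)) \<in> borel_measurable (dualM \<Otimes>\<^sub>M unitM)"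
        unfolding borel_measurable_dual_unit by measurable
      from M2.borel_measurable_nn_integral[OF this] show ?thesis .
    qed
    have "(\<integral>\<^sup>+x. ennreal ((norm (?v x - U x))^2) \<partial>lborel)
       \<le> ennreal (?c^2) * (\<integral>\<^sup>+k. \<integral>\<^sup>+x. ennreal ((norm (bsum ?v k x - P k x / of_real ?c))^2) \<partial>unitM \<partial>dualM)"
      by (rule bloch_Bessel[OF vI Pm Pp Pf U Um])
    also have "\<dots> \<le> ennreal (?c^2) * (\<integral>\<^sup>+k. ennreal (2 * b / r0 * (norm (lam k))^2)
          + ennreal (2 / (\<gamma>^2 * r0) / r0) * ?n2 k \<partial>dualM)"
    proof (intro mult_left_mono nn_integral_mono_AE)
      have "AE k in dualM. k \<in> dual_cell" by (simp add: AE_dualM)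
      then show "AE k in dualM. (\<integral>\<^sup>+x. ennreal ((norm (bsum ?v k x - P k x / of_real ?c))^2) \<partial>unitM)
          \<le> ennreal (2 * b / r0 * (norm (lam k))^2) + ennreal (2 / (\<gamma>^2 * r0) / r0) * ?n2 k"
        using co bsum_L2fun_AE[OF vI vL] bsum_L2fun_AE[OF nI nL]
      proof eventually_elim
        case (elim k)
        let ?N = "bsum (residual R) k"
        let ?z = "lam k * coupling p p k / of_real (w2 p k - c)"
        note FE = fibre_estimate[OF \<gamma>(1) \<gamma>(2)[OF elim(1)] elim(3) elim(4) r
            bsum_relation[OF R hi elim(2)[rule_format]] b[OF elim(1)]]
        have "(\<integral>\<^sup>+x. ennreal ((norm (bsum ?v k x - P k x / of_real ?c))^2) \<partial>unitM)
              = (\<integral>\<^sup>+x. ennreal ((norm (bsum ?v k x - ?z * \<phi> p k x))^2) \<partial>unitM)"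
          using cpos by (simp add: P[OF elim(1)])
        also have "\<dots> = ennreal (L2sq unitM (\<lambda>x. bsum ?v k x - ?z * \<phi> p k x))"
          by (rule L2fun_iff_nn(2)[OF _ FE(2)]) measurable
        also have "\<dots> \<le> ennreal ((2 * (b * (norm (lam k))^2) + 2 / (\<gamma>^2 * r0) * L2sq unitM ?N) / r0)"
          by (intro ennreal_leI FE(1))
        also have "(2 * (b * (norm (lam k))^2) + 2 / (\<gamma>^2 * r0) * L2sq unitM ?N) / r0 = 2 * b / r0
              * (norm (lam k))^2 + 2 / (\<gamma>^2 * r0) / r0 * L2sq unitM ?N"
          by (simp add: add_divide_distrib)
        also have "ennreal \<dots> = ennreal (2 * b / r0 * (norm (lam k))^2) + ennreal (2 / (\<gamma>^2 * r0) / r0)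
              * ennreal (L2sq unitM ?N)"
        proof -
          have "0 \<le> b * (norm (lam k))^2 * (2 / r0)"
              by (rule mult_nonneg_nonneg[OF b0[OF elim(1)]]) (use r(1) in simp)
          then have "0 \<le> 2 * b / r0 * (norm (lam k))^2" by (simp add: mult_ac)
          moreover have "0 \<le> 2 / (\<gamma>^2 * r0) / r0" using r(1) by simp
          ultimately show ?thesis
            unfolding ennreal_mult[OF \<open>0 \<le> 2 / (\<gamma>^2 * r0) / r0\<close> L2sq_nonneg, symmetric]
            by (rule ennreal_plus[OF _ mult_nonneg_nonneg[OF _ L2sq_nonneg]])
        qed
        also have "ennreal (L2sq unitM ?N) = ?n2 k"
          by (rule L2fun_iff_nn(2)[OF _ elim(4), symmetric]) measurable
        finally show ?case .
      qed
    qed simp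
    also have "(\<integral>\<^sup>+k. ennreal (2 * b / r0 * (norm (lam k))^2) + ennreal (2 / (\<gamma>^2 * r0) / r0) * ?n2 k \<partial>dualM)
        = (\<integral>\<^sup>+k. ennreal (2 * b / r0 * (norm (lam k))^2) \<partial>dualM) + ennreal (2 / (\<gamma>^2 * r0) / r0) *
            (\<integral>\<^sup>+k. ?n2 k \<partial>dualM)"
      using n2m by (subst nn_integral_add) (auto simp: nn_integral_cmult)
    also have "(\<integral>\<^sup>+k. ennreal (2 * b / r0 * (norm (lam k))^2) \<partial>dualM) = ennreal (2 * b / r0 * L2sq dualM lam)"
    proof -
      have "(\<integral>\<^sup>+k. ennreal (2 * b / r0 * (norm (lam k))^2) \<partial>dualM)
            = ennreal (LINT k|dualM. 2 * b / r0 * (norm (lam k))^2)"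
      proof (rule nn_integral_eq_integral)
        show "integrable dualM (\<lambda>k. 2 * b / r0 * (norm (lam k))^2)" using lam by (simp add: L2fun_def)
        show "AE k in dualM. 0 \<le> 2 * b / r0 * (norm (lam k))^2"
          unfolding AE_dualM using b0 r(1) by (auto simp: zero_le_mult_iff divide_nonneg_pos)
      qed
      then show ?thesis by (simp add: L2sq_def)
    qed
    also have "(\<integral>\<^sup>+k. ?n2 k \<partial>dualM) = ennreal ((2 * pi)^CARD('a) * L2sq lborel (residual R))"
      by (rule bsum_L2[OF nI nL])
    also have "ennreal (?c^2) * (ennreal (2 * b / r0 * L2sq dualM lam) + ennreal (2 / (\<gamma>^2 * r0) / r0)
          * ennreal ((2 * pi)^CARD('a) * L2sq lborel (residual R)))
        = ennreal (?c^2 * (2 * b / r0 * L2sq dualM lam + K * L2sq lborel (residual R)))"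
    proof -
      have n1: "0 \<le> 2 * b / r0 * L2sq dualM lam" using b0' r(1)
          by (simp add: zero_le_mult_iff divide_nonneg_pos)
      have n2: "0 \<le> 2 / (\<gamma>^2 * r0) / r0" using r(1) by simp
      have "ennreal (2 / (\<gamma>^2 * r0) / r0) * ennreal ((2 * pi)^CARD('a) * L2sq lborel (residual R))
            = ennreal (K * L2sq lborel (residual R))"
        using n2 by (subst ennreal_mult[symmetric]) (auto simp: K_def mult.assoc)
      then show ?thesis using n1 K0
        by (simp add: ennreal_plus[symmetric] ennreal_mult[symmetric] del: ennreal_plus)
    qed
    finally show ?thesis .
  qed
  have lim: "(\<lambda>n. ennreal (?c^2 * (2 * b / r0 * L2sq dualM lam + K * L2sq lborel (residual (real (Suc n))))))
      \<longlonglongrightarrow> ennreal (?c^2 * (2 * b / r0 * L2sq dualM lam + K * 0))"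
    by (intro tendsto_ennrealI tendsto_mult tendsto_add tendsto_const residual_tendsto)
  have "(\<integral>\<^sup>+x. ennreal ((norm (u x - U x))^2) \<partial>lborel)
        = (\<integral>\<^sup>+x. liminf (\<lambda>n. ennreal ((norm (of_real (cutoff (real (Suc n)) x) * u x - U x))^2)) \<partial>lborel)"
  proof (rule nn_integral_cong)
    fix x :: "real^'a"
    have "(\<lambda>n. ennreal ((norm (of_real (cutoff (real (Suc n)) x) * u x - U x))^2))
          \<longlonglongrightarrow> ennreal ((norm (of_real 1 * u x - U x))^2)"
      by (intro tendsto_ennrealI tendsto_power tendsto_norm tendsto_diff tendsto_mult tendsto_of_real
          cutoff_tendsto tendsto_const)
    then show "ennreal ((norm (u x - U x))^2) = liminf
          (\<lambda>n. ennreal ((norm (of_real (cutoff (real (Suc n)) x) * u x - U x))^2))"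
      by (subst lim_imp_Liminf) auto
  qed
  also have "\<dots> \<le> liminf (\<lambda>n. \<integral>\<^sup>+x. ennreal ((norm (of_real (cutoff (real (Suc n)) x) * u x - U x))^2) \<partial>lborel)"
    by (rule nn_integral_liminf) measurable
  also have "\<dots> \<le> liminf (\<lambda>n. ennreal (?c^2 * (2 * b / r0 * L2sq dualM lam + K
        * L2sq lborel (residual (real (Suc n))))))"
    by (intro Liminf_mono always_eventually allI step) simp
  also have "\<dots> = ennreal (?c^2 * (2 * b / r0 * L2sq dualM lam + K * 0))"
    by (rule lim_imp_Liminf[OF _ lim]) simp
  finally show ?thesis by simp
qed

end

section \<open>The source term\<close>

lemma integrable_reflect:
  fixes f :: "real^'d \<Rightarrow> 'b::{banach, second_countable_topology}"
  assumes f: "integrable lborel f"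
  shows "integrable lborel (\<lambda>x. f (- x))"
proof -
  let ?T = "\<lambda>x::real^'d. 0 + (-1) *\<^sub>R x"
  have [measurable]: "f \<in> borel_measurable borel" using f by auto
  have "(lborel :: (real^'d) measure) = density (distr lborel borel ?T) (\<lambda>_. ennreal (\<bar>-1\<bar>^DIM(real^'d)))"
    by (rule lborel_affine) simp
  then have "(lborel :: (real^'d) measure) = distr lborel borel ?T" by (simp add: density_1)
  then have "integrable (distr lborel borel ?T) f" using f by simp
  then show ?thesis by (subst (asm) integrable_distr_eq) auto
qed

text \<open>The slowly varying amplitude of the source, an inverse Fourier integral. Being the
  reflection of \<open>fourier F\<close>, it inherits integrability and square integrability from
  the hypotheses on that transform.\<close>

definition synth :: "(real^'d \<Rightarrow> complex) \<Rightarrow> real^'d \<Rightarrow> complex" where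
  "synth F r = of_real (cst CARD('d)) * (LINT k|lborel. F k * cis (k \<bullet> r))"

lemma synth_eq_fourier: "synth F r = fourier F (- r)"
  by (simp add: synth_def fourier_def mult.commute inner_commute)

lemma synth_scaled:
  fixes F :: "real^'d \<Rightarrow> complex"
  assumes F1: "integrable lborel (fourier F)" and F2: "L2fun lborel (fourier F)" and \<epsilon>: "\<epsilon> > 0"
  shows "integrable lborel (\<lambda>x. synth F (\<epsilon> *\<^sub>R x))" "L2fun lborel (\<lambda>x. synth F (\<epsilon> *\<^sub>R x))"
proof -
  have i: "integrable lborel (synth F)" using integrable_reflect[OF F1] by (simp add: synth_eq_fourier[abs_def])
  have i2: "integrable lborel (\<lambda>r. (norm (synth F r))^2)"
    using integrable_reflect[OF L2fun_sq[OF F2]] by (simp add: synth_eq_fourier)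
  have m[measurable]: "synth F \<in> borel_measurable borel" using i by auto
  show "integrable lborel (\<lambda>x. synth F (\<epsilon> *\<^sub>R x))" using scale_lborel(3)[OF \<epsilon> m] i by simp
  have "integrable lborel (\<lambda>x. (norm (synth F (\<epsilon> *\<^sub>R x)))^2)"
    using scale_lborel(3)[OF \<epsilon>, of "\<lambda>r. (norm (synth F r))^2"] i2 by simp
  then show "L2fun lborel (\<lambda>x. synth F (\<epsilon> *\<^sub>R x))" by (simp add: L2fun_def)
qed

text \<open>For fixed \<open>x\<close> the values \<open>a (x + j)\<close> are the Fourier coefficients of \<open>k \<mapsto> F (k / \<epsilon>)\<close>, which lives
  in the dual cell; uniqueness replaces Poisson summation and Fourier inversion.\<close>

lemma synth_fibre:
  fixes F :: "real^'d \<Rightarrow> complex"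
  assumes F: "integrable lborel F" and supp: "\<And>k. F k \<noteq> 0 \<Longrightarrow> \<epsilon> *\<^sub>R k \<in> dual_cell" and \<epsilon>: "\<epsilon> > 0"
    and a: "integrable lborel (\<lambda>x. synth F (\<epsilon> *\<^sub>R x))"
  shows "AE k in dualM. AE x in unitM. bsum (\<lambda>x. synth F (\<epsilon> *\<^sub>R x)) k x
        = of_real (1 / (cst CARD('d) * \<epsilon>^CARD('d))) * F ((1/\<epsilon>) *\<^sub>R k)"
proof -
  let ?a = "\<lambda>x. synth F (\<epsilon> *\<^sub>R x)" and ?c = "cst CARD('d)"
  let ?C = "1 / (?c * \<epsilon>^CARD('d))"
  have c: "?c > 0" by (rule cst_pos)
  have [measurable]: "F \<in> borel_measurable borel" "?a \<in> borel_measurable borel" using F a by auto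
  \<comment> \<open>The constant is fixed by comparing coefficients: the substitution k ->
    \<epsilon> k contributes \<epsilon>^d, and the lattice series has the coefficients a(y) divided
    by the square of the normalization.\<close>
  define f where "f k = of_real ?C * F ((1/\<epsilon>) *\<^sub>R k)" for k
  have fm[measurable]: "f \<in> borel_measurable borel" unfolding f_def[abs_def] by measurable
  have fsupp: "k \<in> dual_cell" if "f k \<noteq> 0" for k
    using that supp[of "(1/\<epsilon>) *\<^sub>R k"] \<epsilon> by (simp add: f_def)
  have fi: "integrable lborel f"
    unfolding f_def[abs_def] by (intro integrable_mult_right) (use scale_lborel(3)[of "1/\<epsilon>" F] \<epsilon> F in simp)
  have ind: "indicator dual_cell k *\<^sub>R (f k * z) = f k * z" for k z using fsupp[of k]
      by (auto simp: indicator_def)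
  have fD: "integrable dualM f"
    using fi by (subst integral_dualM(2)[OF fm]) (simp add: set_integrable_def ind[of _ 1, simplified])
  have fc: "(LINT k|dualM. f k * cis (k \<bullet> y)) = ?a y / of_real (?c^2)" for y
  proof -
    have m: "(\<lambda>k. f k * cis (k \<bullet> y)) \<in> borel_measurable borel" by measurable
    have "(LINT k|dualM. f k * cis (k \<bullet> y)) = (LINT k|lborel. f k * cis (k \<bullet> y))"
      by (simp add: integral_dualM(1)[OF m] set_lebesgue_integral_def ind)
    also have "\<dots> = \<epsilon>^CARD('d) *\<^sub>R (LINT k|lborel. f (\<epsilon> *\<^sub>R k) * cis ((\<epsilon> *\<^sub>R k) \<bullet> y))"
      by (rule scale_lborel(2)[OF \<epsilon> m])
    also have "(LINT k|lborel. f (\<epsilon> *\<^sub>R k) * cis ((\<epsilon> *\<^sub>R k) \<bullet> y))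
          = (LINT k|lborel. of_real ?C * (F k * cis (k \<bullet> (\<epsilon> *\<^sub>R y))))"
      using \<epsilon> by (intro Bochner_Integration.integral_cong refl) (simp add: f_def)
    also have "\<epsilon>^CARD('d) *\<^sub>R \<dots> = ?a y / of_real (?c^2)"
      using \<epsilon> c by (simp add: synth_def scaleR_conv_of_real power2_eq_square)
    finally show ?thesis .
  qed
  have "AE x in unitM. AE k in dualM. bsum ?a k x = f k"
    using summable_translates[OF a]
  proof eventually_elim
    case (elim x)
    note S = fseries_L2[OF elim, of x]
    let ?S = "fseries (\<lambda>n. ?a (x + lat n)) x"
    have Si: "integrable dualM ?S" by (rule L2_fun_integrable_finite(1)[OF finite_measure_dualM S(1)])
    have ei: "integrable dualM (\<lambda>k. g k * cis (k \<bullet> y))" if "integrable dualM g" for g :: "real^'d \<Rightarrow> complex"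
        and y
      by (rule integrable_mult_bounded[OF that, where B=1]) auto
    have "AE k in dualM. ?S k - f k = 0"
    proof (rule fourier_unique_shifted)
      show "integrable dualM (\<lambda>k. ?S k - f k)" using Si fD by simp
      fix n
      have "of_real ?c * (LINT k|dualM. ?S k * cis (k \<bullet> (x + lat n))) = L2ip dualM ?S (expo x n)"
        unfolding L2ip_def expo_def by (simp add: cis_cnj mult.left_commute[of _ "of_real ?c"])
      also have "\<dots> = ?a (x + lat n) / of_real ?c" by (rule S(2))
      finally have "(LINT k|dualM. ?S k * cis (k \<bullet> (x + lat n))) = ?a (x + lat n) / of_real (?c^2)"
        using c by (simp add: field_simps power2_eq_square)
      moreover have "(LINT k|dualM. (?S k - f k) * cis (k \<bullet> (x + lat n)))
            = (LINT k|dualM. ?S k * cis (k \<bullet> (x + lat n))) - (LINT k|dualM. f k * cis (k \<bullet> (x + lat n)))"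
        unfolding left_diff_distrib by (intro Bochner_Integration.integral_diff ei Si fD)
      ultimately show "(LINT k|dualM. (?S k - f k) * cis (k \<bullet> (x + lat n))) = 0" by (simp only: fc) simp
    qed
    then show ?case by (simp add: bsum_def)
  qed
  \<comment> \<open>Uniqueness was applied in k for almost every fixed x; measurability of this set
    permits exchanging the order of the two quantifiers.\<close>
  moreover have "{p \<in> space (dualM \<Otimes>\<^sub>M unitM). bsum ?a (fst p) (snd p) = f (fst p)}
        \<in> sets (dualM \<Otimes>\<^sub>M (unitM :: (real^'d) measure))"
  proof -
    have "(\<lambda>p. bsum ?a (fst p) (snd p)) \<in> borel_measurable (dualM \<Otimes>\<^sub>M (unitM :: (real^'d) measure))"
      unfolding borel_measurable_dual_unit using bsum_measurable_pair[of ?a] by (simp add: case_prod_unfold)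
    moreover have "(\<lambda>p. f (fst p)) \<in> borel_measurable (dualM \<Otimes>\<^sub>M (unitM :: (real^'d) measure))"
      unfolding borel_measurable_dual_unit by measurable
    ultimately show ?thesis by measurable
  qed
  ultimately have "AE k in dualM. AE x in unitM. bsum ?a k x = f k"
    using pair_sigma_finite.AE_commute[OF pair_dual_unit, of "\<lambda>k x. bsum ?a k x = f k"] by blast
  then show ?thesis by (simp add: f_def)
qed

text \<open>An infinite sum that does not converge has the value 0, and summability over the lattice
  is absolute. The transform is thus the measurable lattice series on the set of absolute
  convergence, which does not depend on k, and 0 elsewhere.\<close>

lemma bloch_measurable:
  fixes v :: "real^'d \<Rightarrow> complex"
  assumes v[measurable]: "v \<in> borel_measurable borel"
  shows "(\<lambda>(k, x). bloch v k x) \<in> borel_measurable (borel \<Otimes>\<^sub>M borel)"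
proof -
  let ?s = "\<lambda>x. \<Sum>n. ennreal (norm (v (x + lat n)))"
  have s: "?s x < \<infinity> \<longleftrightarrow> summable (\<lambda>n. norm (v (x + lat n)))" for x
  proof
    assume "?s x < \<infinity>"
    then show "summable (\<lambda>n. norm (v (x + lat n)))" by (intro summable_suminf_not_top) auto
  next
    assume "summable (\<lambda>n. norm (v (x + lat n)))"
    then have "?s x = ennreal (\<Sum>n. norm (v (x + lat n)))" by (intro suminf_ennreal2) auto
    then show "?s x < \<infinity>" by simp
  qed
  have eq: "bloch v k x = (if ?s x < \<infinity> then of_real (cst CARD('d)) * (cis (k \<bullet> x) * bsum v k x) else 0)" for k x
  proof (cases "?s x < \<infinity>")
    case True
    then show ?thesis using bloch_eq_bsum[of v x k] s[of x] by simp
  next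
    case False
    have "\<not> (\<lambda>j. v (x + j) * cis (- (k \<bullet> j))) summable_on lattice"
    proof
      assume "(\<lambda>j. v (x + j) * cis (- (k \<bullet> j))) summable_on lattice"
      then have "(\<lambda>j. norm (v (x + j))) summable_on lattice"
        by (simp add: summable_on_iff_abs_summable_on_complex norm_mult)
      then have "(\<lambda>n. norm (v (x + lat n))) summable_on UNIV"
        using summable_on_reindex_bij_betw[OF bij_lat, of "\<lambda>j. norm (v (x + j))"] by simp
      then show False using False s[of x] summable_on_imp_summable by blast
    qed
    then show ?thesis using False by (simp add: bloch_def infsum_not_exists)
  qed
  have "(\<lambda>(k, x). if ?s x < \<infinity> then of_real (cst CARD('d)) * (cis (k \<bullet> x) * bsum v k x) else 0)
        \<in> borel_measurable (borel \<Otimes>\<^sub>M borel)"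
    by measurable
  then show ?thesis by (simp only: eq)
qed

lemma measurable_unit_integral:
  fixes f :: "real^'d \<Rightarrow> real^'d \<Rightarrow> complex"
  assumes "(\<lambda>(k, x). f k x) \<in> borel_measurable (borel \<Otimes>\<^sub>M borel)"
  shows "(\<lambda>k. cint (f k)) \<in> borel_measurable borel"
proof -
  interpret finite_measure "unitM :: (real^'d) measure" by (rule finite_measure_unitM)
  have fk: "f k \<in> borel_measurable borel" for k
    using measurable_compose[OF measurable_Pair[OF measurable_const[of k] measurable_ident] assms] by simp
  have "borel_measurable (borel \<Otimes>\<^sub>M unitM) = borel_measurable (borel \<Otimes>\<^sub>M (borel :: (real^'d) measure))"
    by (intro measurable_cong_sets sets_pair_measure_cong) auto
  then have "(\<lambda>k. LINT x|unitM. f k x) \<in> borel_measurable borel"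
    using assms by (intro borel_measurable_lebesgue_integral) simp
  then show ?thesis by (simp add: integral_unitM[OF fk])
qed

lemma measurable_dual_integral:
  fixes f :: "real^'d \<Rightarrow> real^'d \<Rightarrow> complex"
  assumes [measurable]: "(\<lambda>(k, x). f k x) \<in> borel_measurable (borel \<Otimes>\<^sub>M borel)"
  shows "(\<lambda>x. LINT k|dualM. f k x) \<in> borel_measurable borel"
proof -
  interpret finite_measure "dualM :: (real^'d) measure" by (rule finite_measure_dualM)
  have "borel_measurable (borel \<Otimes>\<^sub>M dualM) = borel_measurable (borel \<Otimes>\<^sub>M (borel :: (real^'d) measure))"
    by (intro measurable_cong_sets sets_pair_measure_cong) auto
  moreover have "(\<lambda>(x, k). f k x) \<in> borel_measurable (borel \<Otimes>\<^sub>M borel)" by measurable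
  ultimately show ?thesis
    by (intro borel_measurable_lebesgue_integral) simp
qed

section \<open>Branch p near the origin, the source coefficients and the integral form of
  u^(p)\<close>

context bloch_problem
begin

text \<open>Near k = 0 the branch p stays simple, so its multiplicity is locally constant and the
  eigenfunction is analytic, hence continuous, in k. The indicator extends this to a measurable
  function of all k.\<close>

lemma simple_branch:
  assumes simple: "\<And>m. m \<noteq> p \<Longrightarrow> w2 m 0 \<noteq> w2 p 0"
  obtains \<delta> r where "\<delta> > 0" "r > 0"
    "\<And>k m. norm k < r \<Longrightarrow> m \<noteq> p \<Longrightarrow> 2 * \<delta> \<le> \<bar>w2 m k - w2 p 0\<bar>"
    "\<And>x. (\<lambda>k. indicator (ball 0 r) k *\<^sub>R \<phi> p k x) \<in> borel_measurable borel"
proof -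
  obtain \<delta> r where g: "\<delta> > 0" "r > 0"
    "\<And>k m. norm k < r \<Longrightarrow> m \<noteq> p \<Longrightarrow> 2 * \<delta> \<le> \<bar>w2 m k - w2 p 0\<bar>"
    "\<And>k. norm k < r \<Longrightarrow> \<bar>w2 p k - w2 p 0\<bar> < \<delta>" using simple_branch_gap[OF simple] by blast
  have mult1: "mult w2 p k = 1" if "norm k < r" for k
  proof -
    have "w2 n k = w2 p k \<longleftrightarrow> n = p" for n
      using g(1) g(3)[OF that, of n] g(4)[OF that] by (cases "n = p") auto
    then show ?thesis by (simp add: mult_def)
  qed
  have "isCont (\<lambda>k. \<phi> p k x) k0" if k0: "k0 \<in> ball 0 r" for k0 x
  proof (rule real_analytic_at_isCont)
    obtain s where s: "s > 0" "ball k0 s \<subseteq> ball 0 r" by (rule openE[OF open_ball k0])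
    then have "\<forall>k\<in>ball k0 s. mult w2 p k = mult w2 p k0" using mult1 k0 by (auto simp: subset_iff)
    then show "real_analytic_at (\<lambda>k. \<phi> p k x) k0"
      using eig s(1) unfolding bloch_eigen_def by blast
  qed
  then have "continuous_on (ball 0 r) (\<lambda>k. \<phi> p k x)" for x
    by (intro continuous_at_imp_continuous_on) auto
  then have "(\<lambda>k. indicator (ball 0 r) k *\<^sub>R \<phi> p k x) \<in> borel_measurable borel" for x
    by (intro borel_measurable_continuous_on_indicator) auto
  then show ?thesis using that g(1,2,3) by blast
qed

text \<open>By \<open>synth_fibre\<close> the fibre of the amplitude is constant in x, so
  multiplying by \<rho> \<phi>_p(0) and pairing with an eigenfunction leaves this constant times a
  coupling. The same fact is recorded in the two normalizations that occur: the pairing on the whole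
  space and the inner product with \<open>bloch\<close>.\<close>

lemma source_coefficients:
  fixes F :: "real^'d \<Rightarrow> complex"
  assumes F: "integrable lborel F" and supp: "\<And>k. F k \<noteq> 0 \<Longrightarrow> \<epsilon> *\<^sub>R k \<in> dual_cell" and \<epsilon>: "\<epsilon> > 0"
    and a: "integrable lborel (\<lambda>x. synth F (\<epsilon> *\<^sub>R x))"
  shows "AE k in dualM. (\<forall>m. (LINT x|lborel. (of_real (\<epsilon>^2) * (synth F (\<epsilon> *\<^sub>R x) * of_real (\<rho> x) * \<phi> p 0 x))
        * (cis (- (k \<bullet> x)) * cnj (\<phi> m k x)))
        = (of_real (\<epsilon>^2 / (cst CARD('d) * \<epsilon>^CARD('d))) * F ((1/\<epsilon>) *\<^sub>R k)) * coupling p m k)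
    \<and> cinner_cell (bloch (\<lambda>x. synth F (\<epsilon> *\<^sub>R x) * of_real (\<rho> x) * \<phi> p 0 x) k) (\<lambda>y. cis (k \<bullet> y) * \<phi> p k y)
        = (of_real (1 / \<epsilon>^CARD('d)) * F ((1/\<epsilon>) *\<^sub>R k)) * coupling p p k"
proof -
  have "AE k in dualM. AE x in unitM. bsum (\<lambda>x. synth F (\<epsilon> *\<^sub>R x)) k x
        = of_real (1 / (cst CARD('d) * \<epsilon>^CARD('d))) * F ((1/\<epsilon>) *\<^sub>R k)"
    by (rule synth_fibre[OF F _ \<epsilon> a]) (rule supp)
  then show ?thesis
  proof eventually_elim
    case (elim k)
    let ?a = "\<lambda>x. synth F (\<epsilon> *\<^sub>R x)" and ?c = "cst CARD('d)"
    let ?f = "of_real (1 / (?c * \<epsilon>^CARD('d))) * F ((1/\<epsilon>) *\<^sub>R k)"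
    have c: "?c > 0" by (rule cst_pos)
    have am[measurable]: "?a \<in> borel_measurable borel" using a by auto
    have ae: "AE x in lborel. x \<in> cell \<longrightarrow> bsum ?a k x = ?f" using elim by (simp add: AE_unitM)
    have coup: "coupling p m k = cint (\<lambda>x. of_real (\<rho> x) * (\<phi> p 0 x * cnj (\<phi> m k x)))" for m
      by (simp add: L2ip_M)
    have fc: "cint (\<lambda>x. z * g x) = z * cint g" for z g by (simp add: cint_def)
    show ?case
    proof (intro conjI allI)
      fix m
      let ?q = "\<lambda>x. of_real (\<epsilon>^2) * (of_real (\<rho> x) * (\<phi> p 0 x * cnj (\<phi> m k x)))"
      have qs: "smooth ?q" by (intro smooth_mult smooth_const smooth_of_real sr phi_smooth smooth_cnj)
      have qp: "zperiodic ?q" by (intro zperiodic_rules pr phi_periodic)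
      obtain B where B: "\<And>x. norm (?q x) \<le> B" using continuous_zperiodic_bounded[OF smooth_continuous[OF qs]
          qp] by blast
      have "(LINT x|lborel. (of_real (\<epsilon>^2) * (?a x * of_real (\<rho> x) * \<phi> p 0 x))
            * (cis (- (k \<bullet> x)) * cnj (\<phi> m k x))) = (LINT x|lborel. ?a x * (cis (- (k \<bullet> x)) * ?q x))"
        by (intro Bochner_Integration.integral_cong refl) (simp add: mult_ac)
      also have "\<dots> = cint (\<lambda>x. bsum ?a k x * ?q x)"
        by (rule bsum_coeff(1)[OF a smooth_measurable[OF qs] B qp, symmetric])
      also have "\<dots> = cint (\<lambda>x. ?f * of_real (\<epsilon>^2) * (of_real (\<rho> x) * (\<phi> p 0 x * cnj (\<phi> m k x))))"
        unfolding cint_def set_lebesgue_integral_def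
      proof (rule integral_cong_AE)
        show "AE x in lborel. indicator cell x *\<^sub>R (bsum ?a k x * ?q x) = indicator cell x
              *\<^sub>R (?f * of_real (\<epsilon>^2) * (of_real (\<rho> x) * (\<phi> p 0 x * cnj (\<phi> m k x))))"
          using ae by eventually_elim (auto simp: indicator_def)
      qed measurable
      also have "\<dots> = ?f * of_real (\<epsilon>^2) * coupling p m k" by (simp only: fc coup)
      finally show "(LINT x|lborel. (of_real (\<epsilon>^2) * (?a x * of_real (\<rho> x) * \<phi> p 0 x))
            * (cis (- (k \<bullet> x)) * cnj (\<phi> m k x)))
          = (of_real (\<epsilon>^2 / (?c * \<epsilon>^CARD('d))) * F ((1/\<epsilon>) *\<^sub>R k)) * coupling p m k" by simp
    next
      let ?g = "\<lambda>x. ?a x * of_real (\<rho> x) * \<phi> p 0 x"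
      have gm: "?g \<in> borel_measurable borel" by measurable
      have bm[measurable]: "bloch ?g k \<in> borel_measurable borel"
        using measurable_compose[OF measurable_Pair[OF measurable_const[of k] measurable_ident]
            bloch_measurable[OF gm]] by simp
      have "cinner_cell (bloch ?g k) (\<lambda>y. cis (k \<bullet> y) * \<phi> p k y)
            = cint (\<lambda>x. (of_real ?c * ?f) * (of_real (\<rho> x) * (\<phi> p 0 x * cnj (\<phi> p k x))))"
        unfolding cinner_cell_def cint_def set_lebesgue_integral_def
      proof (rule integral_cong_AE)
        show "AE x in lborel. indicator cell x *\<^sub>R (bloch ?g k x * cnj (cis (k \<bullet> x) * \<phi> p k x))
              = indicator cell x *\<^sub>R (of_real ?c * ?f * (of_real (\<rho> x) * (\<phi> p 0 x * cnj (\<phi> p k x))))"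
          using ae integral_unfold(1)[OF a]
        proof eventually_elim
          case (elim x)
          show ?case
          proof (cases "x \<in> cell")
            case True
            then have s: "summable (\<lambda>n. norm (?a (x + lat n)))" and b: "bsum ?a k x = ?f" using elim by auto
            have qp: "zperiodic (\<lambda>x. of_real (\<rho> x) * \<phi> p 0 x)" by (intro zperiodic_rules pr phi_periodic)
            have geq: "?g = (\<lambda>x. ?a x * (of_real (\<rho> x) * \<phi> p 0 x))" by (simp add: mult.assoc)
            have "norm (?g (x + lat n)) = norm (?a (x + lat n)) * norm (of_real (\<rho> x) * \<phi> p 0 x)" for n
              using qp pr phi_periodic[of p 0] by (simp add: norm_mult)
            then have sg: "summable (\<lambda>n. norm (?g (x + lat n)))" using s by (simp add: summable_mult2)
            have "bloch ?g k x = of_real ?c * (cis (k \<bullet> x) * bsum ?g k x)" by (rule bloch_eq_bsum[OF sg])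
            also have "bsum ?g k x = ?f * (of_real (\<rho> x) * \<phi> p 0 x)"
              unfolding geq bsum_mult_periodic[OF qp s] b ..
            finally have bl: "bloch ?g k x = of_real ?c * (cis (k \<bullet> x) * (?f * (of_real (\<rho> x) * \<phi> p 0 x)))" .
            have cc: "cis (k \<bullet> x) * cnj (cis (k \<bullet> x)) = 1" by (simp add: cis_cnj cis_mult)
            have "bloch ?g k x * cnj (cis (k \<bullet> x) * \<phi> p k x)
                  = (of_real ?c * ?f * (of_real (\<rho> x) * (\<phi> p 0 x * cnj (\<phi> p k x))))
                  * (cis (k \<bullet> x) * cnj (cis (k \<bullet> x)))"
              unfolding bl complex_cnj_mult by (simp only: mult_ac)
            then show ?thesis by (simp only: cc mult_1_right)
          qed simp
        qed
      qed measurable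
      also have "\<dots> = of_real ?c * ?f * coupling p p k" by (simp only: fc coup)
      finally show "cinner_cell (bloch ?g k) (\<lambda>y. cis (k \<bullet> y) * \<phi> p k y)
            = (of_real (1 / \<epsilon>^CARD('d)) * F ((1/\<epsilon>) *\<^sub>R k)) * coupling p p k"
        using c by simp
    qed
  qed
qed

end

context bloch_problem
begin

text \<open>The integral over \<epsilon> Y becomes one over the dual cell because the factor
  F(k/\<epsilon>) vanishes off \<epsilon> Y. This also permits replacing the eigenfunction by its
  measurable truncation, as the two agree wherever the factor is nonzero.\<close>

lemma upsol_representation:
  fixes F :: "real^'d \<Rightarrow> complex" and c :: real
  assumes F: "integrable lborel F" and supp: "\<And>k. F k \<noteq> 0 \<Longrightarrow> k \<in> Y" and Y: "open Y" and \<epsilon>: "\<epsilon> > 0"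
    and YD: "\<And>y. y \<in> Y \<Longrightarrow> \<epsilon> *\<^sub>R y \<in> dual_cell" and Yr: "\<And>y. y \<in> Y \<Longrightarrow> norm (\<epsilon> *\<^sub>R y) < r"
    and a: "integrable lborel (\<lambda>x. synth F (\<epsilon> *\<^sub>R x))"
    and meas: "\<And>x. (\<lambda>k. indicator (ball 0 r) k *\<^sub>R \<phi> p k x) \<in> borel_measurable borel"
  defines "lam \<equiv> \<lambda>k. of_real (\<epsilon>^2 / (cst CARD('d) * \<epsilon>^CARD('d))) * F ((1/\<epsilon>) *\<^sub>R k)"
    and "U \<equiv> upsol w2 \<phi> p c (\<lambda>x. synth F (\<epsilon> *\<^sub>R x) * of_real (\<rho> x) * \<phi> p 0 x) Y \<epsilon>"
  shows "\<exists>P. (\<lambda>(k, x). P k x) \<in> borel_measurable (borel \<Otimes>\<^sub>M borel) \<and> (\<forall>k. zperiodic (P k))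
    \<and> (\<forall>k x. P k x = of_real (cst CARD('d)) * (lam k * coupling p p k / of_real (w2 p k - c) * \<phi> p k x))
    \<and> (\<forall>x. U x = of_real (cst CARD('d)) * (LINT k|dualM. P k x * cis (k \<bullet> x))) \<and> U \<in> borel_measurable borel"
proof -
  let ?d = "CARD('d)" and ?c = "cst CARD('d)"
  have cpos: "?c > 0" by (rule cst_pos)
  have [measurable]: "F \<in> borel_measurable borel" "(\<lambda>x. synth F (\<epsilon> *\<^sub>R x)) \<in> borel_measurable borel"
      using F a by auto
  define \<Phi> where "\<Phi> k x = indicator (ball 0 r) k *\<^sub>R \<phi> p k x" for k x
  have \<Phi>m[measurable]: "(\<lambda>(k, x). \<Phi> k x) \<in> borel_measurable (borel \<Otimes>\<^sub>M borel)"
    unfolding \<Phi>_def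
    by (rule Caratheodory_measurable[OF meas]) (intro continuous_intros smooth_continuous phi_smooth)
  have w2m[measurable]: "w2 p \<in> borel_measurable borel"
    by (intro borel_measurable_continuous_onI continuous_at_imp_continuous_on ballI w2_isCont)
  have lm[measurable]: "lam \<in> borel_measurable borel" unfolding lam_def by measurable
  have inY: "(1/\<epsilon>) *\<^sub>R k \<in> Y \<longleftrightarrow> k \<in> (\<lambda>k. \<epsilon> *\<^sub>R k) ` Y" for k
  proof
    assume "(1/\<epsilon>) *\<^sub>R k \<in> Y"
    then show "k \<in> (\<lambda>k. \<epsilon> *\<^sub>R k) ` Y" by (rule rev_image_eqI) (use \<epsilon> in simp)
  qed (use \<epsilon> in auto)
  let ?Y = "(\<lambda>k. \<epsilon> *\<^sub>R k) ` Y"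
  have Ym[measurable]: "?Y \<in> sets borel" using Y \<epsilon> by (intro borel_open open_scaling) auto
  have lam0: "k \<in> ?Y" if "lam k \<noteq> 0" for k
    using that supp[of "(1/\<epsilon>) *\<^sub>R k"] inY by (simp add: lam_def)
  have ball: "\<Phi> k = \<phi> p k" if "k \<in> ?Y" for k
    using that Yr by (auto simp: \<Phi>_def)
  define cF where "cF k = cint (\<lambda>x. of_real (\<rho> x) * (\<phi> p 0 x * cnj (\<Phi> k x)))" for k
  have cFm[measurable]: "cF \<in> borel_measurable borel"
    unfolding cF_def[abs_def] by (rule measurable_unit_integral) measurable
  have cF: "cF k = coupling p p k" if "k \<in> ?Y" for k
    unfolding cF_def ball[OF that] by (simp add: L2ip_M)
  define P where "P k x = of_real ?c * (lam k * coupling p p k / of_real (w2 p k - c) * \<phi> p k x)" for k x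
  have P_eq: "P k x = of_real ?c * (lam k * cF k / of_real (w2 p k - c) * \<Phi> k x)" for k x
    using lam0[of k] cF[of k] ball[of k] by (cases "lam k = 0") (auto simp: P_def)
  have Pm[measurable]: "(\<lambda>(k, x). P k x) \<in> borel_measurable (borel \<Otimes>\<^sub>M borel)"
    unfolding P_eq by measurable
  have Pp: "zperiodic (P k)" for k
    unfolding P_def[abs_def] by (intro zperiodic_rules phi_periodic)
  let ?g = "\<lambda>x. synth F (\<epsilon> *\<^sub>R x) * of_real (\<rho> x) * \<phi> p 0 x"
  have gm: "?g \<in> borel_measurable borel" by measurable
  note bm[measurable] = bloch_measurable[OF gm]
  let ?ci = "\<lambda>k. cinner_cell (bloch ?g k) (\<lambda>y. cis (k \<bullet> y) * \<phi> p k y)"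
  define ci where "ci k = cint (\<lambda>x. bloch ?g k x * cnj (cis (k \<bullet> x) * \<Phi> k x))" for k
  have cim[measurable]: "ci \<in> borel_measurable borel"
    unfolding ci_def[abs_def] by (rule measurable_unit_integral) measurable
  have ci: "?ci k = ci k" if "k \<in> ?Y" for k
    unfolding ci_def ball[OF that] by (simp add: cinner_cell_def cint_def)
  have U: "U x = of_real ?c * (LINT k|dualM. P k x * cis (k \<bullet> x))" for x
  proof -
    have Pxm[measurable]: "(\<lambda>k. P k x) \<in> borel_measurable borel"
      using measurable_compose[OF measurable_Pair[OF measurable_ident measurable_const[of x]] Pm] by simp
    have \<Phi>xm[measurable]: "(\<lambda>k. \<Phi> k x) \<in> borel_measurable borel" unfolding \<Phi>_def by (rule meas)
    have m1: "(\<lambda>k. P k x * cis (k \<bullet> x)) \<in> borel_measurable borel" by measurable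
    let ?J = "\<lambda>k. of_real (\<epsilon>^2) * ci k / of_real (w2 p k - c) * cis (k \<bullet> x) * \<Phi> k x"
    have "U x = of_real ?c * (LINT k|lborel. indicator ?Y k
          *\<^sub>R (of_real (\<epsilon>^2) * ?ci k / of_real (w2 p k - c) * cis (k \<bullet> x) * \<phi> p k x))"
      by (simp add: U_def upsol_def set_lebesgue_integral_def)
    also have "(\<lambda>k. indicator ?Y k *\<^sub>R (of_real (\<epsilon>^2) * ?ci k / of_real (w2 p k - c) * cis (k \<bullet> x)
          * \<phi> p k x)) = (\<lambda>k. indicator ?Y k *\<^sub>R ?J k)"
    proof (rule ext)
      fix k show "indicator ?Y k *\<^sub>R (of_real (\<epsilon>^2) * ?ci k / of_real (w2 p k - c) * cis (k \<bullet> x) * \<phi> p k x)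
            = indicator ?Y k *\<^sub>R ?J k"
        using ci[of k] ball[of k] by (cases "k \<in> ?Y") simp_all
    qed
    also have "(LINT k|lborel. indicator ?Y k *\<^sub>R ?J k)
          = (LINT k|lborel. indicator dual_cell k *\<^sub>R (P k x * cis (k \<bullet> x)))"
    proof (rule integral_cong_AE)
      have "AE k in dualM. ?ci k = (of_real (1 / \<epsilon>^?d) * F ((1/\<epsilon>) *\<^sub>R k)) * coupling p p k"
      proof -
        have "AE k in dualM. (\<forall>m. (LINT x|lborel. (of_real (\<epsilon>^2) * ?g x) * (cis (- (k \<bullet> x)) * cnj (\<phi> m k x)))
            = (of_real (\<epsilon>^2 / (?c * \<epsilon>^?d)) * F ((1/\<epsilon>) *\<^sub>R k)) * coupling p m k)
          \<and> ?ci k = (of_real (1 / \<epsilon>^?d) * F ((1/\<epsilon>) *\<^sub>R k)) * coupling p p k"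
          by (rule source_coefficients[OF F _ \<epsilon> a]) (rule YD[OF supp])
        then show ?thesis by eventually_elim blast
      qed
      then show "AE k in lborel. indicator ?Y k *\<^sub>R ?J k = indicator dual_cell k *\<^sub>R (P k x * cis (k \<bullet> x))"
        unfolding AE_dualM
      proof eventually_elim
        case (elim k)
        show ?case
        proof (cases "k \<in> ?Y")
          case True
          then have kD: "k \<in> dual_cell" using YD by auto
          \<comment> \<open>The Bloch transform carries the normalization constant, while
            \<open>lam\<close> was defined with its inverse; this explains the factor in P.\<close>
          have "of_real (\<epsilon>^2) * ci k = of_real ?c * lam k * coupling p p k"
            using elim kD ci[OF True] cpos \<epsilon> by (simp add: lam_def)
          then show ?thesis using True kD ball[OF True] by (simp add: P_def)
        next
          case False
          then have "lam k = 0" using lam0[of k] by blast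
          then show ?thesis using False by (simp add: P_def)
        qed
      qed
    qed measurable
    also have "\<dots> = (LINT k|dualM. P k x * cis (k \<bullet> x))"
      by (simp add: integral_dualM(1)[OF m1] set_lebesgue_integral_def)
    finally show ?thesis .
  qed
  have Um: "U \<in> borel_measurable borel"
  proof -
    have "(\<lambda>(k, x). P k x * cis (k \<bullet> x)) \<in> borel_measurable (borel \<Otimes>\<^sub>M borel)" by measurable
    then have "(\<lambda>x. LINT k|dualM. P k x * cis (k \<bullet> x)) \<in> borel_measurable borel"
        by (rule measurable_dual_integral)
    then have "(\<lambda>x. of_real ?c * (LINT k|dualM. P k x * cis (k \<bullet> x))) \<in> borel_measurable borel" by measurable
    then show ?thesis by (simp add: U[abs_def, symmetric])
  qed
  show ?thesis using Pm Pp U Um by (intro exI[of _ P]) (simp add: P_def[abs_def])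
qed

end

section \<open>Assembly of the two error bounds\<close>

lemma L2sq_scale_arg:
  fixes f :: "real^'d \<Rightarrow> complex"
  assumes f: "L2fun lborel f" and s: "s > 0"
  shows "L2fun lborel (\<lambda>x. f ((1/s) *\<^sub>R x))" "L2sq lborel (\<lambda>x. f ((1/s) *\<^sub>R x)) = s^CARD('d) * L2sq lborel f"
proof -
  have [measurable]: "f \<in> borel_measurable borel" using f by (simp add: L2fun_def)
  have m: "(\<lambda>x. (norm (f x))^2) \<in> borel_measurable borel" by measurable
  have m': "(\<lambda>x. (norm (f ((1/s) *\<^sub>R x)))^2) \<in> borel_measurable borel" by measurable
  show "L2fun lborel (\<lambda>x. f ((1/s) *\<^sub>R x))"
    using f scale_lborel(3)[OF _ m, of "1/s"] s by (simp add: L2fun_def)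
  show "L2sq lborel (\<lambda>x. f ((1/s) *\<^sub>R x)) = s^CARD('d) * L2sq lborel f"
    unfolding L2sq_def by (subst scale_lborel(2)[OF s m']) (use s in simp)
qed

theorem theorem4p1:
  fixes G \<rho> :: "real^'d \<Rightarrow> real"
    and w2 :: "nat \<Rightarrow> real^'d \<Rightarrow> real"
    and \<phi> :: "nat \<Rightarrow> real^'d \<Rightarrow> real^'d \<Rightarrow> complex"
    and p :: nat and \<sigma> \<Omega>h :: real
    and F :: "real^'d \<Rightarrow> complex" and Y :: "(real^'d) set"
  assumes "smooth G" and "smooth \<rho>" and "zperiodic G" and "zperiodic \<rho>"
    and "\<exists>c>0. \<forall>x. c \<le> G x" and "\<exists>c>0. \<forall>x. c \<le> \<rho> x"
    and "bloch_eigen G \<rho> w2 \<phi>"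
    and "\<forall>m. m \<noteq> p \<longrightarrow> w2 m 0 \<noteq> w2 p 0"
    and "\<sigma> = 1 \<or> \<sigma> = -1" and "\<Omega>h > 0"
    and "integrable lborel F" and "square_integrable_on UNIV F"
    and "integrable lborel (fourier F)" and "square_integrable_on UNIV (fourier F)"
    and "open Y" and "bounded Y" and "0 \<in> Y" and "{k. F k \<noteq> 0} \<subseteq> Y"
  shows "\<exists>C. \<exists>\<epsilon>0>0. \<forall>\<epsilon> u gu.
     0 < \<epsilon> \<and> \<epsilon> < \<epsilon>0
     \<and> (\<forall>m. \<forall>k\<in>dual_cell. w2 p 0 / \<epsilon>^2 + \<sigma> * \<Omega>h^2 \<noteq> w2 m k / \<epsilon>^2)
     \<and> weak_H1_solution G \<rho> (w2 p 0 + \<epsilon>^2 * \<sigma> * \<Omega>h^2)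
          (\<lambda>x. of_real (\<epsilon>^2) * source F \<rho> (\<phi> p 0) \<epsilon> (\<epsilon> *\<^sub>R x)) u gu
     \<longrightarrow>
     (let up = upsol w2 \<phi> p (w2 p 0 + \<epsilon>^2 * \<sigma> * \<Omega>h^2)
                 (\<lambda>y. source F \<rho> (\<phi> p 0) \<epsilon> (\<epsilon> *\<^sub>R y)) Y \<epsilon>
      in square_integrable_on UNIV (\<lambda>x. u x - up x)
         \<and> l2norm (\<lambda>x. u x - up x) \<le> C * \<epsilon> powr (3 - real CARD('d) / 2) * l2norm F
         \<and> square_integrable_on UNIV (\<lambda>r. u ((1/\<epsilon>) *\<^sub>R r) - up ((1/\<epsilon>) *\<^sub>R r))
         \<and> l2norm (\<lambda>r. u ((1/\<epsilon>) *\<^sub>R r) - up ((1/\<epsilon>) *\<^sub>R r)) \<le> C * \<epsilon>^3 * l2norm F)"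
proof -
  interpret bloch_problem G \<rho> w2 \<phi> by unfold_locales (use assms in auto)
  let ?d = "CARD('d)"
  have simple: "m \<noteq> p \<Longrightarrow> w2 m 0 \<noteq> w2 p 0" for m using assms(8) by blast
  obtain \<delta> r where \<delta>: "\<delta> > 0" and r: "r > 0"
    and gap: "\<And>k m. norm k < r \<Longrightarrow> m \<noteq> p \<Longrightarrow> 2 * \<delta> \<le> \<bar>w2 m k - w2 p 0\<bar>"
    and meas: "\<And>x. (\<lambda>k. indicator (ball 0 r) k *\<^sub>R \<phi> p k x) \<in> borel_measurable borel"
    using simple_branch[OF simple] by blast
  obtain C where C: "C > 0" and coup: "\<And>k I. norm k \<le> 1 \<Longrightarrow> finite I \<Longrightarrow>
      (\<Sum>m\<in>I. (w2 m k - w2 p 0)^2 * (norm (coupling p m k))^2) \<le> C * (norm k)^2"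
    using coupling_bound[of p] by blast
  obtain r0 r1 where rb: "0 < r0" "0 < r1" "\<And>x. r0 \<le> \<rho> x" "\<And>x. \<rho> x \<le> r1" using r_bounds by blast
  obtain T where T: "T > 0" "\<And>y. y \<in> Y \<Longrightarrow> norm y \<le> T" using assms(16) bounded_pos by metis
  have F2: "L2fun lborel F" "L2fun lborel (fourier F)" using assms by (simp_all add: square_integrable_UNIV)
  have supp: "F k \<noteq> 0 \<Longrightarrow> k \<in> Y" for k using assms(18) by blast
  \<comment> \<open>For m different from p, the denominator is at least \<delta> and the distance of
    \<open>w2 m k\<close> to \<omega>_p^2(0) at least 2 \<delta>, so 1/\<delta>^2 is at most that
    distance squared over 4 \<delta>^4. The coupling bound with |k| <= \<epsilon> T then gives C T^2
    / (4 \<delta>^4) times \<epsilon>^2.\<close>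
  define b0 where "b0 = C * T^2 / (4 * \<delta>^4)"
  have b0: "b0 \<ge> 0" using C by (simp add: b0_def)
  \<comment> \<open>The square root of the factor 2 b0 / r0 left by \<open>error_bound\<close>; the
    Fourier normalization cancels against that in \<open>lam\<close>.\<close>
  define K where "K = sqrt (2 * b0 / r0)"
  have K: "K \<ge> 0" "K^2 = 2 * b0 / r0" using b0 rb(1) by (simp_all add: K_def)
  \<comment> \<open>The three bounds keep \<epsilon> Y in the ball where branch p is simple, in the
    unit ball (hence in the dual cell and in the range of the coupling bound), and \<omega>^2 within
    \<delta> of \<omega>_p^2(0).\<close>
  define \<epsilon>0 where "\<epsilon>0 = min (min (r / T) (1 / T)) (sqrt \<delta> / \<Omega>h)"
  have pos: "\<epsilon>0 > 0" using r T \<delta> assms(10) by (simp add: \<epsilon>0_def)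
  have main: "let up = upsol w2 \<phi> p (w2 p 0 + \<epsilon>^2 * \<sigma> * \<Omega>h^2) (\<lambda>y. source F \<rho> (\<phi> p 0) \<epsilon> (\<epsilon> *\<^sub>R y)) Y \<epsilon>
      in square_integrable_on UNIV (\<lambda>x. u x - up x)
         \<and> l2norm (\<lambda>x. u x - up x) \<le> K * \<epsilon> powr (3 - real CARD('d) / 2) * l2norm F
         \<and> square_integrable_on UNIV (\<lambda>r. u ((1/\<epsilon>) *\<^sub>R r) - up ((1/\<epsilon>) *\<^sub>R r))
         \<and> l2norm (\<lambda>r. u ((1/\<epsilon>) *\<^sub>R r) - up ((1/\<epsilon>) *\<^sub>R r)) \<le> K * \<epsilon>^3 * l2norm F"
    if \<epsilon>: "0 < \<epsilon>" "\<epsilon> < \<epsilon>0"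
      and band: "\<forall>m. \<forall>k\<in>dual_cell. w2 p 0 / \<epsilon>^2 + \<sigma> * \<Omega>h^2 \<noteq> w2 m k / \<epsilon>^2"
      and weak: "weak_H1_solution G \<rho> (w2 p 0 + \<epsilon>^2 * \<sigma> * \<Omega>h^2)
          (\<lambda>x. of_real (\<epsilon>^2) * source F \<rho> (\<phi> p 0) \<epsilon> (\<epsilon> *\<^sub>R x)) u gu" for \<epsilon> u gu
  proof -
    define c where "c = w2 p 0 + \<epsilon>^2 * \<sigma> * \<Omega>h^2"
    have eT: "\<epsilon> * T < r" "\<epsilon> * T < 1" using \<epsilon> T by (auto simp: \<epsilon>0_def field_simps)
    have eO: "\<epsilon>^2 * \<Omega>h^2 < \<delta>"
    proof -
      have "\<epsilon> * \<Omega>h < sqrt \<delta>" using \<epsilon> assms(10) by (auto simp: \<epsilon>0_def field_simps)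
      then have "(\<epsilon> * \<Omega>h)^2 < (sqrt \<delta>)^2" using \<epsilon>(1) assms(10) by (intro power_strict_mono) auto
      then show ?thesis using \<delta> by (simp add: power_mult_distrib)
    qed
    have c_near: "\<bar>c - w2 p 0\<bar> < \<delta>" using eO assms(9) by (auto simp: c_def abs_mult)
    have Yn: "norm (\<epsilon> *\<^sub>R y) \<le> \<epsilon> * T" if "y \<in> Y" for y using T(2)[OF that] \<epsilon>(1) by simp
    have YD: "\<epsilon> *\<^sub>R y \<in> dual_cell" if "y \<in> Y" for y
    proof -
      have "\<bar>(\<epsilon> *\<^sub>R y) $ i\<bar> \<le> pi" for i
        using component_le_norm_cart[of "\<epsilon> *\<^sub>R y" i] Yn[OF that] eT(2) pi_gt3 by linarith
      then show ?thesis by (simp add: dual_cell_def abs_le_iff minus_le_iff)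
    qed
    let ?a = "\<lambda>x. synth F (\<epsilon> *\<^sub>R x)"
    note aI = synth_scaled(1)[OF assms(13) F2(2) \<epsilon>(1)] and aL = synth_scaled(2)[OF assms(13) F2(2) \<epsilon>(1)]
    let ?g = "\<lambda>x. ?a x * of_real (\<rho> x) * \<phi> p 0 x"
    define h where "h x = of_real (\<epsilon>^2) * ?g x" for x
    have src: "(\<lambda>y. source F \<rho> (\<phi> p 0) \<epsilon> (\<epsilon> *\<^sub>R y)) = ?g"
      using \<epsilon>(1) by (simp add: source_def synth_def)
    have hb: "h = (\<lambda>x. (of_real (\<epsilon>^2) * (of_real (\<rho> x) * \<phi> p 0 x)) * ?a x)"
      by (rule ext) (simp add: h_def mult_ac)
    let ?q = "\<lambda>x. of_real (\<epsilon>^2) * (of_real (\<rho> x) * \<phi> p 0 x)"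
    have qs: "smooth ?q" and qp: "zperiodic ?q"
      by (intro smooth_mult smooth_const smooth_of_real sr phi_smooth zperiodic_rules pr phi_periodic)+
    obtain Bq where Bq: "\<And>x. norm (?q x) \<le> Bq" using continuous_zperiodic_bounded[OF
        smooth_continuous[OF qs] qp] by blast
    have hL: "L2fun lborel h" unfolding hb
      by (rule L2fun_bounded_mult[OF aL _ Bq]) (use smooth_measurable[OF qs] in simp)
    have hI: "integrable lborel h"
    proof -
      have "integrable lborel (\<lambda>x. ?a x * ?q x)"
        by (rule integrable_mult_bounded[OF aI _ Bq]) (use smooth_measurable[OF qs] in simp)
      then show ?thesis unfolding hb by (simp only: mult.commute)
    qed
    interpret weak_solution G \<rho> w2 \<phi> c h u gu
      using weak hL by unfold_locales (simp_all add: c_def h_def[abs_def] src fun_eq_iff[THEN iffD1, OF src])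
    have nz: "w2 m k \<noteq> c" if "k \<in> dual_cell" for m k
    proof
      assume "w2 m k = c"
      then have "w2 m k / \<epsilon>^2 = w2 p 0 / \<epsilon>^2 + \<sigma> * \<Omega>h^2" using \<epsilon>(1) by (simp add: c_def field_simps)
      then show False using band that by metis
    qed
    \<comment> \<open>This distance depends on \<epsilon>; it is fixed here, after K, and is lost in
      the limit inside \<open>error_bound\<close>.\<close>
    obtain \<gamma> where \<gamma>: "\<gamma> > 0" "\<And>m k. k \<in> dual_cell \<Longrightarrow> \<gamma> \<le> \<bar>w2 m k - c\<bar>" using uniform_gap[OF nz] by blast
    \<comment> \<open>The factor \<epsilon>^2 stems from the right-hand side of the equation,
      \<epsilon>^-d and the normalization from the fibre of the amplitude.\<close>
    define s where "s = \<epsilon>^2 / (cst ?d * \<epsilon>^?d)"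
    define lam where "lam k = of_real s * F ((1/\<epsilon>) *\<^sub>R k)" for k
    note Fs = L2sq_scale_arg[OF F2(1) \<epsilon>(1)]
    have lamL: "L2fun lborel lam" unfolding lam_def[abs_def] by (rule L2fun_scale[OF Fs(1)])
    have lm[measurable]: "lam \<in> borel_measurable borel" using lamL by (simp add: L2fun_def)
    have lam_int: "integrable lborel (\<lambda>k. indicator dual_cell k * (norm (lam k))^2)"
      by (rule Bochner_Integration.integrable_bound[OF L2fun_sq[OF lamL]]) (auto simp: indicator_def)
    have lamD: "L2fun dualM lam"
    proof -
      have m: "(\<lambda>k. (norm (lam k))^2) \<in> borel_measurable borel" by measurable
      show ?thesis unfolding L2fun_def using lam_int by (simp add: integral_dualM(2)[OF m] set_integrable_def)
    qed
    have lam_le: "L2sq dualM lam \<le> s^2 * (\<epsilon>^?d * L2sq lborel F)"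
    proof -
      have m: "(\<lambda>k. (norm (lam k))^2) \<in> borel_measurable borel" by measurable
      have "L2sq dualM lam = (LINT k|lborel. indicator dual_cell k * (norm (lam k))^2)"
        by (simp add: L2sq_def integral_dualM(1)[OF m] set_lebesgue_integral_def)
      also have "\<dots> \<le> L2sq lborel lam"
        unfolding L2sq_def by (rule integral_mono[OF lam_int L2fun_sq[OF lamL]]) (auto simp: indicator_def)
      also have "\<dots> = s^2 * (\<epsilon>^?d * L2sq lborel F)"
        unfolding lam_def[abs_def] L2sq_scale Fs(2) by simp
      finally show ?thesis .
    qed
    define up where "up = upsol w2 \<phi> p c ?g Y \<epsilon>"
    have Yr: "norm (\<epsilon> *\<^sub>R y) < r" if "y \<in> Y" for y using Yn[OF that] eT(1) by linarith
    have lam_eq: "lam = (\<lambda>k. of_real (\<epsilon>^2 / (cst ?d * \<epsilon>^?d)) * F ((1/\<epsilon>) *\<^sub>R k))"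
      by (simp add: lam_def[abs_def] s_def)
    have "\<exists>P. (\<lambda>(k, x). P k x) \<in> borel_measurable (borel \<Otimes>\<^sub>M borel) \<and> (\<forall>k. zperiodic (P k))
      \<and> (\<forall>k x. P k x = of_real (cst ?d) * (lam k * coupling p p k / of_real (w2 p k - c) * \<phi> p k x))
      \<and> (\<forall>x. up x = of_real (cst ?d) * (LINT k|dualM. P k x * cis (k \<bullet> x))) \<and> up \<in> borel_measurable borel"
      unfolding lam_eq up_def
      by (rule upsol_representation[where r=r]) (fact assms(11) supp assms(15) \<epsilon>(1) YD Yr aI meas)+
    then obtain P where Pm: "(\<lambda>(k, x). P k x) \<in> borel_measurable (borel \<Otimes>\<^sub>M borel)"
        and Pp: "\<And>k. zperiodic (P k)"
      and P: "\<And>k x. P k x = of_real (cst ?d) * (lam k * coupling p p k / of_real (w2 p k - c) * \<phi> p k x)"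
      and U: "\<And>x. up x = of_real (cst ?d) * (LINT k|dualM. P k x * cis (k \<bullet> x))"
          and Um: "up \<in> borel_measurable borel"
      by blast
    define b where "b = b0 * \<epsilon>^2"
    \<comment> \<open>Where F(k/\<epsilon>) vanishes there is nothing to estimate; elsewhere k lies
      in \<epsilon> Y, so that the spectral gap and the coupling bound both apply.\<close>
    have b: "(norm (lam k))^2 * (\<Sum>m\<in>I. (norm (coupling p m k))^2 / (w2 m k - c)^2) \<le> b * (norm (lam k))^2"
      if I: "finite I" "p \<notin> I" for k I
    proof (cases "lam k = 0")
      case False
      then have "(1/\<epsilon>) *\<^sub>R k \<in> Y" using supp[of "(1/\<epsilon>) *\<^sub>R k"] by (simp add: lam_def)
      from Yn[OF this] have nk: "norm k \<le> \<epsilon> * T" using \<epsilon>(1) by simp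
      have "(\<Sum>m\<in>I. (norm (coupling p m k))^2 / (w2 m k - c)^2)
            \<le> (\<Sum>m\<in>I. ((w2 m k - w2 p 0)^2 * (norm (coupling p m k))^2) / (4 * \<delta>^4))"
      proof (rule sum_mono)
        fix m assume "m \<in> I"
        then have "m \<noteq> p" using I by auto
        then have g: "2 * \<delta> \<le> \<bar>w2 m k - w2 p 0\<bar>" using gap[of k m] nk eT(1) by linarith
        then have "\<delta> \<le> \<bar>w2 m k - c\<bar>" using c_near by linarith
        then have d1: "\<delta>^2 \<le> (w2 m k - c)^2" using \<delta> by (metis abs_le_square_iff abs_of_pos)
        have d2: "4 * \<delta>^2 \<le> (w2 m k - w2 p 0)^2"
          using power_mono[OF g, of 2] \<delta> by (simp add: power_mult_distrib)
        have "(norm (coupling p m k))^2 / (w2 m k - c)^2 \<le> (norm (coupling p m k))^2 / \<delta>^2"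
          using d1 \<delta> by (intro frac_le) auto
        also have "\<dots> = (4 * \<delta>^2 * (norm (coupling p m k))^2) / (4 * \<delta>^4)"
          using \<delta> by (simp add: field_simps power2_eq_square power4_eq_xxxx)
        also have "\<dots> \<le> ((w2 m k - w2 p 0)^2 * (norm (coupling p m k))^2) / (4 * \<delta>^4)"
          using d2 by (intro divide_right_mono mult_right_mono) auto
        finally show "(norm (coupling p m k))^2 / (w2 m k - c)^2
              \<le> ((w2 m k - w2 p 0)^2 * (norm (coupling p m k))^2) / (4 * \<delta>^4)" .
      qed
      also have "\<dots> = (\<Sum>m\<in>I. (w2 m k - w2 p 0)^2 * (norm (coupling p m k))^2) / (4 * \<delta>^4)"
        by (simp only: sum_divide_distrib)
      also have "\<dots> \<le> C * (norm k)^2 / (4 * \<delta>^4)"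
        using nk eT(2) I by (intro divide_right_mono coup) auto
      also have "\<dots> \<le> C * (\<epsilon> * T)^2 / (4 * \<delta>^4)"
        using nk C by (intro divide_right_mono mult_left_mono power_mono) auto
      also have "\<dots> = b" by (simp add: b_def b0_def power_mult_distrib)
      finally show ?thesis by (subst mult.commute) (rule mult_right_mono, auto)
    qed simp
    have co: "AE k in dualM. \<forall>m. (LINT x|lborel. h x * (cis (- (k \<bullet> x)) * cnj (\<phi> m k x))) = lam k
          * coupling p m k"
    proof -
      have "AE k in dualM. (\<forall>m. (LINT x|lborel. (of_real (\<epsilon>^2) * ?g x) * (cis (- (k \<bullet> x)) * cnj (\<phi> m k x)))
          = (of_real (\<epsilon>^2 / (cst ?d * \<epsilon>^?d)) * F ((1/\<epsilon>) *\<^sub>R k)) * coupling p m k)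
        \<and> cinner_cell (bloch ?g k) (\<lambda>y. cis (k \<bullet> y) * \<phi> p k y) = (of_real (1 / \<epsilon>^?d) * F ((1/\<epsilon>) *\<^sub>R k)) *
            coupling p p k"
        by (rule source_coefficients[OF assms(11) _ \<epsilon>(1) aI]) (rule YD[OF supp])
      then show ?thesis unfolding h_def lam_def s_def by eventually_elim blast
    qed
    have "(\<integral>\<^sup>+x. ennreal ((norm (u x - up x))^2) \<partial>lborel)
          \<le> ennreal ((cst ?d)^2 * (2 * b / r0 * L2sq dualM lam))"
      by (rule error_bound[OF hI \<gamma> lamD co b rb(1,3) Pm Pp P U Um])
    also have "(cst ?d)^2 * (2 * b / r0 * L2sq dualM lam) \<le> (cst ?d)^2
          * (2 * b / r0 * (s^2 * (\<epsilon>^?d * L2sq lborel F)))"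
      using b0 rb(1) by (intro mult_left_mono lam_le) (auto simp: b_def)
    \<comment> \<open>The exponents: \<epsilon>^2 from b, \<epsilon>^(4 - 2d) from the square of s,
      and \<epsilon>^d from rescaling F.\<close>
    also have "\<dots> = K^2 * (\<epsilon>^6 / \<epsilon>^?d) * L2sq lborel F"
      unfolding K(2) b_def s_def using cst_pos[of ?d] \<epsilon>(1) rb(1)
      by (simp add: field_simps power2_eq_square) (simp add: eval_nat_numeral)
    finally have bound: "(\<integral>\<^sup>+x. ennreal ((norm (u x - up x))^2) \<partial>lborel)
          \<le> ennreal (K^2 * (\<epsilon>^6 / \<epsilon>^?d) * L2sq lborel F)"
      by (simp add: ennreal_leI)
    have em: "(\<lambda>x. u x - up x) \<in> borel_measurable lborel" using Um by measurable
    have eL: "L2fun lborel (\<lambda>x. u x - up x)"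
      unfolding L2fun_iff_nn(1)[OF em] using bound by (rule le_less_trans) simp
    have eB: "L2sq lborel (\<lambda>x. u x - up x) \<le> K^2 * (\<epsilon>^6 / \<epsilon>^?d) * L2sq lborel F"
      using bound unfolding L2fun_iff_nn(2)[OF em eL]
      by (subst (asm) ennreal_le_iff) (use \<epsilon>(1) in auto)
    have pw: "\<epsilon>^6 / \<epsilon>^?d = (\<epsilon> powr (3 - real ?d / 2))^2"
    proof -
      have "(\<epsilon> powr (3 - real ?d / 2))^2 = \<epsilon> powr (6 - real ?d)"
        unfolding power2_eq_square powr_add[symmetric] by simp
      also have "\<dots> = \<epsilon>^6 / \<epsilon>^?d" using \<epsilon>(1) by (simp add: powr_diff powr_realpow)
      finally show ?thesis by simp
    qed
    have l2: "l2norm f = sqrt (L2sq lborel f)" for f :: "real^'d \<Rightarrow> complex" by (simp add: l2norm_def L2sq_def)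
    have "l2norm (\<lambda>x. u x - up x) \<le> K * \<epsilon> powr (3 - real ?d / 2) * l2norm F"
      unfolding l2
    proof (rule real_le_lsqrt)
      show "L2sq lborel (\<lambda>x. u x - up x) \<le> (K * \<epsilon> powr (3 - real ?d / 2) * sqrt (L2sq lborel F))^2"
        using eB unfolding pw by (simp add: power_mult_distrib)
    qed (use K(1) in auto)
    moreover have "l2norm (\<lambda>x. u ((1/\<epsilon>) *\<^sub>R x) - up ((1/\<epsilon>) *\<^sub>R x)) \<le> K * \<epsilon>^3 * l2norm F"
      unfolding l2
    proof (rule real_le_lsqrt)
      \<comment> \<open>Passing to r = \<epsilon> x multiplies the squared norm by \<epsilon>^d,
        which removes the dimension from the exponent.\<close>
      have "L2sq lborel (\<lambda>x. u ((1/\<epsilon>) *\<^sub>R x) - up ((1/\<epsilon>) *\<^sub>R x)) = \<epsilon>^?d * L2sq lborel (\<lambda>x. u x - up x)"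
        by (rule L2sq_scale_arg(2)[OF eL \<epsilon>(1)])
      also have "\<dots> \<le> \<epsilon>^?d * (K^2 * (\<epsilon>^6 / \<epsilon>^?d) * L2sq lborel F)"
        using eB \<epsilon>(1) by (intro mult_left_mono) auto
      also have "\<dots> = (K * \<epsilon>^3 * sqrt (L2sq lborel F))^2"
        using \<epsilon>(1) by (simp add: power_mult_distrib flip: power_mult)
      finally show "L2sq lborel (\<lambda>x. u ((1/\<epsilon>) *\<^sub>R x) - up ((1/\<epsilon>) *\<^sub>R x)) \<le> (K * \<epsilon>^3 * sqrt (L2sq lborel F))^2" .
    qed (use K(1) \<epsilon>(1) in auto)
    ultimately show ?thesis
      using eL L2sq_scale_arg(1)[OF eL \<epsilon>(1)]
      unfolding src c_def[symmetric] up_def[symmetric] Let_def square_integrable_UNIV by blast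
  qed
  show ?thesis
  proof (rule exI[of _ K], rule exI[of _ \<epsilon>0], intro conjI allI impI)
    show "\<epsilon>0 > 0" by (rule pos)
  qed (elim conjE, rule main)
qed

end
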